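(* Let $C>1$ be an integer. For all $j\in[t]$, let $G^{(j)}$ be a $d_j$-regular connected graph with $1<|V(G^{(j)})|\le C$. Let $G=\square_{j=1}^t G^{(j)}$, let $n:=|V(G)|$ and let $d:=\sum_{j=1}^t d_j$. Let $\epsilon>0$ be a small enough constant, let $p=\frac{1+\epsilon}{d}$, and let $L_1$ be the largest component of $G_p$. Then whp: (a) the diameter of $L_1$ is $O(d\ln^2 d)$; (b) the mixing time of a lazy random walk on $L_1$ is $O(d^2\ln^2 d)$; (c) the circumference of $L_1$ is $\Omega\left(\frac{n}{d\ln d}\right)$.
   Context: Graphs are finite and simple; $[m]=\{1,\ldots,m\}$. The Cartesian product $\square_{j=1}^t G^{(j)}$ is the graph with vertex set $V(G^{(1)})\times\cdots\times V(G^{(t)})$ in which $u$ and $v$ are adjacent iff there is some $j\in[t]$ with $u_jv_j\in E(G^{(j)})$ and $u_m=v_m$ for all $m\ne j$. $G_p$ is the random subgraph of $G$ on $V(G)$ obtained by retaining every edge of $G$ independently with probability $p$. "Whp" means with probability tending to $1$ as $t\to\infty$, where $C,\epsilon$ are fixed and the base graphs may vary with $t$. "$\epsilon$ small enough" means $0<\epsilon\le\epsilon_0$ for some $\epsilon_0>0$ depending only on $C$. The implicit constants in $O(\cdot)$ and $\Omega(\cdot)$ may depend on $C$ and $\epsilon$ but not on $t$ or the base graphs. The largest component is the one with most vertices (ties broken arbitrarily). The circumference of a graph is the length of a longest cycle in it. The lazy random walk on a connected graph $H$ is the Markov chain on $V(H)$ which at a vertex $v$ stays at $v$ with probability $\frac12$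 and otherwise moves to a uniformly random neighbour of $v$. Its stationary distribution is $\pi(v)=\frac{d_H(v)}{2e(H)}$, where $d_H(v)$ is the degree of $v$ and $e(H)=|E(H)|$. With $P^s(v,\cdot)$ the distribution after $s$ steps started from $v$ and $d_{TV}(\mu,\nu)=\max_{A\subseteq V(H)}|\mu(A)-\nu(A)|$, the mixing time is $\min\{s:\max_{v\in V(H)}d_{TV}(P^s(v,\cdot),\pi)\le\frac14\}$. *)

theory Defs
  imports "HOL-Probability.Probability"
begin

datatype 'a ugraph = UGraph (verts: "'a set") (edges: "'a set set")

definition simple_graph :: "'a ugraph \<Rightarrow> bool" where
  "simple_graph G \<longleftrightarrow>
     finite (verts G) \<and> (\<forall>e\<in>edges G. e \<subseteq> verts G \<and> card e = 2)"

definition adj :: "'a ugraph \<Rightarrow> 'a \<Rightarrow> 'a \<Rightarrow> bool" where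
  "adj G u v \<longleftrightarrow> {u, v} \<in> edges G"

definition neighbours :: "'a ugraph \<Rightarrow> 'a \<Rightarrow> 'a set" where
  "neighbours G v = {u \<in> verts G. adj G v u}"

definition degree :: "'a ugraph \<Rightarrow> 'a \<Rightarrow> nat" where
  "degree G v = card (neighbours G v)"

definition regular :: "nat \<Rightarrow> 'a ugraph \<Rightarrow> bool" where
  "regular r G \<longleftrightarrow> (\<forall>v\<in>verts G. degree G v = r)"

text \<open>A walk is given by its list of vertices, so it has length \<open>length xs - 1\<close>.\<close>

definition walk :: "'a ugraph \<Rightarrow> 'a list \<Rightarrow> bool" where
  "walk G xs \<longleftrightarrow> xs \<noteq> [] \<and> set xs \<subseteq> verts G \<and> successively (adj G) xs"

definition walk_betw :: "'a ugraph \<Rightarrow> 'a \<Rightarrow> 'a list \<Rightarrow> 'a \<Rightarrow> bool" where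
  "walk_betw G u xs v \<longleftrightarrow> walk G xs \<and> hd xs = u \<and> last xs = v"

definition reachable :: "'a ugraph \<Rightarrow> 'a \<Rightarrow> 'a \<Rightarrow> bool" where
  "reachable G u v \<longleftrightarrow> (\<exists>xs. walk_betw G u xs v)"

definition connected_graph :: "'a ugraph \<Rightarrow> bool" where
  "connected_graph G \<longleftrightarrow>
     verts G \<noteq> {} \<and> (\<forall>u\<in>verts G. \<forall>v\<in>verts G. reachable G u v)"

definition induced_subgraph :: "'a ugraph \<Rightarrow> 'a set \<Rightarrow> 'a ugraph" where
  "induced_subgraph G W = UGraph (verts G \<inter> W) {e \<in> edges G. e \<subseteq> W}"

definition components :: "'a ugraph \<Rightarrow> 'a ugraph set" where
  "components G = (\<lambda>v. induced_subgraph G {u. reachable G v u}) ` verts G"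

definition largest_component :: "'a ugraph \<Rightarrow> 'a ugraph \<Rightarrow> bool" where
  "largest_component G L \<longleftrightarrow>
     L \<in> components G \<and> (\<forall>K\<in>components G. card (verts K) \<le> card (verts L))"

definition cart_prod :: "nat \<Rightarrow> (nat \<Rightarrow> 'a ugraph) \<Rightarrow> (nat \<Rightarrow> 'a) ugraph" where
  "cart_prod t G =
     (let V = (\<Pi>\<^sub>E j\<in>{1..t}. verts (G j))
      in UGraph V
           {{u, v} | u v. u \<in> V \<and> v \<in> V \<and>
              (\<exists>j\<in>{1..t}. adj (G j) (u j) (v j) \<and> (\<forall>m\<in>{1..t}. m \<noteq> j \<longrightarrow> u m = v m))})"

text \<open>
  The states of the edges are independent Bernoulli variables (\<open>True\<close> meaning retained);
  \<^const>\<open>bernoulli_pmf\<close> truncates its parameter to the unit interval.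
\<close>

definition random_subgraph :: "real \<Rightarrow> 'a ugraph \<Rightarrow> 'a ugraph pmf" where
  "random_subgraph p G =
     map_pmf (\<lambda>f. UGraph (verts G) {e \<in> edges G. f e})
       (Pi_pmf (edges G) False (\<lambda>_. bernoulli_pmf p))"

definition graph_dist :: "'a ugraph \<Rightarrow> 'a \<Rightarrow> 'a \<Rightarrow> nat" where
  "graph_dist G u v = (LEAST k. \<exists>xs. walk_betw G u xs v \<and> length xs = Suc k)"

definition graph_diameter :: "'a ugraph \<Rightarrow> nat" where
  "graph_diameter G = Max {graph_dist G u v | u v. u \<in> verts G \<and> v \<in> verts G}"

definition cycle :: "'a ugraph \<Rightarrow> 'a list \<Rightarrow> bool" where
  "cycle G xs \<longleftrightarrow>
     walk G xs \<and> distinct xs \<and> 3 \<le> length xs \<and> adj G (last xs) (hd xs)"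

text \<open>An acyclic graph gets circumference \<open>0\<close>.\<close>

definition circumference :: "'a ugraph \<Rightarrow> nat" where
  "circumference G = Max (insert 0 {length xs | xs. cycle G xs})"

text \<open>
  The lazy walk and its stationary distribution are meaningful only on a finite connected graph
  with at least one edge: \<^const>\<open>pmf_of_set\<close> is unspecified on the empty set.
\<close>

definition lazy_step :: "'a ugraph \<Rightarrow> 'a \<Rightarrow> 'a pmf" where
  "lazy_step H v =
     bind_pmf (bernoulli_pmf (1/2))
       (\<lambda>stay. if stay then return_pmf v else pmf_of_set (neighbours H v))"

primrec lazy_walk :: "'a ugraph \<Rightarrow> nat \<Rightarrow> 'a \<Rightarrow> 'a pmf" where
  "lazy_walk H 0 v = return_pmf v"
| "lazy_walk H (Suc s) v = bind_pmf (lazy_walk H s v) (lazy_step H)"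

definition stationary :: "'a ugraph \<Rightarrow> 'a \<Rightarrow> real" where
  "stationary H v = real (degree H v) / (2 * real (card (edges H)))"

definition tv_dist :: "'a set \<Rightarrow> ('a \<Rightarrow> real) \<Rightarrow> ('a \<Rightarrow> real) \<Rightarrow> real" where
  "tv_dist V \<mu> \<nu> = Max ((\<lambda>A. \<bar>sum \<mu> A - sum \<nu> A\<bar>) ` Pow V)"

definition mixing_time :: "'a ugraph \<Rightarrow> nat" where
  "mixing_time H =
     (LEAST s. Max ((\<lambda>v. tv_dist (verts H) (pmf (lazy_walk H s v)) (stationary H)) ` verts H)
                 \<le> 1/4)"

end

theory Submission
  imports Defs "HOL-Real_Asymp.Real_Asymp"
begin

text \<open>
 The random edge set is exposed in two layers: \<open>F1\<close> with a density slightly below \<open>p\<close>, and a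
 sprinkling \<open>F2\<close> of density \<open>\<delta> / d\<close>. Let \<open>W\<close> consist of the vertices whose \<open>F1\<close>-cluster has at
 least \<open>d\<^sup>2\<close> vertices. A first moment computation over trees shows that every connected set with
 at least \<open>K0 * d\<close> vertices has a positive fraction of its vertices in \<open>W\<close>. Shifting a vertex in
 many different coordinates gives almost independent chances to hit \<open>W\<close>; so \<open>W\<close> is spread evenly,
 and between \<open>A \<subseteq> W\<close> and \<open>W - A\<close> there are about as many edges and two-step paths of the product as
 its isoperimetric inequality promises for \<open>A\<close>. Many of them survive in \<open>F2\<close>. A union bound over
 the connected sets of an auxiliary graph on \<open>W\<close> shows that a connected set of volume \<open>v\<close> in the
 giant component has an edge boundary of order \<open>v * ln (e * n / v) / (d * ln d)\<close>.

 This expansion of connected sets suffices for all three claims. Balls grow fast enough to bound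
 the diameter. The superlevel sets of the Green function of a killed walk are connected, so
 hitting times are \<open>O((d * ln d)\<^sup>2)\<close>, and they bound the mixing time. For the circumference, a path
 is extended as long as it can enter a remaining component with more than half of the volume; when it
 stops, many edges lead from the remaining components to the path, so one of them reaches a vertex far
 back and closes a long cycle.
\<close>

section \<open>Random edge sets\<close>

text \<open>The obstacle is the entropy of the union bound. For a set with \<open>k\<close> vertices
  in \<open>W\<close>, the sprinkling fails with probability about exp (- const * k * ln (e * n / k)
  / d), but a graph of degree polynomial in \<open>d\<close> has about exp (const * k * ln d)
  connected sets of that size. Hence only sets with a small boundary in \<open>F1\<close> are
  counted. As all \<open>F1\<close>-clusters in \<open>W\<close> have at least d^2 vertices, such a
  set falls into at most k / d^2 + b pieces connected in \<open>F1\<close>, where \<open>b\<close>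
  bounds that boundary, and about as many links of cost O(ln d) each describe it. For this to stay
  below k * ln (e * n / k) / d, the threshold must be of order d^2 and \<open>b\<close> must give up
  a factor ln d; this is the ln d lost in the expansion. The remaining sums cost a power of n, which
  is affordable once \<open>k\<close> is a large multiple of \<open>d\<close>; this fixes the scale
  \<open>m = K0 * d\<close>. Below that scale only the trivial bound of one boundary edge is
  available.\<close>

text \<open>
 The law of a random edge set is a finite weighted sum over all edge sets; \<open>prob_random_subgraph\<close>
 returns to probability mass functions.
\<close>

definition mean :: "'e set \<Rightarrow> ('e \<Rightarrow> real) \<Rightarrow> ('e set \<Rightarrow> real) \<Rightarrow> real" where
 "mean E q \<phi> = (\<Sum>F\<in>Pow E. (\<Prod>e\<in>F. q e) * (\<Prod>e\<in>E - F. 1 - q e) * \<phi> F)"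

definition chance :: "'e set \<Rightarrow> ('e \<Rightarrow> real) \<Rightarrow> ('e set \<Rightarrow> bool) \<Rightarrow> real" where
 "chance E q Q = mean E q (\<lambda>F. of_bool (Q F))"

definition probs :: "'e set \<Rightarrow> ('e \<Rightarrow> real) \<Rightarrow> bool" where
 "probs E q \<longleftrightarrow> (\<forall>e\<in>E. 0 \<le> q e \<and> q e \<le> 1)"

lemma probs_subset: "probs E q \<Longrightarrow> A \<subseteq> E \<Longrightarrow> probs A q"
 by (auto simp: probs_def)

lemma mean_empty [simp]: "mean {} q \<phi> = \<phi> {}"
 by (simp add: mean_def)

lemma mean_insert:
 assumes "finite E" "e \<notin> E"
 shows "mean (insert e E) q \<phi> = q e * mean E q (\<lambda>F. \<phi> (insert e F)) + (1 - q e) * mean E q \<phi>"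
proof -
 let ?t = "\<lambda>E F. (\<Prod>e\<in>F. q e) * (\<Prod>e\<in>E - F. 1 - q e)"
 have disj: "Pow E \<inter> insert e ` Pow E = {}" using assms by auto
 have inj: "inj_on (insert e) (Pow E)" using assms by (auto simp: inj_on_def) 
 have fin: "finite F" if "F \<in> Pow E" for F using that assms finite_subset by auto
 have 1: "?t (insert e E) (insert e F) = q e * ?t E F" if "F \<in> Pow E" for F
 proof -
  have "e \<notin> F" "insert e E - insert e F = E - F" using that assms by auto
  then show ?thesis using fin[OF that] by simp
 qed
 have 2: "?t (insert e E) F = (1 - q e) * ?t E F" if "F \<in> Pow E" for F
 proof -
  have "e \<notin> F" "insert e E - F = insert e (E - F)" using that assms by auto
  then show ?thesis using assms by simp
 qed
 have "mean (insert e E) q \<phi> = (\<Sum>F\<in>Pow E. ?t (insert e E) F * \<phi> F) + (\<Sum>F\<in>insert e ` Pow E. ?t (insert e E) F * \<phi> F)"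
  unfolding mean_def Pow_insert using assms disj by (subst sum.union_disjoint) auto
 also have "(\<Sum>F\<in>insert e ` Pow E. ?t (insert e E) F * \<phi> F) = (\<Sum>F\<in>Pow E. q e * (?t E F * \<phi> (insert e F)))"
  using 1 by (subst sum.reindex[OF inj]) (auto simp: algebra_simps intro!: sum.cong)
 also have "(\<Sum>F\<in>Pow E. ?t (insert e E) F * \<phi> F) = (\<Sum>F\<in>Pow E. (1 - q e) * (?t E F * \<phi> F))"
  by (intro sum.cong refl) (simp add: 2 mult.assoc)
 finally show ?thesis
  by (simp add: mean_def sum_distrib_left)
qed

lemma mean_cong:
 assumes "\<And>F. F \<subseteq> E \<Longrightarrow> \<phi> F = \<psi> F"
 shows "mean E q \<phi> = mean E q \<psi>"
 using assms by (auto simp: mean_def intro!: sum.cong)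

lemma mean_add: "mean E q (\<lambda>F. \<phi> F + \<psi> F) = mean E q \<phi> + mean E q \<psi>"
 by (simp add: mean_def algebra_simps sum.distrib)

lemma mean_cmult: "mean E q (\<lambda>F. c * \<phi> F) = c * mean E q \<phi>"
 by (simp add: mean_def algebra_simps sum_distrib_left)

lemma mean_sum: "mean E q (\<lambda>F. \<Sum>i\<in>I. \<phi> i F) = (\<Sum>i\<in>I. mean E q (\<phi> i))"
proof -
 have "mean E q (\<lambda>F. \<Sum>i\<in>I. \<phi> i F) = (\<Sum>F\<in>Pow E. \<Sum>i\<in>I. (\<Prod>e\<in>F. q e) * (\<Prod>e\<in>E - F. 1 - q e) * \<phi> i F)"
  by (simp add: mean_def sum_distrib_left)
 also have "... = (\<Sum>i\<in>I. mean E q (\<phi> i))"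
  by (subst sum.swap) (simp add: mean_def)
 finally show ?thesis .
qed

lemma mean_const [simp]: "finite E \<Longrightarrow> mean E q (\<lambda>_. c) = c"
 by (induction rule: finite_induct) (auto simp: mean_insert algebra_simps)

lemma mean_mono:
 assumes "probs E q" "\<And>F. F \<subseteq> E \<Longrightarrow> \<phi> F \<le> \<psi> F"
 shows "mean E q \<phi> \<le> mean E q \<psi>"
 unfolding mean_def using assms
 by (intro sum_mono mult_left_mono mult_nonneg_nonneg prod_nonneg) (auto simp: probs_def)

lemma mean_nonneg:
 assumes "probs E q" "\<And>F. F \<subseteq> E \<Longrightarrow> 0 \<le> \<phi> F"
 shows "0 \<le> mean E q \<phi>"
 unfolding mean_def using assms
 by (intro sum_nonneg mult_nonneg_nonneg prod_nonneg) (auto simp: probs_def)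

lemma mean_le_const:
 assumes "finite E" "probs E q" "\<And>F. F \<subseteq> E \<Longrightarrow> \<phi> F \<le> c"
 shows "mean E q \<phi> \<le> c"
 using mean_mono[of E q \<phi> "\<lambda>_. c"] assms by simp

lemma mean_Un:
 assumes "finite A" "finite B" "A \<inter> B = {}"
 shows "mean (A \<union> B) q \<phi> = mean A q (\<lambda>X. mean B q (\<lambda>Y. \<phi> (X \<union> Y)))"
 using assms
proof (induction A arbitrary: \<phi> rule: finite_induct)
 case (insert e A)
 have "mean (insert e (A \<union> B)) q \<phi> = q e * mean (A \<union> B) q (\<lambda>F. \<phi> (insert e F)) + (1 - q e) * mean (A \<union> B) q \<phi>"
  using insert by (intro mean_insert) auto
 also have "mean (A \<union> B) q (\<lambda>F. \<phi> (insert e F)) = mean A q (\<lambda>X. mean B q (\<lambda>Y. \<phi> (insert e (X \<union> Y))))"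
  using insert by auto
 also have "mean (A \<union> B) q \<phi> = mean A q (\<lambda>X. mean B q (\<lambda>Y. \<phi> (X \<union> Y)))"
  using insert by auto
 finally show ?case using insert by (simp add: mean_insert)
qed auto

lemma mean_split:
 assumes "finite E" "A \<subseteq> E"
 shows "mean E q \<phi> = mean A q (\<lambda>X. mean (E - A) q (\<lambda>Y. \<phi> (X \<union> Y)))"
proof -
 have "E = A \<union> (E - A)" using assms by auto
 then have "mean E q \<phi> = mean (A \<union> (E - A)) q \<phi>" by simp
 also have "... = mean A q (\<lambda>X. mean (E - A) q (\<lambda>Y. \<phi> (X \<union> Y)))"
  using assms by (intro mean_Un) (auto intro: finite_subset)
 finally show ?thesis .
qed

lemma mean_marginal:
 assumes "finite E" "A \<subseteq> E"
 shows "mean E q (\<lambda>F. \<phi> (F \<inter> A)) = mean A q \<phi>"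
proof -
 have *: "(X \<union> Y) \<inter> A = X" if "X \<subseteq> A" "Y \<subseteq> E - A" for X Y using that by auto
 have "mean E q (\<lambda>F. \<phi> (F \<inter> A)) = mean A q (\<lambda>X. mean (E - A) q (\<lambda>Y. \<phi> X))"
  unfolding mean_split[OF assms] using * by (intro mean_cong) auto
 then show ?thesis using assms by simp
qed

text \<open>For one edge, membership in the union of two independent layers has probability 1 - (1 -
  q1) * (1 - q2). This is what permits one random subgraph to be exposed as \<open>F1\<close> and
  \<open>F2\<close>.\<close>

lemma mean_merge:
 assumes "finite E"
 shows "mean E q1 (\<lambda>X. mean E q2 (\<lambda>Y. \<phi> (X \<union> Y))) = mean E (\<lambda>e. 1 - (1 - q1 e) * (1 - q2 e)) \<phi>"
 using assms
proof (induction E arbitrary: \<phi> rule: finite_induct)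
 case (insert e E)
 show ?case
  using insert.hyps
  apply (simp add: mean_insert mean_add mean_cmult)
  apply (simp flip: insert.IH)
  apply (simp add: algebra_simps)
  done
qed auto

text \<open>Restrictions to disjoint edge sets are independent; the tail bounds below use
  independence in this form.\<close>

lemma mean_prod:
 assumes "finite I" "finite E" "\<And>i. i \<in> I \<Longrightarrow> A i \<subseteq> E" "disjoint_family_on A I"
 shows "mean E q (\<lambda>F. \<Prod>i\<in>I. g i (F \<inter> A i)) = (\<Prod>i\<in>I. mean (A i) q (g i))"
 using assms
proof (induction I arbitrary: E rule: finite_induct)
 case (insert i I)
 have fin: "finite (A i)" using insert.prems by (blast intro: finite_subset)
 have dis: "A j \<inter> A i = {}" if "j \<in> I" for j
  using insert that by (auto simp: disjoint_family_on_def)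
 have *: "(X \<union> Y) \<inter> A i = X" if "X \<subseteq> A i" "Y \<subseteq> E - A i" for X Y using that by auto
 have **: "(X \<union> Y) \<inter> A j = Y \<inter> A j" if "X \<subseteq> A i" "Y \<subseteq> E - A i" "j \<in> I" for X Y j
  using that dis by auto
 have "mean E q (\<lambda>F. \<Prod>i\<in>insert i I. g i (F \<inter> A i)) =
  mean (A i) q (\<lambda>X. mean (E - A i) q (\<lambda>Y. \<Prod>j\<in>insert i I. g j ((X \<union> Y) \<inter> A j)))"
  using insert by (subst mean_split[of E "A i"]) auto
 also have "... = mean (A i) q (\<lambda>X. mean (E - A i) q (\<lambda>Y. g i X * (\<Prod>j\<in>I. g j (Y \<inter> A j))))"
  using insert(1,2) * ** by (intro mean_cong) (auto intro!: prod.cong)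
 also have "... = mean (A i) q (\<lambda>X. g i X * (\<Prod>j\<in>I. mean (A j) q (g j)))"
 proof -
  have "mean (E - A i) q (\<lambda>Y. \<Prod>j\<in>I. g j (Y \<inter> A j)) = (\<Prod>j\<in>I. mean (A j) q (g j))"
   using insert.prems dis
   by (intro insert.IH) (auto simp: disjoint_family_on_def)
  then show ?thesis by (simp add: mean_cmult)
 qed
 also have "... = mean (A i) q (g i) * (\<Prod>j\<in>I. mean (A j) q (g j))"
  using mean_cmult[of "A i" q "\<Prod>j\<in>I. mean (A j) q (g j)" "g i"] by (simp add: mult.commute)
 finally show ?case using insert by simp
qed auto

lemma chance_le_1: "finite E \<Longrightarrow> probs E q \<Longrightarrow> chance E q Q \<le> 1"
 unfolding chance_def by (intro mean_le_const) auto

lemma chance_nonneg: "probs E q \<Longrightarrow> 0 \<le> chance E q Q"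
 unfolding chance_def by (intro mean_nonneg) auto

lemma chance_mono:
 assumes "probs E q" "\<And>F. F \<subseteq> E \<Longrightarrow> P F \<Longrightarrow> Q F"
 shows "chance E q P \<le> chance E q Q"
 unfolding chance_def using assms by (intro mean_mono) (auto simp: of_bool_def)

lemma chance_Not: "finite E \<Longrightarrow> chance E q (\<lambda>F. \<not> Q F) = 1 - chance E q Q"
proof -
 assume E: "finite E"
 have "mean E q (\<lambda>F. of_bool (\<not> Q F)) + mean E q (\<lambda>F. of_bool (Q F)) = mean E q (\<lambda>F. 1)"
  unfolding mean_add[symmetric] by (intro mean_cong) auto
 then show ?thesis using E by (simp add: chance_def)
qed

lemma chance_UN:
 assumes "finite I" "probs E q" "\<And>F. F \<subseteq> E \<Longrightarrow> Q F \<Longrightarrow> \<exists>i\<in>I. P i F"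
 shows "chance E q Q \<le> (\<Sum>i\<in>I. chance E q (P i))"
proof -
 have "chance E q Q \<le> mean E q (\<lambda>F. \<Sum>i\<in>I. of_bool (P i F))"
  unfolding chance_def
 proof (intro mean_mono assms)
  fix F assume F: "F \<subseteq> E"
  show "of_bool (Q F) \<le> (\<Sum>i\<in>I. of_bool (P i F) :: real)"
  proof (cases "Q F")
   case True
   then obtain i where "i \<in> I" "P i F" using assms(3) F by auto
   then have "1 \<le> (\<Sum>i\<in>I. of_bool (P i F) :: real)"
    using assms(1) member_le_sum[of i I "\<lambda>i. of_bool (P i F) :: real"] by auto
   then show ?thesis using True by simp
  qed (auto intro: sum_nonneg)
 qed
 then show ?thesis by (simp add: mean_sum chance_def)
qed

lemma chance_disj:
 assumes "probs E q"
 shows "chance E q (\<lambda>F. P F \<or> Q F) \<le> chance E q P + chance E q Q"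
 unfolding chance_def mean_add[symmetric] using assms by (intro mean_mono) auto

lemma chance_disjoint_sum:
 assumes "finite I" "finite E" "probs E q"
  "\<And>F i j. F \<subseteq> E \<Longrightarrow> i \<in> I \<Longrightarrow> j \<in> I \<Longrightarrow> P i F \<Longrightarrow> P j F \<Longrightarrow> i = j"
 shows "(\<Sum>i\<in>I. chance E q (P i)) \<le> 1"
proof -
 have "(\<Sum>i\<in>I. chance E q (P i)) = mean E q (\<lambda>F. \<Sum>i\<in>I. of_bool (P i F))"
  by (simp add: mean_sum chance_def)
 also have "... \<le> 1"
 proof (intro mean_le_const assms)
  fix F assume F: "F \<subseteq> E"
  show "(\<Sum>i\<in>I. of_bool (P i F)) \<le> (1::real)"
  proof (cases "\<exists>i\<in>I. P i F")
   case True
   then obtain i where i: "i \<in> I" "P i F" by auto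
   have "(\<Sum>j\<in>I. of_bool (P j F) :: real) = (\<Sum>j\<in>I. if j = i then 1 else 0)"
    using assms(4)[OF F] i by (intro sum.cong) auto
   then show ?thesis using i assms(1) by simp
  next
   case False
   then have "(\<Sum>j\<in>I. of_bool (P j F) :: real) = 0" by (intro sum.neutral) auto
   then show ?thesis by simp
  qed
 qed
 finally show ?thesis .
qed

lemma chance_pattern:
 assumes "finite E" "A \<subseteq> E" "B \<subseteq> E" "A \<inter> B = {}"
 shows "chance E q (\<lambda>F. A \<subseteq> F \<and> F \<inter> B = {}) = (\<Prod>e\<in>A. q e) * (\<Prod>e\<in>B. 1 - q e)"
proof -
 have fin: "finite A" "finite B" using assms by (blast intro: finite_subset)+
 define g where "g e X = (if e \<in> A then of_bool (e \<in> X) else of_bool (e \<notin> X) :: real)" for e :: 'a and X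
 have "chance E q (\<lambda>F. A \<subseteq> F \<and> F \<inter> B = {}) = mean E q (\<lambda>F. \<Prod>e\<in>A \<union> B. g e (F \<inter> {e}))"
  unfolding chance_def
 proof (intro mean_cong)
  fix F
  have "(\<Prod>e\<in>A \<union> B. g e (F \<inter> {e})) = (\<Prod>e\<in>A. of_bool (e \<in> F)) * (\<Prod>e\<in>B. of_bool (e \<notin> F))"
   using fin assms(4) by (subst prod.union_disjoint) (auto simp: g_def intro!: arg_cong2[of _ _ _ _ "(*)"] prod.cong)
  also have "... = of_bool (A \<subseteq> F) * of_bool (F \<inter> B = {})"
   using fin by (intro arg_cong2[of _ _ _ _ "(*)"]) (auto simp: of_bool_def intro!: prod.neutral)
  finally show "of_bool (A \<subseteq> F \<and> F \<inter> B = {}) = (\<Prod>e\<in>A \<union> B. g e (F \<inter> {e}))" by simp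
 qed
 also have "... = (\<Prod>e\<in>A \<union> B. mean {e} q (g e))"
  using assms fin by (intro mean_prod) (auto simp: disjoint_family_on_def)
 also have "... = (\<Prod>e\<in>A. q e) * (\<Prod>e\<in>B. 1 - q e)"
  using fin assms(4)
  by (subst prod.union_disjoint) (auto simp: g_def mean_insert intro!: arg_cong2[of _ _ _ _ "(*)"] prod.cong)
 finally show ?thesis .
qed

text \<open>Lower tail through the mean of exp (- X), where X is the number of successes. Since exp
  (- 1) is at most 1/2, a trial with success probability at least \<mu> contributes a factor of at
  most 1 - \<mu> / 2.\<close>

lemma chance_few:
 assumes "finite I" "finite E" "probs E q" "\<And>i. i \<in> I \<Longrightarrow> A i \<subseteq> E" "disjoint_family_on A I"
  and "\<And>i. i \<in> I \<Longrightarrow> \<mu> i \<le> chance (A i) q (Z i)"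
 shows "chance E q (\<lambda>F. real (card {i \<in> I. Z i (F \<inter> A i)}) \<le> b) \<le> exp (b - (\<Sum>i\<in>I. \<mu> i) / 2)"
proof -
 define g where "g i X = (if Z i X then exp (-1) else 1 :: real)" for i X
 have card: "real (card {i \<in> I. Z i (F \<inter> A i)}) = (\<Sum>i\<in>I. of_bool (Z i (F \<inter> A i)))" for F
  using assms(1) by (simp add: Int_def)
 have "chance E q (\<lambda>F. real (card {i \<in> I. Z i (F \<inter> A i)}) \<le> b)
   \<le> mean E q (\<lambda>F. exp b * (\<Prod>i\<in>I. g i (F \<inter> A i)))"
  unfolding chance_def
 proof (intro mean_mono assms)
  fix F
  have "(\<Prod>i\<in>I. g i (F \<inter> A i)) = exp (- real (card {i \<in> I. Z i (F \<inter> A i)}))"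
   unfolding card sum_negf[symmetric] exp_sum[OF assms(1)] by (intro prod.cong) (auto simp: g_def)
  then show "of_bool (real (card {i \<in> I. Z i (F \<inter> A i)}) \<le> b) \<le> exp b * (\<Prod>i\<in>I. g i (F \<inter> A i))"
   by (simp flip: exp_add)
 qed
 also have "... = exp b * (\<Prod>i\<in>I. mean (A i) q (g i))"
  using assms by (simp add: mean_cmult mean_prod)
 also have "(\<Prod>i\<in>I. mean (A i) q (g i)) \<le> (\<Prod>i\<in>I. exp (- \<mu> i / 2))"
 proof (intro prod_mono conjI)
  fix i assume i: "i \<in> I"
  have pr: "probs (A i) q" using assms i probs_subset by metis
  have fA: "finite (A i)" using assms i finite_subset by metis
  show "0 \<le> mean (A i) q (g i)" using pr by (intro mean_nonneg) (auto simp: g_def)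
  have "exp (-1::real) \<le> 1/2" using exp_ge_add_one_self[of "1::real"] by (simp add: exp_minus field_simps)
  then have "mean (A i) q (g i) \<le> mean (A i) q (\<lambda>X. 1 + (- 1/2) * of_bool (Z i X))"
   using pr by (intro mean_mono) (auto simp: g_def)
  also have "... = 1 - chance (A i) q (Z i) / 2"
   unfolding mean_add mean_cmult chance_def using fA by simp
  also have "... \<le> 1 + (- \<mu> i / 2)" using assms(6)[OF i] by simp
  also have "... \<le> exp (- \<mu> i / 2)" by (rule exp_ge_add_one_self)
  finally show "mean (A i) q (g i) \<le> exp (- \<mu> i / 2)" .
 qed
 also have "(\<Prod>i\<in>I. exp (- \<mu> i / 2)) = exp (- (\<Sum>i\<in>I. \<mu> i) / 2)"
  using assms(1) by (simp add: exp_sum[symmetric] sum_divide_distrib sum_negf)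
 finally show ?thesis by (simp add: mult_exp_exp)
qed

text \<open>Upper tail through the mean of exp (X), with a planted set \<open>T\<close>: being
  disjoint from \<open>A\<close>, it only contributes its own probability. The constant 2 comes from
  exp 1 - 1 being at most 2.\<close>

lemma chance_many:
 assumes "finite E" "A \<subseteq> E" "T \<subseteq> E" "A \<inter> T = {}" "probs E q" and q: "\<And>e. e \<in> A \<Longrightarrow> q e \<le> p"
 shows "chance E q (\<lambda>F. T \<subseteq> F \<and> b \<le> real (card (F \<inter> A))) \<le> (\<Prod>e\<in>T. q e) * exp (2 * p * card A - b)"
proof -
 have fin: "finite A" "finite T" using assms by (blast intro: finite_subset)+
 define g where "g e X = (if e \<in> A then (if e \<in> X then exp 1 else 1) else of_bool (e \<in> X) :: real)" for e :: 'a and X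
 have q0: "0 \<le> q e" "q e \<le> 1" if "e \<in> E" for e using assms(5) that by (auto simp: probs_def)
 have "chance E q (\<lambda>F. T \<subseteq> F \<and> b \<le> real (card (F \<inter> A)))
   \<le> mean E q (\<lambda>F. exp (-b) * (\<Prod>e\<in>T \<union> A. g e (F \<inter> {e})))"
  unfolding chance_def
 proof (intro mean_mono assms)
  fix F
  have *: "(\<Prod>e\<in>A. g e (F \<inter> {e})) = exp (real (card (F \<inter> A)))"
  proof -
   have "real (card (F \<inter> A)) = (\<Sum>e\<in>A. of_bool (e \<in> F))"
    using fin by (simp add: Int_commute)
   then show ?thesis using fin by (simp only: exp_sum g_def) (auto intro!: prod.cong)
  qed
  have prod_T: "(\<Prod>e\<in>T. g e (F \<inter> {e})) = of_bool (T \<subseteq> F)"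
  proof -
   have "(\<Prod>e\<in>T. g e (F \<inter> {e})) = (\<Prod>e\<in>T. of_bool (e \<in> F))"
    using assms(4) by (intro prod.cong) (auto simp: g_def)
   also have "... = of_bool (T \<subseteq> F)"
    using fin by (auto simp: of_bool_def intro!: prod.neutral)
   finally show ?thesis .
  qed
  have "(\<Prod>e\<in>T \<union> A. g e (F \<inter> {e})) = of_bool (T \<subseteq> F) * exp (real (card (F \<inter> A)))"
   using fin assms(4)
   by (subst prod.union_disjoint) (simp_all add: * Int_commute prod_T)
  then show "of_bool (T \<subseteq> F \<and> b \<le> real (card (F \<inter> A))) \<le> exp (-b) * (\<Prod>e\<in>T \<union> A. g e (F \<inter> {e}))"
   by (auto simp flip: exp_add simp: of_bool_def)
 qed
 also have "... = exp (-b) * (\<Prod>e\<in>T \<union> A. mean {e} q (g e))"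
  unfolding mean_cmult using assms fin by (subst mean_prod) (auto simp: disjoint_family_on_def)
 also have "(\<Prod>e\<in>T \<union> A. mean {e} q (g e)) = (\<Prod>e\<in>T. q e) * (\<Prod>e\<in>A. 1 + q e * (exp 1 - 1))"
  using fin assms(4)
  by (subst prod.union_disjoint) (auto simp: g_def mean_insert algebra_simps intro!: arg_cong2[of _ _ _ _ "(*)"] prod.cong)
 finally have *: "chance E q (\<lambda>F. T \<subseteq> F \<and> b \<le> real (card (F \<inter> A)))
  \<le> exp (-b) * ((\<Prod>e\<in>T. q e) * (\<Prod>e\<in>A. 1 + q e * (exp 1 - 1)))" .
 have "(\<Prod>e\<in>A. 1 + q e * (exp 1 - 1)) \<le> (\<Prod>e\<in>A. exp (2 * p))"
 proof (intro prod_mono conjI)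
  fix e assume e: "e \<in> A"
  then have e': "0 \<le> q e" "q e \<le> p" using q0 q assms(2) by auto
  have "exp (1::real) \<le> 3" by (rule exp_le)
  then have "q e * (exp 1 - 1) \<le> p * 2"
   using e' by (intro mult_mono) auto
  then have "1 + q e * (exp 1 - 1) \<le> 1 + 2 * p" by simp
  also have "... \<le> exp (2 * p)" by (rule exp_ge_add_one_self)
  finally show "1 + q e * (exp 1 - 1) \<le> exp (2 * p)" .
  show "0 \<le> 1 + q e * (exp 1 - 1)" using e' by (simp add: add_nonneg_nonneg)
 qed
 also have "(\<Prod>e\<in>A. exp (2 * p)) = exp (2 * p * card A)"
  using fin by (simp add: exp_of_nat_mult[symmetric] mult_ac)
 finally have "exp (-b) * ((\<Prod>e\<in>T. q e) * (\<Prod>e\<in>A. 1 + q e * (exp 1 - 1)))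
   \<le> exp (-b) * ((\<Prod>e\<in>T. q e) * exp (2 * p * card A))"
  using q0 assms(3) by (intro mult_left_mono prod_nonneg) auto
 also have "... = (\<Prod>e\<in>T. q e) * exp (2 * p * card A - b)"
  by (simp add: exp_diff exp_minus field_simps)
 finally show ?thesis using * by linarith
qed

text \<open>The Bernoulli choices are peeled off one edge at a time, which reproduces the recursion
  \<open>mean_insert\<close>.\<close>

lemma prob_random_subgraph:
 assumes "finite (edges G)" "0 \<le> p" "p \<le> 1"
 shows "measure_pmf.prob (random_subgraph p G) {H. Q H} = chance (edges G) (\<lambda>_. p) (\<lambda>F. Q (UGraph (verts G) F))"
proof -
 have *: "measure_pmf.expectation (map_pmf (\<lambda>f. {e \<in> E. f e}) (Pi_pmf E False (\<lambda>_. bernoulli_pmf p))) \<phi>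
   = mean E (\<lambda>_. p) \<phi>" if "finite E" for E :: "'a set set" and \<phi> :: "'a set set \<Rightarrow> real"
  using that
 proof (induction E arbitrary: \<phi> rule: finite_induct)
  case (insert e E)
  let ?M = "\<lambda>E. map_pmf (\<lambda>f. {e \<in> E. f e}) (Pi_pmf E False (\<lambda>_. bernoulli_pmf p))"
  have M: "?M (insert e E) = bind_pmf (bernoulli_pmf p) (\<lambda>b. map_pmf (\<lambda>F. if b then insert e F else F) (?M E))"
   using insert(1,2)
   by (subst Pi_pmf_insert') (auto simp: map_bind_pmf map_pmf_def[symmetric] pmf.map_comp o_def intro!: bind_pmf_cong map_pmf_cong split: if_splits)
  have fin: "finite (set_pmf (?M E))"
   by (rule finite_subset[of _ "Pow E"]) (use insert(1) in auto)
  have fin': "finite (set_pmf (?M (insert e E)))"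
   by (rule finite_subset[of _ "Pow (insert e E)"]) (use insert(1) in auto)
  have "measure_pmf.expectation (?M (insert e E)) \<phi> =
   p * measure_pmf.expectation (?M E) (\<lambda>F. \<phi> (insert e F)) + (1 - p) * measure_pmf.expectation (?M E) \<phi>"
   unfolding M using assms fin
   by (subst pmf_expectation_bind[of "{True, False}"]) (auto simp: algebra_simps)
  then show ?case by (simp only: mean_insert[OF insert(1,2)] insert.IH)
 qed auto
 have "measure_pmf.prob (random_subgraph p G) {H. Q H} =
   measure_pmf.expectation (random_subgraph p G) (indicator {H. Q H})"
  by simp
 also have rs: "random_subgraph p G = map_pmf (UGraph (verts G)) (map_pmf (\<lambda>f. {e \<in> edges G. f e}) (Pi_pmf (edges G) False (\<lambda>_. bernoulli_pmf p)))"
  by (simp add: random_subgraph_def pmf.map_comp o_def)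
 also have "measure_pmf.expectation \<dots> (indicator {H. Q H}) = mean (edges G) (\<lambda>_. p) (\<lambda>F. indicator {H. Q H} (UGraph (verts G) F))"
  by (subst integral_map_pmf) (rule *[OF assms(1)])
 also have "... = chance (edges G) (\<lambda>_. p) (\<lambda>F. Q (UGraph (verts G) F))"
  unfolding chance_def by (intro mean_cong) (simp add: indicator_def)
 finally show ?thesis using rs by simp
qed

section \<open>Connected sets\<close>

definition links :: "'v set set \<Rightarrow> 'v set \<Rightarrow> ('v \<times> 'v) set" where
 "links F S = {(x, y). x \<in> S \<and> y \<in> S \<and> {x, y} \<in> F}"

definition comp :: "'v set set \<Rightarrow> 'v set \<Rightarrow> 'v \<Rightarrow> 'v set" where
 "comp F S x = {y. (x, y) \<in> (links F S)\<^sup>*}"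

abbreviation cluster :: "'v set set \<Rightarrow> 'v \<Rightarrow> 'v set" where
 "cluster F x \<equiv> comp F UNIV x"

definition conn :: "'v set set \<Rightarrow> 'v set \<Rightarrow> bool" where
 "conn F S \<longleftrightarrow> S \<noteq> {} \<and> (\<forall>x\<in>S. \<forall>y\<in>S. (x, y) \<in> (links F S)\<^sup>*)"

definition cut :: "'v set set \<Rightarrow> 'v set \<Rightarrow> 'v set set" where
 "cut F S = {e \<in> F. e \<inter> S \<noteq> {} \<and> \<not> e \<subseteq> S}"

definition inc :: "'v set set \<Rightarrow> 'v set \<Rightarrow> 'v set set" where
 "inc F S = {e \<in> F. e \<inter> S \<noteq> {}}"

definition pairs :: "'v set set \<Rightarrow> bool" where
 "pairs E \<longleftrightarrow> (\<forall>e\<in>E. card e = 2)"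

lemma pairs_subset: "pairs E \<Longrightarrow> F \<subseteq> E \<Longrightarrow> pairs F"
 by (auto simp: pairs_def)

lemma pairs_edgeE:
 assumes "pairs E" "e \<in> E" "x \<in> e"
 obtains y where "e = {x, y}" "x \<noteq> y"
 using assms unfolding pairs_def by (metis card_2_iff doubleton_eq_iff insert_iff singleton_iff)

lemma card_neighbourhood:
 assumes "pairs E" shows "card {z. {x, z} \<in> E} = card {e \<in> E. x \<in> e}"
proof -
 have "(\<lambda>z. {x, z}) ` {z. {x, z} \<in> E} = {e \<in> E. x \<in> e}"
  using pairs_edgeE[OF assms] by (auto simp: image_iff) metis
 moreover have "inj_on (\<lambda>z. {x, z}) {z. {x, z} \<in> E}" by (auto simp: inj_on_def doubleton_eq_iff)
 ultimately show ?thesis by (metis card_image)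
qed

lemma cutE:
 assumes "pairs E" "e \<in> cut E S"
 obtains x y where "e = {x, y}" "x \<in> S" "y \<notin> S" "{x, y} \<in> E"
proof -
 from assms obtain x where x: "x \<in> e" "x \<in> S" "e \<in> E" by (auto simp: cut_def)
 then obtain y where "e = {x, y}" using pairs_edgeE[OF assms(1)] by metis
 then show ?thesis using that[of x y] assms x by (auto simp: cut_def)
qed

lemma cutI: "{x, y} \<in> E \<Longrightarrow> x \<in> S \<Longrightarrow> y \<notin> S \<Longrightarrow> {x, y} \<in> cut E S"
 by (auto simp: cut_def)

lemma sym_links: "sym (links F S)"
 by (auto simp: sym_def links_def insert_commute)

lemma links_rtrancl_sym: "(x, y) \<in> (links F S)\<^sup>* \<Longrightarrow> (y, x) \<in> (links F S)\<^sup>*"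
 by (rule symD[OF sym_rtrancl[OF sym_links]])

lemma links_mono: "F \<subseteq> F' \<Longrightarrow> S \<subseteq> S' \<Longrightarrow> links F S \<subseteq> links F' S'"
 by (auto simp: links_def)

lemma links_rtrancl_mono: "(x, y) \<in> (links F S)\<^sup>* \<Longrightarrow> F \<subseteq> F' \<Longrightarrow> S \<subseteq> S' \<Longrightarrow> (x, y) \<in> (links F' S')\<^sup>*"
 using rtrancl_mono[OF links_mono] by blast

lemma conn_mono: "conn F S \<Longrightarrow> F \<subseteq> F' \<Longrightarrow> conn F' S"
 unfolding conn_def by (meson links_rtrancl_mono subset_refl)

lemma comp_self [simp]: "x \<in> comp F S x"
 by (simp add: comp_def)

lemma comp_nonempty [simp]: "comp F S x \<noteq> {}"
 using comp_self[of x F S] by blast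

lemma comp_subset: "x \<in> S \<Longrightarrow> comp F S x \<subseteq> S"
proof
 fix y assume "x \<in> S" "y \<in> comp F S x"
 then have "(x, y) \<in> (links F S)\<^sup>*" by (simp add: comp_def)
 then show "y \<in> S" using \<open>x \<in> S\<close> by (induction rule: rtrancl_induct) (auto simp: links_def)
qed

lemma comp_step: "y \<in> comp F S x \<Longrightarrow> {y, z} \<in> F \<Longrightarrow> y \<in> S \<Longrightarrow> z \<in> S \<Longrightarrow> z \<in> comp F S x"
 unfolding comp_def by (auto simp: links_def intro: rtrancl_into_rtrancl)

lemma comp_eq: "y \<in> comp F S x \<Longrightarrow> comp F S y = comp F S x"
 unfolding comp_def by (auto dest: links_rtrancl_sym intro: rtrancl_trans)

lemma comp_disjoint: "comp F S x \<inter> comp F S y = {} \<or> comp F S x = comp F S y"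
 using comp_eq by (metis disjoint_iff)

lemma comp_conn: 
 assumes "x \<in> S" shows "conn F (comp F S x)"
proof -
 have *: "(x, y) \<in> (links F (comp F S x))\<^sup>*" if "(x, y) \<in> (links F S)\<^sup>*" for y
  using that
 proof (induction rule: rtrancl_induct)
  case (step y z)
  have "y \<in> comp F S x" "z \<in> comp F S x" 
   using step.hyps by (auto simp: comp_def intro: rtrancl_into_rtrancl)
  then have "(y, z) \<in> links F (comp F S x)" using step.hyps by (auto simp: links_def)
  then show ?case using step by auto
 qed auto
 have "(y, z) \<in> (links F (comp F S x))\<^sup>*" if "y \<in> comp F S x" "z \<in> comp F S x" for y z
  by (rule rtrancl_trans[OF links_rtrancl_sym[OF *] *]) (use that in \<open>simp_all add: comp_def\<close>)
 then show ?thesis unfolding conn_def using comp_self[of x F S] by blast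
qed

lemma conn_via_comp: "x \<in> S \<Longrightarrow> S \<subseteq> comp F S x \<Longrightarrow> conn F S"
 using comp_conn[of x S F] comp_subset[of x S F] by simp

lemma conn_subset_comp:
 assumes "conn F T" "x \<in> T" "T \<subseteq> S" shows "T \<subseteq> comp F S x"
 using assms unfolding conn_def comp_def by (auto intro: links_rtrancl_mono)

lemma conn_crossing:
 assumes "conn F S" "A \<subseteq> S" "A \<noteq> {}" "A \<noteq> S"
 shows "\<exists>x\<in>A. \<exists>y\<in>S - A. {x, y} \<in> F"
proof (rule ccontr)
 assume no: "\<not> ?thesis"
 obtain x where x: "x \<in> A" using assms by auto
 have "y \<in> A" if "(x, y) \<in> (links F S)\<^sup>*" for y
  using that x by (induction rule: rtrancl_induct) (use no in \<open>auto simp: links_def\<close>)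
 then show False using assms x unfolding conn_def by blast
qed

lemma connI:
 assumes "S \<noteq> {}" "\<And>A. A \<subseteq> S \<Longrightarrow> A \<noteq> {} \<Longrightarrow> A \<noteq> S \<Longrightarrow> \<exists>x\<in>A. \<exists>y\<in>S - A. {x, y} \<in> F"
 shows "conn F S"
proof -
 have "comp F S x = S" if x: "x \<in> S" for x
 proof (rule ccontr)
  assume "comp F S x \<noteq> S"
  then obtain y z where "y \<in> comp F S x" "z \<in> S - comp F S x" "{y, z} \<in> F"
   using assms(2)[OF comp_subset[OF x] comp_nonempty] by blast
  then show False using comp_step[of y F S x z] comp_subset[OF x] by auto
 qed
 then show ?thesis using assms(1) conn_via_comp[of _ S F] by auto
qed

lemma conn_singleton [simp]: "conn F {x}"
 by (simp add: conn_def)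

lemma conn_Un:
 assumes "conn F S" "conn F T" "S \<inter> T \<noteq> {}"
 shows "conn F (S \<union> T)"
proof -
 obtain x where x: "x \<in> S" "x \<in> T" using assms by auto
 have "S \<subseteq> comp F (S \<union> T) x" "T \<subseteq> comp F (S \<union> T) x"
  using conn_subset_comp[OF assms(1) x(1), of "S \<union> T"] conn_subset_comp[OF assms(2) x(2), of "S \<union> T"] by auto
 then show ?thesis using x by (intro conn_via_comp[of x]) auto
qed

lemma conn_insert:
 assumes "conn F S" "x \<in> S" "{x, y} \<in> F"
 shows "conn F (insert y S)"
proof -
 have "conn F {x, y}"
  using comp_step[of x F "{x, y}" x y] assms(3) by (intro conn_via_comp[of x]) auto
 then have "conn F (S \<union> {x, y})" using assms by (intro conn_Un) auto
 moreover have "S \<union> {x, y} = insert y S" using assms by auto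
 ultimately show ?thesis by simp
qed

lemma conn_restrict: "conn F S \<Longrightarrow> conn (F \<inter> Pow S) S"
proof -
 have "links (F \<inter> Pow S) S = links F S" by (auto simp: links_def)
 then show "conn F S \<Longrightarrow> conn (F \<inter> Pow S) S" by (simp add: conn_def)
qed

lemma cluster_cut [simp]: "pairs F \<Longrightarrow> cut F (cluster F v) = {}"
proof (rule equals0I)
 fix e assume "pairs F" "e \<in> cut F (cluster F v)"
 then obtain x y where "x \<in> cluster F v" "y \<notin> cluster F v" "{x, y} \<in> F"
  using cutE by metis
 then show False using comp_step[of x F UNIV v y] by simp
qed

lemma cluster_eqI:
 assumes "pairs F" "conn F S" "v \<in> S" "cut F S = {}"
 shows "cluster F v = S"
proof
 show "S \<subseteq> cluster F v" using assms by (intro conn_subset_comp) auto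
 show "cluster F v \<subseteq> S"
 proof
  fix u assume "u \<in> cluster F v"
  then have "(v, u) \<in> (links F UNIV)\<^sup>*" by (simp add: comp_def)
  then show "u \<in> S"
  proof (induction rule: rtrancl_induct)
   case (step y z)
   then have "{y, z} \<in> F" by (auto simp: links_def)
   then show ?case using step cutI[of y z F S] assms(4) by auto
  qed (rule assms)
 qed
qed

lemma cluster_mono: "F \<subseteq> F' \<Longrightarrow> cluster F v \<subseteq> cluster F' v"
 unfolding comp_def by (auto intro: links_rtrancl_mono)

lemma cluster_subset:
 assumes "v \<in> S" "\<And>e. e \<in> F \<Longrightarrow> e \<subseteq> S"
 shows "cluster F v \<subseteq> S"
proof
 fix u assume "u \<in> cluster F v"
 then have "(v, u) \<in> (links F UNIV)\<^sup>*" by (simp add: comp_def)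
 then show "u \<in> S" using assms
  by (induction rule: rtrancl_induct) (auto simp: links_def)
qed

lemma conn_extend:
 assumes "conn F S" "finite S" "conn F U" "U \<subseteq> S" "card U \<le> m" "m \<le> card S"
 shows "\<exists>T. U \<subseteq> T \<and> T \<subseteq> S \<and> conn F T \<and> card T = m"
 using assms(3-6)
proof (induction "m - card U" arbitrary: U)
 case 0
 then show ?case by (intro exI[of _ U]) auto
next
 case (Suc k)
 have "U \<noteq> S" using Suc by auto
 then obtain x y where xy: "x \<in> U" "y \<in> S - U" "{x, y} \<in> F"
  using conn_crossing[OF assms(1), of U] Suc by (auto simp: conn_def)
 have fU: "finite U" using assms(2) Suc finite_subset by auto
 have "\<exists>T. insert y U \<subseteq> T \<and> T \<subseteq> S \<and> conn F T \<and> card T = m"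
  using Suc xy fU by (intro Suc.hyps(1)) (auto intro: conn_insert)
 then show ?case by auto
qed

section \<open>Spanning edge sets and the cutting of connected sets\<close>

definition ncomp :: "'v set set \<Rightarrow> 'v set \<Rightarrow> nat" where
 "ncomp F A = card (comp F A ` A)"

lemma ncomp_pos: "finite A \<Longrightarrow> A \<noteq> {} \<Longrightarrow> 0 < ncomp F A"
 by (simp add: ncomp_def card_gt_0_iff)

lemma ncomp_empty: "ncomp {} A = card A"
proof -
 have "comp {} A x = {x}" for x by (auto simp: comp_def links_def)
 then show ?thesis unfolding ncomp_def by (simp add: card_image inj_on_def)
qed

text \<open>As long as \<open>F\<close> leaves \<open>A\<close> disconnected, some edge of
  \<open>L\<close> joins two of its components and lowers \<open>ncomp\<close>. The strict
  inequality is the edge count of a spanning tree on the components; with \<open>F = {}\<close> the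
  lemma produces spanning trees of \<open>A\<close>.\<close>

lemma spanning_links:
 assumes "finite A" "conn (F \<union> L) A"
 shows "\<exists>L'. L' \<subseteq> L \<and> L' \<subseteq> Pow A \<and> finite L' \<and> conn (F \<union> L') A \<and> card L' < ncomp F A"
 using assms(2)
proof (induction "ncomp F A" arbitrary: F rule: less_induct)
 case less
 have ne: "A \<noteq> {}" using less by (auto simp: conn_def)
 show ?case
 proof (cases "conn F A")
  case True
  then show ?thesis using ncomp_pos[OF assms(1) ne] by (intro exI[of _ "{}"]) auto
 next
  case False
  then obtain x where x: "x \<in> A" "comp F A x \<noteq> A" using ne
   unfolding conn_def comp_def by blast
  obtain u w where uw: "u \<in> comp F A x" "w \<in> A - comp F A x" "{u, w} \<in> F \<union> L"
   using conn_crossing[OF less.prems comp_subset[OF x(1)] comp_nonempty x(2)] by blast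
  have uA: "u \<in> A" using uw comp_subset[OF x(1)] by auto
  have uwL: "{u, w} \<in> L" using uw comp_step[OF uw(1), of w] uA by auto
  let ?F = "insert {u, w} F"
  \<comment> \<open>\<open>h\<close> sends an old component to the new one that contains it, by way
    of an arbitrary representative. It identifies the components of \<open>u\<close> and
    \<open>w\<close>, so there are strictly fewer new components.\<close>
  define h where "h K = comp ?F A (SOME x. x \<in> K)" for K
  have h: "h (comp F A y) = comp ?F A y" for y
  proof -
   have "(SOME x. x \<in> comp F A y) \<in> comp F A y" by (rule someI[of _ y]) simp
   then have "(SOME x. x \<in> comp F A y) \<in> comp ?F A y"
    unfolding comp_def by (auto intro: links_rtrancl_mono)
   then show ?thesis unfolding h_def by (rule comp_eq)
  qed
  let ?X = "comp F A ` A"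
  have img: "comp ?F A ` A = h ` ?X" by (simp only: image_image h)
  have "w \<in> comp ?F A u" by (rule comp_step[of u]) (use uA uw in simp_all)
  then have "comp ?F A w = comp ?F A u" by (rule comp_eq)
  then have huw: "h (comp F A u) = h (comp F A w)" by (simp only: h)
  have "comp F A w \<noteq> comp F A x" using comp_self[of w F A] uw(2) by blast
  then have "comp F A u \<noteq> comp F A w" using comp_eq[OF uw(1)] by simp
  then have "\<not> inj_on h ?X" using inj_onD[of h ?X "comp F A u" "comp F A w", OF _ huw] uA uw(2) by blast
  then have "card (h ` ?X) \<noteq> card ?X" using eq_card_imp_inj_on[of ?X h] assms(1) by blast
  moreover have "card (h ` ?X) \<le> card ?X" using assms(1) by (intro card_image_le finite_imageI)
  ultimately have "card (h ` ?X) < card ?X" by linarith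
  then have lt: "ncomp ?F A < ncomp F A" unfolding ncomp_def img .
  have "conn (?F \<union> L) A" using less.prems by (rule conn_mono) auto
  from less.hyps[OF lt this] obtain L' where
   L': "L' \<subseteq> L" "L' \<subseteq> Pow A" "finite L'" "conn (?F \<union> L') A" "card L' < ncomp ?F A" by auto
  have "card (insert {u, w} L') < ncomp F A"
  proof -
   have "card (insert {u, w} L') \<le> Suc (card L')" by (simp add: card_insert_if L'(3))
   then show ?thesis using L'(5) lt by linarith
  qed
  then show ?thesis using L' uwL uA uw
   by (intro exI[of _ "insert {u, w} L'"]) (auto simp: insert_commute Un_insert_left)
 qed
qed

text \<open>The terms are probabilities of disjoint events: \<open>T\<close> is the set of all random edges that meet the
 cluster of \<open>v\<close>.\<close>

lemma sum_connected_weights: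
 assumes "finite E" "pairs E" "probs E q" "finite \<T>"
  and T: "\<And>T. T \<in> \<T> \<Longrightarrow> T \<subseteq> E \<and> conn T (insert v (\<Union>T))"
 shows "(\<Sum>T\<in>\<T>. (\<Prod>e\<in>T. q e) * (\<Prod>e\<in>inc E (insert v (\<Union>T)) - T. 1 - q e)) \<le> 1"
proof -
 let ?B = "\<lambda>T. inc E (insert v (\<Union>T)) - T"
 let ?P = "\<lambda>T F. T \<subseteq> F \<and> F \<inter> ?B T = {}"
 have "(\<Sum>T\<in>\<T>. (\<Prod>e\<in>T. q e) * (\<Prod>e\<in>?B T. 1 - q e)) = (\<Sum>T\<in>\<T>. chance E q (?P T))"
  using T assms by (intro sum.cong refl chance_pattern[symmetric]) (auto simp: inc_def)
 also have "... \<le> 1"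
 proof (intro chance_disjoint_sum assms)
  have *: "cluster F v = insert v (\<Union>T) \<and> F \<inter> inc E (cluster F v) = T"
   if "F \<subseteq> E" "T \<in> \<T>" "?P T F" for F T
  proof -
   let ?S = "insert v (\<Union>T)"
   have pF: "pairs F" using assms(2) that pairs_subset by auto
   have c: "conn F ?S" using T[OF that(2)] that(3) conn_mono by blast
   have TI: "T \<subseteq> inc E ?S"
   proof
    fix e assume e: "e \<in> T"
    then have "card e = 2" using T[OF that(2)] assms(2) by (auto simp: pairs_def)
    then have "e \<noteq> {}" by auto
    then show "e \<in> inc E ?S" using e T[OF that(2)] by (auto simp: inc_def)
   qed
   have sub: "F \<inter> inc E ?S = T" using that TI by blast
   have "cut F ?S = {}"
   proof (rule ccontr)
    assume "cut F ?S \<noteq> {}"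
    then obtain e where e: "e \<in> F" "e \<inter> ?S \<noteq> {}" "\<not> e \<subseteq> ?S" by (auto simp: cut_def)
    then have "e \<in> T" using sub that(1) by (auto simp: inc_def)
    then show False using e by auto
   qed
   then have "cluster F v = ?S" using cluster_eqI[OF pF c] by auto
   then show ?thesis using sub by auto
  qed
  fix F T T' assume "F \<subseteq> E" "T \<in> \<T>" "T' \<in> \<T>" "?P T F" "?P T' F"
  then show "T = T'" using *[of F T] *[of F T'] by metis
 qed
 finally show ?thesis .
qed

text \<open>The analogue of cutting a subtree off a tree at a single shared vertex. Consider the
  connected pieces with at least \<open>m\<close> vertices whose complement becomes connected when
  one attachment vertex of the piece is added back. A smallest one has at most \<open>2 * m\<close>
  vertices, since otherwise the removal of its attachment vertex exposes a smaller admissible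
  piece.\<close>

lemma conn_split:
 assumes "finite S" "conn F S" "1 \<le> m" "2 * m < card S"
 shows "\<exists>v Q. v \<in> Q \<and> Q \<subseteq> S \<and> conn F Q \<and> m \<le> card Q \<and> card Q \<le> 2 * m \<and> conn F (insert v (S - Q))"
proof -
 let ?P = "\<lambda>Q. m \<le> card Q \<and> Q \<subseteq> S \<and> conn F Q \<and> (\<exists>v\<in>Q. conn F (insert v (S - Q)))"
 have "?P S" using assms by (auto simp: conn_def)
 then obtain Q where Q: "?P Q" and min: "\<And>Q'. ?P Q' \<Longrightarrow> card Q \<le> card Q'"
  using ex_has_least_nat[of ?P S card] by blast
 obtain v where v: "v \<in> Q" "conn F (insert v (S - Q))" using Q by auto
 have fQ: "finite Q" using Q assms finite_subset by auto
 have "card Q \<le> 2 * m"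
 proof (rule ccontr)
  assume big: "\<not> card Q \<le> 2 * m"
  have cQ: "card (Q - {v}) = card Q - 1" using v fQ by simp
  have "Q - {v} \<noteq> {}"
  proof
   assume "Q - {v} = {}"
   then have "card (Q - {v}) = 0" by (metis card.empty)
   then show False using cQ big assms(3) by linarith
  qed
  then obtain x where x: "x \<in> Q - {v}" by auto
  define K where "K = comp F (Q - {v}) x"
  have K: "K \<subseteq> Q - {v}" "conn F K" "x \<in> K" unfolding K_def
   using comp_subset[OF x] comp_conn[OF x] by auto
  have cl: "z \<in> K" if "y \<in> K" "{y, z} \<in> F" "z \<in> Q - {v}" for y z
   using that comp_step[of y F "Q - {v}" x z] K unfolding K_def by auto
  obtain y where y: "y \<in> K" "{y, v} \<in> F"
  proof -
   have "K \<noteq> Q" using K v by auto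
   then obtain y z where "y \<in> K" "z \<in> Q - K" "{y, z} \<in> F"
    using conn_crossing[of F Q K] Q K by auto
   then show ?thesis using cl[of y z] that[of y] by (cases "z = v") auto
  qed
  have cK: "conn F (insert v K)" using conn_insert[OF K(2) y] .
  have fK: "finite K" using K fQ finite_subset by auto
  show False
  proof (cases "K = Q - {v}")
   \<comment> \<open>\<open>Q - {v}\<close> is connected, hence itself admissible, with the
     neighbour \<open>y\<close> of \<open>v\<close> as its attachment vertex.\<close>
   case True
   have "conn F (insert y (insert v (S - Q)))"
    using conn_insert[OF v(2), of v y] y(2) by (simp add: insert_commute)
   moreover have "insert y (S - K) = insert y (insert v (S - Q))"
    using True v Q by auto
   ultimately have "conn F (insert y (S - K))" by simp
   then have "?P K" using K Q cQ big True y by auto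
   then show False using min[of K] cQ True fQ v by (metis card_Diff1_less not_le)
  next
   case False
   have c2: "conn F (Q - K)"
   proof (rule connI)
    show "Q - K \<noteq> {}" using v K by auto
    fix A assume A: "A \<subseteq> Q - K" "A \<noteq> {}" "A \<noteq> Q - K"
    show "\<exists>x\<in>A. \<exists>y\<in>Q - K - A. {x, y} \<in> F"
    proof (cases "v \<in> A")
     case True
     then obtain x z where xz: "x \<in> A \<union> K" "z \<in> Q - (A \<union> K)" "{x, z} \<in> F"
      using conn_crossing[of F Q "A \<union> K"] Q K A by blast
     have "x \<notin> K" using cl[of x z] xz True by auto
     then show ?thesis using xz by auto
    next
     case False
     then obtain x z where xz: "x \<in> A" "z \<in> Q - A" "{x, z} \<in> F"
      using conn_crossing[of F Q A] Q K A v by blast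
     have "z \<notin> K" using cl[of z x] xz False A by (auto simp: insert_commute)
     then show ?thesis using xz by auto
    qed
   qed
   show False
   \<comment> \<open>\<open>v\<close> disconnects \<open>Q\<close>. Either \<open>insert v K\<close>
     is large enough to be admissible, or it has fewer than \<open>m\<close> vertices and then
     \<open>Q - K\<close> keeps at least \<open>m\<close>.\<close>
   proof (cases "m \<le> card (insert v K)")
    case True
    have "insert v (S - insert v K) = (insert v (S - Q)) \<union> (Q - K)" using v K Q by auto
    moreover have "conn F ((insert v (S - Q)) \<union> (Q - K))"
     using v K c2 by (intro conn_Un) auto
    ultimately have "?P (insert v K)" using True K Q cK v by auto
    moreover have "card (insert v K) < card Q"
     using K v False fQ by (intro psubset_card_mono) auto
    ultimately show False using min by (metis not_le)
   next
    case False
    then have "card K < m" using fK by (simp add: card_insert_if split: if_splits)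
    then have "m \<le> card (Q - K)" using big K fK fQ by (subst card_Diff_subset) auto
    moreover have "conn F (insert v (S - (Q - K)))"
    proof -
     have "insert v (S - (Q - K)) = insert v (S - Q) \<union> insert v K" using K Q by auto
     moreover have "conn F (insert v (S - Q) \<union> insert v K)" using v cK by (intro conn_Un) auto
     ultimately show ?thesis by simp
    qed
    moreover have "v \<in> Q - K" using v K by auto
    ultimately have "?P (Q - K)" using c2 Q by blast
    moreover have "card (Q - K) < card Q"
     using K fQ by (intro psubset_card_mono) auto
    ultimately show False using min by (metis not_le)
   qed
  qed
 qed
 then show ?thesis using Q v by auto
qed

text \<open>Reduces density on all connected sets to sets of size O(m), the only ones for which a
  union bound is needed. Pieces are cut off by \<open>conn_split\<close>; the vertex shared with the
  remainder is counted twice. Half of the contribution of a piece pays for it, because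
  \<open>c * m\<close> is at least 2; this is the loss of the factor 2.\<close>

lemma conn_density:
 assumes "2 \<le> c * real m" "1 \<le> m" "c \<le> 1" "0 \<le> c"
  and dens: "\<And>Q. conn F Q \<Longrightarrow> finite Q \<Longrightarrow> m \<le> card Q \<Longrightarrow> card Q \<le> 3 * m \<Longrightarrow> Q \<subseteq> V \<Longrightarrow> c * card Q \<le> card (Q \<inter> W)"
  and S: "conn F S" "finite S" "m \<le> card S" "S \<subseteq> V"
 shows "c / 2 * card S \<le> card (S \<inter> W)"
 using S
proof (induction "card S" arbitrary: S rule: less_induct)
 case less
 show ?case
 proof (cases "card S \<le> 3 * m")
  case True
  then have "c * card S \<le> card (S \<inter> W)" using less dens by blast
  moreover have "c / 2 * card S \<le> c * card S" using assms by (intro mult_right_mono) auto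
  ultimately show ?thesis by linarith
 next
  case False
  then obtain v Q where Q: "v \<in> Q" "Q \<subseteq> S" "conn F Q" "m \<le> card Q" "card Q \<le> 2 * m" "conn F (insert v (S - Q))"
   using conn_split[of S F m] less assms by auto
  let ?S = "insert v (S - Q)"
  have fQ: "finite Q" using Q less finite_subset by auto
  have "c * real m \<le> 1 * real m" using assms by (intro mult_right_mono) auto
  then have m2: "2 \<le> m" using assms(1) by linarith
  have cS: "card ?S = card S - card Q + 1" using Q less fQ by (simp add: card_Diff_subset)
  have le: "card Q \<le> card S" using Q less card_mono by auto
  have "c / 2 * card ?S \<le> card (?S \<inter> W)"
   using Q less cS False m2 le by (intro less.hyps) auto
  moreover have "c * card Q \<le> card (Q \<inter> W)" using Q less m2 fQ by (intro dens) auto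
  moreover have "card (Q \<inter> W) + card (?S \<inter> W) \<le> card (S \<inter> W) + 1"
  proof -
   have "card (Q \<inter> W) + card (?S \<inter> W) = card ((Q \<inter> W) \<union> (?S \<inter> W)) + card ((Q \<inter> W) \<inter> (?S \<inter> W))"
    using fQ less by (intro card_Un_Int) auto
   moreover have "(Q \<inter> W) \<union> (?S \<inter> W) = S \<inter> W" using Q by auto
   moreover have "card ((Q \<inter> W) \<inter> (?S \<inter> W)) \<le> card {v}" by (intro card_mono) auto
   ultimately show ?thesis by simp
  qed
  moreover have "c * real m \<le> c * real (card Q)" using Q assms by (intro mult_left_mono) auto
  moreover have "real (card (Q \<inter> W)) + real (card (?S \<inter> W)) \<le> real (card (S \<inter> W) + 1)"
   using calculation(3) by linarith
  moreover have "c / 2 * card ?S = c / 2 * (real (card S) - real (card Q) + 1)" using cS le by simp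
  ultimately have "c / 2 * (real (card S) - real (card Q) + 1) + c * card Q \<le> card (S \<inter> W) + 1"
   "2 \<le> c * card Q" using assms(1) by linarith+
  then have "c * card S / 2 + c / 2 + c * card Q / 2 \<le> card (S \<inter> W) + 1" "2 \<le> c * card Q"
   by (simp_all add: field_simps)
  then show ?thesis using assms(4) by simp
 qed
qed

lemma chance_insert:
 "finite E \<Longrightarrow> e \<notin> E \<Longrightarrow> chance (insert e E) q P = q e * chance E q (\<lambda>F. P (insert e F)) + (1 - q e) * chance E q P"
 by (simp add: chance_def mean_insert)

section \<open>Exploration of clusters\<close>

definition reach :: "'v set set \<Rightarrow> 'v set \<Rightarrow> 'v set" where
 "reach F X = (\<Union>x\<in>X. cluster F x)"

lemma reach_subset: "X \<subseteq> S \<Longrightarrow> (\<And>e. e \<in> F \<Longrightarrow> e \<subseteq> S) \<Longrightarrow> reach F X \<subseteq> S"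
 unfolding reach_def using cluster_subset[of _ S F] by blast

lemma reach_insert_edge:
 assumes "x \<in> X" shows "reach F (insert y X) \<subseteq> reach (insert {x, y} F) X"
proof -
 let ?F = "insert {x, y} F"
 have "cluster F z \<subseteq> cluster ?F z" for z by (rule cluster_mono) auto
 moreover have "y \<in> cluster ?F x" by (rule comp_step[of x]) auto
 then have "cluster ?F y = cluster ?F x" by (rule comp_eq)
 ultimately show ?thesis unfolding reach_def using assms by blast
qed

text \<open>Edges are revealed one at a time; the bound is a supermartingale in the number of reached vertices
 and of unrevealed edges.\<close>

lemma chance_reach_small:
 assumes E: "finite E" "pairs E" "\<And>e. e \<in> E \<Longrightarrow> e \<subseteq> S0" "finite S0"
  and p: "0 \<le> p" "p \<le> 1" and l: "0 < l" "l \<le> 1" and u: "u * (1 - p + p * l) = 1" "1 \<le> u"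
  and iso: "\<And>S. S \<subseteq> S0 \<Longrightarrow> S \<noteq> {} \<Longrightarrow> card S < N \<Longrightarrow> 1 \<le> l ^ card S * u ^ card (cut E S)"
  and X: "X \<subseteq> S0" "X \<noteq> {}" "D \<subseteq> E"
 shows "chance D (\<lambda>_. p) (\<lambda>F. card (reach F X) < N) \<le> l ^ card X * u ^ card (E - D)"
 using X
proof (induction "card D" arbitrary: X D rule: less_induct)
 case less
 have fD: "finite D" by (rule finite_subset[OF less.prems(3) E(1)])
 have fX: "finite X" by (rule finite_subset[OF less.prems(1) E(4)])
 have pr: "probs D' (\<lambda>_. p)" for D' :: "'a set set" using p by (simp add: probs_def)
 have sub: "X \<subseteq> reach F X" for F unfolding reach_def by auto
 have fr: "finite (reach F Y)" if "F \<subseteq> D" "Y \<subseteq> S0" for F Y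
 proof (rule finite_subset[OF reach_subset E(4)])
  show "e \<subseteq> S0" if "e \<in> F" for e using \<open>F \<subseteq> D\<close> less.prems(3) that by (intro E(3)) auto
 qed (rule that(2))
 show ?case
 proof (cases "N \<le> card X")
  case True
  have "chance D (\<lambda>_. p) (\<lambda>F. card (reach F X) < N) = chance D (\<lambda>_. p) (\<lambda>F. False)"
   unfolding chance_def
  proof (intro mean_cong)
   fix F assume F: "F \<subseteq> D"
   have "card X \<le> card (reach F X)" by (intro card_mono fr[OF F less.prems(1)] sub)
   then show "of_bool (card (reach F X) < N) = (of_bool False :: real)" using True by simp
  qed
  also have "... = 0" using fD by (simp add: chance_def)
  finally show ?thesis using l u by simp
 next
  case False
  show ?thesis
  proof (cases "\<exists>e\<in>D. e \<in> cut E X")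
   \<comment> \<open>All edges leaving \<open>X\<close> have been revealed, so the cut of
     \<open>X\<close> is contained in \<open>E - D\<close>, and \<open>iso\<close> makes the claimed
     bound at least 1.\<close>
   case False
   then have "cut E X \<subseteq> E - D" by (auto simp: cut_def)
   then have "card (cut E X) \<le> card (E - D)" using E by (intro card_mono) auto
   then have "u ^ card (cut E X) \<le> u ^ card (E - D)" using u by (intro power_increasing)
   then have "l ^ card X * u ^ card (cut E X) \<le> l ^ card X * u ^ card (E - D)"
    using l by (intro mult_left_mono) auto
   moreover have "1 \<le> l ^ card X * u ^ card (cut E X)"
    using less.prems \<open>\<not> N \<le> card X\<close> by (intro iso) auto
   moreover have "chance D (\<lambda>_. p) (\<lambda>F. card (reach F X) < N) \<le> 1"
    by (rule chance_le_1[OF fD pr])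
   ultimately show ?thesis by linarith
  next
   case True
   then obtain e where e: "e \<in> D" "e \<in> cut E X" by auto
   from cutE[OF E(2) e(2)] obtain x y where xy: "e = {x, y}" "x \<in> X" "y \<notin> X" "{x, y} \<in> E" by metis
   define D' where "D' = D - {e}"
   have D: "D = insert e D'" "e \<notin> D'" "finite D'" using e fD by (auto simp: D'_def)
   have D'E: "D' \<subseteq> E" using less.prems(3) by (auto simp: D'_def)
   have yS: "y \<in> S0" using xy E(3) by blast
   have lt: "card D' < card D" unfolding D'_def using fD e(1) by (rule card_Diff1_less)
   have ED: "E - D' = insert e (E - D)" "e \<notin> E - D" using e less.prems D by auto
   have cED: "card (E - D') = Suc (card (E - D))" using ED E by simp
   have IH1: "chance D' (\<lambda>_. p) (\<lambda>F. card (reach F (insert y X)) < N) \<le> l ^ Suc (card X) * u ^ Suc (card (E - D))"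
    using less.hyps[OF lt, of "insert y X"] less.prems(1) yS xy(3) fX D'E cED by simp
   have IH2: "chance D' (\<lambda>_. p) (\<lambda>F. card (reach F X) < N) \<le> l ^ card X * u ^ Suc (card (E - D))"
    using less.hyps[OF lt, of X] less.prems(1,2) D'E cED by simp
   have step: "chance D' (\<lambda>_. p) (\<lambda>F. card (reach (insert e F) X) < N) \<le> chance D' (\<lambda>_. p) (\<lambda>F. card (reach F (insert y X)) < N)"
   proof (intro chance_mono pr)
    fix F assume F: "F \<subseteq> D'" "card (reach (insert e F) X) < N"
    have "card (reach F (insert y X)) \<le> card (reach (insert e F) X)"
     using F D less.prems reach_insert_edge[OF xy(2)] xy(1) by (intro card_mono fr) auto
    then show "card (reach F (insert y X)) < N" using F by simp
   qed
   have "chance D (\<lambda>_. p) (\<lambda>F. card (reach F X) < N) =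
    p * chance D' (\<lambda>_. p) (\<lambda>F. card (reach (insert e F) X) < N) + (1 - p) * chance D' (\<lambda>_. p) (\<lambda>F. card (reach F X) < N)"
    unfolding D(1) using D by (simp add: chance_insert)
   \<comment> \<open>Revealing an edge costs a factor \<open>u\<close>; with probability
     \<open>p\<close> a new vertex is reached and brings a factor \<open>l\<close>. The relation
     between \<open>u\<close> and \<open>l\<close> balances the two exactly.\<close>
   also have "... \<le> p * (l ^ Suc (card X) * u ^ Suc (card (E - D))) + (1 - p) * (l ^ card X * u ^ Suc (card (E - D)))"
    using p IH1 IH2 step by (intro add_mono mult_left_mono) auto
   also have "... = l ^ card X * u ^ card (E - D) * (u * (1 - p + p * l))"
    by (simp add: algebra_simps)
   finally show ?thesis using u by simp
  qed
 qed
qed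

text \<open>Survival of a supercritical exploration: with at least \<open>qb\<close> boundary edges
  per reached vertex, the mean number of offspring is at least \<open>1 + 2 * y\<close>. The weights
  are \<open>l = 1 - y\<close> per vertex and \<open>u = 1 / (1 - p * y)\<close> per edge. The
  exploration starts from one vertex and no revealed edge, hence the bound
  \<open>1 - y\<close>.\<close>

lemma chance_cluster_small:
 fixes qb :: real
 assumes E: "finite E" "pairs E" "\<And>e. e \<in> E \<Longrightarrow> e \<subseteq> S0" "finite S0" "v \<in> S0"
  and p: "0 \<le> p" "p \<le> 1" and y: "0 \<le> y" "y \<le> 1 / 2" and qb: "1 + 2 * y \<le> p * qb"
  and iso: "\<And>S. S \<subseteq> S0 \<Longrightarrow> S \<noteq> {} \<Longrightarrow> card S < N \<Longrightarrow> qb * card S \<le> card (cut E S)"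
 shows "chance E (\<lambda>_. p) (\<lambda>F. card (cluster F v) < N) \<le> 1 - y"
proof -
 define u where "u = 1 / (1 - p * y)"
 have py: "p * y \<le> 1 / 2" using mult_mono[of p 1 y "1/2"] p y by simp
 have py0: "0 \<le> p * y" using p y by simp
 have u1: "1 \<le> u" using py py0 by (simp add: u_def field_simps)
 have eu: "exp (p * y) \<le> u"
 proof -
  have "1 - p * y \<le> exp (- (p * y))" using exp_ge_add_one_self[of "- (p * y)"] by simp
  then have "(1 - p * y) * exp (p * y) \<le> exp (- (p * y)) * exp (p * y)" by (intro mult_right_mono) auto
  then show ?thesis using py by (simp add: u_def field_simps exp_minus)
 qed
 have ly: "exp (- y - 2 * y\<^sup>2) \<le> 1 - y"
 proof -
  have "- y - 2 * y\<^sup>2 \<le> ln (1 - y)" by (rule ln_one_minus_pos_lower_bound) (use y in auto)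
  then have "exp (- y - 2 * y\<^sup>2) \<le> exp (ln (1 - y))" by simp
  then show ?thesis using y by simp
 qed
 have "chance E (\<lambda>_. p) (\<lambda>F. card (reach F {v}) < N) \<le> (1 - y) ^ card {v} * u ^ card (E - E)"
 proof (rule chance_reach_small[where ?S0.0 = S0])
  show "u * (1 - p + p * (1 - y)) = 1" using py by (simp add: u_def field_simps)
  fix S assume S: "S \<subseteq> S0" "S \<noteq> {}" "card S < N"
  let ?s = "real (card S)"
  have "(1 + 2 * y) * ?s \<le> p * qb * ?s" using qb by (intro mult_right_mono) auto
  also have "... \<le> p * card (cut E S)" using mult_left_mono[OF iso[OF S] p(1)] by (simp add: mult_ac)
  finally have "y * ((1 + 2 * y) * ?s) \<le> y * (p * card (cut E S))" using y by (intro mult_left_mono) auto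
  then have "1 \<le> exp ((- y - 2 * y\<^sup>2) * ?s + (p * y) * card (cut E S))"
   by (simp add: algebra_simps power2_eq_square)
  also have "... = exp (- y - 2 * y\<^sup>2) ^ card S * exp (p * y) ^ card (cut E S)"
   by (simp add: exp_add exp_of_nat_mult[symmetric] mult_ac)
  also have "... \<le> (1 - y) ^ card S * u ^ card (cut E S)"
   using ly eu y by (intro mult_mono power_mono) auto
  finally show "1 \<le> (1 - y) ^ card S * u ^ card (cut E S)" .
 qed (use assms u1 in auto)
 then show ?thesis by (simp add: reach_def)
qed

section \<open>Counting trees and small subsets\<close>

lemma sum_power_card: "finite S \<Longrightarrow> (\<Sum>R\<in>Pow S. x ^ card R) = (1 + x :: real) ^ card S"
proof (induction S rule: finite_induct)
 case (insert a S)
 have inj: "inj_on (insert a) (Pow S)" using insert by (auto simp: inj_on_def)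
 have "(\<Sum>R\<in>Pow (insert a S). x ^ card R) = (\<Sum>R\<in>Pow S. x ^ card R) + (\<Sum>R\<in>insert a ` Pow S. x ^ card R)"
  unfolding Pow_insert using insert by (intro sum.union_disjoint) auto
 also have "(\<Sum>R\<in>insert a ` Pow S. x ^ card R) = (\<Sum>R\<in>Pow S. x * x ^ card R)"
 proof (subst sum.reindex[OF inj], intro sum.cong refl, unfold o_def)
  fix R assume "R \<in> Pow S"
  then have "a \<notin> R" "finite R" using insert finite_subset by auto
  then show "x ^ card (insert a R) = x * x ^ card R" by simp
 qed
 finally show ?case using insert by (simp add: sum_distrib_left[symmetric] algebra_simps)
qed auto

text \<open>Weighted counting: each of the subsets has weight \<open>x ^ card R\<close> at least
  \<open>x powr r\<close>, while all subsets of \<open>S\<close> together weigh (1 + x) to the power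
  \<open>card S\<close>.\<close>

lemma card_small_subsets:
 assumes "finite S" "0 < x" "x \<le> 1" "0 \<le> r"
 shows "real (card {R. R \<subseteq> S \<and> real (card R) \<le> r}) \<le> exp (r * ln (1 / x) + x * card S)"
proof -
 let ?A = "{R. R \<subseteq> S \<and> real (card R) \<le> r}"
 have "real (card ?A) * x powr r = (\<Sum>R\<in>?A. x powr r)" by simp
 also have "... \<le> (\<Sum>R\<in>?A. x ^ card R)"
 proof (intro sum_mono)
  fix R assume "R \<in> ?A"
  then have "x powr r \<le> x powr real (card R)" using assms by (intro powr_mono') auto
  then show "x powr r \<le> x ^ card R" using assms by (simp add: powr_realpow)
 qed
 also have "... \<le> (\<Sum>R\<in>Pow S. x ^ card R)" using assms by (intro sum_mono2) auto
 also have "... = (1 + x) ^ card S" using assms(1) by (rule sum_power_card)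
 also have "... \<le> exp x ^ card S" using assms by (intro power_mono) (auto simp: exp_ge_add_one_self)
 also have "... = exp (x * card S)" by (simp add: exp_of_nat_mult[symmetric] mult_ac)
 finally have "real (card ?A) * x powr r \<le> exp (x * card S)" .
 then have "real (card ?A) * x powr r * exp (r * ln (1 / x)) \<le> exp (x * card S) * exp (r * ln (1 / x))"
  by (intro mult_right_mono) auto
 moreover have "x powr r * exp (r * ln (1 / x)) = 1" using assms by (simp add: powr_def ln_div exp_add[symmetric])
 ultimately have "real (card ?A) \<le> exp (x * card S) * exp (r * ln (1 / x))"
  unfolding mult.assoc by simp
 then show ?thesis by (simp add: exp_add mult.commute)
qed

text \<open>Trees with \<open>M\<close> vertices through \<open>v\<close>, encoded by their edge
  sets: a connected graph with fewer edges than vertices is a tree. Inserting \<open>v\<close>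
  covers the one-vertex tree, whose edge set is empty.\<close>

definition trees :: "'v set set \<Rightarrow> 'v \<Rightarrow> nat \<Rightarrow> 'v set set set" where
 "trees E v M = {T. T \<subseteq> E \<and> conn T (insert v (\<Union>T)) \<and> card (insert v (\<Union>T)) = M \<and> card T < M}"

lemma conn_spanning_tree:
 assumes "conn F S" "finite S" "v \<in> S" "pairs F"
 shows "\<exists>T\<in>trees F v (card S). insert v (\<Union>T) = S"
proof -
 obtain T where T: "T \<subseteq> F" "T \<subseteq> Pow S" "conn T S" "card T < card S"
  using spanning_links[of S "{}" F] assms by (auto simp: ncomp_empty)
 have "S \<subseteq> insert v (\<Union>T)"
 proof
  fix x assume x: "x \<in> S"
  show "x \<in> insert v (\<Union>T)"
  proof (cases "S = {x}")
   case False
   then obtain y where "{x, y} \<in> T" using conn_crossing[OF T(3), of "{x}"] x by auto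
   then show ?thesis by auto
  qed (use assms in auto)
 qed
 then have "insert v (\<Union>T) = S" using T assms by auto
 then show ?thesis using T by (auto simp: trees_def)
qed

locale host =
 fixes V :: "'v set" and E :: "'v set set" and d :: nat
 assumes finV: "finite V" and neV: "V \<noteq> {}" and pairsE: "pairs E" and EV: "e \<in> E \<Longrightarrow> e \<subseteq> V"
  and deg: "x \<in> V \<Longrightarrow> card {e \<in> E. x \<in> e} = d" and d2: "2 \<le> d"
begin

lemma finE: "finite E"
 using EV finV by (intro finite_subset[of E "Pow V"]) auto

lemma card_nbrs: "z \<in> V \<Longrightarrow> card {a. {z, a} \<in> E} = d" and finite_nbrs: "finite {a. {z, a} \<in> E}"
proof -
 show "z \<in> V \<Longrightarrow> card {a. {z, a} \<in> E} = d" using card_neighbourhood[OF pairsE] deg by simp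
 show "finite {a. {z, a} \<in> E}" by (rule finite_subset[OF _ finV]) (use EV in blast)
qed

lemma card_inc: "S \<subseteq> V \<Longrightarrow> card (inc E S) \<le> d * card S"
proof -
 assume S: "S \<subseteq> V"
 have "inc E S = (\<Union>x\<in>S. {e \<in> E. x \<in> e})" by (auto simp: inc_def)
 also have "card \<dots> \<le> (\<Sum>x\<in>S. card {e \<in> E. x \<in> e})"
  using S finV finite_subset by (intro card_UN_le) auto
 also have "... = (\<Sum>x\<in>S. d)" using S deg by (intro sum.cong) auto
 finally show ?thesis by (simp add: mult.commute)
qed

lemma finite_trees: "finite (trees E v M)"
 using finE by (intro finite_subset[of "trees E v M" "Pow E"]) (auto simp: trees_def)

lemma tree_vertices:
 assumes "T \<in> trees E v M" "v \<in> V" shows "insert v (\<Union>T) \<subseteq> V"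
 using assms EV by (auto simp: trees_def)

text \<open>Weighted form of the bound (e * d)^M for the number of subtrees through a vertex. In
  percolation with edge probability 1 / d, a given tree is exactly the set of kept edges meeting the
  cluster of \<open>v\<close> with probability at least d^(- card T) * exp (- M * (1 + 2 / d)),
  because at most \<open>d * M\<close> edges meet it. These events are disjoint, so their
  probabilities sum to at most 1.\<close>

lemma sum_trees:
 assumes "v \<in> V" "1 \<le> a"
 shows "(\<Sum>T\<in>trees E v M. (a / d) ^ card T) \<le> exp (M * (ln a + 1 + 2 / d))"
proof -
 let ?q = "1 / real d" and ?S = "\<lambda>T. insert v (\<Union>T)"
 have q: "0 < ?q" "?q \<le> 1 / 2" using d2 by (auto simp: field_simps)
 have lb: "?q ^ card T * exp (- (M * (1 + 2 / d))) \<le> (\<Prod>e\<in>T. ?q) * (\<Prod>e\<in>inc E (?S T) - T. 1 - ?q)"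
  if T: "T \<in> trees E v M" for T
 proof -
  have "card (inc E (?S T) - T) \<le> card (inc E (?S T))"
   using finE by (intro card_mono) (auto simp: inc_def)
  also have "... \<le> d * M" using card_inc[OF tree_vertices[OF T assms(1)]] T by (simp add: trees_def)
  finally have c: "card (inc E (?S T) - T) \<le> d * M" .
  have "- ?q - 2 * ?q\<^sup>2 \<le> ln (1 - ?q)" by (rule ln_one_minus_pos_lower_bound) (use q in auto)
  then have "real (d * M) * (- ?q - 2 * ?q\<^sup>2) \<le> real (d * M) * ln (1 - ?q)" by (intro mult_left_mono) auto
  moreover have "real (d * M) * (- ?q - 2 * ?q\<^sup>2) = - (M * (1 + 2 / d))"
   using d2 by (simp add: field_simps power2_eq_square)
  ultimately have "exp (- (M * (1 + 2 / d))) \<le> exp (real (d * M) * ln (1 - ?q))" by simp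
  also have "... = (1 - ?q) ^ (d * M)" using q by (simp add: exp_of_nat_mult del: of_nat_mult)
  also have "... \<le> (1 - ?q) ^ card (inc E (?S T) - T)" using q c by (intro power_decreasing) auto
  finally show ?thesis using q by (simp add: mult_left_mono)
 qed
 have "(\<Sum>T\<in>trees E v M. ?q ^ card T * exp (- (M * (1 + 2 / d)))) \<le> 1"
 proof (rule order_trans[OF sum_mono[OF lb]])
  show "(\<Sum>T\<in>trees E v M. (\<Prod>e\<in>T. ?q) * (\<Prod>e\<in>inc E (?S T) - T. 1 - ?q)) \<le> 1"
   using q by (intro sum_connected_weights finE pairsE finite_trees) (auto simp: probs_def trees_def)
 qed
 then have "(\<Sum>T\<in>trees E v M. ?q ^ card T) * exp (- (M * (1 + 2 / d))) \<le> 1"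
  unfolding sum_distrib_right .
 then have "(\<Sum>T\<in>trees E v M. ?q ^ card T) * exp (- (M * (1 + 2 / d))) * exp (M * (1 + 2 / d)) \<le> 1 * exp (M * (1 + 2 / d))"
  by (intro mult_right_mono) auto
 then have 1: "(\<Sum>T\<in>trees E v M. ?q ^ card T) \<le> exp (M * (1 + 2 / d))"
  unfolding mult.assoc exp_add[symmetric] by simp
 have "(\<Sum>T\<in>trees E v M. (a / d) ^ card T) \<le> (\<Sum>T\<in>trees E v M. a ^ M * ?q ^ card T)"
 proof (intro sum_mono)
  fix T assume "T \<in> trees E v M"
  then have "a ^ card T \<le> a ^ M" using assms(2) by (intro power_increasing) (auto simp: trees_def)
  then have "a ^ card T * ?q ^ card T \<le> a ^ M * ?q ^ card T" by (intro mult_right_mono) auto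
  then show "(a / d) ^ card T \<le> a ^ M * ?q ^ card T" by (simp add: power_divide power_one_over)
 qed
 also have "... \<le> a ^ M * exp (M * (1 + 2 / d))"
  unfolding sum_distrib_left[symmetric] using 1 assms by (intro mult_left_mono) auto
 also have "a ^ M = exp (M * ln a)" using assms by (simp add: exp_of_nat_mult)
 finally show ?thesis by (simp add: exp_add[symmetric] algebra_simps)
qed

text \<open>Union bound over spanning trees. At most \<open>k\<close> of the \<open>10 * k\<close>
  incident edges belong to the tree; the other \<open>9 * k\<close> exceed a mean of at most
  \<open>2 * k\<close>, so \<open>chance_many\<close> gives exp (4 * k - 9 * k). The weighted number
  of trees is at most exp (3 * k).\<close>

lemma chance_dense_conn:
 fixes a :: real
 assumes a: "1 \<le> a" "a \<le> 2" "a \<le> d" and m: "1 \<le> m"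
 shows "chance E (\<lambda>_. a / d) (\<lambda>F. \<exists>S\<subseteq>V. conn F S \<and> m \<le> card S \<and> 10 * card S \<le> card (inc F S))
  \<le> (card V)\<^sup>2 * exp (- 2 * real m)"
proof -
 let ?p = "a / real d"
 have p: "0 \<le> ?p" "?p \<le> 1" using a d2 by (auto simp: field_simps)
 have pr: "probs D (\<lambda>_. ?p)" for D :: "'v set set" using p by (simp add: probs_def)
 let ?I = "SIGMA v:V. SIGMA k:{m..card V}. trees E v k"
 let ?B = "\<lambda>v T. inc E (insert v (\<Union>T)) - T"
 let ?P = "\<lambda>v k T F. T \<subseteq> F \<and> 9 * real k \<le> card (F \<inter> ?B v T)"
 have "chance E (\<lambda>_. ?p) (\<lambda>F. \<exists>S\<subseteq>V. conn F S \<and> m \<le> card S \<and> 10 * card S \<le> card (inc F S))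
  \<le> (\<Sum>i\<in>?I. chance E (\<lambda>_. ?p) (?P (fst i) (fst (snd i)) (snd (snd i))))"
 proof (intro chance_UN pr)
  show "finite ?I" using finV finite_trees by auto
  fix F assume F: "F \<subseteq> E" "\<exists>S\<subseteq>V. conn F S \<and> m \<le> card S \<and> 10 * card S \<le> card (inc F S)"
  then obtain S where S: "S \<subseteq> V" "conn F S" "m \<le> card S" "10 * card S \<le> card (inc F S)" by auto
  then obtain v where v: "v \<in> S" by (auto simp: conn_def)
  have fS: "finite S" using S finV finite_subset by auto
  obtain T where T: "T \<in> trees F v (card S)" "insert v (\<Union>T) = S"
   using conn_spanning_tree[OF S(2) fS v pairs_subset[OF pairsE F(1)]] by auto
  have T': "T \<in> trees E v (card S)" using T F by (auto simp: trees_def)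
  have "inc F S \<subseteq> (F \<inter> ?B v T) \<union> T" using F T by (auto simp: inc_def)
  then have "card (inc F S) \<le> card ((F \<inter> ?B v T) \<union> T)"
   using finE F T' by (intro card_mono) (auto simp: trees_def intro: finite_subset)
  also have "... \<le> card (F \<inter> ?B v T) + card T" by (rule card_Un_le)
  also have "card T \<le> card S" using T by (simp add: trees_def)
  finally have "9 * real (card S) \<le> card (F \<inter> ?B v T)" using S by linarith
  moreover have "card S \<le> card V" using S finV card_mono by auto
  ultimately show "\<exists>i\<in>?I. ?P (fst i) (fst (snd i)) (snd (snd i)) F" using v S T T'
   by (intro bexI[of _ "(v, card S, T)"]) (auto simp: trees_def)
 qed
 also have "... = (\<Sum>v\<in>V. \<Sum>k\<in>{m..card V}. \<Sum>T\<in>trees E v k. chance E (\<lambda>_. ?p) (?P v k T))"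
  using finV finite_trees by (simp add: sum.Sigma case_prod_unfold)
 also have "... \<le> (\<Sum>v\<in>V. \<Sum>k\<in>{m..card V}. exp (- 2 * real m))"
 proof (intro sum_mono)
  fix v k assume v: "v \<in> V" and k: "k \<in> {m..card V}"
  have "(\<Sum>T\<in>trees E v k. chance E (\<lambda>_. ?p) (?P v k T)) \<le> (\<Sum>T\<in>trees E v k. ?p ^ card T * exp (- 5 * real k))"
  proof (intro sum_mono)
   fix T assume T: "T \<in> trees E v k"
   have "card (?B v T) \<le> card (inc E (insert v (\<Union>T)))"
    using finE by (intro card_mono) (auto simp: inc_def)
   also have "... \<le> d * k" using card_inc[OF tree_vertices[OF T v]] T by (simp add: trees_def)
   finally have "?p * real (card (?B v T)) \<le> ?p * real (d * k)"
    using p by (intro mult_left_mono of_nat_mono) auto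
   also have "... = a * k" using d2 by simp
   also have "... \<le> 2 * real k" using a by (intro mult_right_mono) auto
   finally have *: "?p * card (?B v T) \<le> 2 * real k" .
   have "chance E (\<lambda>_. ?p) (?P v k T) \<le> (\<Prod>e\<in>T. ?p) * exp (2 * ?p * card (?B v T) - 9 * real k)"
    using T finE pr
    by (intro chance_many) (auto simp: trees_def inc_def)
   also have "... \<le> ?p ^ card T * exp (- 5 * real k)"
    using p * by (intro mult_mono) auto
   finally show "chance E (\<lambda>_. ?p) (?P v k T) \<le> ?p ^ card T * exp (- 5 * real k)" .
  qed
  also have "... \<le> exp (k * (ln a + 1 + 2 / d)) * exp (- 5 * real k)"
   unfolding sum_distrib_right[symmetric] by (intro mult_right_mono sum_trees v a) auto
  also have "... \<le> exp (- 2 * real m)"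
  proof -
   have "ln a \<le> 1" using ln_le_minus_one[of a] a by simp
   moreover have "2 / real d \<le> 1" using d2 by simp
   ultimately have "real k * (ln a + 1 + 2 / d) \<le> real k * 3" by (intro mult_left_mono) auto
   then show ?thesis using k by (simp add: exp_add[symmetric])
  qed
  finally show "(\<Sum>T\<in>trees E v k. chance E (\<lambda>_. ?p) (?P v k T)) \<le> exp (- 2 * real m)" .
 qed
 also have "... \<le> (\<Sum>v\<in>V. card V * exp (- 2 * real m))"
  using m by (intro sum_mono) (auto intro!: mult_right_mono)
 also have "... = (card V)\<^sup>2 * exp (- 2 * real m)" by (simp add: power2_eq_square)
 finally show ?thesis .
qed

end

section \<open>Connected sets with few vertices in large clusters\<close>

context host begin

text \<open>The two requirements concern disjoint edge sets: \<open>T\<close> has to be covered by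
  the union of the layers, and \<open>U\<close> has to be avoided by the first layer alone. Hence
  the probabilities multiply.\<close>

lemma chance_two_layers:
 assumes pr: "probs E q1" "probs E q2" and TU: "T \<subseteq> E" "U \<subseteq> E" "T \<inter> U = {}"
 shows "mean E q1 (\<lambda>F1. chance E q2 (\<lambda>F2. T \<subseteq> F1 \<union> F2 \<and> F1 \<inter> U = {}))
  = (\<Prod>e\<in>T. 1 - (1 - q1 e) * (1 - q2 e)) * (\<Prod>e\<in>U. 1 - q1 e)"
proof -
 let ?C = "\<lambda>F1. chance E q2 (\<lambda>F2. T \<subseteq> F1 \<union> F2)"
 let ?D = "E - U"
 have TD: "T \<subseteq> ?D" using TU by auto
 have fin: "finite U" "finite ?D" using TU finE by (auto intro: finite_subset)
 have *: "chance E q2 (\<lambda>F2. T \<subseteq> (X \<union> Y) \<union> F2 \<and> (X \<union> Y) \<inter> U = {}) = of_bool (X = {}) * ?C Y"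
  if "X \<subseteq> U" "Y \<subseteq> ?D" for X Y
 proof -
  have eq: "(T \<subseteq> (X \<union> Y) \<union> F2 \<and> (X \<union> Y) \<inter> U = {}) \<longleftrightarrow> (X = {} \<and> T \<subseteq> Y \<union> F2)" for F2
   using that TU by blast
  show ?thesis unfolding eq using finE by (cases "X = {}") (simp_all add: chance_def)
 qed
 have "mean E q1 (\<lambda>F1. chance E q2 (\<lambda>F2. T \<subseteq> F1 \<union> F2 \<and> F1 \<inter> U = {}))
  = mean U q1 (\<lambda>X. mean ?D q1 (\<lambda>Y. of_bool (X = {}) * ?C Y))"
  unfolding mean_split[OF finE TU(2)] using * by (intro mean_cong) auto
 also have "... = mean ?D q1 ?C * mean U q1 (\<lambda>X. of_bool (X = {}))"
 proof -
  have "mean ?D q1 (\<lambda>Y. of_bool (X = {}) * ?C Y) = mean ?D q1 ?C * of_bool (X = {})" for X :: "'v set set"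
   by (simp add: mean_cmult)
  then show ?thesis by (simp only: mean_cmult)
 qed
 also have "mean U q1 (\<lambda>X. of_bool (X = {})) = (\<Prod>e\<in>U. 1 - q1 e)"
 proof -
  have "mean U q1 (\<lambda>X. of_bool (X = {})) = chance U q1 (\<lambda>F. {} \<subseteq> F \<and> F \<inter> U = {})"
   unfolding chance_def by (intro mean_cong) (auto simp: Int_absorb2)
  also have "... = (\<Prod>e\<in>U. 1 - q1 e)" using fin by (subst chance_pattern) auto
  finally show ?thesis .
 qed
 also have "mean ?D q1 ?C = mean E q1 (\<lambda>F. ?C (F \<inter> ?D))"
  by (rule mean_marginal[symmetric]) (auto simp: finE)
 also have "... = mean E q1 ?C"
 proof (intro mean_cong)
  fix F
  have "T \<subseteq> F \<inter> ?D \<union> F2 \<longleftrightarrow> T \<subseteq> F \<union> F2" for F2 using TD by blast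
  then show "?C (F \<inter> ?D) = ?C F" by simp
 qed
 also have "... = mean E (\<lambda>e. 1 - (1 - q1 e) * (1 - q2 e)) (\<lambda>F. of_bool (T \<subseteq> F))"
  unfolding chance_def by (rule mean_merge[OF finE])
 also have "... = (\<Prod>e\<in>T. 1 - (1 - q1 e) * (1 - q2 e))"
  using chance_pattern[OF finE TU(1), of "{}"] by (simp add: chance_def)
 finally show ?thesis .
qed

definition giants :: "nat \<Rightarrow> 'v set set \<Rightarrow> 'v set" where
 "giants N F = {v \<in> V. N \<le> card (cluster F v)}"

lemma cluster_V: "F \<subseteq> E \<Longrightarrow> v \<in> V \<Longrightarrow> cluster F v \<subseteq> V"
 using cluster_subset[of v V F] EV by blast

text \<open>Each vertex of \<open>Q\<close> outside \<open>giants\<close> is replaced by its whole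
  \<open>F1\<close>-cluster, which has fewer than \<open>N\<close> vertices. The resulting set can
  be left along \<open>F1\<close> only from the few vertices \<open>R\<close> of \<open>Q\<close>
  that lie in \<open>giants\<close>. It is this closedness, not the sparsity of
  \<open>giants\<close> in \<open>Q\<close>, to which a first moment bound applies.\<close>

lemma small_closure:
 assumes F: "F1 \<subseteq> E" "F2 \<subseteq> E" and Q: "Q \<subseteq> V" "conn (F1 \<union> F2) Q"
  and cW: "card (Q \<inter> giants N F1) \<le> r" "1 \<le> N"
 shows "\<exists>S R. Q \<subseteq> S \<and> S \<subseteq> V \<and> conn (F1 \<union> F2) S \<and> card S \<le> card Q * N \<and> R \<subseteq> S \<and> card R \<le> r \<and>
  F1 \<inter> {e \<in> E. e \<inter> (S - R) \<noteq> {} \<and> \<not> e \<subseteq> S} = {}"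
proof -
 define W where "W = giants N F1"
 define g where "g x = (if x \<in> W then {x} else cluster F1 x)" for x
 define S where "S = (\<Union>x\<in>Q. g x)"
 define R where "R = Q \<inter> W"
 have fQ: "finite Q" using Q finV finite_subset by auto
 have gx: "x \<in> g x" for x by (simp add: g_def)
 then have QS: "Q \<subseteq> S" unfolding S_def by blast
 have gV: "g x \<subseteq> V" if "x \<in> Q" for x
  using that Q cluster_V[OF F(1), of x] by (auto simp: g_def)
 have gc: "conn (F1 \<union> F2) (g x)" for x
  unfolding g_def using conn_mono[OF comp_conn[of x UNIV F1], of "F1 \<union> F2"] by auto
 have "S \<subseteq> comp (F1 \<union> F2) S y" if y: "y \<in> Q" for y
 proof
  fix z assume "z \<in> S"
  then obtain x where x: "x \<in> Q" "z \<in> g x" by (auto simp: S_def)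
  have "x \<in> comp (F1 \<union> F2) S y"
   using conn_subset_comp[OF Q(2) y QS] x by auto
  moreover have "z \<in> comp (F1 \<union> F2) S x"
   using conn_subset_comp[OF gc gx, of x S] x by (auto simp: S_def)
  ultimately show "z \<in> comp (F1 \<union> F2) S y" using comp_eq by metis
 qed
 moreover obtain y where "y \<in> Q" using Q by (auto simp: conn_def)
 ultimately have cS: "conn (F1 \<union> F2) S" using QS by (intro conn_via_comp[of y]) auto
 have "card S \<le> (\<Sum>x\<in>Q. card (g x))" unfolding S_def using fQ by (rule card_UN_le)
 also have "... \<le> (\<Sum>x\<in>Q. N)"
  using Q cW by (intro sum_mono) (auto simp: g_def W_def giants_def)
 finally have "card S \<le> card Q * N" by simp
 moreover have "F1 \<inter> {e \<in> E. e \<inter> (S - R) \<noteq> {} \<and> \<not> e \<subseteq> S} = {}"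
 proof (rule ccontr)
  assume "\<not> ?thesis"
  then obtain e z where e: "e \<in> F1" "z \<in> e" "z \<in> S" "z \<notin> R" "\<not> e \<subseteq> S" by auto
  obtain w where w: "e = {z, w}" using pairs_edgeE[OF pairs_subset[OF pairsE F(1)] e(1,2)] by metis
  obtain x where x: "x \<in> Q" "z \<in> g x" using e by (auto simp: S_def)
  have "x \<notin> W" using x e by (auto simp: g_def R_def split: if_splits)
  then have "z \<in> cluster F1 x" using x by (simp add: g_def)
  then have "w \<in> cluster F1 x" using comp_step[of z F1 UNIV x w] e w by auto
  then have "w \<in> S" using x \<open>x \<notin> W\<close> by (auto simp: S_def g_def)
  then show False using e w by auto
 qed
 moreover have "S \<subseteq> V" unfolding S_def using gV by blast
 moreover have "R \<subseteq> S" "card R \<le> r" using QS cW unfolding R_def W_def by auto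
 ultimately show ?thesis using QS cS by blast
qed

text \<open>First moment over a spanning tree of the closed set with \<open>M\<close> vertices and
  over its exceptional set \<open>R\<close>. Per vertex the exponent collects
  \<open>ln a + 1 + 2 / d\<close> from the trees, \<open>c * ln (1 / x) + x\<close> from the choice
  of \<open>R\<close>, and minus \<open>p1\<close> times the number of edges that leave the set away
  from \<open>R\<close> and have to avoid the first layer. For \<open>a = 1 + \<epsilon>\<close> and
  \<open>p1 * d\<close> close to \<open>a\<close> this is about ln (1 + \<epsilon>) - \<epsilon>,
  which is negative.\<close>

lemma chance_sparse_giants:
 fixes a p1 p2 c x B \<kappa> :: real
 assumes a: "1 \<le> a" "a \<le> d" and p: "0 \<le> p1" "p1 \<le> 1" "0 \<le> p2" "p2 \<le> 1" "1 - (1 - p1) * (1 - p2) = a / d"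
  and x: "0 < x" "x \<le> 1" and c: "0 \<le> c" and m: "1 \<le> m" "1 \<le> N"
  and iso: "\<And>S. S \<subseteq> V \<Longrightarrow> S \<noteq> {} \<Longrightarrow> d * card S - B * card S * ln (card S) \<le> card (cut E S)"
  and \<kappa>: "\<And>M. m \<le> M \<Longrightarrow> M \<le> 3 * m * N \<Longrightarrow>
   ln a + 1 + 2 / d + c * ln (1 / x) + x - p1 * (d - B * ln (real M) - d * c) \<le> - \<kappa>" "0 \<le> \<kappa>"
 shows "mean E (\<lambda>_. p1) (\<lambda>F1. chance E (\<lambda>_. p2) (\<lambda>F2. \<exists>Q\<subseteq>V. conn (F1 \<union> F2) Q \<and> m \<le> card Q \<and> card Q \<le> 3 * m \<and>
   card (Q \<inter> giants N F1) < c * card Q)) \<le> card V * (3 * m * N) * exp (- \<kappa> * m)"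
proof -
 let ?I = "SIGMA v:V. SIGMA M:{m..3 * m * N}. SIGMA T:trees E v M. {R. R \<subseteq> insert v (\<Union>T) \<and> real (card R) \<le> c * M}"
 let ?S = "\<lambda>v T. insert v (\<Union>T)"
 let ?U = "\<lambda>v T R. {e \<in> E. e \<inter> (?S v T - R) \<noteq> {} \<and> \<not> e \<subseteq> ?S v T}"
 let ?P = "\<lambda>v T R F1 F2. T \<subseteq> F1 \<union> F2 \<and> F1 \<inter> ?U v T R = {}"
 have pr: "probs D (\<lambda>_. p1)" "probs D (\<lambda>_. p2)" for D :: "'v set set"
  using p(1-4) by (simp_all add: probs_def)
 have finS: "finite (?S v T)" if "v \<in> V" "T \<in> trees E v M" for v T M
  by (rule finite_subset[OF tree_vertices[OF that(2,1)] finV])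
 have finI: "finite ?I"
  by (intro finite_SigmaI finV finite_trees finite_atLeastAtMost) (use finS in auto)
 have "mean E (\<lambda>_. p1) (\<lambda>F1. chance E (\<lambda>_. p2) (\<lambda>F2. \<exists>Q\<subseteq>V. conn (F1 \<union> F2) Q \<and> m \<le> card Q \<and> card Q \<le> 3 * m \<and>
   card (Q \<inter> giants N F1) < c * card Q))
  \<le> mean E (\<lambda>_. p1) (\<lambda>F1. \<Sum>i\<in>?I. chance E (\<lambda>_. p2) (?P (fst i) (fst (snd (snd i))) (snd (snd (snd i))) F1))"
 proof (intro mean_mono pr chance_UN finI)
  fix F1 F2 assume F: "F1 \<subseteq> E" "F2 \<subseteq> E" "\<exists>Q\<subseteq>V. conn (F1 \<union> F2) Q \<and> m \<le> card Q \<and> card Q \<le> 3 * m \<and>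
   card (Q \<inter> giants N F1) < c * card Q"
  then obtain Q where Q: "Q \<subseteq> V" "conn (F1 \<union> F2) Q" "m \<le> card Q" "card Q \<le> 3 * m" "card (Q \<inter> giants N F1) < c * card Q"
   by auto
  obtain S R where S: "Q \<subseteq> S" "S \<subseteq> V" "conn (F1 \<union> F2) S" "card S \<le> card Q * N" "R \<subseteq> S"
    "card R \<le> card (Q \<inter> giants N F1)" "F1 \<inter> {e \<in> E. e \<inter> (S - R) \<noteq> {} \<and> \<not> e \<subseteq> S} = {}"
   using small_closure[OF F(1,2) Q(1,2) order_refl m(2)] by (elim exE conjE) (rule that; assumption)
  obtain v where v: "v \<in> S" using S by (auto simp: conn_def)
  have fS: "finite S" by (rule finite_subset[OF S(2) finV])
  have FE: "F1 \<union> F2 \<subseteq> E" using F by auto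
  obtain T where T: "T \<in> trees (F1 \<union> F2) v (card S)" "insert v (\<Union>T) = S"
   using conn_spanning_tree[OF S(3) fS v pairs_subset[OF pairsE FE]] by auto
  have T': "T \<in> trees E v (card S)" using T FE by (auto simp: trees_def)
  have QSc: "card Q \<le> card S" by (rule card_mono[OF fS S(1)])
  have "card Q * N \<le> 3 * m * N" using Q by (intro mult_right_mono) auto
  then have "card S \<le> 3 * m * N" by (rule order_trans[OF S(4)])
  then have M: "card S \<in> {m..3 * m * N}" using QSc Q(3) by simp
  have "c * card Q \<le> c * card S" using QSc c by (intro mult_left_mono) auto
  then have "real (card R) \<le> c * card S" using Q S by linarith
  then show "\<exists>i\<in>?I. ?P (fst i) (fst (snd (snd i))) (snd (snd (snd i))) F1 F2"
   using v S T T' M by (intro bexI[of _ "(v, card S, T, R)"]) (auto simp: trees_def)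
 qed
 also have "... = (\<Sum>v\<in>V. \<Sum>M\<in>{m..3 * m * N}. \<Sum>T\<in>trees E v M. \<Sum>R\<in>{R. R \<subseteq> ?S v T \<and> real (card R) \<le> c * M}.
   mean E (\<lambda>_. p1) (\<lambda>F1. chance E (\<lambda>_. p2) (?P v T R F1)))"
  using finV finite_trees finS by (simp add: sum.Sigma case_prod_unfold mean_sum)
 also have "... \<le> (\<Sum>v\<in>V. \<Sum>M\<in>{m..3 * m * N}. exp (- \<kappa> * m))"
 proof (intro sum_mono)
  fix v M assume v: "v \<in> V" and M: "M \<in> {m..3 * m * N}"
  let ?h = "c * M * ln (1 / x) + x * M" and ?g = "p1 * M * (d - B * ln (real M) - d * c)"
  have "(\<Sum>R\<in>{R. R \<subseteq> ?S v T \<and> real (card R) \<le> c * M}. mean E (\<lambda>_. p1) (\<lambda>F1. chance E (\<lambda>_. p2) (?P v T R F1)))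
   \<le> (a / d) ^ card T * exp (?h - ?g)" if T: "T \<in> trees E v M" for T
  proof -
   have cS: "card (?S v T) = M" "T \<subseteq> E" using T by (auto simp: trees_def)
   have SV: "?S v T \<subseteq> V" using tree_vertices[OF T v] .
   have "mean E (\<lambda>_. p1) (\<lambda>F1. chance E (\<lambda>_. p2) (?P v T R F1)) \<le> (a / d) ^ card T * exp (- ?g)"
    if R: "R \<subseteq> ?S v T" "real (card R) \<le> c * M" for R
   proof -
    have "mean E (\<lambda>_. p1) (\<lambda>F1. chance E (\<lambda>_. p2) (?P v T R F1)) = (\<Prod>e\<in>T. 1 - (1 - p1) * (1 - p2)) * (\<Prod>e\<in>?U v T R. 1 - p1)"
     using cS by (intro chance_two_layers pr) auto
    also have "... = (a / d) ^ card T * (1 - p1) ^ card (?U v T R)" using p by simp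
    also have "(1 - p1) ^ card (?U v T R) \<le> exp (- p1) ^ card (?U v T R)"
     using p exp_ge_add_one_self[of "- p1"] by (intro power_mono) auto
    also have "... = exp (- p1 * card (?U v T R))" by (simp add: exp_of_nat_mult[symmetric] mult_ac)
    also have "... \<le> exp (- ?g)"
    proof -
     \<comment> \<open>Boundary edges that need not avoid \<open>F1\<close> all meet
       \<open>R\<close>, and at most \<open>d * card R\<close> edges do.\<close>
     have "cut E (?S v T) \<subseteq> ?U v T R \<union> inc E R" by (auto simp: cut_def inc_def)
     then have "card (cut E (?S v T)) \<le> card (?U v T R \<union> inc E R)"
      using finE by (intro card_mono) (auto simp: inc_def)
     also have "... \<le> card (?U v T R) + card (inc E R)" by (rule card_Un_le)
     also have "card (inc E R) \<le> d * card R" using R SV by (intro card_inc) auto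
     finally have "real (card (cut E (?S v T))) \<le> card (?U v T R) + real d * real (card R)"
      by (metis (mono_tags, lifting) add_left_mono of_nat_add of_nat_le_iff of_nat_mult)
     also have "real d * real (card R) \<le> real d * (c * M)" using R by (intro mult_left_mono) auto
     finally have "d * real M - B * M * ln M - d * (c * M) \<le> card (?U v T R)"
      using iso[OF SV] cS by simp
     then have "p1 * (d * real M - B * M * ln M - d * (c * M)) \<le> p1 * card (?U v T R)"
      using p by (intro mult_left_mono) auto
     then show ?thesis by (simp add: algebra_simps)
    qed
    finally show ?thesis using a by (simp add: mult_left_mono)
   qed
   then have "(\<Sum>R\<in>{R. R \<subseteq> ?S v T \<and> real (card R) \<le> c * M}. mean E (\<lambda>_. p1) (\<lambda>F1. chance E (\<lambda>_. p2) (?P v T R F1)))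
    \<le> (\<Sum>R\<in>{R. R \<subseteq> ?S v T \<and> real (card R) \<le> c * M}. (a / d) ^ card T * exp (- ?g))"
    by (intro sum_mono) auto
   also have "... = real (card {R. R \<subseteq> ?S v T \<and> real (card R) \<le> c * M}) * ((a / d) ^ card T * exp (- ?g))" by simp
   also have "... \<le> exp ?h * ((a / d) ^ card T * exp (- ?g))"
    using card_small_subsets[OF finS[OF v T] x, of "c * M"] c a cS by (intro mult_right_mono) auto
   also have "... = (a / d) ^ card T * exp (?h - ?g)" using exp_add[of ?h "- ?g"] by simp
   finally show ?thesis .
  qed
  then have "(\<Sum>T\<in>trees E v M. \<Sum>R\<in>{R. R \<subseteq> ?S v T \<and> real (card R) \<le> c * M}. mean E (\<lambda>_. p1) (\<lambda>F1. chance E (\<lambda>_. p2) (?P v T R F1)))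
   \<le> (\<Sum>T\<in>trees E v M. (a / d) ^ card T * exp (?h - ?g))" by (rule sum_mono)
  also have "... \<le> exp (M * (ln a + 1 + 2 / d)) * exp (?h - ?g)"
   unfolding sum_distrib_right[symmetric] by (intro mult_right_mono sum_trees v a) auto
  also have "... = exp (M * (ln a + 1 + 2 / d + c * ln (1 / x) + x - p1 * (d - B * ln (real M) - d * c)))"
   by (simp add: exp_add[symmetric] algebra_simps)
  also have "... \<le> exp (- \<kappa> * m)"
  proof -
   have "M * (ln a + 1 + 2 / d + c * ln (1 / x) + x - p1 * (d - B * ln (real M) - d * c)) \<le> M * (- \<kappa>)"
    using \<kappa>(1)[of M] M by (intro mult_left_mono) auto
   also have "... \<le> - \<kappa> * m" using M \<kappa>(2) by (simp add: mult_left_mono mult.commute)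
   finally show ?thesis by simp
  qed
  finally show "(\<Sum>T\<in>trees E v M. \<Sum>R\<in>{R. R \<subseteq> ?S v T \<and> real (card R) \<le> c * M}. mean E (\<lambda>_. p1) (\<lambda>F1. chance E (\<lambda>_. p2) (?P v T R F1)))
   \<le> exp (- \<kappa> * m)" .
 qed
 also have "... = card V * (real (card {m..3 * m * N}) * exp (- \<kappa> * m))" by simp
 also have "... \<le> card V * ((3 * m * N) * exp (- \<kappa> * m))"
  using m by (intro mult_left_mono mult_right_mono of_nat_mono) auto
 finally show ?thesis by simp
qed

end

section \<open>Boundaries within the giant clusters\<close>

lemma xlog_mono:
 fixes x y N :: real
 assumes "0 < x" "x \<le> y" "y \<le> N"
 shows "x * ln (exp 1 * N / x) \<le> y * ln (exp 1 * N / y)"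
proof -
 have pos: "0 < y" "0 < N" using assms by auto
 have 1: "ln (exp 1 * N / z) = 1 + ln (N / y) + ln (y / z)" if "0 < z" for z
  using that pos by (simp add: ln_div ln_mult)
 have "ln (y / x) \<le> y / x - 1" using assms pos by (intro ln_le_minus_one) auto
 then have "x * ln (y / x) \<le> x * (y / x - 1)" using assms by (intro mult_left_mono) auto
 also have "... = y - x" using assms by (simp add: field_simps)
 finally have a: "x * ln (y / x) \<le> y - x" .
 have "0 \<le> (y - x) * ln (N / y)" using assms pos by (intro mult_nonneg_nonneg) auto
 then show ?thesis using a 1[OF assms(1)] 1[OF pos(1)] pos by (simp add: algebra_simps)
qed

text \<open>The function \<open>a * ln (N / a)\<close> increases up to \<open>N / exp 1\<close>, and
  there monotonicity compares \<open>a\<close> with \<open>k\<close>. Beyond that point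
  \<open>a\<close> is at least \<open>N / 3\<close> and \<open>ln (N / a)\<close> at least \<alpha>,
  whereas \<open>k * ln (exp 1 * N / k)\<close> never exceeds \<open>N\<close>.\<close>

lemma xlog_lower:
 fixes k a N \<alpha> :: real
 assumes "0 < k" "k \<le> a" "a \<le> (1 - \<alpha>) * N" "0 < \<alpha>" "\<alpha> \<le> 1"
 shows "\<alpha> / 3 * (k * ln (exp 1 * N / k)) \<le> a * ln (N / a)"
proof -
 have a0: "0 < a" using assms by auto
 have "0 < (1 - \<alpha>) * N" using assms a0 by linarith
 then have N: "0 < N" using assms by (simp add: zero_less_mult_iff)
 have aN: "a \<le> N"
 proof -
  have "(1 - \<alpha>) * N \<le> 1 * N" using assms N by (intro mult_right_mono) auto
  then show ?thesis using assms by simp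
 qed
 have kN: "k * ln (exp 1 * N / k) \<le> N * ln (exp 1 * N / N)"
  using assms aN by (intro xlog_mono) auto
 have k0: "0 \<le> k * ln (exp 1 * N / k)"
 proof (intro mult_nonneg_nonneg)
  have "N / k \<ge> 1" using assms aN by simp
  then have "1 \<le> exp 1 * (N / k)" by (smt (verit) exp_ge_add_one_self mult_le_cancel_left1)
  then show "0 \<le> ln (exp 1 * N / k)" by simp
 qed (use assms in auto)
 show ?thesis
 proof (cases "a \<le> N / exp 1")
  case True
  have "k * ln (exp 1 * (N / exp 1) / k) \<le> a * ln (exp 1 * (N / exp 1) / a)"
   using True assms by (intro xlog_mono) auto
  then have 1: "k * ln (N / k) \<le> a * ln (N / a)" by simp
  have "k \<le> N / exp 1" using True assms by simp
  then have "exp 1 \<le> N / k" using assms by (simp add: field_simps)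
  then have 2: "1 \<le> ln (N / k)" using N assms by (subst ln_ge_iff) auto
  have "ln (exp 1 * N / k) = 1 + ln (N / k)" using N assms by (simp add: ln_div ln_mult)
  then have "k * ln (exp 1 * N / k) \<le> k * (2 * ln (N / k))" using 2 assms by (intro mult_left_mono) auto
  moreover have "\<alpha> / 3 * (k * ln (exp 1 * N / k)) \<le> 1 / 2 * (k * ln (exp 1 * N / k))"
   using k0 assms by (intro mult_right_mono) auto
  ultimately show ?thesis using 1 by linarith
 next
  case False
  have "ln (a / N) \<le> a / N - 1" using a0 N by (intro ln_le_minus_one) auto
  also have "a / N \<le> 1 - \<alpha>" using assms N by (simp add: field_simps)
  finally have l: "\<alpha> \<le> ln (N / a)" using a0 N by (simp add: ln_div)
  have "N / 3 \<le> N / exp 1" using exp_le N by (intro divide_left_mono) auto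
  then have "N / 3 \<le> a" using False by linarith
  then have "N / 3 * \<alpha> \<le> a * ln (N / a)" using l assms N by (intro mult_mono) auto
  moreover have "\<alpha> / 3 * (k * ln (exp 1 * N / k)) \<le> \<alpha> / 3 * N"
   using kN N assms by (intro mult_left_mono) auto
  ultimately show ?thesis by (simp add: mult.commute)
 qed
qed

section \<open>Shift maps, the majority set and its boundary\<close>

locale shifts = host V E d for V :: "'v set" and E d +
 fixes I :: "nat set" and sh :: "nat \<Rightarrow> 'v \<Rightarrow> 'v" and C :: nat
 assumes finI: "finite I" and neI: "I \<noteq> {}"
  and sh_V: "i \<in> I \<Longrightarrow> x \<in> V \<Longrightarrow> sh i x \<in> V"
  and sh_E: "i \<in> I \<Longrightarrow> x \<in> V \<Longrightarrow> {x, sh i x} \<in> E"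
  and sh_inj: "i \<in> I \<Longrightarrow> j \<in> I \<Longrightarrow> x \<in> V \<Longrightarrow> sh i x = sh j x \<Longrightarrow> i = j"
  and sh_fib: "i \<in> I \<Longrightarrow> w \<in> V \<Longrightarrow> card {x \<in> V. sh i x = w} \<le> C"
begin

definition nb :: "'v set \<Rightarrow> 'v \<Rightarrow> 'v set" where "nb A z = {a \<in> A. {z, a} \<in> E}"
definition hits :: "'v set \<Rightarrow> 'v \<Rightarrow> nat set" where "hits W x = {i \<in> I. sh i x \<in> W}"
text \<open>In a product, a shift in a coordinate other than that of the edge between
  \<open>x\<close> and \<open>y\<close> moves this edge to a parallel one. The indices collected
  here bring it inside \<open>W\<close>.\<close>

definition para :: "'v set \<Rightarrow> 'v \<Rightarrow> 'v \<Rightarrow> nat set" where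
 "para W x y = {i \<in> I. sh i x \<in> W \<and> sh i y \<in> W \<and> {sh i x, sh i y} \<in> E}"
definition good :: "'v set \<Rightarrow> real \<Rightarrow> 'v \<Rightarrow> bool" where "good W \<theta> x \<longleftrightarrow> \<theta> * card I \<le> card (hits W x)"
definition straight :: "'v set \<Rightarrow> real \<Rightarrow> 'v \<Rightarrow> 'v \<Rightarrow> bool" where
 "straight W \<theta> x y \<longleftrightarrow> \<theta> * card I \<le> card (para W x y)"
definition bonds :: "'v set \<Rightarrow> 'v set \<Rightarrow> 'v set set" where
 "bonds A B = {e \<in> E. \<exists>a\<in>A. \<exists>b\<in>B. e = {a, b}}"
definition twosteps :: "'v set \<Rightarrow> 'v set \<Rightarrow> 'v set \<Rightarrow> real" where
 "twosteps U A B = (\<Sum>z\<in>U. real (card (nb A z)) * real (card (nb B z)))"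

text \<open>The isoperimetric inequality speaks of subsets of the whole product, so the vertices
  outside \<open>W\<close> have to be assigned to \<open>A\<close> or to \<open>W - A\<close>. Good
  vertices follow the vote of their shifts, with draws going to \<open>A\<close>; the others stay on
  the side of \<open>W - A\<close>.\<close>

definition majority :: "'v set \<Rightarrow> real \<Rightarrow> 'v set \<Rightarrow> 'v set" where
 "majority W \<theta> A = A \<union> {x \<in> V - W. good W \<theta> x \<and> card (hits (W - A) x) \<le> card (hits A x)}"

lemma card_nb: "z \<in> V \<Longrightarrow> card (nb A z) \<le> d"
 using card_mono[OF finite_nbrs, of "nb A z" z] card_nbrs[of z] by (auto simp: nb_def)

lemma hits_nb:
 assumes "x \<in> V" "A \<subseteq> V" shows "card (hits A x) \<le> card (nb A x)"
proof (rule card_inj_on_le)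
 show "inj_on (\<lambda>i. sh i x) (hits A x)" using assms sh_inj by (auto simp: inj_on_def hits_def)
 show "(\<lambda>i. sh i x) ` hits A x \<subseteq> nb A x" using assms sh_E by (auto simp: nb_def hits_def)
 show "finite (nb A x)" by (rule finite_subset[OF _ finV]) (use assms in \<open>auto simp: nb_def\<close>)
qed

lemma card_pairs_le:
 assumes "finite U" "\<And>x. x \<in> U \<Longrightarrow> finite (R x)" "P \<subseteq> (SIGMA x:U. R x)" "\<And>x. x \<in> U \<Longrightarrow> real (card (R x)) \<le> f x"
 shows "real (card P) \<le> (\<Sum>x\<in>U. f x)"
proof -
 have "card P \<le> card (SIGMA x:U. R x)" using assms by (intro card_mono) auto
 also have "... = (\<Sum>x\<in>U. card (R x))" using assms by (intro card_SigmaI) auto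
 finally have "real (card P) \<le> (\<Sum>x\<in>U. real (card (R x)))" by (metis of_nat_le_iff of_nat_sum)
 also have "... \<le> (\<Sum>x\<in>U. f x)" using assms by (intro sum_mono)
 finally show ?thesis .
qed

text \<open>Every boundary pair that is not lost is charged to a bond between \<open>A\<close> and
  \<open>W - A\<close> or to two-step paths between them through a vertex outside \<open>W\<close>.
  If both ends lie outside \<open>W\<close>, the parallel shifts of the edge produce many bonds or
  reveal an end with many neighbours on both sides. The factors do not depend on \<open>d\<close>
  because the number of shifts is proportional to \<open>d\<close>.\<close>

lemma boundary_of_majority:
 fixes \<theta> \<theta>' \<rho> :: real
 assumes W: "W \<subseteq> V" "A \<subseteq> W" and \<theta>: "0 < \<theta>" "0 < \<theta>'" "0 < \<rho>" "\<rho> * d \<le> card I"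
 defines "B \<equiv> W - A" and "A' \<equiv> majority W \<theta> A"
 shows "real (card (cut E A')) \<le> (1 + 4 * (real C)\<^sup>2 / \<theta>' + 4 / (\<theta> * \<rho>) + 32 / (\<theta>' * \<rho>)\<^sup>2) *
   (card (bonds A B) + twosteps (V - W) A B / d) +
   card {(x, y). x \<in> A' \<and> y \<in> V - A' \<and> {x, y} \<in> E \<and> (\<not> good W \<theta> y \<or> (good W \<theta> x \<and> \<not> straight W \<theta>' x y))}"
proof -
 let ?D = "bonds A B" and ?h = "real (card I)" and ?n = "\<lambda>A z. real (card (nb A z))"
 define Lost where "Lost = {(x, y). x \<in> A' \<and> y \<in> V - A' \<and> {x, y} \<in> E \<and> (\<not> good W \<theta> y \<or> (good W \<theta> x \<and> \<not> straight W \<theta>' x y))}"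
 have V: "A \<subseteq> V" "B \<subseteq> V" "A' \<subseteq> V" using W by (auto simp: B_def A'_def majority_def)
 have AB: "A \<inter> B = {}" by (auto simp: B_def)
 have h: "0 < ?h" using finI neI by (simp add: card_gt_0_iff)
 have fD: "finite ?D" using finE by (auto simp: bonds_def)
 have fin: "finite A" "finite B" "finite A'" "finite (V - W)" using V finV by (auto intro: finite_subset)
 define PP where "PP = {(x, y). x \<in> A' \<and> y \<in> V - A' \<and> {x, y} \<in> E}"
 have fPP: "finite PP" using fin finV by (intro finite_subset[of PP "A' \<times> V"]) (auto simp: PP_def)
 have "cut E A' \<subseteq> (\<lambda>(x, y). {x, y}) ` PP"
 proof
  fix e assume e: "e \<in> cut E A'"
  then obtain x y where xy: "e = {x, y}" "x \<in> A'" "y \<notin> A'" "{x, y} \<in> E" using cutE[OF pairsE e] by metis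
  then have "y \<in> V" using EV by auto
  then have "(x, y) \<in> PP" using xy by (simp add: PP_def)
  then show "e \<in> (\<lambda>(x, y). {x, y}) ` PP" using xy(1) by force
 qed
 then have cutPP: "card (cut E A') \<le> card PP" by (rule surj_card_le[OF fPP])
 let ?out = "{x \<in> V - W. good W \<theta> x}"
 define P1 where "P1 = {(x, y). x \<in> A \<and> y \<in> B \<and> {x, y} \<in> E}"
 \<comment> \<open>A good vertex outside \<open>W\<close> has at least \<theta> * \<open>?h\<close>
   / 2 neighbours on the side of its majority. A boundary pair joining it to the other side
   therefore extends to that many two-step paths through it.\<close>
 define P2 where "P2 = {(y, x). y \<in> ?out \<and> x \<in> A \<and> {x, y} \<in> E \<and> card (hits A y) < card (hits B y)}"
 define P3 where "P3 = {(x, y). x \<in> ?out \<and> y \<in> B \<and> {x, y} \<in> E \<and> card (hits B x) \<le> card (hits A x)}"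
 define mix where "mix x y = {i \<in> I. {sh i x, sh i y} \<in> ?D}" for x y
 define P4 where "P4 = {(x, y). x \<in> V \<and> y \<in> V \<and> \<theta>' * ?h / 2 \<le> card (mix x y)}"
 define Mx where "Mx = {z \<in> V - W. \<theta>' * ?h / 4 \<le> card (hits A z) \<and> \<theta>' * ?h / 4 \<le> card (hits B z)}"
 define P5 where "P5 = {(y, x). y \<in> Mx \<and> x \<in> nb V y}"
 have "PP \<subseteq> P1 \<union> prod.swap ` P2 \<union> P3 \<union> P4 \<union> P5 \<union> prod.swap ` P5 \<union> Lost"
 proof
  fix p assume "p \<in> PP"
  then obtain x y where p: "p = (x, y)" "x \<in> A'" "y \<in> V" "y \<notin> A'" "{x, y} \<in> E" by (auto simp: PP_def)
  show "p \<in> P1 \<union> prod.swap ` P2 \<union> P3 \<union> P4 \<union> P5 \<union> prod.swap ` P5 \<union> Lost"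
  proof (cases "p \<in> Lost")
   case False
   then have gy: "good W \<theta> y" and st: "good W \<theta> x \<Longrightarrow> straight W \<theta>' x y" using p by (auto simp: Lost_def)
   show ?thesis
   proof (cases "x \<in> A")
    case xA: True
    show ?thesis
    proof (cases "y \<in> W")
     case True
     then have "y \<in> B" using p by (auto simp: A'_def majority_def B_def)
     then show ?thesis using xA p by (auto simp: P1_def)
    next
     case False
     then have "card (hits A y) < card (hits B y)" using p gy by (auto simp: A'_def majority_def B_def)
     then have "(y, x) \<in> P2" using False p xA gy by (auto simp: P2_def)
     then show ?thesis using p by force
    qed
   next
    case xA: False
    then have x: "x \<in> V - W" "good W \<theta> x" "card (hits B x) \<le> card (hits A x)"
     using p by (auto simp: A'_def majority_def B_def)
    show ?thesis
    proof (cases "y \<in> W")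
     case True
     then have "y \<in> B" using p by (auto simp: A'_def majority_def B_def)
     then show ?thesis using x p by (auto simp: P3_def)
    next
     case False
     then have y: "y \<in> V - W" "card (hits A y) < card (hits B y)" using p gy by (auto simp: A'_def majority_def B_def)
     let ?AA = "{i \<in> I. sh i x \<in> A \<and> sh i y \<in> A}" and ?BB = "{i \<in> I. sh i x \<in> B \<and> sh i y \<in> B}"
     have sub: "para W x y \<subseteq> mix x y \<union> ?AA \<union> ?BB"
      by (auto simp: para_def mix_def bonds_def B_def insert_commute)
     have "card (para W x y) \<le> card (mix x y \<union> ?AA \<union> ?BB)"
      using finI by (intro card_mono sub) (auto simp: mix_def)
     also have "... \<le> card (mix x y \<union> ?AA) + card ?BB" by (rule card_Un_le)
     also have "card (mix x y \<union> ?AA) \<le> card (mix x y) + card ?AA" by (rule card_Un_le)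
     finally have "\<theta>' * ?h \<le> real (card (mix x y)) + real (card ?AA) + real (card ?BB)"
      using st[OF x(2)] unfolding straight_def by linarith
     \<comment> \<open>A parallel shift inside \<open>W\<close> is mixed, or has both ends in
       \<open>A\<close>, or both in \<open>B\<close>. If one of the last two kinds is frequent, one
       of \<open>x\<close> and \<open>y\<close> has many hits on the side opposite to its majority,
       hence many on both sides.\<close>
     then consider "\<theta>' * ?h / 2 \<le> card (mix x y)" | "\<theta>' * ?h / 4 \<le> card ?AA" | "\<theta>' * ?h / 4 \<le> card ?BB"
      by linarith
     then show ?thesis
     proof cases
      case 1
      then have "p \<in> P4" using p x by (auto simp: P4_def)
      then show ?thesis by blast
     next
      case 2
      have "card ?AA \<le> card (hits A y)" using finI by (intro card_mono) (auto simp: hits_def)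
      then have "y \<in> Mx" using 2 y by (auto simp: Mx_def)
      then have "(y, x) \<in> P5" using p x by (auto simp: P5_def nb_def insert_commute)
      then show ?thesis using p by force
     next
      case 3
      have "card ?BB \<le> card (hits B x)" using finI by (intro card_mono) (auto simp: hits_def)
      then have "x \<in> Mx" using 3 x by (auto simp: Mx_def)
      then have "(x, y) \<in> P5" using p x by (auto simp: P5_def nb_def insert_commute)
      then show ?thesis using p by blast
     qed
    qed
   qed
  qed blast
 qed
 moreover have fP: "finite P1" "finite P2" "finite P3" "finite P4" "finite P5" "finite Lost"
  by (rule finite_subset[of _ "V \<times> V"], use V finV EV in \<open>auto simp: P1_def P2_def P3_def P4_def P5_def Lost_def Mx_def nb_def\<close>)+
 ultimately have "card PP \<le> card (P1 \<union> prod.swap ` P2 \<union> P3 \<union> P4 \<union> P5 \<union> prod.swap ` P5 \<union> Lost)"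
  by (intro card_mono) auto
 also have "... \<le> card P1 + card (prod.swap ` P2) + card P3 + card P4 + card P5 + card (prod.swap ` P5) + card Lost"
  by (intro order_trans[OF card_Un_le] add_mono order_refl)
 also have "card (prod.swap ` P2) = card P2" by (intro card_image) (auto simp: inj_on_def)
 also have "card (prod.swap ` P5) = card P5" by (intro card_image) (auto simp: inj_on_def)
 finally have PP: "real (card PP) \<le> card P1 + real (card P2) + card P3 + card P4 + 2 * real (card P5) + card Lost" by simp
 have c1: "card P1 \<le> card ?D"
 proof (rule card_inj_on_le)
  show "inj_on (\<lambda>(x, y). {x, y}) P1" using AB by (auto simp: inj_on_def P1_def doubleton_eq_iff)
  show "(\<lambda>(x, y). {x, y}) ` P1 \<subseteq> ?D" by (auto simp: P1_def bonds_def)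
 qed (rule fD)
 let ?S = "twosteps (V - W) A B"
 have fnb: "finite (nb A z)" "finite (nb B z)" "finite (nb V z)" for z using fin finV by (auto simp: nb_def)
 have half: "\<theta> * ?h / 2 \<le> ?n A x" if "x \<in> V" "good W \<theta> x" "card (hits B x) \<le> card (hits A x)" for x
 proof -
  have "hits W x \<subseteq> hits A x \<union> hits B x" by (auto simp: hits_def B_def)
  then have "card (hits W x) \<le> card (hits A x \<union> hits B x)" using finI by (intro card_mono) (auto simp: hits_def)
  also have "... \<le> card (hits A x) + card (hits B x)" by (rule card_Un_le)
  finally show ?thesis using that hits_nb[OF that(1) V(1)] unfolding good_def by linarith
 qed
 have half': "\<theta> * ?h / 2 \<le> ?n B x" if "x \<in> V" "good W \<theta> x" "card (hits A x) < card (hits B x)" for x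
 proof -
  have "hits W x \<subseteq> hits A x \<union> hits B x" by (auto simp: hits_def B_def)
  then have "card (hits W x) \<le> card (hits A x \<union> hits B x)" using finI by (intro card_mono) (auto simp: hits_def)
  also have "... \<le> card (hits A x) + card (hits B x)" by (rule card_Un_le)
  finally show ?thesis using that hits_nb[OF that(1) V(2)] unfolding good_def by linarith
 qed
 have scale: "r \<le> r * s * (2 / (\<theta> * ?h))" if "\<theta> * ?h / 2 \<le> s" "0 \<le> r" for r s
 proof -
  have "1 \<le> s * (2 / (\<theta> * ?h))" using that \<theta> h by (simp add: field_simps)
  then have "r * 1 \<le> r * (s * (2 / (\<theta> * ?h)))" using that by (intro mult_left_mono)
  then show ?thesis by (simp only: mult_1_right mult.assoc)
 qed
 have c2: "real (card P2) \<le> ?S * (2 / (\<theta> * ?h))"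
 proof -
  have "real (card P2) \<le> (\<Sum>y\<in>V - W. ?n A y * ?n B y * (2 / (\<theta> * ?h)))"
   apply (rule card_pairs_le[of "V - W" "\<lambda>y. {x. x \<in> nb A y \<and> good W \<theta> y \<and> card (hits A y) < card (hits B y)}"])
   subgoal by (rule fin)
   subgoal using fnb by auto
   subgoal by (auto simp: P2_def nb_def insert_commute)
   subgoal for y using half'[of y] scale[of "?n B y" "?n A y"] \<theta> h
    by (cases "good W \<theta> y \<and> card (hits A y) < card (hits B y)") (auto simp: mult_nonneg_nonneg)
   done
  then show ?thesis by (simp only: twosteps_def sum_distrib_right)
 qed
 have c3: "real (card P3) \<le> ?S * (2 / (\<theta> * ?h))"
 proof -
  have "real (card P3) \<le> (\<Sum>y\<in>V - W. ?n A y * ?n B y * (2 / (\<theta> * ?h)))"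
   apply (rule card_pairs_le[of "V - W" "\<lambda>y. {x. x \<in> nb B y \<and> good W \<theta> y \<and> card (hits B y) \<le> card (hits A y)}"])
   subgoal by (rule fin)
   subgoal using fnb by auto
   subgoal by (auto simp: P3_def nb_def insert_commute)
   subgoal for y using half[of y] scale[of "?n A y" "?n B y"] \<theta> h
    by (cases "good W \<theta> y \<and> card (hits B y) \<le> card (hits A y)") (auto simp: mult_nonneg_nonneg mult.commute mult.left_commute)
   done
  then show ?thesis by (simp only: twosteps_def sum_distrib_right)
 qed
 have c5: "real (card P5) \<le> ?S * (d * (16 / (\<theta>' * ?h)\<^sup>2))"
 proof -
  have "real (card P5) \<le> (\<Sum>y\<in>V - W. ?n A y * ?n B y * (d * (16 / (\<theta>' * ?h)\<^sup>2)))"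
   apply (rule card_pairs_le[of "V - W" "\<lambda>y. {x. x \<in> nb V y \<and> y \<in> Mx}"])
   subgoal by (rule fin)
   subgoal using fnb by auto
   subgoal by (auto simp: P5_def Mx_def)
   subgoal for y
   proof (cases "y \<in> Mx")
    case True
    assume y: "y \<in> V - W"
    then have "\<theta>' * ?h / 4 \<le> ?n A y" "\<theta>' * ?h / 4 \<le> ?n B y"
     using True hits_nb[of y A] hits_nb[of y B] V by (auto simp: Mx_def)
    then have "(\<theta>' * ?h / 4) * (\<theta>' * ?h / 4) \<le> ?n A y * ?n B y"
     using \<theta> h by (intro mult_mono) auto
    then have "1 \<le> ?n A y * ?n B y * (16 / (\<theta>' * ?h)\<^sup>2)"
     using \<theta> h by (simp add: field_simps power2_eq_square)
    then have "real d * 1 \<le> real d * (?n A y * ?n B y * (16 / (\<theta>' * ?h)\<^sup>2))" by (intro mult_left_mono) auto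
    moreover have "card (nb V y) \<le> d" using card_nb[of y V] y by auto
    ultimately show ?thesis using True by (simp add: mult_ac)
   qed (auto simp: mult_nonneg_nonneg)
   done
  then show ?thesis by (simp only: twosteps_def sum_distrib_right)
 qed
 have c4: "real (card P4) \<le> real (card ?D) * (4 * (real C)\<^sup>2 / \<theta>')"
 proof -
  have "card P4 * (\<theta>' * ?h / 2) = (\<Sum>p\<in>P4. \<theta>' * ?h / 2)" by simp
  also have "... \<le> (\<Sum>p\<in>P4. real (card (mix (fst p) (snd p))))" by (intro sum_mono) (auto simp: P4_def)
  also have "... = real (card (SIGMA p:P4. mix (fst p) (snd p)))"
   using fP finI by (subst card_SigmaI) (auto simp: mix_def)
  also have "... \<le> (\<Sum>ie\<in>I \<times> ?D. real (2 * C * C))"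
  proof -
   let ?f = "\<lambda>((x, y), i). ((i, {sh i x, sh i y}), (x, y))"
   let ?R = "\<lambda>(i, e). {(x, y). x \<in> V \<and> y \<in> V \<and> {sh i x, sh i y} = e}"
   have "card (SIGMA p:P4. mix (fst p) (snd p)) = card (?f ` (SIGMA p:P4. mix (fst p) (snd p)))"
    by (intro card_image[symmetric]) (auto simp: inj_on_def)
   also have "real ... \<le> (\<Sum>ie\<in>I \<times> ?D. real (2 * C * C))"
   proof (rule card_pairs_le[of "I \<times> ?D" ?R])
    show "finite (I \<times> ?D)" using finI fD by auto
    show "finite (?R ie)" for ie by (rule finite_subset[of _ "V \<times> V"]) (use finV in auto)
    show "?f ` (SIGMA p:P4. mix (fst p) (snd p)) \<subseteq> (SIGMA ie:I \<times> ?D. ?R ie)"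
     by (auto simp: P4_def mix_def)
    fix ie assume "ie \<in> I \<times> ?D"
    then obtain i a b where ie: "ie = (i, {a, b})" "i \<in> I" "a \<in> A" "b \<in> B" by (auto simp: bonds_def)
    let ?X = "\<lambda>w. {x \<in> V. sh i x = w}"
    \<comment> \<open>Under a given shift each end of the bond has at most \<open>C\<close>
      preimages; the two products account for the two orders of the ends.\<close>
    have "?R ie \<subseteq> ?X a \<times> ?X b \<union> ?X b \<times> ?X a" using ie by (auto simp: doubleton_eq_iff)
    then have "card (?R ie) \<le> card (?X a \<times> ?X b \<union> ?X b \<times> ?X a)" using finV by (intro card_mono) auto
    also have "... \<le> card (?X a \<times> ?X b) + card (?X b \<times> ?X a)" by (rule card_Un_le)
    also have "... \<le> C * C + C * C" unfolding card_cartesian_product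
     using sh_fib[OF ie(2), of a] sh_fib[OF ie(2), of b] ie V by (intro add_mono mult_mono) auto
    finally have "card (?R ie) \<le> 2 * C * C" by simp
    then show "real (card (?R ie)) \<le> real (2 * C * C)" by (rule of_nat_mono)
   qed
   finally show ?thesis .
  qed
  also have "... = ?h * real (card ?D) * (2 * (real C)\<^sup>2)" by (simp add: card_cartesian_product power2_eq_square)
  finally show ?thesis using \<theta> h by (simp add: field_simps power2_eq_square)
 qed
 have S0: "0 \<le> ?S" by (auto simp: twosteps_def intro!: sum_nonneg)
 have d0: "0 < real d" using d2 by simp
 have e2: "?S * (2 / (\<theta> * ?h)) \<le> 2 / (\<theta> * \<rho>) * (?S / d)"
 proof -
  have "2 / (\<theta> * ?h) \<le> 2 / (\<theta> * (\<rho> * d))" using \<theta> h d0 by (intro divide_left_mono mult_left_mono) auto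
  then have "?S * (2 / (\<theta> * ?h)) \<le> ?S * (2 / (\<theta> * (\<rho> * d)))" using S0 by (intro mult_left_mono)
  then show ?thesis by (simp add: field_simps)
 qed
 have e5: "?S * (d * (16 / (\<theta>' * ?h)\<^sup>2)) \<le> 16 / (\<theta>' * \<rho>)\<^sup>2 * (?S / d)"
 proof -
  have "16 / (\<theta>' * ?h)\<^sup>2 \<le> 16 / (\<theta>' * (\<rho> * d))\<^sup>2"
   using \<theta> h d0 by (intro divide_left_mono power_mono mult_left_mono) auto
  then have "?S * (d * (16 / (\<theta>' * ?h)\<^sup>2)) \<le> ?S * (d * (16 / (\<theta>' * (\<rho> * d))\<^sup>2))"
   using S0 by (intro mult_left_mono) auto
  also have "... = 16 / (\<theta>' * \<rho>)\<^sup>2 * (?S / d)" using d0 \<theta> by (simp add: field_simps power2_eq_square)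
  finally show ?thesis .
 qed
 have "real (card (cut E A')) \<le> card ?D + card ?D * (4 * (real C)\<^sup>2 / \<theta>') + 4 / (\<theta> * \<rho>) * (?S / d) + 32 / (\<theta>' * \<rho>)\<^sup>2 * (?S / d) + card Lost"
  using cutPP PP c1 c2 c3 c4 c5 e2 e5 by linarith
 also have "... \<le> (1 + 4 * (real C)\<^sup>2 / \<theta>' + 4 / (\<theta> * \<rho>) + 32 / (\<theta>' * \<rho>)\<^sup>2) * (card ?D + ?S / d) + card Lost"
 proof -
  have gen: "D + D * a + b * s + c * s \<le> (1 + a + b + c) * (D + s)" if "0 \<le> a" "0 \<le> b" "0 \<le> c" "0 \<le> D" "0 \<le> s" for a b c D s :: real
  proof -
   have "(1 + a + b + c) * (D + s) = D + D * a + b * s + c * s + (s + a * s + b * D + c * D)" by (simp add: algebra_simps)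
   moreover have "0 \<le> s + a * s + b * D + c * D" using that by auto
   ultimately show ?thesis by linarith
  qed
  show ?thesis using gen[of "4 * (real C)\<^sup>2 / \<theta>'" "4 / (\<theta> * \<rho>)" "32 / (\<theta>' * \<rho>)\<^sup>2" "card ?D" "?S / d"] S0 \<theta> by simp
 qed
 finally show ?thesis by (simp add: Lost_def)
qed

text \<open>The first two conditions bound the lost edges at every vertex and serve small sets,
  whose isoperimetric gain per vertex is large. The third bounds the total loss by
  \<open>card V / d\<close> and serves sets of linear size.\<close>

definition typical :: "'v set \<Rightarrow> real \<Rightarrow> real \<Rightarrow> nat \<Rightarrow> bool" where
 "typical W \<theta> \<theta>' K \<longleftrightarrow>
  (\<forall>x\<in>V. card {y \<in> V. {x, y} \<in> E \<and> \<not> good W \<theta> y} \<le> K) \<and>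
  (\<forall>x\<in>V. good W \<theta> x \<longrightarrow> card {y \<in> V. {x, y} \<in> E \<and> \<not> straight W \<theta>' x y} \<le> K) \<and>
  real d * card {(x, y). x \<in> V \<and> y \<in> V \<and> {x, y} \<in> E \<and> (\<not> good W \<theta> y \<or> \<not> straight W \<theta>' x y)} \<le> card V"

text \<open>The isoperimetric inequality is applied to the majority set \<open>A'\<close>, and at
  most half of its boundary is lost. If \<open>ln (card V / card A')\<close> is at least
  \<open>4 * K / cI\<close>, a loss of \<open>2 * K\<close> per vertex is affordable. Otherwise
  \<open>A'\<close> has linear size, and for large \<open>d\<close> the total loss
  \<open>card V / d\<close> is negligible; \<open>dl\<close> quantifies this.\<close>

lemma bonds_twosteps_lower:
 fixes \<theta> \<theta>' \<rho> \<alpha> cI :: real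
 assumes W: "W \<subseteq> V" "A \<subseteq> W" "A \<noteq> {}" and \<theta>: "0 < \<theta>" "0 < \<theta>'" "0 < \<rho>" "\<rho> * d \<le> card I"
  and tp: "typical W \<theta> \<theta>' K"
  and iso: "\<And>S. S \<subseteq> V \<Longrightarrow> S \<noteq> {} \<Longrightarrow> cI * card S * ln (card V / card S) \<le> card (cut E S)"
  and \<alpha>: "0 < \<alpha>" "\<alpha> \<le> 1" "\<alpha> * card V \<le> card (W - A)" and cI: "0 < cI"
  and dl: "2 \<le> d * (cI * \<alpha> * exp (- 4 * K / cI))"
 shows "cI * \<alpha> / 6 * (card A * ln (exp 1 * card V / card A)) \<le>
  (1 + 4 * (real C)\<^sup>2 / \<theta>' + 4 / (\<theta> * \<rho>) + 32 / (\<theta>' * \<rho>)\<^sup>2) *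
   (card (bonds A (W - A)) + twosteps (V - W) A (W - A) / d)"
proof -
 define A' where "A' = majority W \<theta> A"
 define Lost where "Lost = {(x, y). x \<in> A' \<and> y \<in> V - A' \<and> {x, y} \<in> E \<and> (\<not> good W \<theta> y \<or> (good W \<theta> x \<and> \<not> straight W \<theta>' x y))}"
 let ?n = "real (card V)" and ?a = "real (card A')"
 have A'V: "A' \<subseteq> V" using W by (auto simp: A'_def majority_def)
 have AA': "A \<subseteq> A'" by (auto simp: A'_def majority_def)
 have fA': "finite A'" using A'V finV by (rule finite_subset)
 have fW: "finite W" using W finV finite_subset by metis
 have A'ne: "A' \<noteq> {}" using W AA' by auto
 have a0: "0 < ?a" using fA' A'ne by (simp add: card_gt_0_iff)
 have n0: "0 < ?n" using finV neV by (simp add: card_gt_0_iff)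
 have kA: "card A \<le> card A'" using fA' AA' by (rule card_mono)
 have k0: "0 < card A" using W fW finite_subset by (metis card_gt_0_iff)
 have "W - A \<subseteq> V - A'" using W by (auto simp: A'_def majority_def)
 then have "card (W - A) \<le> card (V - A')" using finV by (intro card_mono) auto
 also have "... = card V - card A'" using A'V fA' by (intro card_Diff_subset)
 finally have "card (W - A) \<le> card V - card A'" .
 moreover have "card A' \<le> card V" using A'V finV by (rule card_mono[rotated])
 ultimately have aub: "?a \<le> (1 - \<alpha>) * ?n" using \<alpha>(3) by (simp add: algebra_simps of_nat_diff)
 have cutI: "cI * (?a * ln (?n / ?a)) \<le> card (cut E A')" using iso[OF A'V A'ne] by (simp add: mult.assoc)
 have lpos: "\<alpha> \<le> ln (?n / ?a)"
 proof -
  have "ln (?a / ?n) \<le> ?a / ?n - 1" using a0 n0 by (intro ln_le_minus_one) auto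
  also have "?a / ?n \<le> 1 - \<alpha>" using aub n0 by (simp add: field_simps)
  finally show ?thesis using a0 n0 by (simp add: ln_div)
 qed
 have lost: "2 * real (card Lost) \<le> cI * (?a * ln (?n / ?a))"
 proof (cases "4 * K / cI \<le> ln (?n / ?a)")
  case True
  let ?R = "\<lambda>x. {y \<in> V. {x, y} \<in> E \<and> \<not> good W \<theta> y} \<union> {y \<in> V. {x, y} \<in> E \<and> good W \<theta> x \<and> \<not> straight W \<theta>' x y}"
  have "real (card Lost) \<le> (\<Sum>x\<in>A'. 2 * real K)"
  proof (rule card_pairs_le[of A' ?R])
   fix x assume x: "x \<in> A'"
   have "card {y \<in> V. {x, y} \<in> E \<and> good W \<theta> x \<and> \<not> straight W \<theta>' x y} \<le> K"
    using tp x A'V unfolding typical_def by (cases "good W \<theta> x") auto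
   moreover have "card {y \<in> V. {x, y} \<in> E \<and> \<not> good W \<theta> y} \<le> K"
    using tp x A'V unfolding typical_def by auto
   ultimately have "card (?R x) \<le> K + K" by (intro order_trans[OF card_Un_le] add_mono)
   then show "real (card (?R x)) \<le> 2 * real K" by linarith
  qed (use fA' finV in \<open>auto simp: Lost_def\<close>)
  then have "real (card Lost) \<le> ?a * (2 * K)" by simp
  then have "2 * real (card Lost) \<le> 2 * (?a * (2 * K))" by linarith
  also have "... = ?a * (4 * K)" by simp
  finally have "2 * real (card Lost) \<le> ?a * (4 * K)" .
  also have "... \<le> ?a * (cI * ln (?n / ?a))"
   using True cI a0 by (intro mult_left_mono) (auto simp: field_simps)
  finally show ?thesis by (simp add: mult_ac)
 next
  case False
  have "Lost \<subseteq> {(x, y). x \<in> V \<and> y \<in> V \<and> {x, y} \<in> E \<and> (\<not> good W \<theta> y \<or> \<not> straight W \<theta>' x y)}"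
   using A'V by (auto simp: Lost_def)
  then have "card Lost \<le> card {(x, y). x \<in> V \<and> y \<in> V \<and> {x, y} \<in> E \<and> (\<not> good W \<theta> y \<or> \<not> straight W \<theta>' x y)}"
   by (rule card_mono[rotated]) (rule finite_subset[of _ "V \<times> V"], use finV in auto)
  then have "real d * card Lost \<le> real d * card {(x, y). x \<in> V \<and> y \<in> V \<and> {x, y} \<in> E \<and> (\<not> good W \<theta> y \<or> \<not> straight W \<theta>' x y)}"
   by (intro mult_left_mono) auto
  also have "... \<le> ?n" using tp unfolding typical_def by auto
  finally have dL: "real d * card Lost \<le> ?n" .
  have "exp (ln (?n / ?a)) \<le> exp (4 * K / cI)" using False by simp
  then have "?n / ?a \<le> exp (4 * K / cI)" using a0 n0 by simp
  then have "?n * exp (- 4 * K / cI) \<le> ?a" using a0 by (simp add: field_simps exp_minus)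
  then have "cI * ((?n * exp (- 4 * K / cI)) * \<alpha>) \<le> cI * (?a * ln (?n / ?a))"
   using lpos cI \<alpha> n0 by (intro mult_left_mono mult_mono) auto
  moreover have "2 * real (card Lost) \<le> d * (cI * \<alpha> * exp (- 4 * K / cI)) * card Lost"
   using dl by (intro mult_right_mono) auto
  moreover have "... = (cI * \<alpha> * exp (- 4 * K / cI)) * (d * card Lost)" by simp
  moreover have "... \<le> (cI * \<alpha> * exp (- 4 * K / cI)) * ?n"
   using dL cI \<alpha> by (intro mult_left_mono) auto
  ultimately show ?thesis by (simp add: mult_ac)
 qed
 have "cI / 2 * (?a * ln (?n / ?a)) \<le> (1 + 4 * (real C)\<^sup>2 / \<theta>' + 4 / (\<theta> * \<rho>) + 32 / (\<theta>' * \<rho>)\<^sup>2) *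
   (card (bonds A (W - A)) + twosteps (V - W) A (W - A) / d)"
  using boundary_of_majority[OF W(1,2) \<theta>] lost cutI unfolding A'_def[symmetric] Lost_def[symmetric] by linarith
 moreover have "cI / 2 * (\<alpha> / 3 * (card A * ln (exp 1 * ?n / card A))) \<le> cI / 2 * (?a * ln (?n / ?a))"
  using xlog_lower[of "card A" ?a \<alpha> ?n] k0 kA aub \<alpha> cI by (intro mult_left_mono) auto
 moreover have "cI / 2 * (\<alpha> / 3 * (card A * ln (exp 1 * ?n / card A))) = cI * \<alpha> / 6 * (card A * ln (exp 1 * ?n / card A))"
  by simp
 ultimately show ?thesis by linarith
qed

end

section \<open>Sprinkling\<close>

lemma chance_hit:
 fixes p :: real
 assumes "finite S" "0 \<le> p" "p * card S \<le> 1" "p \<le> 1"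
 shows "p * card S / 2 \<le> chance S (\<lambda>_. p) (\<lambda>F. F \<noteq> {})"
proof -
 have "chance S (\<lambda>_. p) (\<lambda>F. \<not> ({} \<subseteq> F \<and> F \<inter> S = {})) = 1 - (1 - p) ^ card S"
  using assms(1) by (simp add: chance_Not[OF assms(1)] chance_pattern[of S "{}" S, simplified])
 moreover have "chance S (\<lambda>_. p) (\<lambda>F. \<not> ({} \<subseteq> F \<and> F \<inter> S = {})) = chance S (\<lambda>_. p) (\<lambda>F. F \<noteq> {})"
  unfolding chance_def by (intro mean_cong) (auto simp: Int_absorb2)
 moreover have "(1 - p) ^ card S \<le> exp (- p) ^ card S"
  using assms exp_ge_add_one_self[of "- p"] by (intro power_mono) auto
 moreover have "exp (- p) ^ card S = exp (- (p * card S))" by (simp add: exp_of_nat_mult[symmetric] mult_ac)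
 moreover have ex: "exp (- x) \<le> 1 - x / 2" if "0 \<le> x" "x \<le> 1" for x :: real
 proof -
  have "(1 - x / 2) * (1 + x) = 1 + x * (1 - x) / 2" by (simp add: field_simps)
  moreover have "0 \<le> x * (1 - x) / 2" using that by simp
  ultimately have "1 \<le> (1 - x / 2) * (1 + x)" by linarith
  also have "... \<le> (1 - x / 2) * exp x" using that exp_ge_add_one_self[of x] by (intro mult_left_mono) auto
  finally show ?thesis by (simp add: exp_minus field_simps)
 qed
 moreover have "exp (- (p * card S)) \<le> 1 - p * card S / 2" using assms by (intro ex) auto
 ultimately show ?thesis by linarith
qed

lemma chance_both_hit:
 fixes p :: real
 assumes "finite E" "S \<subseteq> E" "T \<subseteq> E" "S \<inter> T = {}" "0 \<le> p" "p \<le> 1" "p * card S \<le> 1" "p * card T \<le> 1"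
 shows "p\<^sup>2 * (card S * card T) / 4 \<le> chance E (\<lambda>_. p) (\<lambda>F. F \<inter> S \<noteq> {} \<and> F \<inter> T \<noteq> {})"
proof -
 have fin: "finite S" "finite T" using assms by (auto intro: finite_subset)
 let ?g = "\<lambda>b F. of_bool (F \<noteq> {}) :: real" and ?A = "\<lambda>b. if b then S else T"
 have "chance E (\<lambda>_. p) (\<lambda>F. F \<inter> S \<noteq> {} \<and> F \<inter> T \<noteq> {}) = mean E (\<lambda>_. p) (\<lambda>F. \<Prod>b\<in>{True, False}. ?g b (F \<inter> ?A b))"
  unfolding chance_def by (intro mean_cong) auto
 also have "... = (\<Prod>b\<in>{True, False}. mean (?A b) (\<lambda>_. p) (?g b))"
  using assms by (intro mean_prod) (auto simp: disjoint_family_on_def)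
 also have "... = chance S (\<lambda>_. p) (\<lambda>F. F \<noteq> {}) * chance T (\<lambda>_. p) (\<lambda>F. F \<noteq> {})" by (simp add: chance_def)
 also have "... \<ge> (p * card S / 2) * (p * card T / 2)"
  using assms fin by (intro mult_mono chance_hit chance_nonneg) (auto simp: probs_def)
 finally show ?thesis by (simp add: power2_eq_square algebra_simps)
qed

section \<open>The auxiliary graph on the large clusters\<close>

context host begin

definition outside :: "'v set \<Rightarrow> 'v set set" where "outside W = {e \<in> E. e \<inter> W = {}}"

definition pocket :: "'v set \<Rightarrow> 'v set set \<Rightarrow> 'v \<Rightarrow> 'v set" where
 "pocket W F z = cluster (F \<inter> outside W) z"

text \<open>The second alternative passes through a connected piece of \<open>F\<close> outside
  \<open>W\<close>, entered and left by edges of \<open>E\<close> that need not belong to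
  \<open>F\<close>. So this graph depends on \<open>F\<close> only through the edges avoiding
  \<open>W\<close> and stays fixed while the edges meeting \<open>W\<close> are exposed.\<close>

definition ties :: "'v set \<Rightarrow> 'v set set \<Rightarrow> 'v set set" where
 "ties W F = {{w, w'} | w w'. w \<in> W \<and> w' \<in> W \<and> w \<noteq> w' \<and> ({w, w'} \<in> E \<or>
  (\<exists>z z'. z \<in> V - W \<and> {w, z} \<in> E \<and> z' \<in> pocket W F z \<and> {z', w'} \<in> E))}"

lemma pairs_ties: "pairs (ties W F)"
 by (auto simp: pairs_def ties_def)

lemma finite_ties: "W \<subseteq> V \<Longrightarrow> finite (ties W F)"
proof -
 assume W: "W \<subseteq> V"
 have "ties W F \<subseteq> Pow V" using W by (auto simp: ties_def)
 then show ?thesis using finV by (metis finite_Pow_iff finite_subset)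
qed

lemma pocket_subset:
 assumes "W \<subseteq> V" "z \<in> V - W" shows "pocket W F z \<subseteq> V - W"
 unfolding pocket_def using assms EV by (intro cluster_subset) (auto simp: outside_def)

lemma ties_degree:
 assumes W: "W \<subseteq> V" and w: "w \<in> W" and small: "\<And>z. z \<in> V - W \<Longrightarrow> card (pocket W F z) \<le> m"
 shows "card {e \<in> ties W F. w \<in> e} \<le> d + d * (m * d)"
proof -
 let ?N = "\<lambda>z. {a. {z, a} \<in> E}"
 let ?X = "\<Union>z\<in>?N w \<inter> (V - W). \<Union>z'\<in>pocket W F z. ?N z'"
 have fp: "finite (pocket W F z)" if "z \<in> V - W" for z
  by (rule finite_subset[OF pocket_subset[OF W that]]) (use finV in simp)
 have "{e \<in> ties W F. w \<in> e} \<subseteq> (\<lambda>a. {w, a}) ` (?N w \<union> ?X)"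
 proof
  fix e assume e: "e \<in> {e \<in> ties W F. w \<in> e}"
  then obtain u u' where u: "e = {u, u'}" "u \<in> W" "u' \<in> W" "w = u \<or> w = u'" and
   c: "{u, u'} \<in> E \<or> (\<exists>z z'. z \<in> V - W \<and> {u, z} \<in> E \<and> z' \<in> pocket W F z \<and> {z', u'} \<in> E)"
   by (auto simp: ties_def)
  from c show "e \<in> (\<lambda>a. {w, a}) ` (?N w \<union> ?X)"
  proof
   assume "{u, u'} \<in> E"
   then show ?thesis using u by (auto simp: insert_commute)
  next
   assume "\<exists>z z'. z \<in> V - W \<and> {u, z} \<in> E \<and> z' \<in> pocket W F z \<and> {z', u'} \<in> E"
   then obtain z z' where z: "z \<in> V - W" "{u, z} \<in> E" "z' \<in> pocket W F z" "{z', u'} \<in> E" by auto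
   have z': "z' \<in> V - W" using pocket_subset[OF W z(1)] z(3) by auto
   have zp: "z \<in> pocket W F z'"
    using comp_eq[of z' "F \<inter> outside W" UNIV z] comp_self[of z "F \<inter> outside W" UNIV] z(3) unfolding pocket_def by blast
   from u(4) show ?thesis
   proof
    assume w: "w = u"
    have "u' \<in> ?X" using z w by blast
    then show ?thesis using u(1) w by blast
   next
    assume w: "w = u'"
    have "{w, z'} \<in> E" "{z, u} \<in> E" using z w by (auto simp: insert_commute)
    then have "u \<in> ?X" using z' zp by blast
    then show ?thesis using u(1) w by (auto simp: insert_commute)
   qed
  qed
 qed
 then have "card {e \<in> ties W F. w \<in> e} \<le> card ((\<lambda>a. {w, a}) ` (?N w \<union> ?X))"
  using finite_nbrs fp by (intro card_mono) auto
 also have "... \<le> card (?N w \<union> ?X)" using finite_nbrs fp by (intro card_image_le) auto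
 also have "... \<le> card (?N w) + card ?X" by (rule card_Un_le)
 also have "card (?N w) \<le> d" using card_nbrs[of w] w W by auto
 also have "card ?X \<le> (\<Sum>z\<in>?N w \<inter> (V - W). card (\<Union>z'\<in>pocket W F z. ?N z'))"
  using finite_nbrs by (intro card_UN_le) auto
 also have "... \<le> (\<Sum>z\<in>?N w \<inter> (V - W). m * d)"
 proof (intro sum_mono)
  fix z assume z: "z \<in> ?N w \<inter> (V - W)"
  have "card (\<Union>z'\<in>pocket W F z. ?N z') \<le> (\<Sum>z'\<in>pocket W F z. card (?N z'))"
   using fp z by (intro card_UN_le) auto
  also have "... \<le> (\<Sum>z'\<in>pocket W F z. d)"
   using pocket_subset[OF W, of z F] z by (intro sum_mono eq_imp_le card_nbrs) auto
  also have "... \<le> m * d" using small[of z] z by simp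
  finally show "card (\<Union>z'\<in>pocket W F z. ?N z') \<le> m * d" .
 qed
 also have "... = card (?N w \<inter> (V - W)) * (m * d)" by simp
 also have "card (?N w \<inter> (V - W)) \<le> card (?N w)" using finite_nbrs by (intro card_mono) auto
 also have "card (?N w) \<le> d" using card_nbrs[of w] w W by auto
 finally show ?thesis by simp
qed

text \<open>A walk in \<open>S\<close> that leaves \<open>W\<close> stays in one pocket until it
  returns, so consecutive visits to \<open>W\<close> are tied. For a vertex outside \<open>W\<close>
  the induction records the vertex of \<open>W\<close> next to the entrance of its pocket.\<close>

lemma conn_ties:
 assumes W: "W \<subseteq> V" and F: "F \<subseteq> E" and S: "S \<subseteq> V" "conn F S" "S \<inter> W \<noteq> {}"
 shows "conn (ties W F) (S \<inter> W)"
proof -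
 obtain a where a: "a \<in> S" "a \<in> W" using S by auto
 let ?C = "comp (ties W F) (S \<inter> W) a"
 have ne: "x \<noteq> y" if "{x, y} \<in> E" for x y using that pairsE by (auto simp: pairs_def)
 have "(x \<in> W \<longrightarrow> x \<in> ?C) \<and> (x \<notin> W \<longrightarrow> (\<exists>w z. w \<in> ?C \<and> z \<in> V - W \<and> {w, z} \<in> E \<and> x \<in> pocket W F z))"
  if "(a, x) \<in> (links F S)\<^sup>*" for x
  using that
 proof (induction rule: rtrancl_induct)
  case base
  then show ?case using a by auto
 next
  case (step x y)
  have xy: "x \<in> S" "y \<in> S" "{x, y} \<in> F" "{x, y} \<in> E" using step.hyps F by (auto simp: links_def)
  have CS: "?C \<subseteq> S \<inter> W" using a by (intro comp_subset) auto
  show ?case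
  proof (cases "x \<in> W")
   case True
   then have xC: "x \<in> ?C" using step.IH by auto
   show ?thesis
   proof (cases "y \<in> W")
    case yW: True
    have "{x, y} \<in> ties W F" using True yW xy ne[OF xy(4)] by (auto simp: ties_def)
    then have "y \<in> ?C" using comp_step[OF xC] xy True yW by auto
    then show ?thesis using yW by auto
   next
    case False
    then have "y \<in> V - W" "y \<in> pocket W F y" using xy S by (auto simp: pocket_def)
    then show ?thesis using False xC xy by blast
   qed
  next
   case False
   then obtain w z where wz: "w \<in> ?C" "z \<in> V - W" "{w, z} \<in> E" "x \<in> pocket W F z" using step.IH by auto
   show ?thesis
   proof (cases "y \<in> W")
    case yW: True
    show ?thesis
    proof (cases "w = y")
     case False
     then have "{w, y} \<in> ties W F" using wz yW xy CS unfolding ties_def by blast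
     then have "y \<in> ?C" using comp_step[OF wz(1)] xy yW CS wz(1) by blast
     then show ?thesis using yW by auto
    qed (use wz yW in auto)
   next
    case yW: False
    have "{x, y} \<in> F \<inter> outside W" using xy False yW by (auto simp: outside_def)
    then have "y \<in> pocket W F z" using wz(4) comp_step[of x "F \<inter> outside W" UNIV z y] unfolding pocket_def by simp
    then show ?thesis using yW wz by auto
   qed
  qed
 qed
 then have "S \<inter> W \<subseteq> ?C" using S(2) a unfolding conn_def by blast
 then show ?thesis using a by (intro conn_via_comp[of a]) auto
qed

text \<open>A component of \<open>F\<close> on \<open>A\<close> that no edge of the cut of
  \<open>A\<close> touches is a whole cluster and has at least \<open>N\<close> vertices, so there
  are at most \<open>card A / N\<close> of these. Any other component owns an edge of the cut; such
  an edge meets \<open>A\<close> in a single vertex and is owned by one component only.\<close>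

lemma ncomp_bound:
 assumes F: "F \<subseteq> E" and A: "A \<subseteq> giants N F" and N: "1 \<le> N"
 shows "N * ncomp (F \<inter> Pow A) A \<le> card A + N * card (cut F A)"
proof -
 let ?F = "F \<inter> Pow A" and ?c = "\<lambda>x. comp (F \<inter> Pow A) A x"
 have AV: "A \<subseteq> V" using A by (auto simp: giants_def)
 have fA: "finite A" using AV finV by (rule finite_subset)
 have fc: "finite (cut F A)" using F finE by (auto simp: cut_def intro: finite_subset)
 define g where "g e = ?c (SOME x. x \<in> e \<inter> A)" for e
 let ?X = "?c ` A"
 let ?X1 = "?X \<inter> g ` cut F A" and ?X2 = "?X - g ` cut F A"
 have "card ?X1 \<le> card (g ` cut F A)" using fc by (intro card_mono) auto
 also have "... \<le> card (cut F A)" using fc by (rule card_image_le)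
 finally have c1: "card ?X1 \<le> card (cut F A)" .
 have big: "N \<le> card U" if U: "U \<in> ?X2" for U
 proof -
  from U obtain x where x: "x \<in> A" "U = ?c x" by auto
  have pF: "pairs F" using pairs_subset[OF pairsE F] .
  have UA: "U \<subseteq> A" using x comp_subset by metis
  have "cut F U = {}"
  proof (rule equals0I)
   fix e assume e: "e \<in> cut F U"
   obtain u w where uw: "e = {u, w}" "u \<in> U" "w \<notin> U" "{u, w} \<in> F" using cutE[OF pF e] by metis
   have uc: "u \<in> ?c x" using uw x by simp
   have "w \<notin> A" using comp_step[OF uc, of w] uw x UA by auto
   then have "e \<in> cut F A" "e \<inter> A = {u}" using uw UA by (auto simp: cut_def)
   then have "g e = ?c u" by (simp add: g_def)
   also have "... = U" using comp_eq[OF uc] x by simp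
   finally show False using U \<open>e \<in> cut F A\<close> by auto
  qed
  moreover have "conn F U" using comp_conn[OF x(1), of ?F] x(2) conn_mono[of ?F U F] by auto
  ultimately have "cluster F x = U" using pF x by (intro cluster_eqI) auto
  then show ?thesis using A x by (auto simp: giants_def)
 qed
 have "N * card ?X2 = (\<Sum>U\<in>?X2. N)" by simp
 also have "... \<le> (\<Sum>U\<in>?X2. card U)" by (intro sum_mono big)
 also have "... = card (\<Union>?X2)"
 proof (intro card_Union_disjoint[symmetric])
  show "disjoint ?X2"
   unfolding disjoint_def
  proof (intro ballI impI)
   fix U U' assume U: "U \<in> ?X2" "U' \<in> ?X2" "U \<noteq> U'"
   then obtain x y where "U = ?c x" "U' = ?c y" by blast
   then show "U \<inter> U' = {}" using comp_disjoint[of ?F A x y] U(3) by simp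
  qed
  fix U assume "U \<in> ?X2"
  then obtain x where "x \<in> A" "U = ?c x" by blast
  then show "finite U" using finite_subset[OF comp_subset fA] by simp
 qed
 also have "... \<le> card A" using fA comp_subset[of _ A ?F] by (intro card_mono) auto
 finally have c2: "N * card ?X2 \<le> card A" .
 have "ncomp ?F A = card (?X1 \<union> ?X2)" unfolding ncomp_def by (simp add: Int_Diff_Un)
 also have "... \<le> card ?X1 + card ?X2" by (rule card_Un_le)
 finally have "N * ncomp ?F A \<le> N * (card ?X1 + card ?X2)" by (rule mult_left_mono) simp
 also have "... \<le> N * card (cut F A) + card A" using c1 c2 by (simp add: distrib_left add_mono)
 finally show ?thesis by simp
qed

definition family :: "'v set \<Rightarrow> 'v set set \<Rightarrow> 'v set set \<Rightarrow> 'v \<Rightarrow> nat \<Rightarrow> nat \<Rightarrow> nat \<Rightarrow> 'v set set" where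
 "family W F1 L v k b s = {A. A \<subseteq> W \<and> v \<in> A \<and> card A = k \<and> conn L A \<and> card (cut F1 A) \<le> b \<and> card (F1 \<inter> Pow A) \<le> s}"

lemma giants_closed: 
 assumes "F \<subseteq> E" "e \<in> F" "x \<in> e" "x \<in> giants N F" shows "e \<subseteq> giants N F"
proof
 fix y assume y: "y \<in> e"
 obtain z where z: "e = {x, z}" using pairs_edgeE[OF pairs_subset[OF pairsE assms(1)] assms(2,3)] by metis
 have "y \<in> cluster F x" using y z assms comp_step[of x F UNIV x z] by auto
 then have "cluster F y = cluster F x" by (rule comp_eq)
 moreover have "y \<in> V" using y assms EV by auto
 ultimately show "y \<in> giants N F" using assms by (simp add: giants_def)
qed

text \<open>Counting by a fictitious percolation on \<open>L\<close> that keeps edges of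
  \<open>F1\<close> with probability \<open>1 - q1\<close> and all others with probability
  \<open>q2\<close>. By \<open>ncomp_bound\<close> a member is spanned by its
  \<open>F1\<close>-edges and at most \<open>r + b\<close> further links. The events that these are
  exactly the kept edges meeting it are disjoint for different members, and each has at least the
  displayed weight. The expensive factor \<open>q2\<close> thus occurs only \<open>r + b\<close>
  times instead of once per vertex.\<close>

lemma card_family:
 fixes q1 q2 :: real
 assumes F1: "F1 \<subseteq> E" and N: "1 \<le> N" and W: "W = giants N F1" and L: "L = ties W F"
  and deg_L: "\<And>w. w \<in> W \<Longrightarrow> card {e \<in> L. w \<in> e} \<le> \<Delta>"
  and q: "0 < q1" "q1 < 1" "0 < q2" "q2 < 1" and r: "k \<le> N * r"
 shows "card (family W F1 L v k b s) * ((1 - q1) ^ s * q2 ^ (r + b) * (q1 ^ b * (1 - q2) ^ (\<Delta> * k))) \<le> 1"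
proof -
 let ?A = "family W F1 L v k b s" and ?\<Omega> = "(1 - q1) ^ s * q2 ^ (r + b) * (q1 ^ b * (1 - q2) ^ (\<Delta> * k))"
 define q where "q e = (if e \<in> F1 then 1 - q1 else q2)" for e
 have WV: "W \<subseteq> V" using W by (auto simp: giants_def)
 have fL: "finite L" using finite_ties[OF WV] L by simp
 have fW: "finite W" using WV finV by (rule finite_subset)
 have fam: "finite ?A" using fW by (intro finite_subset[of ?A "Pow W"]) (auto simp: family_def)
 have F1L: "e \<in> L" if e: "e \<in> F1" "e \<inter> W \<noteq> {}" for e
 proof -
  obtain x where x: "x \<in> e" "x \<in> W" using e by auto
  obtain y where y: "e = {x, y}" "x \<noteq> y" using pairs_edgeE[OF pairs_subset[OF pairsE F1] e(1) x(1)] by metis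
  have "e \<subseteq> W" using giants_closed[OF F1 e(1) x(1), of N] x W by simp
  moreover have "{x, y} \<in> E" using e F1 y by auto
  ultimately show ?thesis using y unfolding L ties_def by blast
 qed
 have "\<exists>T. T \<subseteq> L \<and> conn T A \<and> T \<subseteq> Pow A \<and> ?\<Omega> \<le> (\<Prod>e\<in>T. q e) * (\<Prod>e\<in>inc L A - T. 1 - q e)"
  if A: "A \<in> ?A" for A
 proof -
  have A': "A \<subseteq> W" "v \<in> A" "card A = k" "conn L A" "card (cut F1 A) \<le> b" "card (F1 \<inter> Pow A) \<le> s"
   using A by (auto simp: family_def)
  have fA: "finite A" using A' fW finite_subset by blast
  let ?F = "F1 \<inter> Pow A"
  have "conn (?F \<union> (L - F1)) A" by (rule conn_mono[OF conn_restrict[OF A'(4)]]) blast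
  from spanning_links[OF fA this] obtain L'
   where L': "L' \<subseteq> L - F1" "L' \<subseteq> Pow A" "finite L'" "conn (?F \<union> L') A" "card L' < ncomp ?F A"
   by (elim exE conjE) (rule that; assumption)
  have FL: "?F \<subseteq> L"
  proof
   fix e assume e: "e \<in> ?F"
   then have "e \<noteq> {}" using pairs_subset[OF pairsE F1] by (auto simp: pairs_def)
   then show "e \<in> L" using e A' by (intro F1L) auto
  qed
  let ?T = "?F \<union> L'"
  have fF: "finite ?F" using F1 finE finite_subset by blast
  have "N * card L' \<le> N * (r + b)"
  proof -
   have "N * card L' \<le> N * ncomp ?F A" using L' by (intro mult_left_mono) auto
   also have "... \<le> card A + N * card (cut F1 A)" using A' W by (intro ncomp_bound F1 N) auto
   also have "... \<le> N * r + N * b" using A' r by (intro add_mono mult_left_mono) auto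
   finally show ?thesis by (simp add: distrib_left)
  qed
  then have cL: "card L' \<le> r + b" using N by simp
  have qs1: "(\<Prod>e\<in>?F. q e) = (\<Prod>e\<in>?F. 1 - q1)" by (rule prod.cong) (auto simp: q_def)
  have qs2: "(\<Prod>e\<in>L'. q e) = (\<Prod>e\<in>L'. q2)" by (rule prod.cong) (use L'(1) in \<open>auto simp: q_def\<close>)
  have "(\<Prod>e\<in>?T. q e) = (\<Prod>e\<in>?F. q e) * (\<Prod>e\<in>L'. q e)"
   using fF L' by (intro prod.union_disjoint) auto
  also have "... = (\<Prod>e\<in>?F. 1 - q1) * (\<Prod>e\<in>L'. q2)" by (simp only: qs1 qs2)
  also have "... = (1 - q1) ^ card ?F * q2 ^ card L'" by simp
  also have "... \<ge> (1 - q1) ^ s * q2 ^ (r + b)"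
   using \<open>0 < q1\<close> \<open>q1 < 1\<close> \<open>0 < q2\<close> \<open>q2 < 1\<close> A' cL by (intro mult_mono power_decreasing) auto
  finally have 1: "(1 - q1) ^ s * q2 ^ (r + b) \<le> (\<Prod>e\<in>?T. q e)" .
  let ?I = "inc L A - ?T"
  have fI: "finite ?I" using fL by (auto simp: inc_def)
  have "(\<Prod>e\<in>?I. 1 - q e) = (\<Prod>e\<in>?I \<inter> F1. 1 - q e) * (\<Prod>e\<in>?I - F1. 1 - q e)"
   using fI by (metis prod.Int_Diff)
  also have "(\<Prod>e\<in>?I \<inter> F1. 1 - q e) = q1 ^ card (?I \<inter> F1)" by (simp add: q_def)
  also have "(\<Prod>e\<in>?I - F1. 1 - q e) = (1 - q2) ^ card (?I - F1)" by (simp add: q_def)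
  also have "q1 ^ card (?I \<inter> F1) * (1 - q2) ^ card (?I - F1) \<ge> q1 ^ b * (1 - q2) ^ (\<Delta> * k)"
  proof -
   have "?I \<inter> F1 \<subseteq> cut F1 A" by (auto simp: inc_def cut_def)
   then have "card (?I \<inter> F1) \<le> card (cut F1 A)" using F1 finE by (intro card_mono) (auto simp: cut_def intro: finite_subset)
   then have a: "card (?I \<inter> F1) \<le> b" using A' by simp
   have "card (?I - F1) \<le> card (inc L A)" using fL by (intro card_mono) (auto simp: inc_def)
   also have "card (inc L A) = card (\<Union>w\<in>A. {e \<in> L. w \<in> e})" by (rule arg_cong[of _ _ card]) (auto simp: inc_def)
   also have "... \<le> (\<Sum>w\<in>A. card {e \<in> L. w \<in> e})" using fA by (rule card_UN_le)
   also have "... \<le> (\<Sum>w\<in>A. \<Delta>)" using A' by (intro sum_mono deg_L) auto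
   finally have "card (?I - F1) \<le> \<Delta> * k" using A' by (simp add: mult.commute)
   then show ?thesis using a \<open>0 < q1\<close> \<open>q1 < 1\<close> \<open>0 < q2\<close> \<open>q2 < 1\<close> by (intro mult_mono power_decreasing) auto
  qed
  finally have 2: "q1 ^ b * (1 - q2) ^ (\<Delta> * k) \<le> (\<Prod>e\<in>?I. 1 - q e)" .
  have "?\<Omega> \<le> (\<Prod>e\<in>?T. q e) * (\<Prod>e\<in>?I. 1 - q e)"
  proof (rule mult_mono[OF 1 2])
   show "0 \<le> (\<Prod>e\<in>?T. q e)" using \<open>0 < q1\<close> \<open>q1 < 1\<close> \<open>0 < q2\<close> by (intro prod_nonneg) (auto simp: q_def)
  qed (use \<open>0 < q1\<close> \<open>q2 < 1\<close> in auto)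
  then show ?thesis using L' FL by (intro exI[of _ ?T]) auto
 qed
 then obtain T where T: "\<And>A. A \<in> ?A \<Longrightarrow> T A \<subseteq> L \<and> conn (T A) A \<and> T A \<subseteq> Pow A \<and> ?\<Omega> \<le> (\<Prod>e\<in>T A. q e) * (\<Prod>e\<in>inc L A - T A. 1 - q e)"
  by metis
 have vs: "insert v (\<Union>(T A)) = A" if A: "A \<in> ?A" for A
 proof -
  have vA: "v \<in> A" using A by (simp add: family_def)
  have "x \<in> insert v (\<Union>(T A))" if x: "x \<in> A" for x
  proof (cases "A = {x}")
   case False
   then obtain y where "{x, y} \<in> T A" using conn_crossing[of "T A" A "{x}"] T[OF A] x by auto
   then show ?thesis by auto
  qed (use vA in auto)
  then have "A \<subseteq> insert v (\<Union>(T A))" by (rule subsetI)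
  moreover have "insert v (\<Union>(T A)) \<subseteq> A" using vA T[OF A] by auto
  ultimately show ?thesis by simp
 qed
 have inj: "inj_on T ?A" using vs by (metis inj_onI)
 have pq: "probs L q" using \<open>0 < q1\<close> \<open>q1 < 1\<close> \<open>0 < q2\<close> \<open>q2 < 1\<close> by (auto simp: probs_def q_def)
 have "card ?A * ?\<Omega> = (\<Sum>A\<in>?A. ?\<Omega>)" by simp
 also have "... \<le> (\<Sum>A\<in>?A. (\<Prod>e\<in>T A. q e) * (\<Prod>e\<in>inc L (insert v (\<Union>(T A))) - T A. 1 - q e))"
  using T vs by (intro sum_mono) auto
 also have "... = (\<Sum>T\<in>T ` ?A. (\<Prod>e\<in>T. q e) * (\<Prod>e\<in>inc L (insert v (\<Union>T)) - T. 1 - q e))"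
  by (subst sum.reindex[OF inj]) simp
 also have "... \<le> 1"
  using T vs fam L pairs_ties by (intro sum_connected_weights fL pq) auto
 finally show ?thesis .
qed

end

section \<open>Union bound over sets with few links\<close>

context shifts begin

definition linked :: "'v set \<Rightarrow> 'v set \<Rightarrow> 'v set set \<Rightarrow> 'v set" where
 "linked W A Y = {z \<in> V - W. (\<exists>a\<in>A. {z, a} \<in> Y) \<and> (\<exists>b\<in>W - A. {z, b} \<in> Y)}"

text \<open>On whichever side of \<open>S\<close> a linked vertex \<open>z\<close> lies, one of its
  two edges crosses. Edges found for different \<open>z\<close> differ, because \<open>z\<close> is
  their only end outside \<open>W\<close>; for the same reason none of them is a bond.\<close>

lemma linked_le_cut:
 assumes F: "F \<subseteq> E" "Y \<subseteq> F" and W: "W \<subseteq> V" and S: "S \<subseteq> V"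
 shows "card (Y \<inter> bonds (S \<inter> W) (W - S)) + card (linked W (S \<inter> W) Y) \<le> card (cut F S)"
proof -
 let ?A = "S \<inter> W" let ?D = "Y \<inter> bonds ?A (W - S)" and ?M = "linked W ?A Y"
 have ex: "\<exists>w. w \<in> W \<and> {z, w} \<in> Y \<and> {z, w} \<in> cut F S" if z: "z \<in> ?M" for z
 proof -
  obtain a b where ab: "a \<in> ?A" "{z, a} \<in> Y" "b \<in> W - ?A" "{z, b} \<in> Y" using z by (auto simp: linked_def)
  show ?thesis
  proof (cases "z \<in> S")
   case True
   then show ?thesis using ab F by (intro exI[of _ b]) (auto simp: cut_def)
  next
   case False
   then show ?thesis using ab F by (intro exI[of _ a]) (auto simp: cut_def)
  qed
 qed
 define g where "g z = {z, SOME w. w \<in> W \<and> {z, w} \<in> Y \<and> {z, w} \<in> cut F S}" for z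
 have g: "\<exists>w. w \<in> W \<and> g z = {z, w} \<and> g z \<in> cut F S" if "z \<in> ?M" for z
  using someI_ex[OF ex[OF that]] unfolding g_def by blast
 have zW: "z \<notin> W" if "z \<in> ?M" for z using that by (auto simp: linked_def)
 have inj: "inj_on g ?M"
 proof (rule inj_onI)
  fix z z' assume z: "z \<in> ?M" "z' \<in> ?M" "g z = g z'"
  obtain w where w: "w \<in> W" "g z = {z, w}" using g[OF z(1)] by auto
  obtain w' where w': "w' \<in> W" "g z' = {z', w'}" using g[OF z(2)] by auto
  then show "z = z'" using w z zW[of z] zW[of z'] by (auto simp: doubleton_eq_iff)
 qed
 have fc: "finite (cut F S)" using F finE by (auto simp: cut_def intro: finite_subset)
 have fM: "finite ?M" by (rule finite_subset[OF _ finV]) (auto simp: linked_def)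
 have D: "?D \<subseteq> cut F S"
 proof
  fix e assume e: "e \<in> ?D"
  then obtain a b where "a \<in> ?A" "b \<in> W - S" "e = {a, b}" by (auto simp: bonds_def)
  then show "e \<in> cut F S" using e F by (auto simp: cut_def)
 qed
 have dis: "?D \<inter> g ` ?M = {}"
 proof (rule ccontr)
  assume "?D \<inter> g ` ?M \<noteq> {}"
  then obtain z where z: "z \<in> ?M" "g z \<in> ?D" by auto
  then have "z \<in> g z" unfolding g_def by simp
  moreover have "g z \<subseteq> W" using z(2) by (auto simp: bonds_def)
  ultimately show False using zW[OF z(1)] by auto
 qed
 have "card ?D + card ?M = card ?D + card (g ` ?M)" using card_image[OF inj] by simp
 also have "... = card (?D \<union> g ` ?M)"
  using finite_subset[OF D fc] fM dis by (intro card_Un_disjoint[symmetric]) auto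
 also have "... \<le> card (cut F S)" using D g by (intro card_mono fc) auto
 finally show ?thesis .
qed

text \<open>The independent trials are the bonds and, for every vertex \<open>z\<close> outside
  \<open>W\<close>, the star of edges from \<open>z\<close> to \<open>W\<close>. The trial of
  \<open>z\<close> needs an edge to each side and succeeds with probability at least p^2 / 4 times
  the product of the two neighbour counts. The factor 1/2 of \<open>chance_few\<close> then turns 4
  into 8.\<close>

lemma chance_few_links:
 fixes \<delta> :: real
 assumes W: "W \<subseteq> V" "A \<subseteq> W" and \<delta>: "0 < \<delta>" "\<delta> \<le> 1"
 shows "chance (E - outside W) (\<lambda>_. \<delta> / d) (\<lambda>Y. real (card (Y \<inter> bonds A (W - A)) + card (linked W A Y)) \<le> b)
  \<le> exp (b - \<delta>\<^sup>2 / (8 * d) * (card (bonds A (W - A)) + twosteps (V - W) A (W - A) / d))"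
proof -
 let ?E = "E - outside W" and ?B = "W - A" and ?p = "\<delta> / d" let ?D = "bonds A ?B"
 define I where "I = Inl ` ?D \<union> Inr ` (V - W)"
 define star where "star z = {e \<in> E. z \<in> e \<and> e \<inter> W \<noteq> {}}" for z
 define Ai where "Ai i = (case i of Inl e \<Rightarrow> {e} | Inr z \<Rightarrow> star z)" for i
 define Z where "Z i F = (case i of Inl e \<Rightarrow> e \<in> F | Inr z \<Rightarrow> (\<exists>a\<in>A. {z, a} \<in> F) \<and> (\<exists>b\<in>?B. {z, b} \<in> F))" for i F
 define \<mu> where "\<mu> i = (case i of Inl e \<Rightarrow> ?p | Inr z \<Rightarrow> ?p\<^sup>2 * (card (nb A z) * card (nb ?B z)) / 4)" for i :: "'v set + 'v"
 have d0: "0 < real d" using d2 by simp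
 have p: "0 \<le> ?p" "?p \<le> 1" "?p * d \<le> 1" using \<delta> d2 by (auto simp: field_simps)
 have fD: "finite ?D" using finE by (auto simp: bonds_def)
 have fI: "finite I" using fD finV by (auto simp: I_def)
 have pr: "probs D (\<lambda>_. ?p)" for D :: "'v set set" using p by (simp add: probs_def)
 have sub: "Ai i \<subseteq> ?E" if i: "i \<in> I" for i
  using i W by (auto simp: I_def Ai_def star_def bonds_def outside_def)
 have uniq: "z = z'" if s: "e \<in> star z" "e \<in> star z'" "z \<notin> W" "z' \<notin> W" for e z z'
 proof -
  have "e \<in> E" "z \<in> e" using s by (auto simp: star_def)
  then obtain y where "e = {z, y}" using pairs_edgeE[OF pairsE] by metis
  then show ?thesis using s by (auto simp: star_def)
 qed
 have dis: "disjoint_family_on Ai I"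
  unfolding disjoint_family_on_def
 proof (intro ballI impI)
  fix i j assume ij: "i \<in> I" "j \<in> I" "i \<noteq> j"
  have DW: "e \<subseteq> W" if "e \<in> ?D" for e using that W by (auto simp: bonds_def)
  have st: "e \<notin> star z" if "e \<subseteq> W" "z \<notin> W" for e z using that by (auto simp: star_def)
  show "Ai i \<inter> Ai j = {}"
  proof (rule equals0I)
   fix e assume e: "e \<in> Ai i \<inter> Ai j"
   show False
   proof (cases i; cases j)
    fix e1 e2 assume "i = Inl e1" "j = Inl e2"
    then show False using ij e by (auto simp: Ai_def)
   next
    fix e1 z assume c: "i = Inl e1" "j = Inr z"
    then have "e1 \<in> ?D" "z \<notin> W" "e = e1" "e \<in> star z" using ij e by (auto simp: I_def Ai_def)
    then show False using st[OF DW] by blast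
   next
    fix e1 z assume c: "i = Inr z" "j = Inl e1"
    then have "e1 \<in> ?D" "z \<notin> W" "e = e1" "e \<in> star z" using ij e by (auto simp: I_def Ai_def)
    then show False using st[OF DW] by blast
   next
    fix z z' assume c: "i = Inr z" "j = Inr z'"
    then have "z \<notin> W" "z' \<notin> W" "e \<in> star z" "e \<in> star z'" using ij e by (auto simp: I_def Ai_def)
    then show False using uniq c ij(3) by blast
   qed
  qed
 qed
 have ch: "\<mu> i \<le> chance (Ai i) (\<lambda>_. ?p) (Z i)" if i: "i \<in> I" for i
 proof (cases i)
  case (Inl e)
  then show ?thesis by (simp add: \<mu>_def Ai_def Z_def chance_insert chance_def mean_insert)
 next
  case (Inr z)
  then have z: "z \<in> V" "z \<notin> W" using i by (auto simp: I_def)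
  let ?S = "(\<lambda>a. {z, a}) ` nb A z" and ?T = "(\<lambda>a. {z, a}) ` nb ?B z"
  have inj: "inj_on (\<lambda>a. {z, a}) X" for X by (auto simp: inj_on_def doubleton_eq_iff)
  have c: "card ?S = card (nb A z)" "card ?T = card (nb ?B z)" by (rule card_image[OF inj])+
  have le: "?p * card (nb X z) \<le> 1" for X
  proof -
   have "?p * card (nb X z) \<le> ?p * d" using card_nb[OF z(1)] p by (intro mult_left_mono) auto
   then show ?thesis using p by simp
  qed
  have "?p\<^sup>2 * (card ?S * card ?T) / 4 \<le> chance (star z) (\<lambda>_. ?p) (\<lambda>F. F \<inter> ?S \<noteq> {} \<and> F \<inter> ?T \<noteq> {})"
  proof (rule chance_both_hit)
   show "finite (star z)" using finE by (simp add: star_def)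
   show "?S \<subseteq> star z" "?T \<subseteq> star z" using W by (auto simp: nb_def star_def)
   show "?S \<inter> ?T = {}" using z W by (auto simp: nb_def doubleton_eq_iff)
  qed (use p le c in auto)
  also have "... \<le> chance (star z) (\<lambda>_. ?p) (\<lambda>F. (\<exists>a\<in>A. {z, a} \<in> F) \<and> (\<exists>b\<in>?B. {z, b} \<in> F))"
   by (intro chance_mono pr) (auto simp: nb_def)
  also have "(\<lambda>F. (\<exists>a\<in>A. {z, a} \<in> F) \<and> (\<exists>b\<in>?B. {z, b} \<in> F)) = Z i"
   using Inr by (simp add: Z_def fun_eq_iff)
  finally show ?thesis using Inr c by (simp add: \<mu>_def Ai_def)
 qed
 have cI: "card {i \<in> I. Z i (Y \<inter> Ai i)} = card (Y \<inter> ?D) + card (linked W A Y)" if Y: "Y \<subseteq> ?E" for Y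
 proof -
  have YE: "e \<in> E" if "e \<in> Y" for e using Y that by auto
  have st: "{z, w} \<in> star z" if "{z, w} \<in> Y" "w \<in> W" for z w
   using YE[OF that(1)] that(2) by (auto simp: star_def)
  have Zl: "Z (Inl e) (Y \<inter> Ai (Inl e)) \<longleftrightarrow> e \<in> Y" for e by (simp add: Z_def Ai_def)
  have Zr: "Z (Inr z) (Y \<inter> Ai (Inr z)) \<longleftrightarrow> (\<exists>a\<in>A. {z, a} \<in> Y) \<and> (\<exists>b\<in>?B. {z, b} \<in> Y)" for z
   unfolding Z_def Ai_def sum.case using st W(2) by blast
  have "{i \<in> I. Z i (Y \<inter> Ai i)} = Inl ` (Y \<inter> ?D) \<union> Inr ` linked W A Y"
   by (auto simp: I_def Zl Zr linked_def)
  moreover have "finite (linked W A Y)" by (rule finite_subset[OF _ finV]) (auto simp: linked_def)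
  moreover have "card (Inl ` P \<union> Inr ` R) = card P + card R" if "finite P" "finite R" for P :: "'v set set" and R :: "'v set"
   by (subst card_Un_disjoint) (use that in \<open>auto simp: card_image\<close>)
  ultimately show ?thesis using fD by simp
 qed
 have "chance ?E (\<lambda>_. ?p) (\<lambda>Y. real (card (Y \<inter> ?D) + card (linked W A Y)) \<le> b) =
   chance ?E (\<lambda>_. ?p) (\<lambda>Y. real (card {i \<in> I. Z i (Y \<inter> Ai i)}) \<le> b)"
  unfolding chance_def by (intro mean_cong) (simp add: cI)
 also have "... \<le> exp (b - (\<Sum>i\<in>I. \<mu> i) / 2)"
  using fI sub dis ch finE by (intro chance_few pr) auto
 also have "... \<le> exp (b - \<delta>\<^sup>2 / (8 * d) * (card ?D + twosteps (V - W) A ?B / d))"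
 proof -
  have "(\<Sum>i\<in>I. \<mu> i) = (\<Sum>i\<in>Inl ` ?D. \<mu> i) + (\<Sum>i\<in>Inr ` (V - W). \<mu> i)"
   unfolding I_def using fD finV by (intro sum.union_disjoint) auto
  also have "(\<Sum>i\<in>Inl ` ?D. \<mu> i) = ?p * card ?D" by (subst sum.reindex) (auto simp: \<mu>_def)
  also have "(\<Sum>i\<in>Inr ` (V - W). \<mu> i) = ?p\<^sup>2 / 4 * twosteps (V - W) A ?B"
   by (subst sum.reindex) (auto simp: \<mu>_def twosteps_def sum_distrib_left)
  also have "?p * card ?D + ?p\<^sup>2 / 4 * twosteps (V - W) A ?B \<ge> \<delta>\<^sup>2 / (4 * d) * (card ?D + twosteps (V - W) A ?B / d)"
  proof -
   have "\<delta>\<^sup>2 \<le> \<delta> * 1" using \<delta> unfolding power2_eq_square by (intro mult_left_mono) auto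
   then have "\<delta>\<^sup>2 / (4 * d) \<le> ?p" using \<delta> d0 by (simp add: field_simps)
   then have "\<delta>\<^sup>2 / (4 * d) * card ?D \<le> ?p * card ?D" by (intro mult_right_mono) auto
   moreover have "\<delta>\<^sup>2 / (4 * d) * (twosteps (V - W) A ?B / d) = ?p\<^sup>2 / 4 * twosteps (V - W) A ?B"
    by (simp add: power2_eq_square)
   ultimately show ?thesis by (simp add: distrib_left)
  qed
  finally have "\<delta>\<^sup>2 / (4 * d) * (card ?D + twosteps (V - W) A ?B / d) / 2 \<le> (\<Sum>i\<in>I. \<mu> i) / 2"
   by (rule divide_right_mono) simp
  moreover have "\<delta>\<^sup>2 / (4 * d) * (card ?D + twosteps (V - W) A ?B / d) / 2 = \<delta>\<^sup>2 / (8 * d) * (card ?D + twosteps (V - W) A ?B / d)"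
   by simp
  ultimately show ?thesis by simp
 qed
 finally show ?thesis .
qed

text \<open>The sprinkled edges avoiding \<open>W\<close> are exposed first, and they fix the
  auxiliary graph. For a candidate trace \<open>A\<close> of size \<open>k\<close>, few links appear
  among the edges meeting \<open>W\<close> with probability at most \<open>err\<close> times the
  weight for which \<open>card_family\<close> bounds the number of candidates. Thus each choice of
  \<open>v\<close> and \<open>k\<close> contributes at most \<open>err\<close>.\<close>

lemma chance_slow_set:
 fixes \<delta> \<alpha> err Q :: real and b s r :: "nat \<Rightarrow> nat" and q1 q2 :: "nat \<Rightarrow> real"
 assumes F1: "F1 \<subseteq> E" and N: "1 \<le> N" and W: "W = giants N F1" and \<delta>: "0 < \<delta>" "\<delta> \<le> 1"
  and k0: "1 \<le> k0" and err0: "0 \<le> err"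
  and lower: "\<And>A. A \<subseteq> W \<Longrightarrow> A \<noteq> {} \<Longrightarrow> \<alpha> * card V \<le> card (W - A) \<Longrightarrow>
   \<mu> (card A) \<le> card (bonds A (W - A)) + twosteps (V - W) A (W - A) / d"
  and q: "\<And>k. k0 \<le> k \<Longrightarrow> k \<le> card V \<Longrightarrow> 0 < q1 k \<and> q1 k < 1 \<and> 0 < q2 k \<and> q2 k < 1 \<and> k \<le> N * r k"
  and num: "\<And>k. k0 \<le> k \<Longrightarrow> k \<le> card V \<Longrightarrow>
   exp (b k - \<delta>\<^sup>2 / (8 * d) * \<mu> k) \<le>
   err * ((1 - q1 k) ^ s k * q2 k ^ (r k + b k) * (q1 k ^ b k * (1 - q2 k) ^ ((d + d * (m * d)) * k)))"
 shows "chance E (\<lambda>_. \<delta> / d) (\<lambda>F2. (\<forall>z\<in>V - W. card (pocket W (F1 \<union> F2) z) \<le> m) \<and>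
  (\<exists>S\<subseteq>V. conn (F1 \<union> F2) S \<and> k0 \<le> card (S \<inter> W) \<and> \<alpha> * card V \<le> card (W - S) \<and>
    card (inc (F1 \<union> F2) S) \<le> s (card (S \<inter> W)) \<and> card (cut (F1 \<union> F2) S) \<le> b (card (S \<inter> W))))
  \<le> (card V)\<^sup>2 * err"
proof -
 let ?p = "\<delta> / d"
 let ?Q = "\<lambda>F2. (\<forall>z\<in>V - W. card (pocket W (F1 \<union> F2) z) \<le> m) \<and>
  (\<exists>S\<subseteq>V. conn (F1 \<union> F2) S \<and> k0 \<le> card (S \<inter> W) \<and> \<alpha> * card V \<le> card (W - S) \<and>
    card (inc (F1 \<union> F2) S) \<le> s (card (S \<inter> W)) \<and> card (cut (F1 \<union> F2) S) \<le> b (card (S \<inter> W)))"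
 have p: "0 \<le> ?p" "?p \<le> 1" using \<delta> d2 by (auto simp: field_simps)
 have pr: "probs D (\<lambda>_. ?p)" for D :: "'v set set" using p by (simp add: probs_def)
 have WV: "W \<subseteq> V" using W by (auto simp: giants_def)
 have fW: "finite W" using WV finV by (rule finite_subset)
 have out: "outside W \<subseteq> E" by (auto simp: outside_def)
 have inner: "chance (E - outside W) (\<lambda>_. ?p) (\<lambda>Y. ?Q (X \<union> Y)) \<le> (card V)\<^sup>2 * err" if X: "X \<subseteq> outside W" for X
 proof (cases "\<forall>z\<in>V - W. card (pocket W (F1 \<union> X) z) \<le> m")
  case False
  \<comment> \<open>Pockets are already determined by the first exposure, so the event cannot happen
    in this case.\<close>
  have "pocket W (F1 \<union> (X \<union> Y)) z = pocket W (F1 \<union> X) z" if "Y \<subseteq> E - outside W" for Y z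
  proof -
   have "(F1 \<union> (X \<union> Y)) \<inter> outside W = (F1 \<union> X) \<inter> outside W" using that by auto
   then show ?thesis by (simp add: pocket_def)
  qed
  then have "chance (E - outside W) (\<lambda>_. ?p) (\<lambda>Y. ?Q (X \<union> Y)) \<le> chance (E - outside W) (\<lambda>_. ?p) (\<lambda>Y. False)"
   using False by (intro chance_mono pr) auto
  also have "... = 0" using finE by (simp add: chance_def)
  also have "0 \<le> (card V)\<^sup>2 * err" using err0 by simp
  finally show ?thesis .
 next
  case True
  define L where "L = ties W (F1 \<union> X)"
  have deg_L: "card {e \<in> L. w \<in> e} \<le> d + d * (m * d)" if "w \<in> W" for w
   unfolding L_def using ties_degree[OF WV that, of "F1 \<union> X" m] True by auto
  let ?fam = "\<lambda>v k. {A \<in> family W F1 L v k (b k) (s k). \<alpha> * card V \<le> card (W - A)}"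
  let ?P = "\<lambda>k A Y. real (card (Y \<inter> bonds A (W - A)) + card (linked W A Y)) \<le> b k"
  let ?I = "SIGMA v:V. SIGMA k:{k0..card V}. ?fam v k"
  have ffam: "finite (?fam v k)" for v k
   by (rule finite_subset[of _ "Pow W"]) (use fW in \<open>auto simp: family_def\<close>)
  have fI: "finite ?I" using finV ffam by auto
  have "chance (E - outside W) (\<lambda>_. ?p) (\<lambda>Y. ?Q (X \<union> Y)) \<le> (\<Sum>i\<in>?I. chance (E - outside W) (\<lambda>_. ?p) (?P (fst (snd i)) (snd (snd i))))"
  proof (intro chance_UN pr fI)
   fix Y assume Y: "Y \<subseteq> E - outside W" "?Q (X \<union> Y)"
   let ?F = "F1 \<union> (X \<union> Y)"
   obtain S where S: "S \<subseteq> V" "conn ?F S" "k0 \<le> card (S \<inter> W)" "\<alpha> * card V \<le> card (W - S)"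
    "card (inc ?F S) \<le> s (card (S \<inter> W))" "card (cut ?F S) \<le> b (card (S \<inter> W))" using Y(2) by blast
   define A where "A = S \<inter> W"
   have FE: "?F \<subseteq> E" using F1 X Y out by auto
   have Ane: "S \<inter> W \<noteq> {}" using S(3) k0 by auto
   then obtain v where v: "v \<in> A" by (auto simp: A_def)
   have WS: "W - A = W - S" by (auto simp: A_def)
   have "ties W ?F = L"
   proof -
    have "?F \<inter> outside W = (F1 \<union> X) \<inter> outside W" using Y by auto
    then show ?thesis by (simp add: L_def ties_def pocket_def)
   qed
   then have cL: "conn L A" using conn_ties[OF WV FE S(1,2) Ane] by (simp add: A_def)
   have fF: "finite ?F" using FE finE by (rule finite_subset)
   \<comment> \<open>An edge of \<open>F1\<close> never joins \<open>W\<close> to its complement, so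
     an \<open>F1\<close>-edge leaving the trace \<open>A\<close> ends in \<open>W - S\<close> and
     leaves \<open>S\<close> too.\<close>
   have "cut F1 A \<subseteq> cut ?F S"
   proof
    fix e assume e: "e \<in> cut F1 A"
    then obtain x where x: "x \<in> e" "x \<in> A" "e \<in> F1" by (auto simp: cut_def)
    have "e \<subseteq> W" using giants_closed[OF F1 x(3,1), of N] x W by (auto simp: A_def)
    then show "e \<in> cut ?F S" using e x by (auto simp: cut_def A_def)
   qed
   then have c1: "card (cut F1 A) \<le> b (card A)"
    using S(6) card_mono[of "cut ?F S" "cut F1 A"] fF by (simp add: A_def cut_def)
   have "F1 \<inter> Pow A \<subseteq> inc ?F S"
   proof
    fix e assume e: "e \<in> F1 \<inter> Pow A"
    then have "e \<noteq> {}" using pairs_subset[OF pairsE F1] by (auto simp: pairs_def)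
    then show "e \<in> inc ?F S" using e by (auto simp: inc_def A_def)
   qed
   then have c2: "card (F1 \<inter> Pow A) \<le> s (card A)"
    using S(5) card_mono[of "inc ?F S" "F1 \<inter> Pow A"] fF by (simp add: A_def inc_def)
   have cA: "card A \<le> card V" using WV finV by (intro card_mono) (auto simp: A_def)
   have "A \<in> ?fam v (card A)" using v cL c1 c2 S(4) WS by (auto simp: family_def A_def)
   moreover have "?P (card A) A Y"
   proof -
    have "card (Y \<inter> bonds A (W - A)) + card (linked W A Y) \<le> card (cut ?F S)"
     using linked_le_cut[OF FE _ WV S(1), of Y] unfolding WS unfolding A_def by auto
    then show ?thesis using S(6) by (simp add: A_def)
   qed
   ultimately show "\<exists>i\<in>?I. ?P (fst (snd i)) (snd (snd i)) Y"
    using v WV cA S(3) by (intro bexI[of _ "(v, card A, A)"]) (auto simp: A_def)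
  qed
  also have "... = (\<Sum>v\<in>V. \<Sum>k\<in>{k0..card V}. \<Sum>A\<in>?fam v k. chance (E - outside W) (\<lambda>_. ?p) (?P k A))"
   using finV ffam by (simp add: sum.Sigma case_prod_unfold)
  also have "... \<le> (\<Sum>v\<in>V. \<Sum>k\<in>{k0..card V}. err)"
  proof (intro sum_mono)
   fix v k assume v: "v \<in> V" and k: "k \<in> {k0..card V}"
   let ?\<Omega> = "(1 - q1 k) ^ s k * q2 k ^ (r k + b k) * (q1 k ^ b k * (1 - q2 k) ^ ((d + d * (m * d)) * k))"
   have qk: "0 < q1 k" "q1 k < 1" "0 < q2 k" "q2 k < 1" "k \<le> N * r k" using q[of k] k by auto
   have "(\<Sum>A\<in>?fam v k. chance (E - outside W) (\<lambda>_. ?p) (?P k A)) \<le> (\<Sum>A\<in>?fam v k. err * ?\<Omega>)"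
   proof (intro sum_mono)
    fix A assume A: "A \<in> ?fam v k"
    then have A': "A \<subseteq> W" "A \<noteq> {}" "card A = k" "\<alpha> * card V \<le> card (W - A)" by (auto simp: family_def)
    have "chance (E - outside W) (\<lambda>_. ?p) (?P k A) \<le> exp (b k - \<delta>\<^sup>2 / (8 * d) * (card (bonds A (W - A)) + twosteps (V - W) A (W - A) / d))"
     by (rule chance_few_links[OF WV A'(1) \<delta>])
    also have "... \<le> exp (b k - \<delta>\<^sup>2 / (8 * d) * \<mu> k)"
    proof -
     have "\<delta>\<^sup>2 / (8 * d) * \<mu> k \<le> \<delta>\<^sup>2 / (8 * d) * (card (bonds A (W - A)) + twosteps (V - W) A (W - A) / d)"
      using lower[OF A'(1,2,4)] A'(3) by (intro mult_left_mono) auto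
     then show ?thesis by (simp only: exp_le_cancel_iff diff_left_mono)
    qed
    also have "... \<le> err * ?\<Omega>" using num[of k] k by auto
    finally show "chance (E - outside W) (\<lambda>_. ?p) (?P k A) \<le> err * ?\<Omega>" .
   qed
   also have "... = err * (card (?fam v k) * ?\<Omega>)" by simp
   also have "... \<le> err * (card (family W F1 L v k (b k) (s k)) * ?\<Omega>)"
   proof (intro mult_left_mono mult_right_mono of_nat_mono card_mono)
    show "finite (family W F1 L v k (b k) (s k))"
     by (rule finite_subset[of _ "Pow W"]) (use fW in \<open>auto simp: family_def\<close>)
   qed (use err0 qk in auto)
   also have "... \<le> err * 1"
   proof (rule mult_left_mono[OF _ err0])
    show "card (family W F1 L v k (b k) (s k)) * ?\<Omega> \<le> 1"
     using deg_L qk by (intro card_family[OF F1 N W L_def]) auto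
   qed
   finally show "(\<Sum>A\<in>?fam v k. chance (E - outside W) (\<lambda>_. ?p) (?P k A)) \<le> err" by simp
  qed
  also have "... = card V * (real (card {k0..card V}) * err)" by simp
  also have "... \<le> card V * (card V * err)"
   using k0 err0 by (intro mult_left_mono mult_right_mono of_nat_mono) auto
  finally show ?thesis by (simp add: power2_eq_square mult.assoc)
 qed
 have 1: "chance E (\<lambda>_. ?p) ?Q = mean (outside W) (\<lambda>_. ?p) (\<lambda>X. chance (E - outside W) (\<lambda>_. ?p) (\<lambda>Y. ?Q (X \<union> Y)))"
  unfolding chance_def by (rule mean_split[OF finE out])
 have 2: "mean (outside W) (\<lambda>_. ?p) (\<lambda>X. chance (E - outside W) (\<lambda>_. ?p) (\<lambda>Y. ?Q (X \<union> Y))) \<le> (card V)\<^sup>2 * err"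
  by (intro mean_le_const pr inner finite_subset[OF out finE])
 show ?thesis by (rule ord_eq_le_trans[OF 1 2])
qed

end

section \<open>Product graphs\<close>

text \<open>For a uniform point of \<open>S\<close>, the average logarithm of the fibre size in
  direction \<open>j\<close> is the entropy of coordinate \<open>j\<close> conditioned on all
  others. These conditional entropies add up to at most the joint entropy
  \<open>ln (card S)\<close>. The induction slices \<open>S\<close> by one coordinate, in the manner
  of the chain rule.\<close>

lemma entropy_projections:
 fixes S :: "('i \<Rightarrow> 'b) set"
 assumes "finite J" "finite S" "\<And>x y. x \<in> S \<Longrightarrow> y \<in> S \<Longrightarrow> (\<And>i. i \<in> J \<Longrightarrow> x i = y i) \<Longrightarrow> x = y"
 shows "(\<Sum>j\<in>J. \<Sum>x\<in>S. ln (real (card {y \<in> S. \<forall>i\<in>J - {j}. y i = x i}))) \<le> card S * ln (card S)"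
 using assms
proof (induction J arbitrary: S rule: finite_induct)
 case empty
 show ?case
 proof (cases "S = {}")
  case False
  then obtain x where "x \<in> S" by auto
  then have "S = {x}" using empty by auto
  then show ?thesis by simp
 qed simp
next
 case (insert j0 J)
 let ?sl = "\<lambda>s. {x \<in> S. x j0 = s}" and ?a = "\<lambda>x. real (card {y \<in> S. \<forall>i\<in>J. y i = x i})"
 let ?vals = "(\<lambda>x. x j0) ` S" and ?f = "\<lambda>x. real (card {y \<in> S. y j0 = x j0})" and ?n = "real (card S)"
 have fS: "finite S" by (rule insert.prems)
 have slices: "(\<Sum>x\<in>S. g x) = (\<Sum>s\<in>?vals. \<Sum>x\<in>?sl s. g x)" for g :: "_ \<Rightarrow> real"
  using sum.group[of S ?vals "\<lambda>x. x j0" g] fS by simp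
 have eq: "{y \<in> S. \<forall>i\<in>insert j0 J - {j}. y i = x i} = {y \<in> ?sl s. \<forall>i\<in>J - {j}. y i = x i}"
  if "j \<in> J" "x \<in> ?sl s" for j x s
  using that insert.hyps by auto
 have "(\<Sum>j\<in>J. \<Sum>x\<in>S. ln (real (card {y \<in> S. \<forall>i\<in>insert j0 J - {j}. y i = x i})))
   = (\<Sum>j\<in>J. \<Sum>s\<in>?vals. \<Sum>x\<in>?sl s. ln (real (card {y \<in> ?sl s. \<forall>i\<in>J - {j}. y i = x i})))"
  unfolding slices by (intro sum.cong refl) (simp only: eq)
 also have "... = (\<Sum>s\<in>?vals. \<Sum>j\<in>J. \<Sum>x\<in>?sl s. ln (real (card {y \<in> ?sl s. \<forall>i\<in>J - {j}. y i = x i})))"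
  by (rule sum.swap)
 also have "... \<le> (\<Sum>s\<in>?vals. card (?sl s) * ln (card (?sl s)))"
 proof (intro sum_mono insert.IH)
  fix s x y assume "x \<in> ?sl s" "y \<in> ?sl s" "\<And>i. i \<in> J \<Longrightarrow> x i = y i"
  then show "x = y" by (intro insert.prems(2)) auto
 qed (use fS in auto)
 also have "... = (\<Sum>x\<in>S. ln (?f x))" unfolding slices by (intro sum.cong refl) simp
 finally have 1: "(\<Sum>j\<in>J. \<Sum>x\<in>S. ln (real (card {y \<in> S. \<forall>i\<in>insert j0 J - {j}. y i = x i}))) \<le> (\<Sum>x\<in>S. ln (?f x))" .
 \<comment> \<open>Here \<open>?a\<close> is the fibre size in direction \<open>j0\<close> and
   \<open>?f\<close> the size of the slice through \<open>x\<close>. The inequality ln z \<le> z - 1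
   reduces the claim to a bound for the sum of the products of the two.\<close>
 have "(\<Sum>x\<in>S. ln (?a x)) + (\<Sum>x\<in>S. ln (?f x)) \<le> ?n * ln ?n"
 proof (cases "S = {}")
  case False
  then have n0: "0 < ?n" using fS by (simp add: card_gt_0_iff)
  have pos: "0 < ?a x" "0 < ?f x" if "x \<in> S" for x
   using that fS by (auto simp: card_gt_0_iff)
  have "(\<Sum>x\<in>S. ln (?a x)) + (\<Sum>x\<in>S. ln (?f x)) - ?n * ln ?n = (\<Sum>x\<in>S. ln (?a x * ?f x / ?n))"
  proof -
   have "(\<Sum>x\<in>S. ln (?a x * ?f x / ?n)) = (\<Sum>x\<in>S. ln (?a x) + ln (?f x) - ln ?n)"
    using pos n0 by (intro sum.cong refl) (simp add: ln_mult ln_div)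
   then show ?thesis by (simp add: sum.distrib sum_subtractf)
  qed
  also have "... \<le> (\<Sum>x\<in>S. ?a x * ?f x / ?n - 1)"
   using pos n0 by (intro sum_mono ln_le_minus_one) auto
  also have "... = (\<Sum>x\<in>S. ?a x * ?f x) / ?n - ?n" by (simp add: sum_subtractf sum_divide_distrib)
  also have "... \<le> 0"
  proof -
   let ?R = "\<lambda>x. {y \<in> S. \<forall>i\<in>J. y i = x i} \<times> {z \<in> S. z j0 = x j0}"
   have "(\<Sum>x\<in>S. ?a x * ?f x) = real (card (SIGMA x:S. ?R x))"
    using fS by (subst card_SigmaI) (auto simp: card_cartesian_product)
   also have "card (SIGMA x:S. ?R x) \<le> card (S \<times> S)"
   \<comment> \<open>The point \<open>x\<close> can be recovered from the pair: it agrees with the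
     first member on \<open>J\<close> and with the second at \<open>j0\<close>.\<close>
   proof (rule card_inj_on_le[of snd])
    show "inj_on snd (SIGMA x:S. ?R x)"
    proof (rule inj_onI)
     fix p q assume pq: "p \<in> (SIGMA x:S. ?R x)" "q \<in> (SIGMA x:S. ?R x)" "snd p = snd q"
     then have "fst p = fst q" by (intro insert.prems(2)) auto
     then show "p = q" using pq(3) by (rule prod_eqI)
    qed
   qed (use fS in auto)
   finally have "(\<Sum>x\<in>S. ?a x * ?f x) \<le> ?n * ?n" by (simp add: card_cartesian_product)
   then have "(\<Sum>x\<in>S. ?a x * ?f x) / ?n \<le> ?n" using n0 by (simp add: field_simps)
   then show ?thesis by simp
  qed
  finally show ?thesis by simp
 qed simp
 moreover have "{y \<in> S. \<forall>i\<in>insert j0 J - {j0}. y i = x i} = {y \<in> S. \<forall>i\<in>J. y i = x i}" for x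
  using insert.hyps by auto
 ultimately show ?case using 1 insert.hyps by simp
qed

lemma reachable_iff:
 "reachable H u v \<longleftrightarrow> u \<in> verts H \<and> (u, v) \<in> (links (edges H) (verts H))\<^sup>*"
proof
 assume "reachable H u v"
 then obtain xs where xs: "walk H xs" "hd xs = u" "last xs = v" by (auto simp: reachable_def walk_betw_def)
 then show "u \<in> verts H \<and> (u, v) \<in> (links (edges H) (verts H))\<^sup>*"
 proof (induction xs arbitrary: u)
  case (Cons x xs)
  show ?case
  proof (cases "xs = []")
   case True
   then show ?thesis using Cons by (auto simp: walk_def)
  next
   case False
   then have "(hd xs, v) \<in> (links (edges H) (verts H))\<^sup>*" using Cons by (auto simp: walk_def successively_Cons)
   moreover have "(x, hd xs) \<in> links (edges H) (verts H)"
    using Cons False by (auto simp: walk_def successively_Cons links_def adj_def)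
   ultimately show ?thesis using Cons by (auto simp: walk_def)
  qed
 qed (auto simp: walk_def)
next
 assume "u \<in> verts H \<and> (u, v) \<in> (links (edges H) (verts H))\<^sup>*"
 then have u: "u \<in> verts H" and uv: "(u, v) \<in> (links (edges H) (verts H))\<^sup>*" by auto
 from uv have "\<exists>xs. walk_betw H u xs v"
 proof (induction rule: rtrancl_induct)
  case base
  then show ?case using u by (intro exI[of _ "[u]"]) (auto simp: walk_betw_def walk_def)
 next
  case (step y z)
  then obtain xs where "walk_betw H u xs y" by auto
  then have "walk_betw H u (xs @ [z]) z" using step.hyps
   by (auto simp: walk_betw_def walk_def successively_append_iff links_def adj_def)
  then show ?case by auto
 qed
 then show "reachable H u v" by (simp add: reachable_def)
qed

lemma connected_graph_iff: "connected_graph H \<longleftrightarrow> conn (edges H) (verts H)"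
 unfolding connected_graph_def conn_def reachable_iff by blast

section \<open>Cartesian products and their isoperimetry\<close>

locale product =
 fixes t :: nat and G :: "nat \<Rightarrow> 'a ugraph" and r :: "nat \<Rightarrow> nat" and C :: nat
 assumes t1: "1 \<le> t"
  and base: "j \<in> {1..t} \<Longrightarrow> simple_graph (G j) \<and> connected_graph (G j) \<and> regular (r j) (G j) \<and>
   1 < card (verts (G j)) \<and> card (verts (G j)) \<le> C"
begin

abbreviation "V \<equiv> verts (cart_prod t G)"
abbreviation "E \<equiv> edges (cart_prod t G)"
abbreviation "J0 \<equiv> {1..t}"

definition mv :: "nat \<Rightarrow> (nat \<Rightarrow> 'a) \<Rightarrow> (nat \<Rightarrow> 'a) set" where
 "mv j x = (\<lambda>s. x(j := s)) ` neighbours (G j) (x j)"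

definition along :: "nat set \<Rightarrow> (nat \<Rightarrow> 'a) set set" where
 "along J = {{x, y} | x y j. x \<in> V \<and> j \<in> J \<and> y \<in> mv j x}"

lemma V_def: "V = (\<Pi>\<^sub>E j\<in>J0. verts (G j))" by (simp add: cart_prod_def Let_def)

lemma baseG:
 assumes "j \<in> J0"
 shows "finite (verts (G j))" "pairs (edges (G j))" "e \<in> edges (G j) \<Longrightarrow> e \<subseteq> verts (G j)" "conn (edges (G j)) (verts (G j))"
  "s \<in> verts (G j) \<Longrightarrow> card (neighbours (G j) s) = r j" "1 < card (verts (G j))" "card (verts (G j)) \<le> C"
 using base[OF assms] unfolding simple_graph_def pairs_def connected_graph_iff regular_def degree_def by blast+

lemma nbs:
 assumes "j \<in> J0" "s' \<in> neighbours (G j) s"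
 shows "s' \<in> verts (G j)" "s \<in> verts (G j)" "s' \<noteq> s" "s \<in> neighbours (G j) s'"
proof -
 have e: "{s, s'} \<in> edges (G j)" using assms by (simp add: neighbours_def adj_def)
 then show "s' \<in> verts (G j)" "s \<in> verts (G j)" using baseG(3)[OF assms(1)] by blast+
 then show "s \<in> neighbours (G j) s'" using e by (simp add: neighbours_def adj_def insert_commute)
 show "s' \<noteq> s" using e baseG(2)[OF assms(1)] by (auto simp: pairs_def)
qed

lemma finV: "finite V" unfolding V_def using baseG(1) by (intro finite_PiE) auto

lemma coord: "x \<in> V \<Longrightarrow> j \<in> J0 \<Longrightarrow> x j \<in> verts (G j)" unfolding V_def by auto

lemma upd_V: "x \<in> V \<Longrightarrow> j \<in> J0 \<Longrightarrow> s \<in> verts (G j) \<Longrightarrow> x(j := s) \<in> V"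
 unfolding V_def by (auto simp: PiE_iff extensional_def)

lemma V_eqI: "x \<in> V \<Longrightarrow> y \<in> V \<Longrightarrow> (\<And>i. i \<in> J0 \<Longrightarrow> x i = y i) \<Longrightarrow> x = y"
 unfolding V_def by (rule PiE_ext)

lemma mv_V: "j \<in> J0 \<Longrightarrow> x \<in> V \<Longrightarrow> y \<in> mv j x \<Longrightarrow> y \<in> V"
proof -
 assume a: "j \<in> J0" "x \<in> V" "y \<in> mv j x"
 then obtain s where "s \<in> neighbours (G j) (x j)" "y = x(j := s)" by (auto simp: mv_def)
 then show "y \<in> V" using upd_V[OF a(2,1) nbs(1)[OF a(1)]] by simp
qed

lemma mv_iff:
 assumes "j \<in> J0" "x \<in> V" "y \<in> V"
 shows "y \<in> mv j x \<longleftrightarrow> adj (G j) (x j) (y j) \<and> (\<forall>m\<in>J0. m \<noteq> j \<longrightarrow> x m = y m)"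
proof
 assume "y \<in> mv j x"
 then show "adj (G j) (x j) (y j) \<and> (\<forall>m\<in>J0. m \<noteq> j \<longrightarrow> x m = y m)"
  by (auto simp: mv_def neighbours_def)
next
 assume a: "adj (G j) (x j) (y j) \<and> (\<forall>m\<in>J0. m \<noteq> j \<longrightarrow> x m = y m)"
 have "y = x(j := y j)" using a assms coord[OF assms(3,1)] by (intro V_eqI upd_V) auto
 moreover have "y j \<in> neighbours (G j) (x j)" using a coord[OF assms(3,1)] by (auto simp: neighbours_def)
 ultimately show "y \<in> mv j x" unfolding mv_def by (metis imageI)
qed

lemma mv_sym: "j \<in> J0 \<Longrightarrow> x \<in> V \<Longrightarrow> y \<in> mv j x \<Longrightarrow> x \<in> mv j y"
proof -
 assume a: "j \<in> J0" "x \<in> V" "y \<in> mv j x"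
 have y: "y \<in> V" by (rule mv_V[OF a])
 have "adj (G j) (x j) (y j) \<and> (\<forall>m\<in>J0. m \<noteq> j \<longrightarrow> x m = y m)" using mv_iff[OF a(1,2) y] a(3) by blast
 then have "adj (G j) (y j) (x j) \<and> (\<forall>m\<in>J0. m \<noteq> j \<longrightarrow> y m = x m)" by (simp add: adj_def insert_commute)
 then show "x \<in> mv j y" using mv_iff[OF a(1) y a(2)] by blast
qed

lemma mv_neq: "j \<in> J0 \<Longrightarrow> y \<in> mv j x \<Longrightarrow> y j \<noteq> x j"
 using nbs(3) by (auto simp: mv_def)

lemma mv_off: "y \<in> mv j x \<Longrightarrow> m \<noteq> j \<Longrightarrow> y m = x m"
 by (auto simp: mv_def)

lemma mv_unique: "i \<in> J0 \<Longrightarrow> j \<in> J0 \<Longrightarrow> y \<in> mv i x \<Longrightarrow> y \<in> mv j x \<Longrightarrow> i = j"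
 using mv_neq[of i y x] mv_off[of y j x i] by blast

lemma along_iff:
 assumes "J \<subseteq> J0" shows "{x, y} \<in> along J \<longleftrightarrow> x \<in> V \<and> (\<exists>j\<in>J. y \<in> mv j x)"
proof
 assume "{x, y} \<in> along J"
 then obtain u v j where u: "{x, y} = {u, v}" "u \<in> V" "j \<in> J" "v \<in> mv j u" by (auto simp: along_def)
 have "j \<in> J0" using u assms by auto
 then have "u \<in> mv j v" "v \<in> V" using u mv_sym[of j u v] mv_V[of j u v] by blast+
 then show "x \<in> V \<and> (\<exists>j\<in>J. y \<in> mv j x)" using u by (auto simp: doubleton_eq_iff)
qed (auto simp: along_def)

lemma E_along: "E = along J0"
proof -
 have "E = {{u, v} | u v. u \<in> V \<and> v \<in> V \<and> (\<exists>j\<in>J0. adj (G j) (u j) (v j) \<and> (\<forall>m\<in>J0. m \<noteq> j \<longrightarrow> u m = v m))}"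
  by (simp add: cart_prod_def Let_def)
 also have "... = along J0" unfolding along_def using mv_iff mv_V by (intro Collect_cong) metis
 finally show ?thesis .
qed

lemma along_mono: "J \<subseteq> J' \<Longrightarrow> along J \<subseteq> along J'"
 unfolding along_def by blast

lemma pairs_E: "pairs E"
proof (unfold pairs_def, intro ballI)
 fix e assume "e \<in> E"
 then obtain x y j where e: "e = {x, y}" "j \<in> J0" "y \<in> mv j x" unfolding E_along along_def by blast
 then have "x \<noteq> y" using mv_neq by blast
 then show "card e = 2" using e by simp
qed

lemma E_V: "e \<in> E \<Longrightarrow> e \<subseteq> V"
 unfolding E_along along_def using mv_V by blast

lemma finE: "finite E"
 by (rule finite_subset[of E "Pow V"]) (use E_V finV in auto)

lemma card_mv: "j \<in> J0 \<Longrightarrow> x \<in> V \<Longrightarrow> card (mv j x) = r j" and finite_mv: "j \<in> J0 \<Longrightarrow> finite (mv j x)"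
proof -
 assume j: "j \<in> J0"
 have "neighbours (G j) (x j) \<subseteq> verts (G j)" by (auto simp: neighbours_def)
 then show "finite (mv j x)" unfolding mv_def using baseG(1)[OF j] finite_subset by blast
 assume "x \<in> V"
 have "inj_on (\<lambda>s. x(j := s)) X" for X by (auto simp: inj_on_def dest: fun_cong[of _ _ j])
 then show "card (mv j x) = r j" unfolding mv_def using baseG(5)[OF j coord[OF \<open>x \<in> V\<close> j]] by (simp add: card_image)
qed

lemma degree_along:
 assumes "J \<subseteq> J0" "x \<in> V"
 shows "card {e \<in> along J. x \<in> e} = (\<Sum>j\<in>J. r j)"
proof -
 have J: "finite J" "\<And>j. j \<in> J \<Longrightarrow> j \<in> J0" using finite_subset[OF assms(1)] assms(1) by blast+
 have "{e \<in> along J. x \<in> e} = (\<lambda>y. {x, y}) ` (\<Union>j\<in>J. mv j x)"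
 proof
  show "{e \<in> along J. x \<in> e} \<subseteq> (\<lambda>y. {x, y}) ` (\<Union>j\<in>J. mv j x)"
  proof
   fix e assume "e \<in> {e \<in> along J. x \<in> e}"
   then obtain y where "e = {x, y}" "e \<in> along J" by (auto simp: along_def insert_commute)
   then show "e \<in> (\<lambda>y. {x, y}) ` (\<Union>j\<in>J. mv j x)" using along_iff[OF assms(1)] by auto
  qed
  show "(\<lambda>y. {x, y}) ` (\<Union>j\<in>J. mv j x) \<subseteq> {e \<in> along J. x \<in> e}"
   using along_iff[OF assms(1)] assms(2) by auto
 qed
 moreover have "inj_on (\<lambda>y. {x, y}) X" for X by (auto simp: inj_on_def doubleton_eq_iff)
 ultimately have "card {e \<in> along J. x \<in> e} = card (\<Union>j\<in>J. mv j x)" by (simp add: card_image)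
 also have "... = (\<Sum>j\<in>J. card (mv j x))"
  using J finite_mv mv_unique by (intro card_UN_disjoint) (auto simp: disjoint_iff)
 also have "... = (\<Sum>j\<in>J. r j)" using J card_mv assms by (intro sum.cong) auto
 finally show ?thesis .
qed

lemma r_bounds: "j \<in> J0 \<Longrightarrow> 1 \<le> r j \<and> r j \<le> C"
proof -
 assume j: "j \<in> J0"
 obtain s where s: "s \<in> verts (G j)" using baseG(6)[OF j] by fastforce
 have "neighbours (G j) s \<subseteq> verts (G j)" by (auto simp: neighbours_def)
 then have "card (neighbours (G j) s) \<le> card (verts (G j))" using baseG(1)[OF j] by (intro card_mono)
 then have ub: "r j \<le> C" using baseG(5)[OF j s] baseG(7)[OF j] by simp
 have "{s} \<noteq> verts (G j)" using baseG(6)[OF j] by (metis card_1_singleton_iff less_irrefl One_nat_def)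
 then obtain s' where s': "s' \<in> verts (G j)" "{s, s'} \<in> edges (G j)"
  using conn_crossing[OF baseG(4)[OF j], of "{s}"] s by auto
 then have "s' \<in> neighbours (G j) s" by (simp add: neighbours_def adj_def)
 moreover have "finite (neighbours (G j) s)" using baseG(1)[OF j] by (simp add: neighbours_def)
 ultimately have "0 < card (neighbours (G j) s)" by (auto simp: card_gt_0_iff)
 then show ?thesis using ub baseG(5)[OF j s] by simp
qed

definition fibre :: "(nat \<Rightarrow> 'a) set \<Rightarrow> nat \<Rightarrow> (nat \<Rightarrow> 'a) \<Rightarrow> (nat \<Rightarrow> 'a) set" where
 "fibre S j x = {y \<in> S. \<forall>i\<in>J0 - {j}. y i = x i}"

lemma entropy_fibres:
 assumes "S \<subseteq> V" shows "(\<Sum>j\<in>J0. \<Sum>x\<in>S. ln (real (card (fibre S j x)))) \<le> card S * ln (card S)"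
 unfolding fibre_def
proof (rule entropy_projections)
 show "finite S" by (rule finite_subset[OF assms finV])
 fix x y assume "x \<in> S" "y \<in> S" "\<And>i. i \<in> J0 \<Longrightarrow> x i = y i"
 then show "x = y" using assms by (intro V_eqI) blast+
qed simp

lemma fibre_inj: "j \<in> J0 \<Longrightarrow> S \<subseteq> V \<Longrightarrow> inj_on (\<lambda>y. y j) (fibre S j x)"
proof (rule inj_onI)
 fix y z assume a: "j \<in> J0" "S \<subseteq> V" "y \<in> fibre S j x" "z \<in> fibre S j x" "y j = z j"
 show "y = z"
 proof (rule V_eqI)
  fix i assume "i \<in> J0"
  then show "y i = z i" using a(3,4,5) by (cases "i = j") (simp_all add: fibre_def)
 qed (use a in \<open>auto simp: fibre_def\<close>)
qed

lemma finite_fibre: "S \<subseteq> V \<Longrightarrow> finite (fibre S j x)"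
 by (rule finite_subset[OF _ finV]) (auto simp: fibre_def)

lemma card_fibre_le: "j \<in> J0 \<Longrightarrow> S \<subseteq> V \<Longrightarrow> card (fibre S j x) \<le> card (verts (G j))"
proof -
 assume a: "j \<in> J0" "S \<subseteq> V"
 have "(\<lambda>y. y j) ` fibre S j x \<subseteq> verts (G j)" using a coord by (auto simp: fibre_def)
 then show ?thesis using card_inj_on_le[OF fibre_inj[OF a]] baseG(1)[OF a(1)] by blast
qed

definition crossing :: "(nat \<Rightarrow> 'a) set \<Rightarrow> nat \<Rightarrow> ((nat \<Rightarrow> 'a) \<times> (nat \<Rightarrow> 'a)) set" where
 "crossing S j = {(x, y). x \<in> S \<and> y \<in> V - S \<and> y \<in> mv j x}"

lemma sum_crossing:
 assumes "J \<subseteq> J0" "S \<subseteq> V" shows "(\<Sum>j\<in>J. card (crossing S j)) \<le> card (cut (along J) S)"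
proof -
 have J: "finite J" "\<And>j. j \<in> J \<Longrightarrow> j \<in> J0" using finite_subset[OF assms(1)] assms(1) by blast+
 have fin: "finite (crossing S j)" for j
  by (rule finite_subset[of _ "V \<times> V"]) (use assms finV in \<open>auto simp: crossing_def\<close>)
 have "(\<Sum>j\<in>J. card (crossing S j)) = card (\<Union>j\<in>J. crossing S j)"
  using J fin mv_unique by (intro card_UN_disjoint[symmetric]) (auto simp: crossing_def disjoint_iff)
 also have "... \<le> card (cut (along J) S)"
 proof (rule card_inj_on_le[of "\<lambda>(x, y). {x, y}"])
  show "inj_on (\<lambda>(x, y). {x, y}) (\<Union>j\<in>J. crossing S j)"
   by (auto simp: inj_on_def crossing_def doubleton_eq_iff)
  show "(\<lambda>(x, y). {x, y}) ` (\<Union>j\<in>J. crossing S j) \<subseteq> cut (along J) S"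
   using assms along_iff[OF assms(1)] by (auto simp: crossing_def intro!: cutI)
  show "finite (cut (along J) S)"
   using finE along_mono[OF assms(1)] unfolding E_along cut_def by (auto intro: finite_subset)
 qed
 finally show ?thesis .
qed

text \<open>In direction \<open>j\<close> a point has at most its fibre size minus 1 neighbours
  inside \<open>S\<close>. Fibre sizes lie between 1 and \<open>C\<close>, where s - 1 \<le> 2 * C *
  ln s, and the entropy inequality sums the logarithms. For small sets almost the whole degree
  leaves \<open>S\<close>. The restriction to directions in \<open>J\<close> keeps the other
  coordinates free for separating points.\<close>

lemma isoperimetry_small:
 assumes "J \<subseteq> J0" "S \<subseteq> V"
 shows "real (\<Sum>j\<in>J. r j) * card S - 2 * C * card S * ln (card S) \<le> card (cut (along J) S)"
proof -
 have J: "finite J" "\<And>j. j \<in> J \<Longrightarrow> j \<in> J0" using finite_subset[OF assms(1)] assms(1) by blast+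
 have fS: "finite S" by (rule finite_subset[OF assms(2) finV])
 let ?a = "\<lambda>j x. real (card (fibre S j x))"
 have a1: "1 \<le> ?a j x" if "x \<in> S" for j x
 proof -
  have "x \<in> fibre S j x" using that by (auto simp: fibre_def)
  then have "fibre S j x \<noteq> {}" by blast
  then show ?thesis using finite_fibre[OF assms(2)] by (simp add: Suc_leI card_gt_0_iff)
 qed
 have one: "real (r j) * card S - (\<Sum>x\<in>S. 2 * C * ln (?a j x)) \<le> card (crossing S j)" if j: "j \<in> J" for j
 proof -
  have j0: "j \<in> J0" using j J by auto
  have "crossing S j = (SIGMA x:S. mv j x - S)"
   using assms(2) mv_V[OF j0] by (auto simp: crossing_def)
  then have c: "real (card (crossing S j)) = (\<Sum>x\<in>S. real (card (mv j x - S)))"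
   using fS finite_mv[OF j0] by simp
  have "real (r j) * card S - (\<Sum>x\<in>S. 2 * C * ln (?a j x)) = (\<Sum>x\<in>S. real (r j) - 2 * C * ln (?a j x))"
   by (simp add: sum_subtractf)
  also have "... \<le> (\<Sum>x\<in>S. real (card (mv j x - S)))"
  proof (rule sum_mono)
   fix x assume x: "x \<in> S"
   have "mv j x \<inter> S \<subseteq> fibre S j x - {x}" using mv_off mv_neq[OF j0, of x x] by (auto simp: fibre_def)
   then have "card (mv j x \<inter> S) \<le> card (fibre S j x - {x})"
    using finite_fibre[OF assms(2)] by (intro card_mono) auto
   also have "... = card (fibre S j x) - 1" using x by (intro card_Diff_singleton) (auto simp: fibre_def)
   finally have m: "card (mv j x \<inter> S) \<le> card (fibre S j x) - 1" .
   have "real (card (fibre S j x)) - 1 \<le> 2 * C * ln (?a j x)"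
   proof (cases "card (fibre S j x) = 1")
    case False
    then have "2 \<le> card (fibre S j x)" using a1[OF x, of j] by simp
    then have "ln 2 \<le> ln (?a j x)" by simp
    then have "1 / 2 \<le> ln (?a j x)" using ln2_ge_two_thirds by linarith
    moreover have "?a j x \<le> C" using card_fibre_le[OF j0 assms(2), of x] baseG(7)[OF j0] by simp
    ultimately have "?a j x * 1 \<le> C * (2 * ln (?a j x))" using a1[OF x, of j] by (intro mult_mono) auto
    then show ?thesis by simp
   qed simp
   moreover have "card (mv j x) = card (mv j x - S) + card (mv j x \<inter> S)"
    using card_Diff_subset_Int[of "mv j x" S] finite_mv[OF j0, of x] card_mono[of "mv j x" "mv j x \<inter> S"] by auto
   ultimately show "real (r j) - 2 * C * ln (?a j x) \<le> real (card (mv j x - S))"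
    using m card_mv[OF j0, of x] x assms(2) a1[OF x, of j] by auto
  qed
  finally show ?thesis using c by simp
 qed
 have "real (\<Sum>j\<in>J. r j) * card S - (\<Sum>j\<in>J. \<Sum>x\<in>S. 2 * C * ln (?a j x)) \<le> (\<Sum>j\<in>J. real (card (crossing S j)))"
  using sum_mono[of J, OF one] by (simp add: sum_subtractf sum_distrib_right)
 also have "... \<le> card (cut (along J) S)" using sum_crossing[OF assms] by (metis of_nat_le_iff of_nat_sum)
 finally have 1: "real (\<Sum>j\<in>J. r j) * card S - (\<Sum>j\<in>J. \<Sum>x\<in>S. 2 * C * ln (?a j x)) \<le> card (cut (along J) S)" .
 have "(\<Sum>j\<in>J. \<Sum>x\<in>S. 2 * C * ln (?a j x)) \<le> (\<Sum>j\<in>J0. \<Sum>x\<in>S. 2 * C * ln (?a j x))"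
  using assms a1 by (intro sum_mono2 sum_nonneg mult_nonneg_nonneg ln_ge_zero) auto
 also have "... = 2 * C * (\<Sum>j\<in>J0. \<Sum>x\<in>S. ln (?a j x))" by (simp add: sum_distrib_left)
 also have "... \<le> 2 * C * (card S * ln (card S))" by (intro mult_left_mono entropy_fibres assms) auto
 finally show ?thesis using 1 by simp
qed

lemma ln_card_V: "ln (card V) = (\<Sum>j\<in>J0. ln (real (card (verts (G j)))))"
proof -
 have "card V = (\<Prod>j\<in>J0. card (verts (G j)))" unfolding V_def by (rule card_PiE) simp
 then have "real (card V) = (\<Prod>j\<in>J0. real (card (verts (G j))))" by simp
 moreover have "0 < real (card (verts (G j)))" if "j \<in> J0" for j using baseG(6)[OF that] by simp
 ultimately show ?thesis using ln_prod[of J0 "\<lambda>j. real (card (verts (G j)))"] by fastforce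
qed

lemma fibre_boundary:
 assumes j: "j \<in> J0" and S: "S \<subseteq> V" "x \<in> S" "card (fibre S j x) < card (verts (G j))"
 shows "\<exists>p\<in>crossing S j. fst p \<in> fibre S j x"
proof -
 let ?A = "{s \<in> verts (G j). x(j := s) \<in> S}"
 have xV: "x \<in> V" using S by auto
 have "x j \<in> ?A" using S coord[OF xV j] by simp
 moreover have "?A \<noteq> verts (G j)"
 proof
  assume A: "?A = verts (G j)"
  have "card ((\<lambda>s. x(j := s)) ` verts (G j)) \<le> card (fibre S j x)"
   using A by (intro card_mono finite_fibre[OF S(1)]) (auto simp: fibre_def split: if_splits)
  moreover have "inj_on (\<lambda>s. x(j := s)) (verts (G j))" by (auto simp: inj_on_def dest: fun_cong[of _ _ j])
  ultimately show False using S(3) by (simp add: card_image)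
 qed
 ultimately obtain s s' where s: "s \<in> ?A" "s' \<in> verts (G j) - ?A" "{s, s'} \<in> edges (G j)"
  using conn_crossing[OF baseG(4)[OF j], of ?A] by blast
 let ?u = "x(j := s)" and ?v = "x(j := s')"
 have "?v \<in> mv j ?u" using s by (auto simp: mv_def neighbours_def adj_def image_iff intro!: bexI[of _ s'])
 moreover have "?v \<in> V" using s xV j by (intro upd_V) auto
 ultimately have "(?u, ?v) \<in> crossing S j" using s by (auto simp: crossing_def)
 moreover have "?u \<in> fibre S j x" using s by (auto simp: fibre_def)
 ultimately show ?thesis by force
qed

text \<open>Since \<open>ln (card V)\<close> is the sum of the logarithms of the base sizes, the
  entropy inequality bounds \<open>card S * ln (card V / card S)\<close> by the total defect of the
  fibres. A fibre that is not full has a crossing edge, as the base graph is connected. Each of its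
  points has a defect of at most \<open>C\<close> divided by the fibre size, so one crossing edge
  has to pay for at most \<open>C\<close>.\<close>

lemma isoperimetry_large:
 assumes S: "S \<subseteq> V" "S \<noteq> {}"
 shows "1 / C * card S * ln (card V / card S) \<le> card (cut E S)"
proof -
 have fS: "finite S" by (rule finite_subset[OF S(1) finV])
 have C0: "0 < real C" using baseG(6,7)[of 1] t1 by auto
 let ?a = "\<lambda>j x. real (card (fibre S j x))" and ?c = "\<lambda>j. real (card (verts (G j)))"
 have a0: "0 < ?a j x" if "x \<in> S" for j x
 proof -
  have "x \<in> fibre S j x" using that by (auto simp: fibre_def)
  then show ?thesis using finite_fibre[OF S(1)] by (auto simp: card_gt_0_iff)
 qed
 have one: "(\<Sum>x\<in>S. ln (?c j) - ln (?a j x)) \<le> C * card (crossing S j)" if j: "j \<in> J0" for j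
 proof -
  let ?S = "{x \<in> S. card (fibre S j x) < card (verts (G j))}"
  have "\<exists>f. \<forall>x\<in>?S. f x \<in> crossing S j \<and> fst (f x) \<in> fibre S j x"
  proof (rule bchoice, rule ballI)
   fix x assume "x \<in> ?S"
   then obtain p where "p \<in> crossing S j" "fst p \<in> fibre S j x" using fibre_boundary[OF j S(1)] by blast
   then show "\<exists>p. p \<in> crossing S j \<and> fst p \<in> fibre S j x" by blast
  qed
  then obtain f where f: "\<And>x. x \<in> ?S \<Longrightarrow> f x \<in> crossing S j \<and> fst (f x) \<in> fibre S j x" by blast
  have fc: "finite (crossing S j)"
   by (rule finite_subset[of _ "V \<times> V"]) (use S finV in \<open>auto simp: crossing_def\<close>)
  have "(\<Sum>x\<in>S. ln (?c j) - ln (?a j x)) = (\<Sum>x\<in>?S. ln (?c j) - ln (?a j x))"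
  proof (rule sum.mono_neutral_right[OF fS])
   show "\<forall>x\<in>S - ?S. ln (?c j) - ln (?a j x) = 0"
   proof
    fix x assume "x \<in> S - ?S"
    then have "card (fibre S j x) = card (verts (G j))" using card_fibre_le[OF j S(1), of x] by auto
    then show "ln (?c j) - ln (?a j x) = 0" by simp
   qed
  qed auto
  also have "... \<le> (\<Sum>x\<in>?S. C / ?a j x)"
  proof (rule sum_mono)
   fix x assume x: "x \<in> ?S"
   have c0: "0 < ?c j" using baseG(6)[OF j] by simp
   have "ln (?c j) - ln (?a j x) = ln (?c j / ?a j x)" using c0 a0[of x j] x by (simp add: ln_div)
   also have "... \<le> ?c j / ?a j x - 1" using c0 a0[of x j] x by (intro ln_le_minus_one) auto
   also have "... \<le> C / ?a j x" using baseG(7)[OF j] a0[of x j] x divide_right_mono[of "?c j" C "?a j x"] by simp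
   finally show "ln (?c j) - ln (?a j x) \<le> C / ?a j x" .
  qed
  also have "... = (\<Sum>p\<in>f ` ?S. \<Sum>x\<in>{x \<in> ?S. f x = p}. C / ?a j x)"
   using fS by (intro sum.group[symmetric]) auto
  also have "... \<le> (\<Sum>p\<in>f ` ?S. real C)"
  proof (rule sum_mono)
   fix p assume "p \<in> f ` ?S"
   then obtain x0 where x0: "x0 \<in> ?S" "p = f x0" by auto
   have sub: "fibre S j x = fibre S j (fst p)" if "x \<in> ?S" "f x = p" for x
    using f[OF that(1)] that(2) by (auto simp: fibre_def)
   let ?X = "{x \<in> ?S. f x = p}"
   have X: "?X \<subseteq> fibre S j (fst p)" using sub by (auto simp: fibre_def)
   have "fst p \<in> S" using f[OF x0(1)] x0(2) by (auto simp: fibre_def)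
   have "(\<Sum>x\<in>?X. C / ?a j x) = (\<Sum>x\<in>?X. C / ?a j (fst p))" using sub by (intro sum.cong) auto
   also have "... = card ?X * (C / ?a j (fst p))" by simp
   also have "... \<le> ?a j (fst p) * (C / ?a j (fst p))"
    using card_mono[OF finite_fibre[OF S(1)] X] by (intro mult_right_mono) auto
   also have "... = C" using a0[OF \<open>fst p \<in> S\<close>] by simp
   finally show "(\<Sum>x\<in>?X. C / ?a j x) \<le> C" .
  qed
  also have "... \<le> C * card (crossing S j)"
   using f fc card_mono[OF fc, of "f ` ?S"] C0 by (auto simp: mult.commute intro!: mult_left_mono)
  finally show ?thesis .
 qed
 have "card S * ln (card V / card S) = card S * ln (card V) - card S * ln (card S)"
  using S fS finV card_gt_0_iff[of S] card_gt_0_iff[of V] by (subst ln_div) (auto simp: algebra_simps)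
 also have "... \<le> (\<Sum>j\<in>J0. \<Sum>x\<in>S. ln (?c j) - ln (?a j x))"
  using entropy_fibres[OF S(1)] by (simp add: ln_card_V sum_subtractf sum_distrib_left)
 also have "... \<le> (\<Sum>j\<in>J0. C * real (card (crossing S j)))" using one by (intro sum_mono) simp
 also have "... = C * real (\<Sum>j\<in>J0. card (crossing S j))" by (simp add: sum_distrib_left)
 also have "... \<le> C * real (card (cut E S))"
  using sum_crossing[OF order_refl S(1)] unfolding E_along by (intro mult_left_mono of_nat_mono) auto
 finally show ?thesis using C0 by (simp add: field_simps)
qed

end

context shifts begin

text \<open>Double counting of the pairs of a good vertex and a shift taking it into
  \<open>W\<close>. The third condition of \<open>typical\<close>, with \<open>d\<close> at least 2,
  makes at least half of the vertices good, and a vertex of \<open>W\<close> is hit at most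
  \<open>C\<close> times by each shift.\<close>

lemma typical_size:
 assumes W: "W \<subseteq> V" and tp: "typical W \<theta> \<theta>' K" and \<theta>: "0 < \<theta>"
 shows "\<theta> * card V \<le> 2 * C * card W"
proof -
 let ?bad = "{y \<in> V. \<not> good W \<theta> y}" and ?n = "real (card V)"
 let ?P = "{(x, y). x \<in> V \<and> y \<in> V \<and> {x, y} \<in> E \<and> (\<not> good W \<theta> y \<or> \<not> straight W \<theta>' x y)}"
 have fP: "finite ?P" by (rule finite_subset[of _ "V \<times> V"]) (use finV in auto)
 have nb1: "card {x \<in> V. {x, y} \<in> E} = d" if y: "y \<in> V" for y
 proof -
  have "{x \<in> V. {x, y} \<in> E} = {x. {y, x} \<in> E}" using EV by (auto simp: insert_commute)
  then show ?thesis using card_nbrs[OF y] by simp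
 qed
 have "card ?bad * d = (\<Sum>y\<in>?bad. card {x \<in> V. {x, y} \<in> E})" using nb1 by simp
 also have "... = card (SIGMA y:?bad. {x \<in> V. {x, y} \<in> E})" using finV by (intro card_SigmaI[symmetric]) auto
 also have "... \<le> card ?P"
  by (rule card_inj_on_le[of prod.swap]) (use fP in \<open>auto simp: inj_on_def\<close>)
 finally have "real d * (card ?bad * d) \<le> real d * card ?P" by (intro mult_left_mono of_nat_mono) (auto simp flip: of_nat_mult)
 also have "... \<le> ?n" using tp by (simp add: typical_def)
 finally have b: "real d * (card ?bad * d) \<le> ?n" .
 have "2 * 2 \<le> real d * d" using d2 by (intro mult_mono) auto
 then have "2 * real (card ?bad) \<le> (real d * d) * card ?bad" by (intro mult_right_mono) auto
 then have b2: "2 * real (card ?bad) \<le> ?n" using b by (simp add: mult_ac)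
 let ?gd = "{y \<in> V. good W \<theta> y}"
 have "V = ?gd \<union> ?bad" by auto
 then have "card V \<le> card ?gd + card ?bad" by (metis card_Un_le)
 then have g: "?n / 2 \<le> card ?gd" using b2 by linarith
 have fW: "finite W" using W finV by (rule finite_subset)
 have h0: "0 < real (card I)" using finI neI by (simp add: card_gt_0_iff)
 have "?n / 2 * (\<theta> * card I) \<le> card ?gd * (\<theta> * card I)" using g \<theta> by (intro mult_right_mono) auto
 also have "... = (\<Sum>y\<in>?gd. \<theta> * card I)" by simp
 also have "... \<le> (\<Sum>y\<in>?gd. real (card (hits W y)))" by (intro sum_mono) (auto simp: good_def)
 also have "... = real (card (SIGMA y:?gd. hits W y))" using finV finI by (subst card_SigmaI) (auto simp: hits_def)
 also have "card (SIGMA y:?gd. hits W y) = card ((\<lambda>(y, i). ((i, sh i y), y)) ` (SIGMA y:?gd. hits W y))"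
  by (intro card_image[symmetric]) (auto simp: inj_on_def)
 also have "real ... \<le> (\<Sum>p\<in>I \<times> W. real C)"
 proof (rule card_pairs_le[of "I \<times> W" "\<lambda>(i, w). {x \<in> V. sh i x = w}"])
  show "real (card (case p of (i, w) \<Rightarrow> {x \<in> V. sh i x = w})) \<le> real C" if "p \<in> I \<times> W" for p
   using that W sh_fib[of "fst p" "snd p"] by auto
 qed (use finI fW finV in \<open>auto simp: hits_def\<close>)
 also have "... = card I * (C * card W)" by (simp add: card_cartesian_product)
 finally have "card I * (?n / 2 * \<theta>) \<le> card I * (C * card W)" by (simp add: mult_ac)
 then have "?n / 2 * \<theta> \<le> C * card W" using h0 by (simp add: mult_le_cancel_left_pos)
 then show ?thesis by (simp add: mult_ac)
qed

end

lemma (in product) size_bounds: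
 assumes d: "d = (\<Sum>j\<in>J0. r j)"
 shows "t \<le> d" "d \<le> C * t" "d * (ln 2 / C) \<le> ln (card V)" "ln (card V) \<le> d * ln C"
proof -
 have "(\<Sum>j\<in>J0. 1) \<le> (\<Sum>j\<in>J0. r j)" by (intro sum_mono) (use r_bounds in auto)
 then show td: "t \<le> d" by (simp add: d)
 have "(\<Sum>j\<in>J0. r j) \<le> (\<Sum>j\<in>J0. C)" by (intro sum_mono) (use r_bounds in auto)
 then show dC: "d \<le> C * t" by (simp add: d mult.commute)
 have C1: "1 \<le> C" using r_bounds[of 1] t1 by auto
 have "t * ln 2 = (\<Sum>j\<in>J0. ln 2)" by simp
 also have "... \<le> (\<Sum>j\<in>J0. ln (real (card (verts (G j)))))"
  using baseG(6) by (intro sum_mono) (fastforce simp: Suc_le_eq)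
 finally have 1: "t * ln 2 \<le> ln (card V)" by (simp add: ln_card_V)
 have "real d / C \<le> t" using dC C1 by (simp add: divide_le_eq mult.commute flip: of_nat_mult)
 then have "real d / C * ln 2 \<le> t * ln 2" by (intro mult_right_mono) auto
 then show "d * (ln 2 / C) \<le> ln (card V)" using 1 by simp
 have "ln (card V) \<le> (\<Sum>j\<in>J0. ln C)"
  unfolding ln_card_V using baseG(6,7) by (intro sum_mono) (fastforce simp: Suc_le_eq)
 also have "... = t * ln C" by simp
 also have "... \<le> d * ln C" using td C1 by (intro mult_right_mono) auto
 finally show "ln (card V) \<le> d * ln C" .
qed

section \<open>Independence of shifted points through disjoint cosets\<close>

locale big_product = product +
 fixes h :: nat and d :: nat
 assumes t2: "2 \<le> t" and h: "1 \<le> h" "h \<le> t" and d_def: "d = (\<Sum>j\<in>J0. r j)"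
begin

definition step :: "nat \<Rightarrow> 'a \<Rightarrow> 'a" where "step i s = (SOME s'. s' \<in> neighbours (G i) s)"
definition sh :: "nat \<Rightarrow> (nat \<Rightarrow> 'a) \<Rightarrow> nat \<Rightarrow> 'a" where "sh i x = x(i := step i (x i))"

lemma step: "i \<in> J0 \<Longrightarrow> s \<in> verts (G i) \<Longrightarrow> step i s \<in> neighbours (G i) s"
proof -
 assume i: "i \<in> J0" "s \<in> verts (G i)"
 have "card (neighbours (G i) s) \<noteq> 0" using baseG(5)[OF i] r_bounds[OF i(1)] by simp
 then have "neighbours (G i) s \<noteq> {}" by auto
 then show ?thesis unfolding step_def by (simp add: some_in_eq)
qed

lemma sh_mv: "i \<in> J0 \<Longrightarrow> x \<in> V \<Longrightarrow> sh i x \<in> mv i x"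
 unfolding sh_def mv_def using step coord by blast

lemma sh_same: "i \<in> J0 \<Longrightarrow> x \<in> V \<Longrightarrow> sh i x i \<noteq> x i"
 using mv_neq sh_mv by blast

lemma sh_other: "m \<noteq> i \<Longrightarrow> sh i x m = x m" by (simp add: sh_def)

lemma I_J0: "i \<in> {1..h} \<Longrightarrow> i \<in> J0" using h by auto

lemma EI: "{x, y} \<in> E \<longleftrightarrow> x \<in> V \<and> (\<exists>j\<in>J0. y \<in> mv j x)"
 unfolding E_along by (rule along_iff) simp

lemma V_ne: "V \<noteq> {}"
proof -
 have "verts (G j) \<noteq> {}" if "j \<in> J0" for j using baseG(6)[OF that] by auto
 then show ?thesis unfolding V_def by (simp add: PiE_eq_empty_iff)
qed

sublocale H: shifts V E d "{1..h}" sh C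
proof
 show "finite V" by (rule finV)
 show "V \<noteq> {}" by (rule V_ne)
 show "pairs E" by (rule pairs_E)
 show "e \<in> E \<Longrightarrow> e \<subseteq> V" for e by (rule E_V)
 show "card {e \<in> E. x \<in> e} = d" if "x \<in> V" for x
  unfolding E_along d_def by (rule degree_along[OF order_refl that])
 show "2 \<le> d" using t2 size_bounds(1)[OF d_def] by simp
 show "finite {1..h}" "{1..h} \<noteq> {}" using h by auto
 show "sh i x \<in> V" "{x, sh i x} \<in> E" if "i \<in> {1..h}" "x \<in> V" for i x
 proof -
  have i: "i \<in> J0" by (rule I_J0[OF that(1)])
  show "sh i x \<in> V" by (rule mv_V[OF i that(2) sh_mv[OF i that(2)]])
  show "{x, sh i x} \<in> E" unfolding EI using that(2) sh_mv[OF i that(2)] i by blast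
 qed
 show "i = j" if "i \<in> {1..h}" "j \<in> {1..h}" "x \<in> V" "sh i x = sh j x" for i j x
  using sh_same[OF I_J0[OF that(1)] that(3)] sh_other[of i j x] that(4) by metis
 show "card {x \<in> V. sh i x = w} \<le> C" if "i \<in> {1..h}" "w \<in> V" for i w
 proof -
  have i: "i \<in> J0" by (rule I_J0[OF that(1)])
  have "{x \<in> V. sh i x = w} \<subseteq> fibre V i w" by (auto simp: fibre_def sh_def split: if_splits)
  then have "card {x \<in> V. sh i x = w} \<le> card (fibre V i w)" by (intro card_mono finite_fibre) auto
  also have "... \<le> card (verts (G i))" by (rule card_fibre_le[OF i order_refl])
  also have "... \<le> C" by (rule baseG(7)[OF i])
  finally show ?thesis .
 qed
qed

definition coset :: "nat set \<Rightarrow> (nat \<Rightarrow> 'a) \<Rightarrow> (nat \<Rightarrow> 'a) set" where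
 "coset J w = {x \<in> V. \<forall>i\<in>J0 - J. x i = w i}"

text \<open>Edges that can be explored from \<open>w\<close> while all coordinates outside
  \<open>J\<close> stay fixed. For points that differ outside \<open>J\<close> these edge sets are
  disjoint, so clusters grown inside them are independent.\<close>

definition inner :: "nat set \<Rightarrow> (nat \<Rightarrow> 'a) \<Rightarrow> (nat \<Rightarrow> 'a) set set" where
 "inner J w = {e \<in> along J. e \<subseteq> coset J w}"

lemma inner_E: "J \<subseteq> J0 \<Longrightarrow> inner J w \<subseteq> E"
 unfolding inner_def E_along using along_mono by blast

lemma inner_disjoint:
 assumes "J \<subseteq> J0" "i \<in> J0 - J" "w i \<noteq> w' i" shows "inner J w \<inter> inner J w' = {}"
proof (rule equals0I)
 fix e assume e: "e \<in> inner J w \<inter> inner J w'"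
 then have "e \<in> E" using inner_E[OF assms(1)] by blast
 then obtain x where "x \<in> e" using pairs_E unfolding pairs_def by (metis card.empty equals0I zero_neq_numeral)
 then have "x \<in> coset J w" "x \<in> coset J w'" using e by (auto simp: inner_def)
 then show False using assms by (auto simp: coset_def)
qed

text \<open>Confining the exploration to a coset costs only the degrees of the directions outside
  \<open>J\<close>. The term \<open>2 * C * ln N\<close> is the internal degree that
  \<open>isoperimetry_small\<close> allows for sets with fewer than \<open>N\<close>
  vertices.\<close>

lemma chance_big:
 fixes p y :: real
 assumes J: "J \<subseteq> J0" "w \<in> V" and p: "0 \<le> p" "p \<le> 1" and y: "0 \<le> y" "y \<le> 1 / 2" and N: "1 \<le> N"
  and dJ: "1 + 2 * y \<le> p * ((\<Sum>j\<in>J. r j) - 2 * C * ln N)"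
 shows "y \<le> chance (inner J w) (\<lambda>_. p) (\<lambda>F. N \<le> card (cluster F w))"
proof -
 have fin: "finite (inner J w)" using finE by (rule finite_subset[OF inner_E[OF J(1)]])
 have sub: "coset J w \<subseteq> V" by (auto simp: coset_def)
 have "chance (inner J w) (\<lambda>_. p) (\<lambda>F. card (cluster F w) < N) \<le> 1 - y"
 proof (rule chance_cluster_small[where ?S0.0 = "coset J w"])
  show "pairs (inner J w)" by (rule pairs_subset[OF pairs_E inner_E[OF J(1)]])
  show "finite (coset J w)" by (rule finite_subset[OF sub finV])
  show "w \<in> coset J w" using J by (simp add: coset_def)
  fix S assume S: "S \<subseteq> coset J w" "S \<noteq> {}" "card S < N"
  have SV: "S \<subseteq> V" using S sub by auto
  have "cut (along J) S \<subseteq> cut (inner J w) S"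
  proof
   fix e assume e: "e \<in> cut (along J) S"
   have pa: "pairs (along J)" by (rule pairs_subset[OF pairs_E]) (use along_mono[OF J(1)] in \<open>simp add: E_along\<close>)
   obtain x z where xz: "e = {x, z}" "x \<in> S" "z \<notin> S" "{x, z} \<in> along J" using cutE[OF pa e] by metis
   obtain j where j: "j \<in> J" "z \<in> mv j x" "x \<in> V" using xz along_iff[OF J(1)] by auto
   have "z \<in> V" using mv_V[of j x z] j J(1) by blast
   moreover have "z i = w i" if i: "i \<in> J0 - J" for i
   proof -
    have "i \<noteq> j" using i j by blast
    then have "z i = x i" by (rule mv_off[OF j(2)])
    also have "x i = w i" using xz(2) S(1) i by (auto simp: coset_def)
    finally show ?thesis .
   qed
   ultimately have "z \<in> coset J w" by (simp add: coset_def)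
   then show "e \<in> cut (inner J w) S" using e xz S by (auto simp: cut_def inner_def)
  qed
  then have c: "card (cut (along J) S) \<le> card (cut (inner J w) S)"
   using fin by (intro card_mono) (auto simp: cut_def)
  have fS: "finite S" using SV finV by (rule finite_subset)
  have c0: "0 < card S" using fS S by (simp add: card_gt_0_iff)
  have "ln (card S) \<le> ln N" using c0 S by simp
  then have "2 * C * card S * ln (card S) \<le> 2 * C * card S * ln N" by (intro mult_left_mono) auto
  then have "((\<Sum>j\<in>J. r j) - 2 * C * ln N) * card S \<le> card (cut (along J) S)"
   using isoperimetry_small[OF J(1) SV] by (simp add: algebra_simps)
  then show "((\<Sum>j\<in>J. r j) - 2 * C * ln N) * card S \<le> card (cut (inner J w) S)" using c by linarith
 qed (use fin p y dJ in \<open>auto simp: inner_def\<close>)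
 moreover have "chance (inner J w) (\<lambda>_. p) (\<lambda>F. N \<le> card (cluster F w)) = 1 - chance (inner J w) (\<lambda>_. p) (\<lambda>F. card (cluster F w) < N)"
  unfolding chance_Not[OF fin, symmetric] by (simp add: not_less)
 ultimately show ?thesis by linarith
qed

text \<open>Each query asks that all of its at most two points lie in large clusters. Since all
  points are separated outside \<open>J\<close>, their clusters can be grown in disjoint cosets. A
  query then succeeds with probability at least \<open>y\<^sup>2\<close>, independently of the
  others.\<close>

lemma chance_few_giants:
 fixes p y :: real and R :: "'q \<Rightarrow> (nat \<Rightarrow> 'a) set"
 assumes J: "J \<subseteq> J0" and p: "0 \<le> p" "p \<le> 1" and y: "0 \<le> y" "y \<le> 1 / 2" and N: "1 \<le> N"
  and dJ: "1 + 2 * y \<le> p * ((\<Sum>j\<in>J. r j) - 2 * C * ln N)"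
  and Q: "finite Q" "\<And>q. q \<in> Q \<Longrightarrow> R q \<subseteq> V \<and> card (R q) \<le> 2"
  and sep: "\<And>q q' w w'. q \<in> Q \<Longrightarrow> q' \<in> Q \<Longrightarrow> w \<in> R q \<Longrightarrow> w' \<in> R q' \<Longrightarrow> q \<noteq> q' \<or> w \<noteq> w' \<Longrightarrow> \<exists>i\<in>J0 - J. w i \<noteq> w' i"
 shows "chance E (\<lambda>_. p) (\<lambda>F. real (card {q \<in> Q. R q \<subseteq> H.giants N F}) \<le> b) \<le> exp (b - card Q * y\<^sup>2 / 2)"
proof -
 define A where "A q = (\<Union>w\<in>R q. inner J w)" for q
 define Z where "Z q X = (\<forall>w\<in>R q. N \<le> card (cluster (X \<inter> inner J w) w))" for q X
 have pr: "probs D (\<lambda>_. p)" for D :: "(nat \<Rightarrow> 'a) set set" using p by (simp add: probs_def)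
 have AE: "A q \<subseteq> E" for q unfolding A_def using inner_E[OF J] by blast
 have fR: "finite (R q)" if "q \<in> Q" for q using Q(2)[OF that] finV finite_subset by blast
 have "chance E (\<lambda>_. p) (\<lambda>F. real (card {q \<in> Q. R q \<subseteq> H.giants N F}) \<le> b)
  \<le> chance E (\<lambda>_. p) (\<lambda>F. real (card {q \<in> Q. Z q (F \<inter> A q)}) \<le> b)"
 proof (intro chance_mono pr)
  fix F assume F: "F \<subseteq> E" "real (card {q \<in> Q. R q \<subseteq> H.giants N F}) \<le> b"
  have "{q \<in> Q. Z q (F \<inter> A q)} \<subseteq> {q \<in> Q. R q \<subseteq> H.giants N F}"
  proof
   fix q assume q: "q \<in> {q \<in> Q. Z q (F \<inter> A q)}"
   have "w \<in> H.giants N F" if w: "w \<in> R q" for w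
   proof -
    have "w \<in> V" using Q(2)[of q] q w by blast
    then have fc: "finite (cluster F w)" using H.cluster_V[OF F(1)] finV finite_subset by blast
    have "N \<le> card (cluster (F \<inter> A q \<inter> inner J w) w)" using q w by (auto simp: Z_def)
    also have "... \<le> card (cluster F w)" by (intro card_mono fc cluster_mono) auto
    finally show ?thesis using \<open>w \<in> V\<close> by (simp add: H.giants_def)
   qed
   then show "q \<in> {q \<in> Q. R q \<subseteq> H.giants N F}" using q by auto
  qed
  then have "card {q \<in> Q. Z q (F \<inter> A q)} \<le> card {q \<in> Q. R q \<subseteq> H.giants N F}" using Q(1) by (intro card_mono) auto
  then show "real (card {q \<in> Q. Z q (F \<inter> A q)}) \<le> b" using F by linarith
 qed
 also have "... \<le> exp (b - (\<Sum>q\<in>Q. y\<^sup>2) / 2)"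
 proof (intro chance_few pr Q(1) finE AE)
  show "disjoint_family_on A Q"
   unfolding disjoint_family_on_def A_def
  proof (intro ballI impI)
   fix q q' assume q: "q \<in> Q" "q' \<in> Q" "q \<noteq> q'"
   have "inner J w \<inter> inner J w' = {}" if "w \<in> R q" "w' \<in> R q'" for w w'
    using sep[OF q(1,2) that] q(3) inner_disjoint[OF J] by blast
   then show "(\<Union>w\<in>R q. inner J w) \<inter> (\<Union>w\<in>R q'. inner J w) = {}" by blast
  qed
  fix q assume q: "q \<in> Q"
  have dis: "disjoint_family_on (inner J) (R q)"
   unfolding disjoint_family_on_def
  proof (intro ballI impI)
   fix w w' assume "w \<in> R q" "w' \<in> R q" "w \<noteq> w'"
   then show "inner J w \<inter> inner J w' = {}" using sep[OF q q, of w w'] inner_disjoint[OF J] by blast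
  qed
  have fA: "finite (A q)" by (rule finite_subset[OF AE finE])
  have "y\<^sup>2 \<le> y ^ card (R q)" using y Q(2)[OF q] by (intro power_decreasing) auto
  also have "... = (\<Prod>w\<in>R q. y)" by simp
  also have "... \<le> (\<Prod>w\<in>R q. chance (inner J w) (\<lambda>_. p) (\<lambda>F. N \<le> card (cluster F w)))"
   using Q(2)[OF q] by (intro prod_mono conjI chance_big J p y N dJ) auto
  also have "... = mean (A q) (\<lambda>_. p) (\<lambda>F. \<Prod>w\<in>R q. of_bool (N \<le> card (cluster (F \<inter> inner J w) w)))"
   unfolding chance_def by (rule mean_prod[symmetric, OF fR[OF q] fA _ dis]) (auto simp: A_def)
  also have "... = chance (A q) (\<lambda>_. p) (Z q)"
   unfolding chance_def Z_def using fR[OF q] by (intro mean_cong) (auto simp: of_bool_def intro!: prod.neutral)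
  finally show "y\<^sup>2 \<le> chance (A q) (\<lambda>_. p) (Z q)" .
 qed
 finally show ?thesis by (simp add: mult.commute)
qed

text \<open>For indices \<open>i\<close> other than the direction \<open>j\<close> of the edge,
  \<open>sh i x\<close> and \<open>sh i z\<close> differ in coordinate \<open>j\<close>, and points
  with different indices differ in one of the shifted coordinates. Reserving these at most
  \<open>h + 1\<close> coordinates separates everything. At most the index \<open>j\<close> is lost,
  whence \<open>h - 1\<close>.\<close>

lemma chance_not_straight:
 fixes p y b :: real
 assumes p: "0 \<le> p" "p \<le> 1" and y: "0 \<le> y" "y \<le> 1 / 2" and N: "1 \<le> N"
  and big: "\<And>D. D \<subseteq> J0 \<Longrightarrow> card D \<le> h + 1 \<Longrightarrow> 1 + 2 * y \<le> p * ((\<Sum>j\<in>J0 - D. r j) - 2 * C * ln N)"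
  and xz: "{x, z} \<in> E"
 shows "chance E (\<lambda>_. p) (\<lambda>F. real (card (H.para (H.giants N F) x z)) \<le> b) \<le> exp (b - (real h - 1) * y\<^sup>2 / 2)"
proof -
 obtain j where j: "j \<in> J0" "z \<in> mv j x" and xV: "x \<in> V" using xz EI by auto
 have zV: "z \<in> V" by (rule mv_V[OF j(1) xV j(2)])
 let ?D = "insert j {1..h}" and ?Q = "{1..h} - {j}" and ?R = "\<lambda>i. {sh i x, sh i z}"
 have D: "?D \<subseteq> J0" using h j by auto
 have cD: "card ?D \<le> h + 1" by (simp add: card_insert_if)
 have pr: "probs D (\<lambda>_. p)" for D :: "(nat \<Rightarrow> 'a) set set" using p by (simp add: probs_def)
 have "chance E (\<lambda>_. p) (\<lambda>F. real (card (H.para (H.giants N F) x z)) \<le> b)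
  \<le> chance E (\<lambda>_. p) (\<lambda>F. real (card {i \<in> ?Q. ?R i \<subseteq> H.giants N F}) \<le> b)"
 proof (intro chance_mono pr)
  fix F assume F: "real (card (H.para (H.giants N F) x z)) \<le> b"
  have "{i \<in> ?Q. ?R i \<subseteq> H.giants N F} \<subseteq> H.para (H.giants N F) x z"
  proof
   fix i assume i: "i \<in> {i \<in> ?Q. ?R i \<subseteq> H.giants N F}"
   have "sh i z = (sh i x)(j := z j)"
    using i mv_off[OF j(2)] by (auto simp: sh_def fun_eq_iff)
   moreover have "sh i x j = x j" using i by (simp add: sh_other)
   moreover have "z j \<in> neighbours (G j) (x j)" using j(2) by (auto simp: mv_def)
   ultimately have "sh i z \<in> mv j (sh i x)" by (auto simp: mv_def)
   moreover have "sh i x \<in> V" using i by (intro H.sh_V xV) auto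
   ultimately have "{sh i x, sh i z} \<in> E" using EI j by blast
   then show "i \<in> H.para (H.giants N F) x z" using i unfolding H.para_def by auto
  qed
  moreover have "finite (H.para (H.giants N F) x z)" unfolding H.para_def by simp
  ultimately have "card {i \<in> ?Q. ?R i \<subseteq> H.giants N F} \<le> card (H.para (H.giants N F) x z)"
   by (rule card_mono[rotated])
  then show "real (card {i \<in> ?Q. ?R i \<subseteq> H.giants N F}) \<le> b" using F by linarith
 qed
 also have "... \<le> exp (b - card ?Q * y\<^sup>2 / 2)"
 proof (rule chance_few_giants[where J = "J0 - ?D", OF _ p y N big[OF D cD]])
  show "?R i \<subseteq> V \<and> card (?R i) \<le> 2" if "i \<in> ?Q" for i
   using that H.sh_V[of i] xV zV by (auto simp: card_insert_if)
  fix i i' w w' assume i: "i \<in> ?Q" "i' \<in> ?Q" "w \<in> ?R i" "w' \<in> ?R i'" "i \<noteq> i' \<or> w \<noteq> w'"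
  have iJ: "i \<in> J0" "i' \<in> J0" using i I_J0 by auto
  have ij: "i \<noteq> j" "i' \<noteq> j" using i by auto
  show "\<exists>k\<in>J0 - (J0 - ?D). w k \<noteq> w' k"
  proof (cases "i = i'")
   case True
   have "sh i x j \<noteq> sh i z j" using mv_neq[OF j] ij by (simp add: sh_other)
   then have "w j \<noteq> w' j" using i True by auto
   then show ?thesis using j by blast
  next
   case False
   have "w i = step i (x i)" using i mv_off[OF j(2) ij(1)] by (auto simp: sh_def)
   moreover have "w' i = x i" using i False mv_off[OF j(2) ij(1)] by (auto simp: sh_def)
   moreover have "step i (x i) \<noteq> x i" using sh_same[OF iJ(1) xV] by (simp add: sh_def)
   ultimately show ?thesis using i iJ by (intro bexI[of _ i]) auto
  qed
 qed auto
 also have "... \<le> exp (b - (real h - 1) * y\<^sup>2 / 2)"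
 proof -
  have "card {1..h} \<le> card (?Q \<union> {j})" by (intro card_mono) auto
  also have "... \<le> card ?Q + card {j}" by (rule card_Un_le)
  finally have "h \<le> card ?Q + 1" by (simp only: card_atLeastAtMost card.insert card.empty finite.emptyI) simp
  then have "real h - 1 \<le> card ?Q" by simp
  then have "(real h - 1) * y\<^sup>2 \<le> card ?Q * y\<^sup>2" by (intro mult_right_mono) auto
  then show ?thesis by simp
 qed
 finally show ?thesis .
qed

text \<open>One neighbour of \<open>x\<close> fails with probability exp (- const * h), which may be
  too large for a union bound over all vertices; the joint failure of \<open>k\<close> neighbours
  gains a factor \<open>k\<close> in the exponent. To separate the points \<open>sh i u\<close>, the
  directions of all these neighbours are reserved and dropped as indices, which costs at most
  \<open>k\<close> indices.\<close>

lemma chance_few_hits: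
 fixes p y b :: real
 assumes p: "0 \<le> p" "p \<le> 1" and y: "0 \<le> y" "y \<le> 1 / 2" and N: "1 \<le> N"
  and big: "\<And>D. D \<subseteq> J0 \<Longrightarrow> card D \<le> h + k \<Longrightarrow> 1 + 2 * y \<le> p * ((\<Sum>j\<in>J0 - D. r j) - 2 * C * ln N)"
  and x: "x \<in> V" and U: "finite U" "card U = k" "\<And>u. u \<in> U \<Longrightarrow> {x, u} \<in> E" and J: "J \<subseteq> {1..h}"
 shows "chance E (\<lambda>_. p) (\<lambda>F. \<forall>u\<in>U. real (card {i \<in> J. {x, u} \<notin> along {i} \<and> sh i u \<in> H.giants N F}) \<le> b)
  \<le> exp (k * b - k * (real (card J) - k) * y\<^sup>2 / 2)"
proof -
 have fJ: "finite J" using J finite_subset by blast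
 have "\<forall>u\<in>U. \<exists>j. j \<in> J0 \<and> u \<in> mv j x" using U(3) EI by blast
 then obtain dir where dir: "\<And>u. u \<in> U \<Longrightarrow> dir u \<in> J0 \<and> u \<in> mv (dir u) x" by metis
 have UV: "u \<in> V" if "u \<in> U" for u using mv_V[of "dir u" x u] dir[OF that] x by blast
 let ?D = "{1..h} \<union> dir ` U" and ?Q = "(J - dir ` U) \<times> U" and ?R = "\<lambda>(i, u). {sh i u}"
 let ?S = "\<lambda>F u. {i \<in> J. {x, u} \<notin> along {i} \<and> sh i u \<in> H.giants N F}"
 have D: "?D \<subseteq> J0" using h dir by auto
 have cdir: "card (dir ` U) \<le> k" using U by (metis card_image_le)
 have cD: "card ?D \<le> h + k" using card_Un_le[of "{1..h}" "dir ` U"] cdir by simp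
 have pr: "probs D (\<lambda>_. p)" for D :: "(nat \<Rightarrow> 'a) set set" using p by (simp add: probs_def)
 have "chance E (\<lambda>_. p) (\<lambda>F. \<forall>u\<in>U. real (card (?S F u)) \<le> b)
  \<le> chance E (\<lambda>_. p) (\<lambda>F. real (card {q \<in> ?Q. ?R q \<subseteq> H.giants N F}) \<le> k * b)"
 proof (intro chance_mono pr)
  fix F assume F: "\<forall>u\<in>U. real (card (?S F u)) \<le> b"
  have "{q \<in> ?Q. ?R q \<subseteq> H.giants N F} \<subseteq> prod.swap ` (SIGMA u:U. ?S F u)"
  proof
   fix q assume "q \<in> {q \<in> ?Q. ?R q \<subseteq> H.giants N F}"
   then obtain i u where q: "q = (i, u)" "i \<in> J" "i \<notin> dir ` U" "u \<in> U" "sh i u \<in> H.giants N F" by auto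
   have "{x, u} \<notin> along {i}"
   proof
    have iJ: "i \<in> J0" using q J I_J0 by auto
    assume "{x, u} \<in> along {i}"
    then have "u \<in> mv i x" using along_iff[of "{i}" x u] iJ by auto
    then have "i = dir u" using mv_unique[OF iJ, of "dir u" u x] dir[OF q(4)] by blast
    then show False using q by auto
   qed
   then show "q \<in> prod.swap ` (SIGMA u:U. ?S F u)" using q by (auto simp: image_iff)
  qed
  then have "card {q \<in> ?Q. ?R q \<subseteq> H.giants N F} \<le> card (prod.swap ` (SIGMA u:U. ?S F u))"
   using U fJ by (intro card_mono) auto
  also have "... \<le> card (SIGMA u:U. ?S F u)" using U fJ by (intro card_image_le) auto
  also have "... = (\<Sum>u\<in>U. card (?S F u))" using U fJ by (intro card_SigmaI) auto
  finally have "real (card {q \<in> ?Q. ?R q \<subseteq> H.giants N F}) \<le> (\<Sum>u\<in>U. real (card (?S F u)))"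
   by (simp flip: of_nat_sum)
  also have "... \<le> (\<Sum>u\<in>U. b)" using F by (intro sum_mono) auto
  finally show "real (card {q \<in> ?Q. ?R q \<subseteq> H.giants N F}) \<le> k * b" using U by simp
 qed
 also have "... \<le> exp (k * b - card ?Q * y\<^sup>2 / 2)"
 proof (rule chance_few_giants[where J = "J0 - ?D", OF _ p y N big[OF D cD]])
  show "?R q \<subseteq> V \<and> card (?R q) \<le> 2" if "q \<in> ?Q" for q
   using that H.sh_V UV J by (auto simp: subset_iff)
  show "finite ?Q" using U fJ by auto
  fix q q' w w' assume q: "q \<in> ?Q" "q' \<in> ?Q" "w \<in> ?R q" "w' \<in> ?R q'" "q \<noteq> q' \<or> w \<noteq> w'"
  then obtain i u i' u' where q': "q = (i, u)" "q' = (i', u')" "w = sh i u" "w' = sh i' u'"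
   "i \<in> J" "i \<notin> dir ` U" "i' \<in> J" "i' \<notin> dir ` U" "u \<in> U" "u' \<in> U" by auto
  then have ne: "i \<noteq> i' \<or> u \<noteq> u'" using q(5) by auto
  have iJ: "i \<in> J0" "i \<in> {1..h}" using q' J I_J0 by auto
  have off: "u i = x i" "u' i = x i" using mv_off[of u "dir u" x i] mv_off[of u' "dir u'" x i] dir q' by auto
  show "\<exists>k\<in>J0 - (J0 - ?D). w k \<noteq> w' k"
  proof (cases "i = i'")
   case False
   have "w i = step i (x i)" "w' i = x i" using q' off False by (auto simp: sh_def)
   moreover have "step i (x i) \<noteq> x i" using sh_same[OF iJ(1) x] by (simp add: sh_def)
   ultimately show ?thesis using iJ by (intro bexI[of _ i]) auto
  next
   case True
   have "\<exists>k\<in>dir ` U. u k \<noteq> u' k"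
   proof (cases "dir u = dir u'")
    case True
    have "u m = u' m" if "m \<noteq> dir u" for m
     using mv_off[of u "dir u" x m, OF conjunct2[OF dir[OF q'(9)]]]
      mv_off[of u' "dir u'" x m, OF conjunct2[OF dir[OF q'(10)]]] that True by simp
    then have "u (dir u) \<noteq> u' (dir u)" using ne \<open>i = i'\<close> by (metis ext)
    then show ?thesis using q' by auto
   next
    case False
    have "u (dir u) \<noteq> x (dir u)" using mv_neq dir[OF q'(9)] by blast
    moreover have "u' (dir u) = x (dir u)" using mv_off[of u' "dir u'" x "dir u"] dir[OF q'(10)] False by auto
    ultimately show ?thesis using q' by (intro bexI[of _ "dir u"]) auto
   qed
   then obtain k where k: "k \<in> dir ` U" "u k \<noteq> u' k" by blast
   have "k \<noteq> i" using k q' by blast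
   then have "w k \<noteq> w' k" using k q' True by (simp add: sh_other)
   then show ?thesis using k D by (intro bexI[of _ k]) auto
  qed
 qed auto
 also have "... \<le> exp (k * b - k * (real (card J) - k) * y\<^sup>2 / 2)"
 proof -
  have "card J \<le> card ((J - dir ` U) \<union> dir ` U)" using fJ U by (intro card_mono) auto
  also have "... \<le> card (J - dir ` U) + card (dir ` U)" by (rule card_Un_le)
  finally have "real (card J) - k \<le> card (J - dir ` U)" using cdir by linarith
  then have "(real (card J) - k) * k \<le> card (J - dir ` U) * real k" by (intro mult_right_mono) auto
  also have "... = card ?Q" using U by (simp add: card_cartesian_product)
  finally have "(real (card J) - k) * k * y\<^sup>2 \<le> card ?Q * y\<^sup>2" by (intro mult_right_mono) auto
  then show ?thesis by (simp add: mult_ac)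
 qed
 finally show ?thesis .
qed

end

lemma chance_markov:
 assumes "probs E q" "\<And>F. F \<subseteq> E \<Longrightarrow> 0 \<le> X F"
 shows "c * chance E q (\<lambda>F. c < X F) \<le> mean E q X"
 unfolding chance_def mean_cmult[symmetric] by (rule mean_mono[OF assms(1)]) (use assms(2) in \<open>auto simp: of_bool_def\<close>)

context big_product begin

text \<open>A failure of either of the first two conditions yields a vertex with
  \<open>K + 1\<close> bad neighbours. For straightness the index set \<open>J\<close> of the shifts
  of \<open>x\<close> into \<open>W\<close> is random; a union over all \<open>2 ^ h\<close> index
  sets avoids conditioning on it. Markov's inequality deals with the third condition. With
  \<open>\<theta> = y\<^sup>2 / 8\<close> the tail bound has 4 * \<theta> per trial and the
  threshold takes back \<theta>, which leaves the factors 3.\<close>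

lemma chance_atypical:
 fixes p y \<theta> :: real and K N :: nat
 assumes p: "0 \<le> p" "p \<le> 1" and y: "0 < y" "y \<le> 1 / 2" and N: "1 \<le> N" and \<theta>: "\<theta> = y\<^sup>2 / 8"
  and big: "\<And>D. D \<subseteq> J0 \<Longrightarrow> card D \<le> h + (K + 1) \<Longrightarrow> 1 + 2 * y \<le> p * ((\<Sum>j\<in>J0 - D. r j) - 2 * C * ln N)"
 shows "chance E (\<lambda>_. p) (\<lambda>F. \<not> H.typical (H.giants N F) \<theta> (\<theta>\<^sup>2) K) \<le>
  card V * 2 ^ h * d ^ (K + 1) * exp (4 * (K + 1)\<^sup>2 * \<theta> - 3 * (K + 1) * \<theta>\<^sup>2 * h)
  + 2 * d\<^sup>2 * exp (4 * \<theta> - 3 * \<theta> * h)"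
proof -
 define k where "k = K + 1"
 let ?W = "\<lambda>F. H.giants N F" and ?nbs = "\<lambda>x. {u \<in> V. {x, u} \<in> E}"
 let ?cnt = "\<lambda>F x u J. real (card {i \<in> J. {x, u} \<notin> along {i} \<and> sh i u \<in> ?W F})"
 define I where "I = (SIGMA x:V. {J. J \<subseteq> {1..h} \<and> \<theta> * h \<le> card J} \<times> {U. U \<subseteq> ?nbs x \<and> card U = k})"
 define B where "B = (\<lambda>(x, J, U) F. \<forall>u\<in>U. ?cnt F x u J \<le> \<theta> * card J)"
 define P where "P F = {(x, y). x \<in> V \<and> y \<in> V \<and> {x, y} \<in> E \<and> (\<not> H.good (?W F) \<theta> y \<or> \<not> H.straight (?W F) (\<theta>\<^sup>2) x y)}" for F
 have y2: "y\<^sup>2 \<le> 1 / 4" using power_mono[of y "1/2" 2] y by (simp add: power2_eq_square)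
 have th: "0 < \<theta>" "\<theta> \<le> 1" using y y2 by (auto simp: \<theta>)
 have y8: "y\<^sup>2 = 8 * \<theta>" by (simp add: \<theta>)
 have pr: "probs D (\<lambda>_. p)" for D :: "(nat \<Rightarrow> 'a) set set" using p by (simp add: probs_def)
 have \<theta>sq: "\<theta>\<^sup>2 * c \<le> \<theta> * c" if "0 \<le> c" for c :: real
  using th that by (intro mult_right_mono) (auto simp: power2_eq_square)
 have cntg: "?cnt F x u {1..h} \<le> card (H.hits (?W F) u)" for F x u
  unfolding H.hits_def by (intro of_nat_mono card_mono) auto
 have finI: "finite I" unfolding I_def using finV by auto
 have nbc: "card (?nbs x) \<le> d" "finite (?nbs x)" if "x \<in> V" for x
 proof -
  show f: "finite (?nbs x)" using finV by simp
  have "card (?nbs x) \<le> card {a. {x, a} \<in> E}" using H.finite_nbrs[of x] by (intro card_mono) auto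
  then show "card (?nbs x) \<le> d" using H.card_nbrs[OF that] by linarith
 qed
 have pick: "\<exists>U\<subseteq>S. card U = k" if "K < card S" "finite S" for S :: "(nat \<Rightarrow> 'a) set"
  using obtain_subset_with_card_n[of k S] that by (auto simp: k_def)
 have cases: "(\<exists>q\<in>I. B q F) \<or> card V < d * real (card (P F))"
  if nt: "\<not> H.typical (?W F) \<theta> (\<theta>\<^sup>2) K" for F
 proof -
  consider (1) x where "x \<in> V" "K < card {y \<in> V. {x, y} \<in> E \<and> \<not> H.good (?W F) \<theta> y}"
   | (2) x where "x \<in> V" "H.good (?W F) \<theta> x" "K < card {y \<in> V. {x, y} \<in> E \<and> \<not> H.straight (?W F) (\<theta>\<^sup>2) x y}"
   | (3) "card V < d * real (card (P F))"
   using nt unfolding H.typical_def P_def by (auto simp: not_le)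
  then show ?thesis
  proof cases
   case 1
   obtain U where U: "U \<subseteq> {y \<in> V. {x, y} \<in> E \<and> \<not> H.good (?W F) \<theta> y}" "card U = k"
    using pick[OF 1(2)] finV by auto
   have "(x, {1..h}, U) \<in> I" using 1 U th mult_right_mono[of \<theta> 1 "real h"] by (auto simp: I_def)
   moreover have "B (x, {1..h}, U) F"
    unfolding B_def prod.case
   proof
    fix u assume "u \<in> U"
    then have "\<not> H.good (?W F) \<theta> u" using U by auto
    then have "card (H.hits (?W F) u) \<le> \<theta> * card {1..h}" unfolding H.good_def by linarith
    then show "?cnt F x u {1..h} \<le> \<theta> * card {1..h}" using cntg[of x u F] by linarith
   qed
   ultimately show ?thesis by blast
  next
   case 2
   obtain U where U: "U \<subseteq> {y \<in> V. {x, y} \<in> E \<and> \<not> H.straight (?W F) (\<theta>\<^sup>2) x y}" "card U = k"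
    using pick[OF 2(3)] finV by auto
   let ?J = "H.hits (?W F) x"
   have J: "?J \<subseteq> {1..h}" unfolding H.hits_def by auto
   have cJ: "\<theta> * h \<le> card ?J" using 2 unfolding H.good_def by simp
   have "(x, ?J, U) \<in> I" using 2 U J cJ by (auto simp: I_def)
   moreover have "B (x, ?J, U) F"
    unfolding B_def prod.case
   proof
    fix u assume u: "u \<in> U"
    then have "\<not> H.straight (?W F) (\<theta>\<^sup>2) x u" using U by auto
    then have s: "card (H.para (?W F) x u) \<le> \<theta>\<^sup>2 * h" unfolding H.straight_def by simp
    obtain j where j: "j \<in> J0" "u \<in> mv j x" using U u EI by blast
    \<comment> \<open>A shift in a coordinate other than the direction \<open>j\<close> moves both
      ends in parallel, so the images are adjacent again.\<close>
    have "{i \<in> ?J. {x, u} \<notin> along {i} \<and> sh i u \<in> ?W F} \<subseteq> H.para (?W F) x u"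
    proof
     fix i assume i: "i \<in> {i \<in> ?J. {x, u} \<notin> along {i} \<and> sh i u \<in> ?W F}"
     then have ih: "i \<in> {1..h}" "sh i x \<in> ?W F" unfolding H.hits_def by auto
     have ij: "i \<noteq> j"
     proof
      assume "i = j"
      then have "{x, u} \<in> along {i}" using along_iff[of "{i}" x u] j 2(1) by auto
      then show False using i by blast
     qed
     have "sh i u = (sh i x)(j := u j)" using ij mv_off[OF j(2)] by (auto simp: sh_def fun_eq_iff)
     moreover have "sh i x j = x j" using ij by (simp add: sh_other)
     moreover have "u j \<in> neighbours (G j) (x j)" using j(2) by (auto simp: mv_def)
     ultimately have "sh i u \<in> mv j (sh i x)" by (auto simp: mv_def)
     then have "{sh i x, sh i u} \<in> E" using EI j H.sh_V[OF ih(1) 2(1)] by blast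
     then show "i \<in> H.para (?W F) x u" using i ih unfolding H.para_def by blast
    qed
    moreover have "finite (H.para (?W F) x u)" unfolding H.para_def by simp
    ultimately have "?cnt F x u ?J \<le> card (H.para (?W F) x u)" by (intro of_nat_mono card_mono)
    also have "... \<le> \<theta> * (\<theta> * h)" using s by (simp add: power2_eq_square mult.assoc)
    also have "... \<le> \<theta> * card ?J" using cJ th by (intro mult_left_mono) auto
    finally show "?cnt F x u ?J \<le> \<theta> * card ?J" .
   qed
   ultimately show ?thesis by blast
  qed blast
 qed
 have few: "chance E (\<lambda>_. p) (\<lambda>F. \<forall>u\<in>U. ?cnt F x u J \<le> b) \<le> exp (real l * b - l * (real (card J) - l) * y\<^sup>2 / 2)"
  if "x \<in> V" "finite U" "card U = l" "\<And>u. u \<in> U \<Longrightarrow> {x, u} \<in> E" "J \<subseteq> {1..h}" "l \<le> K + 1" for x U J l b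
  by (rule chance_few_hits[OF p _ y(2) N big that(1-5)]) (use that y in auto)
 have one: "chance E (\<lambda>_. p) (B q) \<le> exp (4 * k\<^sup>2 * \<theta> - 3 * k * \<theta>\<^sup>2 * h)" if q: "q \<in> I" for q
 proof -
  obtain x J U where qq: "q = (x, J, U)" by (cases q)
  have U: "x \<in> V" "J \<subseteq> {1..h}" "\<theta> * h \<le> card J" "U \<subseteq> ?nbs x" "card U = k" using q by (auto simp: I_def qq)
  have fU: "finite U" by (rule finite_subset[OF U(4) nbc(2)[OF U(1)]])
  have "chance E (\<lambda>_. p) (B q) \<le> exp (real k * (\<theta> * card J) - k * (real (card J) - k) * y\<^sup>2 / 2)"
   unfolding B_def qq prod.case by (rule few[OF U(1) fU U(5) _ U(2)]) (use U in \<open>auto simp: k_def\<close>)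
  also have "... \<le> exp (4 * k\<^sup>2 * \<theta> - 3 * k * \<theta>\<^sup>2 * h)"
  proof -
   have "3 * (k * \<theta>) * (\<theta> * h) \<le> 3 * (k * \<theta>) * card J" using U th by (intro mult_left_mono) auto
   then show ?thesis unfolding y8 by (simp add: power2_eq_square algebra_simps diff_divide_distrib)
  qed
  finally show ?thesis .
 qed
 have cI: "real (card I) \<le> card V * 2 ^ h * d ^ k"
 proof -
  have "card I = (\<Sum>x\<in>V. card ({J. J \<subseteq> {1..h} \<and> \<theta> * h \<le> card J} \<times> {U. U \<subseteq> ?nbs x \<and> card U = k}))"
   unfolding I_def using finV by (intro card_SigmaI) auto
  also have "... \<le> (\<Sum>x\<in>V. 2 ^ h * d ^ k)"
  proof (rule sum_mono)
   fix x assume x: "x \<in> V"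
   have a: "card {J. J \<subseteq> {1..h} \<and> \<theta> * h \<le> card J} \<le> 2 ^ h"
    using card_mono[of "Pow {1..h}" "{J. J \<subseteq> {1..h} \<and> \<theta> * h \<le> card J}"] by (auto simp: card_Pow)
   have "card {U. U \<subseteq> ?nbs x \<and> card U = k} = card (?nbs x) choose k" by (rule n_subsets[OF nbc(2)[OF x]])
   also have "... \<le> d choose k" by (rule binomial_right_mono[OF nbc(1)[OF x]])
   also have "... \<le> d ^ k"
   proof (cases "k \<le> d")
    case True then show ?thesis by (rule binomial_le_pow)
   qed (simp add: binomial_eq_0)
   finally have b: "card {U. U \<subseteq> ?nbs x \<and> card U = k} \<le> d ^ k" .
   show "card ({J. J \<subseteq> {1..h} \<and> \<theta> * h \<le> card J} \<times> {U. U \<subseteq> ?nbs x \<and> card U = k}) \<le> 2 ^ h * d ^ k"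
    unfolding card_cartesian_product by (rule mult_mono[OF a b]) auto
  qed
  also have "... = card V * 2 ^ h * d ^ k" by simp
  finally show ?thesis by (metis of_nat_le_iff of_nat_mult of_nat_power of_nat_numeral)
 qed
 have "chance E (\<lambda>_. p) (\<lambda>F. \<exists>q\<in>I. B q F) \<le> (\<Sum>q\<in>I. chance E (\<lambda>_. p) (B q))"
  by (rule chance_UN[OF finI pr]) blast
 also have "... \<le> (\<Sum>q\<in>I. exp (4 * k\<^sup>2 * \<theta> - 3 * k * \<theta>\<^sup>2 * h))" by (intro sum_mono one)
 also have "... \<le> card V * 2 ^ h * d ^ k * exp (4 * k\<^sup>2 * \<theta> - 3 * k * \<theta>\<^sup>2 * h)"
  using cI by (simp add: mult_right_mono)
 finally have 1: "chance E (\<lambda>_. p) (\<lambda>F. \<exists>q\<in>I. B q F) \<le> card V * 2 ^ h * d ^ k * exp (4 * k\<^sup>2 * \<theta> - 3 * k * \<theta>\<^sup>2 * h)" .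
 let ?EP = "{(x, y). x \<in> V \<and> y \<in> V \<and> {x, y} \<in> E}" and ?e = "exp (4 * \<theta> - 3 * \<theta> * h)"
 have fEP: "finite ?EP" by (rule finite_subset[of _ "V \<times> V"]) (use finV in auto)
 have cEP: "card ?EP \<le> card V * d"
 proof -
  have "?EP = (SIGMA x:V. ?nbs x)" by auto
  then have "card ?EP = (\<Sum>x\<in>V. card (?nbs x))" using finV by (simp add: card_SigmaI)
  also have "... \<le> (\<Sum>x\<in>V. d)" by (intro sum_mono nbc)
  finally show ?thesis by simp
 qed
 have ev: "chance E (\<lambda>_. p) (\<lambda>F. \<not> H.good (?W F) \<theta> z \<or> \<not> H.straight (?W F) (\<theta>\<^sup>2) x z) \<le> 2 * ?e"
  if xz: "x \<in> V" "z \<in> V" "{x, z} \<in> E" for x z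
 proof -
  have "chance E (\<lambda>_. p) (\<lambda>F. \<not> H.good (?W F) \<theta> z) \<le> chance E (\<lambda>_. p) (\<lambda>F. \<forall>u\<in>{z}. ?cnt F x u {1..h} \<le> \<theta> * h)"
  proof (rule chance_mono[OF pr])
   fix F assume "\<not> H.good (?W F) \<theta> z"
   then have "card (H.hits (?W F) z) \<le> \<theta> * h" unfolding H.good_def by simp
   then show "\<forall>u\<in>{z}. ?cnt F x u {1..h} \<le> \<theta> * h" using cntg[of x z F] by force
  qed
  also have "... \<le> exp (real 1 * (\<theta> * h) - real 1 * (real (card {1..h}) - real 1) * y\<^sup>2 / 2)"
   by (rule few[OF xz(1)]) (use xz in auto)
  also have "... = ?e" unfolding y8 by (simp add: algebra_simps diff_divide_distrib)
  finally have a: "chance E (\<lambda>_. p) (\<lambda>F. \<not> H.good (?W F) \<theta> z) \<le> ?e" .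
  have "chance E (\<lambda>_. p) (\<lambda>F. \<not> H.straight (?W F) (\<theta>\<^sup>2) x z)
    \<le> chance E (\<lambda>_. p) (\<lambda>F. real (card (H.para (?W F) x z)) \<le> \<theta>\<^sup>2 * h)"
   by (rule chance_mono[OF pr], unfold H.straight_def) simp
  also have "... \<le> exp (\<theta>\<^sup>2 * h - (real h - 1) * y\<^sup>2 / 2)"
   by (rule chance_not_straight[OF p _ y(2) N big xz(3)]) (use y in auto)
  also have "... \<le> ?e" using \<theta>sq[of "real h"] unfolding y8 by (simp add: algebra_simps diff_divide_distrib)
  finally show ?thesis using a chance_disj[OF pr, of E "\<lambda>F. \<not> H.good (?W F) \<theta> z" "\<lambda>F. \<not> H.straight (?W F) (\<theta>\<^sup>2) x z"] by linarith
 qed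
 have mP: "mean E (\<lambda>_. p) (\<lambda>F. d * real (card (P F))) \<le> d * (card V * d * (2 * ?e))"
 proof -
  have "real (card (P F)) = (\<Sum>q\<in>?EP. of_bool (\<not> H.good (?W F) \<theta> (snd q) \<or> \<not> H.straight (?W F) (\<theta>\<^sup>2) (fst q) (snd q)))" for F
  proof -
   have "P F = ?EP \<inter> {q. \<not> H.good (?W F) \<theta> (snd q) \<or> \<not> H.straight (?W F) (\<theta>\<^sup>2) (fst q) (snd q)}"
    unfolding P_def by auto
   then show ?thesis by (rule trans[OF arg_cong[where f = "\<lambda>A. real (card A)"] sum_of_bool_eq[OF fEP fEP, symmetric]])
  qed
  then have "mean E (\<lambda>_. p) (\<lambda>F. d * real (card (P F))) = d * (\<Sum>q\<in>?EP. chance E (\<lambda>_. p) (\<lambda>F. \<not> H.good (?W F) \<theta> (snd q) \<or> \<not> H.straight (?W F) (\<theta>\<^sup>2) (fst q) (snd q)))"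
   unfolding chance_def mean_cmult mean_sum[symmetric] by (simp only:)
  also have "... \<le> d * (\<Sum>q\<in>?EP. 2 * ?e)" 
  proof (intro mult_left_mono sum_mono)
   fix q assume "q \<in> ?EP"
   then show "chance E (\<lambda>_. p) (\<lambda>F. \<not> H.good (?W F) \<theta> (snd q) \<or> \<not> H.straight (?W F) (\<theta>\<^sup>2) (fst q) (snd q)) \<le> 2 * ?e"
    by (intro ev) auto
  qed simp
  also have "... = d * (card ?EP * (2 * ?e))" by simp
  also have "... \<le> d * (card V * d * (2 * ?e))"
   using cEP by (intro mult_left_mono mult_right_mono) (auto simp flip: of_nat_mult)
  finally show ?thesis .
 qed
 have n0: "0 < real (card V)" using finV V_ne by (simp add: card_gt_0_iff)
 have "card V * chance E (\<lambda>_. p) (\<lambda>F. card V < d * real (card (P F))) \<le> mean E (\<lambda>_. p) (\<lambda>F. d * real (card (P F)))"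
  by (rule chance_markov[OF pr]) auto
 also note mP
 also have "d * (card V * d * (2 * ?e)) = card V * (2 * d\<^sup>2 * ?e)" by (simp add: power2_eq_square)
 finally have 2: "chance E (\<lambda>_. p) (\<lambda>F. card V < d * real (card (P F))) \<le> 2 * d\<^sup>2 * ?e" using n0 by simp
 have "chance E (\<lambda>_. p) (\<lambda>F. \<not> H.typical (?W F) \<theta> (\<theta>\<^sup>2) K)
  \<le> chance E (\<lambda>_. p) (\<lambda>F. (\<exists>q\<in>I. B q F) \<or> card V < d * real (card (P F)))"
  by (rule chance_mono[OF pr cases])
 also have "... \<le> chance E (\<lambda>_. p) (\<lambda>F. \<exists>q\<in>I. B q F) + chance E (\<lambda>_. p) (\<lambda>F. card V < d * real (card (P F)))"
  by (rule chance_disj[OF pr])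
 finally show ?thesis using 1 2 unfolding k_def by (simp add: algebra_simps)
qed

end

section \<open>Expansion of the random subgraph\<close>

text \<open>The interface between the random graph and the deterministic arguments. The boundary is
  measured by \<open>card (S \<inter> W)\<close> because the union bound runs over traces on
  \<open>W\<close>; the density condition translates this into \<open>card S\<close>. Expansion is
  claimed only while a fixed fraction of \<open>W\<close> lies outside \<open>S\<close>.\<close>

definition expands :: "'v set \<Rightarrow> 'v set set \<Rightarrow> 'v set \<Rightarrow> nat \<Rightarrow> real \<Rightarrow> real \<Rightarrow> real \<Rightarrow> bool" where
 "expands V F W m c \<alpha> \<psi> \<longleftrightarrow> W \<subseteq> V \<and> 4 * \<alpha> * real (card V) \<le> real (card W) \<and> (\<forall>w\<in>W. m \<le> card (cluster F w)) \<and>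
  (\<forall>S\<subseteq>V. conn F S \<longrightarrow> m \<le> card S \<longrightarrow>
   c * real (card S) \<le> real (card (S \<inter> W)) \<and> card (inc F S) \<le> 10 * card S \<and>
   (\<alpha> * real (card V) \<le> real (card (W - S)) \<longrightarrow>
    \<psi> * (card (S \<inter> W) * ln (exp 1 * card V / card (S \<inter> W))) < card (cut F S)))"

context big_product begin

text \<open>If no \<open>W\<close> works, then for the choice \<open>giants (d\<^sup>2) F1\<close>
  the set is not typical, or some connected set has too few vertices in it, too many incident edges,
  or too small a boundary. The four summands of the bound correspond to these failures.\<close>

lemma chance_expands:
 fixes \<epsilon> \<delta> \<theta> c \<alpha> x \<kappa> \<rho> \<psi> err c4 :: real and m K :: nat
 defines "\<theta> \<equiv> (\<epsilon> / 8)\<^sup>2 / 8" and "\<alpha> \<equiv> \<theta> / (8 * C)"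
 defines "c4 \<equiv> \<alpha> / (6 * C) / (1 + 4 * (real C)\<^sup>2 / \<theta>\<^sup>2 + 4 / (\<theta> * \<rho>) + 32 / (\<theta>\<^sup>2 * \<rho>)\<^sup>2)"
 assumes C: "1 \<le> C"
  and \<epsilon>: "0 < \<epsilon>" "\<epsilon> \<le> 1" and \<delta>: "0 < \<delta>" "\<delta> \<le> \<epsilon> / 4" and \<rho>: "0 < \<rho>" "\<rho> * d \<le> h"
  and big: "1 + \<epsilon> / 4 \<le> (1 + \<epsilon> - \<delta>) / d * (real d - C * (h + (K + 1)) - 2 * C * ln (d\<^sup>2))"
  and x: "0 < x" "x \<le> 1" and c: "0 < c" "c \<le> 1" and m: "1 \<le> m" "m \<le> d\<^sup>2" "2 \<le> c * m"
  and R1: "0 \<le> d - 2 * C * ln (3 * m * d\<^sup>2) - d * c" "0 \<le> \<kappa>"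
   "ln (1 + \<epsilon>) + 1 + 2 / d + c * ln (1 / x) + x - (1 + \<epsilon> - \<delta>) / d * (d - 2 * C * ln (3 * m * d\<^sup>2) - d * c) \<le> - \<kappa>"
  and dl: "2 \<le> real d * (1 / real C * \<alpha> * exp (- 4 * real K / (1 / real C)))"
  and \<psi>: "0 \<le> \<psi>" and err: "0 \<le> err"
  and num: "\<And>k. c / 2 * m \<le> real k \<Longrightarrow> k \<le> card V \<Longrightarrow>
   \<exists>q1 q2 r. 0 < q1 \<and> q1 < 1 \<and> 0 < q2 \<and> q2 < 1 \<and> k \<le> d\<^sup>2 * r \<and>
   exp (nat \<lfloor>\<psi> * (k * ln (exp 1 * card V / k))\<rfloor> - \<delta>\<^sup>2 / (8 * d) * (c4 * (k * ln (exp 1 * card V / k)))) \<le>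
   err * ((1 - q1) ^ nat \<lfloor>20 / c * k\<rfloor> * q2 ^ (r + nat \<lfloor>\<psi> * (k * ln (exp 1 * card V / k))\<rfloor>) *
    (q1 ^ nat \<lfloor>\<psi> * (k * ln (exp 1 * card V / k))\<rfloor> * (1 - q2) ^ ((d + d * (m * d)) * k)))"
 shows "chance E (\<lambda>_. (1 + \<epsilon>) / d) (\<lambda>F. \<not> (\<exists>W. expands V F W m (c / 2) \<alpha> \<psi>)) \<le>
  (card V * 2 ^ h * d ^ (K + 1) * exp (4 * (K + 1)\<^sup>2 * \<theta> - 3 * (K + 1) * \<theta>\<^sup>2 * h) + 2 * d\<^sup>2 * exp (4 * \<theta> - 3 * \<theta> * h))
  + card V * (3 * m * d\<^sup>2) * exp (- \<kappa> * m) + (card V)\<^sup>2 * exp (- 2 * real m) + (card V)\<^sup>2 * err"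
proof -
 \<comment> \<open>\<open>p1\<close> is chosen so that the union of the two layers has density
   exactly \<open>p\<close>; it is at least \<open>p - p2\<close>.\<close>
 define p p2 p1 :: real where "p = (1 + \<epsilon>) / d" and "p2 = \<delta> / d" and "p1 = (p - p2) / (1 - p2)"
 let ?n = "real (card V)" and ?N = "d\<^sup>2" and ?W = "\<lambda>F1. H.giants (d\<^sup>2) F1"
 define b where "b k = nat \<lfloor>\<psi> * (k * ln (exp 1 * ?n / k))\<rfloor>" for k :: nat
 define s where "s k = nat \<lfloor>20 / c * real k\<rfloor>" for k :: nat
 define T where "T F1 \<longleftrightarrow> H.typical (?W F1) \<theta> (\<theta>\<^sup>2) K" for F1
 define B1 where "B1 F1 F2 \<longleftrightarrow> (\<exists>Q\<subseteq>V. conn (F1 \<union> F2) Q \<and> m \<le> card Q \<and> card Q \<le> 3 * m \<and> card (Q \<inter> ?W F1) < c * card Q)" for F1 F2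
 define B2 where "B2 F \<longleftrightarrow> (\<exists>S\<subseteq>V. conn F S \<and> m \<le> card S \<and> 10 * card S \<le> card (inc F S))" for F
 define k0 where "k0 = nat \<lceil>c / 2 * m\<rceil>"
 define B3 where "B3 F1 F2 \<longleftrightarrow> (\<forall>z\<in>V - ?W F1. card (H.pocket (?W F1) (F1 \<union> F2) z) \<le> m) \<and>
  (\<exists>S\<subseteq>V. conn (F1 \<union> F2) S \<and> k0 \<le> card (S \<inter> ?W F1) \<and> \<alpha> * card V \<le> card (?W F1 - S) \<and>
    card (inc (F1 \<union> F2) S) \<le> s (card (S \<inter> ?W F1)) \<and> card (cut (F1 \<union> F2) S) \<le> b (card (S \<inter> ?W F1)))" for F1 F2
 have d2: "2 \<le> d" by (rule H.d2)
 have d0: "0 < real d" using d2 by simp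
 have p2: "0 \<le> p2" "p2 < 1" using \<delta> \<epsilon> d2 by (auto simp: p2_def field_simps)
 have pp: "p \<le> 1" "p2 \<le> p" using \<delta> \<epsilon> d2 by (auto simp: p_def p2_def field_simps)
 have p1: "0 \<le> p1" "p1 \<le> p" "p - p2 \<le> p1"
 proof -
  show "0 \<le> p1" using pp p2 by (simp add: p1_def)
  have "p2 * p \<le> p2" using p2 pp mult_left_mono[of p 1 p2] by simp
  then show "p1 \<le> p" using p2 by (simp add: p1_def divide_le_eq algebra_simps)
  have "0 \<le> (p - p2) * p2" using p2 pp by simp
  then show "p - p2 \<le> p1" using p2 by (simp add: p1_def le_divide_eq algebra_simps)
 qed
 have p1d: "(1 + \<epsilon> - \<delta>) / d \<le> p1" using p1(3) by (simp add: p_def p2_def diff_divide_distrib)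
 have merge: "1 - (1 - p1) * (1 - p2) = p" using p2 by (simp add: p1_def field_simps)
 have pr: "probs E (\<lambda>_. p1)" "probs E (\<lambda>_. p2)" "probs E (\<lambda>_. p)"
  using p1 p2 pp by (auto simp: probs_def)
 have p12: "p1 \<le> 1" "p2 \<le> 1" using p1 p2 pp by auto
 have n0: "0 < ?n" using finV V_ne by (simp add: card_gt_0_iff)
 have \<theta>0: "0 < \<theta>" using \<epsilon> by (simp add: \<theta>_def)
 have N1: "1 \<le> d\<^sup>2" using d2 by (simp add: power2_eq_square)
 have fm: "finite S" if "S \<subseteq> V" for S using that finV by (rule finite_subset)
 have \<theta>1: "\<theta> \<le> 1" using \<epsilon> power_mono[of "\<epsilon> / 8" 1 2] by (simp add: \<theta>_def)
 have \<alpha>: "0 < \<alpha>" "\<alpha> \<le> 1" using \<theta>0 \<theta>1 C by (auto simp: \<alpha>_def divide_le_eq)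

 have atyp: "mean E (\<lambda>_. p1) (\<lambda>F1. of_bool (\<not> T F1)) \<le> card V * 2 ^ h * d ^ (K + 1) * exp (4 * (K + 1)\<^sup>2 * \<theta> - 3 * (K + 1) * \<theta>\<^sup>2 * h) + 2 * d\<^sup>2 * exp (4 * \<theta> - 3 * \<theta> * h)"
  unfolding T_def chance_def[symmetric]
 proof (rule chance_atypical[OF _ _ _ _ N1 \<theta>_def[THEN meta_eq_to_obj_eq]])
  fix D assume D: "D \<subseteq> J0" "card D \<le> h + (K + 1)"
  have fD: "finite D" using D(1) finite_subset by blast
  have "(\<Sum>j\<in>D. r j) \<le> (\<Sum>j\<in>D. C)" using D r_bounds by (intro sum_mono) blast
  also have "... \<le> C * (h + (K + 1))" using mult_le_mono2[OF D(2), of C] by (simp add: mult.commute)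
  finally have rD: "(\<Sum>j\<in>D. r j) \<le> C * (h + (K + 1))" .
  have "d = (\<Sum>j\<in>J0 - D. r j) + (\<Sum>j\<in>D. r j)" unfolding d_def by (rule sum.subset_diff[OF D(1)]) simp
  then have "d \<le> (\<Sum>j\<in>J0 - D. r j) + C * (h + (K + 1))" using rD by linarith
  then have "real d \<le> real ((\<Sum>j\<in>J0 - D. r j) + C * (h + (K + 1)))" by (rule of_nat_mono)
  then have "real d - C * (h + (K + 1)) \<le> (\<Sum>j\<in>J0 - D. r j)" by simp
  then have a: "real d - C * (h + (K + 1)) - 2 * C * ln (d\<^sup>2) \<le> (\<Sum>j\<in>J0 - D. r j) - 2 * C * ln (d\<^sup>2)" by simp
  have f0: "0 < (1 + \<epsilon> - \<delta>) / d" using \<epsilon> \<delta> d0 by simp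
  have pos: "0 \<le> real d - C * (h + (K + 1)) - 2 * C * ln (d\<^sup>2)"
   by (rule less_imp_le[OF zero_less_mult_pos[OF less_le_trans[OF _ big] f0]]) (use \<epsilon> in simp)
  have "(1 + \<epsilon> - \<delta>) / d * (real d - C * (h + (K + 1)) - 2 * C * ln (d\<^sup>2)) \<le> p1 * ((\<Sum>j\<in>J0 - D. r j) - 2 * C * ln (d\<^sup>2))"
   using \<epsilon> \<delta> by (intro mult_mono[OF p1d a p1(1) pos])
  then show "1 + 2 * (\<epsilon> / 8) \<le> p1 * ((\<Sum>j\<in>J0 - D. r j) - 2 * C * ln (d\<^sup>2))" using big by simp
 qed (use p1 pp \<epsilon> in auto)

 have sparse: "mean E (\<lambda>_. p1) (\<lambda>F1. chance E (\<lambda>_. p2) (B1 F1)) \<le> card V * (3 * m * d\<^sup>2) * exp (- \<kappa> * m)"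
  unfolding B1_def
 proof (rule H.chance_sparse_giants[where a = "1 + \<epsilon>" and x = x and B = "real (2 * C)"])
  show "real (d * card S) - real (2 * C) * real (card S) * ln (real (card S)) \<le> real (card (cut E S))" if "S \<subseteq> V" "S \<noteq> {}" for S
   using isoperimetry_small[OF order_refl that(1)] unfolding d_def E_along by simp
  fix M :: nat assume M: "m \<le> M" "M \<le> 3 * m * d\<^sup>2"
  have "ln M \<le> ln (3 * m * d\<^sup>2)" using M m d2 by (subst ln_le_cancel_iff) (auto simp flip: of_nat_power of_nat_mult)
  then have "2 * C * ln M \<le> 2 * C * ln (3 * m * d\<^sup>2)" by (intro mult_left_mono) auto
  then have a: "d - 2 * C * ln (3 * m * d\<^sup>2) - d * c \<le> d - 2 * C * ln M - d * c" by simp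
  have "(1 + \<epsilon> - \<delta>) / d * (d - 2 * C * ln (3 * m * d\<^sup>2) - d * c) \<le> p1 * (d - 2 * C * ln M - d * c)"
   by (rule mult_mono[OF p1d a p1(1) R1(1)])
  then show "ln (1 + \<epsilon>) + 1 + 2 / d + c * ln (1 / x) + x - p1 * (d - 2 * C * ln M - d * c) \<le> - \<kappa>"
   using R1(3) by simp
 qed (use \<epsilon> d2 p1 p2 p12 merge x c m N1 R1 in \<open>auto simp: p_def\<close>)

 have dense: "chance E (\<lambda>_. p) B2 \<le> (card V)\<^sup>2 * exp (- 2 * real m)"
  unfolding B2_def p_def by (rule H.chance_dense_conn) (use \<epsilon> d2 m in auto)

 have slow: "chance E (\<lambda>_. p2) (B3 F1) \<le> (card V)\<^sup>2 * err" if F1: "F1 \<subseteq> E" and ty: "T F1" for F1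
 proof -
  obtain q1 q2 r where q: "\<And>k. c / 2 * m \<le> real k \<Longrightarrow> k \<le> card V \<Longrightarrow>
   0 < q1 k \<and> q1 k < 1 \<and> 0 < q2 k \<and> q2 k < 1 \<and> k \<le> d\<^sup>2 * r k \<and>
   exp (nat \<lfloor>\<psi> * (k * ln (exp 1 * card V / k))\<rfloor> - \<delta>\<^sup>2 / (8 * d) * (c4 * (k * ln (exp 1 * card V / k)))) \<le>
   err * ((1 - q1 k) ^ nat \<lfloor>20 / c * k\<rfloor> * q2 k ^ (r k + nat \<lfloor>\<psi> * (k * ln (exp 1 * card V / k))\<rfloor>) *
    (q1 k ^ nat \<lfloor>\<psi> * (k * ln (exp 1 * card V / k))\<rfloor> * (1 - q2 k) ^ ((d + d * (m * d)) * k)))"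
   using num by metis
  have k0: "c / 2 * m \<le> real k" if "k0 \<le> k" for k using that by (simp add: k0_def ceiling_le_iff nat_le_iff)
  show ?thesis unfolding B3_def p2_def
  proof (rule H.chance_slow_set[where ?q1.0 = q1 and ?q2.0 = q2 and r = r and N = "d\<^sup>2"
     and \<mu> = "\<lambda>k. c4 * (k * ln (exp 1 * card V / k))"])
   have "0 < c / 2 * m" using c m by simp
   then show "1 \<le> k0" unfolding k0_def by linarith
   show "0 < \<delta>" "\<delta> \<le> 1" using \<delta> \<epsilon> by auto
   fix A assume A: "A \<subseteq> ?W F1" "A \<noteq> {}" "\<alpha> * card V \<le> card (?W F1 - A)"
   let ?D = "1 + 4 * (real C)\<^sup>2 / \<theta>\<^sup>2 + 4 / (\<theta> * \<rho>) + 32 / (\<theta>\<^sup>2 * \<rho>)\<^sup>2"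
   let ?R = "card (H.bonds A (?W F1 - A)) + H.twosteps (V - ?W F1) A (?W F1 - A) / d"
   have "1 / C * \<alpha> / 6 * (card A * ln (exp 1 * card V / card A)) \<le> ?D * ?R"
   proof (rule H.bonds_twosteps_lower[OF _ A(1,2) \<theta>0 _ \<rho>(1) _ ty[unfolded T_def] _ \<alpha> A(3), where cI = "1 / real C"])
    show "?W F1 \<subseteq> V" by (auto simp: H.giants_def)
    show "1 / C * card S * ln (card V / card S) \<le> card (cut E S)" if "S \<subseteq> V" "S \<noteq> {}" for S
     by (rule isoperimetry_large[OF that])
    show "2 \<le> real d * (1 / real C * \<alpha> * exp (- 4 * real K / (1 / real C)))" by (rule dl)
   qed (use \<theta>0 \<rho> C in auto)
   moreover have "0 < ?D" using \<theta>0 \<rho> by (intro add_pos_nonneg) auto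
   moreover have "u / D * X \<le> R" if "u * X \<le> D * R" "0 < D" for u D X R :: real
    using that by (simp add: divide_le_eq mult.commute)
   ultimately have "1 / C * \<alpha> / 6 / ?D * (card A * ln (exp 1 * card V / card A)) \<le> ?R" by blast
   moreover have "c4 = 1 / C * \<alpha> / 6 / ?D" unfolding c4_def by simp
   ultimately show "c4 * (card A * ln (exp 1 * card V / card A)) \<le> ?R" by (simp only:)
  next
   fix k assume k: "k0 \<le> k" "k \<le> card V"
   show "0 < q1 k \<and> q1 k < 1 \<and> 0 < q2 k \<and> q2 k < 1 \<and> k \<le> d\<^sup>2 * r k" using q[OF k0[OF k(1)] k(2)] by blast
   show "exp (b k - \<delta>\<^sup>2 / (8 * d) * (c4 * (k * ln (exp 1 * card V / k)))) \<le>
    err * ((1 - q1 k) ^ s k * q2 k ^ (r k + b k) * (q1 k ^ b k * (1 - q2 k) ^ ((d + d * (m * d)) * k)))"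
    using q[OF k0[OF k(1)] k(2)] unfolding b_def s_def by blast
  qed (use F1 N1 err in auto)
 qed

 have cases: "\<not> T F1 \<or> B1 F1 F2 \<or> B2 (F1 \<union> F2) \<or> (T F1 \<and> B3 F1 F2)"
  if F: "F1 \<subseteq> E" "F2 \<subseteq> E" and no: "\<not> (\<exists>W. expands V (F1 \<union> F2) W m (c / 2) \<alpha> \<psi>)" for F1 F2
 proof (rule ccontr)
  assume neg: "\<not> ?thesis"
  let ?F = "F1 \<union> F2" and ?Wg = "?W F1"
  have FE: "?F \<subseteq> E" using F by auto
  have WV: "?Wg \<subseteq> V" by (auto simp: H.giants_def)
  have density: "c / 2 * card S \<le> card (S \<inter> ?Wg)" if S: "S \<subseteq> V" "conn ?F S" "m \<le> card S" for S
  proof (rule conn_density[OF m(3) m(1) c(2) _ _ S(2) fm[OF S(1)] S(3,1)])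
   show "c * card Q \<le> card (Q \<inter> ?Wg)" if "conn ?F Q" "finite Q" "m \<le> card Q" "card Q \<le> 3 * m" "Q \<subseteq> V" for Q
    using that neg unfolding B1_def by (meson not_less)
  qed (use c in simp)
  have dens2: "card (inc ?F S) \<le> 10 * card S" if "S \<subseteq> V" "conn ?F S" "m \<le> card S" for S
   using that neg unfolding B2_def by (meson nat_le_linear)
  \<comment> \<open>A pocket with more than \<open>m\<close> vertices would be a large connected set
    without any vertex of \<open>W\<close>, which the density just obtained excludes.\<close>
  have pock: "card (H.pocket ?Wg ?F z) \<le> m" if z: "z \<in> V - ?Wg" for z
  proof (rule ccontr)
   assume "\<not> ?thesis"
   then have l: "m < card (H.pocket ?Wg ?F z)" by simp
   have ps: "H.pocket ?Wg ?F z \<subseteq> V - ?Wg" by (rule H.pocket_subset[OF WV z])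
   have "conn (?F \<inter> H.outside ?Wg) (H.pocket ?Wg ?F z)" unfolding H.pocket_def by (rule comp_conn) simp
   then have "conn ?F (H.pocket ?Wg ?F z)" by (rule conn_mono) simp
   then have "c / 2 * card (H.pocket ?Wg ?F z) \<le> card (H.pocket ?Wg ?F z \<inter> ?Wg)" using ps l by (intro density) auto
   moreover have "H.pocket ?Wg ?F z \<inter> ?Wg = {}" using ps by blast
   ultimately show False using l c by (simp add: mult_le_0_iff)
  qed
  have cutb: "\<psi> * (card (S \<inter> ?Wg) * ln (exp 1 * card V / card (S \<inter> ?Wg))) < card (cut ?F S)"
   if S: "S \<subseteq> V" "conn ?F S" "m \<le> card S" "\<alpha> * card V \<le> card (?Wg - S)" for S
  proof -
   let ?k = "card (S \<inter> ?Wg)"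
   have dS: "c / 2 * card S \<le> ?k" by (rule density[OF S(1-3)])
   have "c / 2 * m \<le> c / 2 * card S" using c S(3) by (intro mult_left_mono) auto
   then have "k0 \<le> ?k" using dS unfolding k0_def by (simp add: nat_le_iff ceiling_le_iff)
   \<comment> \<open>The factor \<open>20 / c\<close> combines at most 10 incident edges per vertex
     of \<open>S\<close> with at least \<open>c / 2\<close> vertices of \<open>W\<close> per vertex
     of \<open>S\<close>.\<close>
   moreover have "card (inc ?F S) \<le> s ?k"
   proof -
    have "real (card (inc ?F S)) \<le> 10 * card S" using dens2[OF S(1-3)] by linarith
    also have "... \<le> 20 / c * ?k" using dS c by (simp add: field_simps)
    finally show ?thesis unfolding s_def by (simp add: le_nat_floor)
   qed
   ultimately have "\<not> card (cut ?F S) \<le> b ?k" using neg S pock unfolding B3_def by blast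
   then have "b ?k < card (cut ?F S)" by simp
   then show ?thesis unfolding b_def by linarith
  qed
  \<comment> \<open>\<alpha> was set to \<theta> / (8 * C), so that the fraction \<theta> / (2 * C)
    provided by \<open>typical_size\<close> equals 4 * \<alpha>. The surplus over \<alpha> is needed
    when \<open>W\<close> is split between a set and its complement.\<close>
  have "4 * \<alpha> * card V \<le> card ?Wg"
  proof -
   have ty: "H.typical ?Wg \<theta> (\<theta>\<^sup>2) K" using neg unfolding T_def by blast
   have "\<theta> * card V \<le> 2 * C * card ?Wg" by (rule H.typical_size[OF WV ty \<theta>0])
   then show ?thesis using C by (simp add: \<alpha>_def divide_le_eq mult_ac)
  qed
  moreover have "m \<le> card (cluster ?F w)" if w: "w \<in> ?Wg" for w
  proof -
   have wV: "w \<in> V" using w WV by blast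
   have "m \<le> card (cluster F1 w)" using w m(2) by (auto simp: H.giants_def)
   also have "... \<le> card (cluster ?F w)"
    by (rule card_mono[OF fm[OF H.cluster_V[OF FE wV]] cluster_mono]) simp
   finally show ?thesis .
  qed
  ultimately have "expands V ?F ?Wg m (c / 2) \<alpha> \<psi>"
   unfolding expands_def using WV density dens2 cutb by blast
  then show False using no by blast
 qed

 let ?Q = "\<lambda>F. \<not> (\<exists>W. expands V F W m (c / 2) \<alpha> \<psi>)"
 have "chance E (\<lambda>_. (1 + \<epsilon>) / d) ?Q = mean E (\<lambda>_. p1) (\<lambda>F1. chance E (\<lambda>_. p2) (\<lambda>F2. ?Q (F1 \<union> F2)))"
  unfolding chance_def using mean_merge[OF finE, of "\<lambda>_. p1" "\<lambda>_. p2" "\<lambda>F. of_bool (?Q F)"] merge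
  by (simp add: p_def)
 also have "... \<le> mean E (\<lambda>_. p1) (\<lambda>F1. of_bool (\<not> T F1) + (chance E (\<lambda>_. p2) (B1 F1) + (chance E (\<lambda>_. p2) (\<lambda>F2. B2 (F1 \<union> F2)) + (card V)\<^sup>2 * err)))"
 proof (rule mean_mono[OF pr(1)])
  fix F1 assume F1: "F1 \<subseteq> E"
  have nn: "0 \<le> chance E (\<lambda>_. p2) (B1 F1)" "0 \<le> chance E (\<lambda>_. p2) (\<lambda>F2. B2 (F1 \<union> F2))" "0 \<le> (card V)\<^sup>2 * err"
   using err by (auto intro!: chance_nonneg pr)
  show "chance E (\<lambda>_. p2) (\<lambda>F2. ?Q (F1 \<union> F2)) \<le> of_bool (\<not> T F1) + (chance E (\<lambda>_. p2) (B1 F1) + (chance E (\<lambda>_. p2) (\<lambda>F2. B2 (F1 \<union> F2)) + (card V)\<^sup>2 * err))"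
  proof (cases "T F1")
   case False
   have "chance E (\<lambda>_. p2) (\<lambda>F2. ?Q (F1 \<union> F2)) \<le> 1" by (rule chance_le_1[OF finE pr(2)])
   then show ?thesis using False nn by simp
  next
   case True
   have "chance E (\<lambda>_. p2) (\<lambda>F2. ?Q (F1 \<union> F2)) \<le> chance E (\<lambda>_. p2) (\<lambda>F2. B1 F1 F2 \<or> (B2 (F1 \<union> F2) \<or> B3 F1 F2))"
   proof (rule chance_mono[OF pr(2)])
    fix F2 assume "F2 \<subseteq> E" "?Q (F1 \<union> F2)"
    then show "B1 F1 F2 \<or> (B2 (F1 \<union> F2) \<or> B3 F1 F2)" using cases[OF F1] True by blast
   qed
   also have "... \<le> chance E (\<lambda>_. p2) (B1 F1) + chance E (\<lambda>_. p2) (\<lambda>F2. B2 (F1 \<union> F2) \<or> B3 F1 F2)"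
    by (rule chance_disj[OF pr(2)])
   also have "chance E (\<lambda>_. p2) (\<lambda>F2. B2 (F1 \<union> F2) \<or> B3 F1 F2) \<le> chance E (\<lambda>_. p2) (\<lambda>F2. B2 (F1 \<union> F2)) + chance E (\<lambda>_. p2) (B3 F1)"
    by (rule chance_disj[OF pr(2)])
   finally show ?thesis using slow[OF F1 True] True by simp
  qed
 qed
 also have "... = mean E (\<lambda>_. p1) (\<lambda>F1. of_bool (\<not> T F1)) + (mean E (\<lambda>_. p1) (\<lambda>F1. chance E (\<lambda>_. p2) (B1 F1)) + (mean E (\<lambda>_. p1) (\<lambda>F1. chance E (\<lambda>_. p2) (\<lambda>F2. B2 (F1 \<union> F2))) + (card V)\<^sup>2 * err))"
  by (simp only: mean_add mean_const[OF finE])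
 also have "mean E (\<lambda>_. p1) (\<lambda>F1. chance E (\<lambda>_. p2) (\<lambda>F2. B2 (F1 \<union> F2))) = chance E (\<lambda>_. p) B2"
  unfolding chance_def using mean_merge[OF finE, of "\<lambda>_. p1" "\<lambda>_. p2" "\<lambda>F. of_bool (B2 F)"] merge by simp
 finally show ?thesis using atyp sparse dense by linarith
qed

end

section \<open>Choice of the parameters in the union bound\<close>

text \<open>Balance of gain and cost for sets of size \<open>k\<close>. The gain in the exponent is
  \<open>Y = \<sigma> * (k * j) / d\<close>. Half of it pays for the \<open>b\<close> boundary edges
  at a price of \<open>1 + 8 * l\<close> each, which is at most \<open>9 * l\<close> and explains
  the 18 in \<open>b\<close>. One eighth pays for the O(k) edges subject to \<open>q1\<close>, one
  eighth for the about \<open>k / d\<^sup>2\<close> pieces, and one quarter for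
  \<open>3 * ln n\<close>. The value \<open>j / (d * l)\<close> of \<open>q1\<close> is small enough
  that linearly many factors \<open>1 - q1\<close> are affordable, yet at least \<open>d\<close> to
  the power - 2.\<close>

lemma slow_numerics:
 fixes d n K0 k b m :: nat and c \<sigma> l c6 j :: real
 defines "l \<equiv> ln (real d)" and "j \<equiv> ln (exp 1 * real n / real k)"
 defines "b \<equiv> nat \<lfloor>\<sigma> / 18 / (d * l) * (k * j)\<rfloor>" and "m \<equiv> K0 * d"
 assumes c: "0 < c" "c \<le> 1" and \<sigma>: "0 < \<sigma>" and K0: "48 \<le> \<sigma> * c * K0"
  and d: "K0 + 1 \<le> d" "1 \<le> l" "16 * (20 / c + 1) / \<sigma> \<le> l" "48 * l / \<sigma> \<le> d" "1 + ln n \<le> d * l / 2"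
   "c / 2 * K0 * d \<le> exp (c6 * d / 2)"
  and n: "c6 * d \<le> ln n" and k: "c / 2 * m \<le> real k" "k \<le> n"
 shows "\<exists>q1 q2 r. 0 < q1 \<and> q1 < 1 \<and> 0 < q2 \<and> q2 < 1 \<and> k \<le> d\<^sup>2 * r \<and>
  exp (b - \<sigma> * (k * j) / d) \<le> exp (6 * l - 3 * ln n) *
   ((1 - q1) ^ nat \<lfloor>20 / c * k\<rfloor> * q2 ^ (r + b) * (q1 ^ b * (1 - q2) ^ ((d + d * (m * d)) * k)))"
proof -
 define k1 where "k1 = c / 2 * K0 * d"
 define \<Delta> where "\<Delta> = d + d * (m * d)"
 define q1 where "q1 = j / (d * l)"
 \<comment> \<open>Divided by the degree bound of the auxiliary graph: avoiding all
   \<open>\<Delta> * k\<close> of its edges then costs only a factor of exp (- 2 * q1 * k).\<close>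
 define q2 where "q2 = q1 / \<Delta>"
 define r where "r = nat \<lceil>k / (real d)\<^sup>2\<rceil>"
 define s where "s = nat \<lfloor>20 / c * k\<rfloor>"
 have K1: "0 < K0" using K0 by (cases K0) auto
 have d0: "1 < d" using K1 d(1) by linarith
 have k10: "0 < k1" using c K1 d0 by (simp add: k1_def)
 have k1k: "k1 \<le> k" using k by (simp add: k1_def m_def mult.assoc)
 have k0: "0 < real k" using k10 k1k by linarith
 have nk: "real k \<le> real n" using k by simp
 have n0: "0 < real n" using k0 nk by linarith
 have j1: "1 \<le> j"
 proof -
  have "ln (exp 1) \<le> ln (exp 1 * real n / real k)" using k0 nk n0 by (subst ln_le_cancel_iff) (auto simp: field_simps)
  then show ?thesis by (simp add: j_def)
 qed
 have jn: "j \<le> 1 + ln n"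
 proof -
  have "1 \<le> real k" using k0 by simp
  then have "exp 1 * real n / real k \<le> exp 1 * n" using n0 by (simp add: divide_le_eq mult_left_mono)
  then have "j \<le> ln (exp 1 * n)" unfolding j_def using k0 n0 by (subst ln_le_cancel_iff) auto
  then show ?thesis using n0 by (simp add: ln_mult)
 qed
 have dl: "0 < d * l" using d0 d by simp
 have q1: "0 < q1" "q1 \<le> 1 / 2" using j1 dl jn d(5) by (auto simp: q1_def field_simps)
 have "1 \<le> \<Delta>" using d0 by (simp add: \<Delta>_def)
 then have \<Delta>1: "1 \<le> real \<Delta>" by simp
 have q2: "0 < q2" "q2 \<le> 1 / 2"
 proof -
  show "0 < q2" using q1 \<Delta>1 by (simp add: q2_def)
  have "q2 \<le> q1" using q1 \<Delta>1 by (simp add: q2_def divide_le_eq mult_le_cancel_left1)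
  then show "q2 \<le> 1 / 2" using q1 by simp
 qed
 have ld: "l \<le> d" unfolding l_def using d0 ln_le_minus_one[of "real d"] by simp
 have e2: "exp (2 * l) = (real d)\<^sup>2" unfolding l_def using d0 using exp_of_nat_mult[of 2 "ln (real d)"] by simp
 have e6: "exp (6 * l) = (real d) ^ 6" unfolding l_def using d0 exp_of_nat_mult[of 6 "ln (real d)"] by simp
 have q1l: "exp (- (2 * l)) \<le> q1"
 proof -
  have "d * l \<le> (real d)\<^sup>2" using ld by (simp add: power2_eq_square mult_left_mono)
  then have "1 / (real d)\<^sup>2 \<le> 1 / (d * l)" using d0 d(2) by (intro divide_left_mono mult_pos_pos) auto
  also have "... \<le> q1" using j1 dl by (simp add: q1_def divide_right_mono)
  finally show ?thesis by (simp add: exp_minus e2 inverse_eq_divide)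
 qed
 have q2l: "exp (- (6 * l)) \<le> q2"
 proof -
  have d31: "1 \<le> real d ^ 2" using d0 by simp
  have "real \<Delta> = d + K0 * (real d) ^ 3" by (simp add: \<Delta>_def m_def power3_eq_cube mult_ac)
  also have "... \<le> (real d) ^ 3 + K0 * (real d) ^ 3" using d31 mult_left_mono[of 1 "real d ^ 2" "real d"]
   by (simp add: power3_eq_cube power2_eq_square)
  also have "... = real (K0 + 1) * real d ^ 3" by (simp add: algebra_simps)
  also have "... \<le> real d * real d ^ 3" using d(1) by (intro mult_right_mono of_nat_mono) auto
  finally have D4: "real \<Delta> \<le> (real d) ^ 4" by (simp add: eval_nat_numeral)
  have "d * l * \<Delta> \<le> d * d * (real d) ^ 4" using ld D4 d(2) by (intro mult_mono) auto
  also have "... = (real d) ^ 6" by (simp add: eval_nat_numeral)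
  finally have "1 / (real d) ^ 6 \<le> 1 / (d * l * \<Delta>)" using d0 d(2) \<Delta>1 by (intro divide_left_mono mult_pos_pos) auto
  also have "... \<le> q2" using j1 dl \<Delta>1 by (simp add: q1_def q2_def divide_right_mono)
  finally show ?thesis by (simp add: exp_minus e6 inverse_eq_divide)
 qed
 have lowexp: "exp (- (2 * q * a)) \<le> (1 - q) ^ a" if "0 < q" "q \<le> 1 / 2" for q :: real and a :: nat
 proof -
  have "exp (- 2 * q) \<le> 1 - q"
  proof -
   have "1 / (1 - q) = 1 + q / (1 - q)" using that by (simp add: field_simps)
   also have "... \<le> 1 + 2 * q" using that by (simp add: divide_le_eq field_simps)
   also have "... \<le> exp (2 * q)" by (rule exp_ge_add_one_self)
   finally show ?thesis using that by (simp add: exp_minus field_simps)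
  qed
  then have "exp (- 2 * q) ^ a \<le> (1 - q) ^ a" by (intro power_mono) auto
  then show ?thesis by (simp add: exp_of_nat_mult[symmetric] mult_ac)
 qed
 have pw: "exp (- (g * a)) \<le> q ^ a" if "exp (- g) \<le> q" for q g :: real and a :: nat
 proof -
  have "exp (- g) ^ a \<le> q ^ a" using that by (intro power_mono) auto
  then show ?thesis by (simp add: exp_of_nat_mult[symmetric] mult_ac)
 qed
 have rk: "k \<le> d\<^sup>2 * r" "real r \<le> k / (real d)\<^sup>2 + 1"
 proof -
  have "k / (real d)\<^sup>2 \<le> r" unfolding r_def by (simp add: real_nat_ceiling_ge)
  then have "real k \<le> real (d\<^sup>2 * r)" using d0 by (simp add: divide_le_eq mult.commute)
  then show "k \<le> d\<^sup>2 * r" by (simp only: of_nat_le_iff)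
  have "0 \<le> k / (real d)\<^sup>2" by simp
  then show "real r \<le> k / (real d)\<^sup>2 + 1" unfolding r_def by linarith
 qed
 have bk: "real b \<le> \<sigma> / 18 / (d * l) * (k * j)" unfolding b_def using \<sigma> dl j1 by (intro of_nat_floor) auto
 have sk: "real s \<le> 20 / c * k" unfolding s_def using c by (intro of_nat_floor) auto
 define Y where "Y = \<sigma> * (k * j) / d"
 have kjd: "0 < k * j" using k0 j1 by simp
 have Y0: "0 < Y" using kjd \<sigma> d0 by (simp add: Y_def)
 have f1: "b * (1 + 8 * l) \<le> Y / 2"
 proof -
  have "b * (1 + 8 * l) \<le> (\<sigma> / 18 / (d * l) * (k * j)) * (9 * l)"
   using d(2) \<sigma> dl kjd by (intro mult_mono[OF bk]) auto
  also have "... = Y / 2" using d(2) d0 by (simp add: Y_def field_simps)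
  finally show ?thesis .
 qed
 have f2: "2 * q1 * (s + k) \<le> Y / 8"
 proof -
  have "2 * q1 * (s + k) \<le> 2 * q1 * ((20 / c + 1) * k)" using q1 sk by (intro mult_left_mono) (auto simp: algebra_simps)
  also have "... = (2 * (20 / c + 1)) * (k * j / (d * l))" by (simp add: q1_def)
  also have "... \<le> (\<sigma> * l / 8) * (k * j / (d * l))"
   using d(3) \<sigma> kjd dl by (intro mult_right_mono) (auto simp: field_simps)
  also have "... = Y / 8" using d(2) d0 by (simp add: Y_def field_simps)
  finally show ?thesis .
 qed
 \<comment> \<open>The extra \<open>6 * l\<close> is the price of rounding \<open>r\<close> up; it
   reappears as the factor exp (6 * l) of the error.\<close>
 have f3: "6 * l * r \<le> 6 * l + Y / 8"
 proof -
  have "6 * l * r \<le> 6 * l * (k / (real d)\<^sup>2 + 1)" using rk d(2) by (intro mult_left_mono) auto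
  also have "... = 6 * l + (6 * l) * (k / (real d)\<^sup>2)" by (simp add: algebra_simps)
  also have "(6 * l) * (k / (real d)\<^sup>2) \<le> (\<sigma> * d / 8) * (k * j / (real d)\<^sup>2)"
   using d(2,4) \<sigma> k0 j1 by (intro mult_mono divide_right_mono) (auto simp: field_simps)
  also have "... = Y / 8" using d0 by (simp add: Y_def power2_eq_square)
  finally show ?thesis by simp
 qed
 \<comment> \<open>Monotonicity of the profile reduces this to the smallest admissible size
   \<open>k1\<close>, a multiple of \<open>d\<close>. There the logarithm is at least
   \<open>ln n / 2\<close>, and \<open>\<sigma> * c * K0\<close> being at least 48 suffices.\<close>
 have f4: "3 * ln n \<le> Y / 4"
 proof -
  have "k1 * ln (exp 1 * n / k1) \<le> k * j" unfolding j_def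
   using xlog_mono[of k1 k n] k10 k1k nk by simp
  moreover have "ln n / 2 \<le> ln (exp 1 * n / k1)"
  proof -
   have "k1 \<le> exp (c6 * d / 2)" using d(6) by (simp add: k1_def)
   also have "... \<le> exp (ln n / 2)" using n by simp
   finally have "ln k1 \<le> ln (exp (ln n / 2))" using k10 by (subst ln_le_cancel_iff) auto
   then have "ln k1 \<le> ln n / 2" by simp
   then show ?thesis using k10 n0 by (simp add: ln_div ln_mult)
  qed
  ultimately have "k1 * (ln n / 2) \<le> k * j" using k10 mult_left_mono[of "ln n / 2" "ln (exp 1 * n / k1)" k1] by linarith
  then have "(\<sigma> / d / 4) * (k1 * (ln n / 2)) \<le> (\<sigma> / d / 4) * (k * j)" using \<sigma> by (intro mult_left_mono) auto
  then have a: "\<sigma> * c * K0 / 16 * ln n \<le> Y / 4" using d0 by (simp add: Y_def k1_def)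
  have "0 \<le> ln n" using j1 jn by linarith
  then have "48 / 16 * ln n \<le> \<sigma> * c * K0 / 16 * ln n" using K0 by (intro mult_right_mono) auto
  then show ?thesis using a by simp
 qed
 have q2D: "2 * q2 * (\<Delta> * k) = 2 * q1 * k" using \<Delta>1 by (simp add: q2_def)
 have "exp (b - \<sigma> * (k * j) / d) \<le> exp (6 * l - 3 * ln n + (- (2 * q1 * s) + - (6 * l * (r + b)) + (- (2 * l * b) + - (2 * q2 * (\<Delta> * k)))))"
  unfolding q2D Y_def[symmetric] using f1 f2 f3 f4 by (simp add: algebra_simps)
 also have "... = exp (6 * l - 3 * ln n) * (exp (- (2 * q1 * s)) * exp (- (6 * l * (r + b))) * (exp (- (2 * l * b)) * exp (- (2 * q2 * (\<Delta> * k)))))"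
  by (simp only: exp_add)
 also have "... \<le> exp (6 * l - 3 * ln n) * ((1 - q1) ^ s * q2 ^ (r + b) * (q1 ^ b * (1 - q2) ^ (\<Delta> * k)))"
  using lowexp[OF q1, of s] lowexp[OF q2, of "\<Delta> * k"] pw[OF q1l, of b] pw[OF q2l, of "r + b"] q1 q2
  by (intro mult_left_mono mult_mono) auto
 finally show ?thesis unfolding s_def \<Delta>_def using q1 q2 rk by (intro exI[of _ q1] exI[of _ q2] exI[of _ r]) auto
qed

theorem expands_whp:
 fixes C :: nat and \<epsilon> :: real
 assumes C: "1 < C" and \<epsilon>: "0 < \<epsilon>" "\<epsilon> \<le> 1"
 shows "\<exists>(K0::nat) (c::real) (\<alpha>::real) (\<eta>::real). 0 < K0 \<and> 0 < c \<and> c \<le> 1 \<and> 0 < \<alpha> \<and> 0 < \<eta> \<and>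
  (\<forall>\<xi>>0. \<forall>\<^sub>F d::nat in at_top. \<forall>t (G :: nat \<Rightarrow> 'a ugraph) r. product t G r C \<longrightarrow> d = (\<Sum>j\<in>{1..t}. r j) \<longrightarrow>
   chance (edges (cart_prod t G)) (\<lambda>_. (1 + \<epsilon>) / d)
    (\<lambda>F. \<not> (\<exists>W. expands (verts (cart_prod t G)) F W (K0 * d) c \<alpha> (\<eta> / (d * ln d)))) \<le> \<xi>)"
proof -
 \<comment> \<open>The slack of the first moment bound: at density (1 + \<epsilon>) / d its exponent
   ln (1 + \<epsilon>) + 1 - (1 + \<epsilon>) is exactly minus \<kappa>0. The sprinkling density and
   the other small terms are fractions of this slack.\<close>
 define \<kappa>0 where "\<kappa>0 = \<epsilon> - ln (1 + \<epsilon>)"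
 define \<delta> x \<kappa> where "\<delta> = \<kappa>0 / 4" and "x = \<kappa>0 / 8" and "\<kappa> = \<kappa>0 / 4"
 \<comment> \<open>Small enough for \<open>c * (2 + ln (1 / x))\<close> to be at most one eighth of
   the slack: \<open>2 * c\<close> covers the edges at the exceptional vertices,
   \<open>c * ln (1 / x)\<close> their choice.\<close>
 define c where "c = min (1 / 2) (\<kappa>0 / 8 / (2 + ln (1 / x)))"
 define \<theta> where "\<theta> = (\<epsilon> / 8)\<^sup>2 / 8"
 define \<alpha> \<rho> where "\<alpha> = \<theta> / (8 * C)" and "\<rho> = \<epsilon> / (16 * (real C)\<^sup>2)"
 define c4 where "c4 = \<alpha> / (6 * C) / (1 + 4 * (real C)\<^sup>2 / \<theta>\<^sup>2 + 4 / (\<theta> * \<rho>) + 32 / (\<theta>\<^sup>2 * \<rho>)\<^sup>2)"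
 define \<sigma> where "\<sigma> = \<delta>\<^sup>2 * c4 / 8"
 \<comment> \<open>So many neighbours failing together beat both the at most exp (d * ln C) vertices
   and the \<open>2 ^ h\<close> index sets.\<close>
 define K where "K = nat \<lceil>(ln C + 1) / (\<theta>\<^sup>2 * \<rho>)\<rceil>"
 define n1 n2 n3 where "n1 = nat \<lceil>48 / (\<sigma> * c)\<rceil>" and "n2 = nat \<lceil>(ln C + 1) / \<kappa>\<rceil>" and "n3 = nat \<lceil>ln C + 1\<rceil>"
 \<comment> \<open>The three rounded terms serve, in this order, the union bound over small
   boundaries, the density of \<open>W\<close>, and the edge count of connected sets.\<close>
 define K0 where "K0 = n1 + n2 + n3 + 1"
 have "0 \<le> ln (1 + \<epsilon>)" using \<epsilon> by (intro ln_ge_zero) simp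
 moreover have "ln (1 + \<epsilon>) < \<epsilon>" by (rule ln_add_one_self_less_self[OF \<epsilon>(1)])
 ultimately have \<kappa>\<epsilon>: "0 < \<kappa>0 \<and> \<kappa>0 \<le> \<epsilon>" unfolding \<kappa>0_def by linarith
 then have \<kappa>0: "0 < \<kappa>0" "\<kappa>0 \<le> 1" using \<epsilon> by auto
 have \<delta>: "0 < \<delta>" "\<delta> \<le> \<epsilon> / 4" using \<kappa>\<epsilon> by (auto simp: \<delta>_def)
 have x: "0 < x" "x \<le> 1" using \<kappa>0 by (auto simp: x_def)
 have lx: "0 \<le> ln (1 / x)" using x by (intro ln_ge_zero) auto
 have c: "0 < c" "c \<le> 1 / 2" "c * (2 + ln (1 / x)) \<le> \<kappa>0 / 8"
 proof -
  show "0 < c" "c \<le> 1 / 2" using \<kappa>0 lx by (auto simp: c_def)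
  have "c \<le> \<kappa>0 / 8 / (2 + ln (1 / x))" by (simp add: c_def)
  then show "c * (2 + ln (1 / x)) \<le> \<kappa>0 / 8" using lx pos_le_divide_eq[of "2 + ln (1 / x)" c "\<kappa>0 / 8"] by linarith
 qed
 have c1: "c \<le> 1" using c by simp
 have \<theta>: "0 < \<theta>" using \<epsilon> by (simp add: \<theta>_def)
 have \<rho>: "0 < \<rho>" using \<epsilon> C by (simp add: \<rho>_def)
 have \<alpha>: "0 < \<alpha>" using \<theta> C by (simp add: \<alpha>_def)
 have c4: "0 < c4" unfolding c4_def using \<alpha> \<theta> \<rho> C by (intro divide_pos_pos add_pos_nonneg) auto
 have \<sigma>: "0 < \<sigma>" using \<delta> c4 by (simp add: \<sigma>_def)
 have lC: "0 < ln C" using C by simp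
 have KK: "ln C + 1 \<le> (K + 1) * (\<theta>\<^sup>2 * \<rho>)"
 proof -
  have "(ln C + 1) / (\<theta>\<^sup>2 * \<rho>) \<le> K" unfolding K_def by (simp add: real_nat_ceiling_ge)
  then have "ln C + 1 \<le> K * (\<theta>\<^sup>2 * \<rho>)" using \<theta> \<rho> by (simp add: divide_le_eq)
  also have "... \<le> (K + 1) * (\<theta>\<^sup>2 * \<rho>)" using \<rho> by (intro mult_right_mono) auto
  finally show ?thesis .
 qed
 have K0: "48 \<le> \<sigma> * c * K0" "ln C + 1 \<le> \<kappa> * K0" "ln C + 1 \<le> K0" "0 < K0"
 proof -
  have "48 / (\<sigma> * c) \<le> n1" "(ln C + 1) / \<kappa> \<le> n2" "ln C + 1 \<le> n3"
   unfolding n1_def n2_def n3_def by (rule real_nat_ceiling_ge)+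
  then have "48 / (\<sigma> * c) \<le> K0" "(ln C + 1) / \<kappa> \<le> K0" "ln C + 1 \<le> K0"
   by (simp_all add: K0_def)
  moreover have "0 < \<sigma> * c" "0 < \<kappa>" using \<sigma> c \<kappa>0 by (auto simp: \<kappa>_def)
  ultimately show "48 \<le> \<sigma> * c * K0" "ln C + 1 \<le> \<kappa> * K0" "ln C + 1 \<le> K0"
   by (simp_all only: pos_divide_le_eq mult.commute[of "real K0"])
 qed (simp add: K0_def)
 define c6 where "c6 = ln 2 / C"
 have c6: "0 < c6" using C by (simp add: c6_def)
 have c0: "0 < real K0" using K0 by simp
 have "\<forall>\<^sub>F d::nat in at_top. \<forall>t (G :: nat \<Rightarrow> 'a ugraph) r. product t G r C \<longrightarrow> d = (\<Sum>j\<in>{1..t}. r j) \<longrightarrow>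
   chance (edges (cart_prod t G)) (\<lambda>_. (1 + \<epsilon>) / d)
    (\<lambda>F. \<not> (\<exists>W. expands (verts (cart_prod t G)) F W (K0 * d) (c / 2) \<alpha> (\<sigma> / 18 / (d * ln d)))) \<le> \<xi>"
  if \<xi>: "0 < \<xi>" for \<xi>
 proof -
  have ev: "\<forall>\<^sub>F d::nat in at_top. K0 + 1 \<le> d" "\<forall>\<^sub>F d::nat in at_top. 2 * C \<le> d"
   "\<forall>\<^sub>F d::nat in at_top. 1 \<le> ln (real d)"
   "\<forall>\<^sub>F d::nat in at_top. 16 * (20 / c + 1) / \<sigma> \<le> ln (real d)"
   "\<forall>\<^sub>F d::nat in at_top. 48 * ln (real d) / \<sigma> \<le> real d"
   "\<forall>\<^sub>F d::nat in at_top. 1 + real d * ln (real C) \<le> real d * ln (real d) / 2"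
   "\<forall>\<^sub>F d::nat in at_top. c / 2 * real K0 * real d \<le> exp (c6 * real d / 2)"
   "\<forall>\<^sub>F d::nat in at_top. 2 \<le> c * (real K0 * real d)"
   "\<forall>\<^sub>F d::nat in at_top. 1 \<le> \<rho> * real d"
   "\<forall>\<^sub>F d::nat in at_top. (real C * (real K + 1) + 2 * real C * ln (real d ^ 2)) / real d \<le> \<epsilon> / 8"
   "\<forall>\<^sub>F d::nat in at_top. 2 * real C * ln (3 * real K0 * real d * real d ^ 2) / real d \<le> 1 / 2"
   "\<forall>\<^sub>F d::nat in at_top. 2 / real d + 4 * real C * ln (3 * real K0 * real d * real d ^ 2) / real d \<le> \<kappa>0 / 8"
   "\<forall>\<^sub>F d::nat in at_top. 2 \<le> real d * (1 / real C * \<alpha> * exp (- 4 * real K / (1 / real C)))"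
   "\<forall>\<^sub>F d::nat in at_top. exp (- 2 * real d + (real K + 1) * ln (real d) + 4 * (real K + 1)\<^sup>2 * \<theta>) \<le> \<xi> / 5"
   "\<forall>\<^sub>F d::nat in at_top. 2 * real d ^ 2 * exp (4 * \<theta> - 3 * \<theta> * (\<rho> * real d)) \<le> \<xi> / 5"
   "\<forall>\<^sub>F d::nat in at_top. 3 * real K0 * real d * real d ^ 2 * exp (- real d) \<le> \<xi> / 5"
   "\<forall>\<^sub>F d::nat in at_top. exp (- 2 * real d) \<le> \<xi> / 5"
   "\<forall>\<^sub>F d::nat in at_top. exp (6 * ln (real d) - c6 * real d) \<le> \<xi> / 5"
   subgoal by (rule eventually_ge_at_top)
   subgoal by (rule eventually_ge_at_top)
   subgoal by real_asymp
   subgoal using c \<sigma> by real_asymp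
   subgoal using \<sigma> by real_asymp
   subgoal using C by real_asymp
   subgoal using c c0 c6 by real_asymp
   subgoal using c c0 by real_asymp
   subgoal using \<rho> by real_asymp
   subgoal using \<epsilon> C by real_asymp
   subgoal using C c0 by real_asymp
   subgoal using C c0 \<kappa>0 by real_asymp
   subgoal using C \<alpha> by real_asymp
   subgoal using \<xi> by real_asymp
   subgoal using \<xi> \<theta> \<rho> by real_asymp
   subgoal using \<xi> c0 by real_asymp
   subgoal using \<xi> by real_asymp
   subgoal using \<xi> c6 by real_asymp
   done
  from ev show ?thesis
  proof eventually_elim
   case (elim d)
   show ?case
   proof (intro allI impI)
    fix t and G :: "nat \<Rightarrow> 'a ugraph" and r
    assume P: "product t G r C" and d: "d = (\<Sum>j\<in>{1..t}. r j)"
    interpret product t G r C by (rule P)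
    \<comment> \<open>Reserving \<open>h\<close> coordinates removes at most \<open>C * h\<close>,
      hence at most \<epsilon> * d / 8, from the degree, while \<open>h\<close> remains a constant
      fraction of \<open>d\<close>.\<close>
    define h where "h = nat \<lfloor>\<epsilon> * t / (8 * C)\<rfloor>"
    let ?n = "real (card V)"
    note sb = size_bounds[OF d]
    have d0: "0 < real d" using elim(1) by simp
    have C1: "0 < real C" using C by simp
    have hb: "real h \<le> \<epsilon> * t / (8 * C)" unfolding h_def using \<epsilon> by (intro of_nat_floor) auto
    have hd: "C * real h \<le> \<epsilon> * d / 8"
    proof -
     have "C * real h \<le> C * (\<epsilon> * t / (8 * C))" using hb by (intro mult_left_mono) auto
     also have "... = \<epsilon> * t / 8" using C1 by simp
     also have "... \<le> \<epsilon> * d / 8" using sb(1) \<epsilon> by simp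
     finally show ?thesis .
    qed
    have hl: "\<rho> * d \<le> h"
    proof -
     have "real d \<le> C * real t" using sb(2) by (simp flip: of_nat_mult)
     then have "2 * \<rho> * d \<le> 2 * \<rho> * (C * t)" using \<rho> by (intro mult_left_mono) auto
     also have "... = \<epsilon> * t / (8 * C)" using C1 by (simp add: \<rho>_def power2_eq_square field_simps)
     finally have "2 * (\<rho> * d) \<le> \<epsilon> * t / (8 * C)" by simp
     then show ?thesis using elim(9) unfolding h_def by linarith
    qed
    have h1: "1 \<le> h" using hl elim(9) by linarith
    have ht: "h \<le> t"
    proof -
     have "\<epsilon> * t \<le> 1 * real t" using \<epsilon> by (intro mult_right_mono) auto
     also have "... \<le> (8 * real C) * real t" using C by (intro mult_right_mono) auto
     finally have "\<epsilon> * t / (8 * C) \<le> t" using C by (simp add: divide_le_eq mult_ac)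
     then show ?thesis using hb by linarith
    qed
    have t2: "2 \<le> t"
    proof -
     have "C * 2 \<le> C * t" using elim(2) sb(2) by linarith
     then show ?thesis using C by simp
    qed
    interpret big_product t G r C h d
     by unfold_locales (use t2 h1 ht d in auto)
    have n0: "0 < ?n" using finV V_ne by (simp add: card_gt_0_iff)
    have nle: "?n \<le> exp (d * ln C)" using sb(4) n0 by (metis exp_le_cancel_iff exp_ln)
    have hd': "h \<le> d" using ht sb(1) by simp
    define f where "f = (1 + \<epsilon> - \<delta>) / d"
    have f0: "0 \<le> f" "f * d = 1 + \<epsilon> - \<delta>" using \<delta> \<epsilon> d0 by (auto simp: f_def)
    have fu: "f \<le> 2 / d" unfolding f_def using \<delta> \<epsilon> d0 by (intro divide_right_mono) auto
    have big: "1 + \<epsilon> / 4 \<le> f * (real d - C * (h + (K + 1)) - 2 * C * ln (d\<^sup>2))"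
    proof -
     have "C * (real K + 1) + 2 * C * ln (real d ^ 2) \<le> \<epsilon> / 8 * d" using elim(10) d0 by (simp add: divide_le_eq)
     then have "d * (1 - \<epsilon> / 4) \<le> real d - C * (h + (K + 1)) - 2 * C * ln (d\<^sup>2)" using hd by (simp add: algebra_simps)
     then have "f * (d * (1 - \<epsilon> / 4)) \<le> f * (real d - C * (h + (K + 1)) - 2 * C * ln (d\<^sup>2))" using f0 by (intro mult_left_mono) auto
     moreover have "1 + \<epsilon> / 4 \<le> (1 + 3 * \<epsilon> / 4) * (1 - \<epsilon> / 4)"
      using \<epsilon> mult_left_mono[of \<epsilon> 1 \<epsilon>] by (simp add: algebra_simps)
     moreover have "(1 + 3 * \<epsilon> / 4) * (1 - \<epsilon> / 4) \<le> (f * d) * (1 - \<epsilon> / 4)" unfolding f0 using \<delta> \<epsilon> by (intro mult_right_mono) auto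
     ultimately show ?thesis by (simp add: mult.assoc)
    qed
    define Y where "Y = 2 * C * ln (3 * real K0 * real d * real d ^ 2)"
    have Y: "Y \<le> d / 2" using elim(11) d0 by (simp add: Y_def divide_le_eq)
    have R1: "0 \<le> d - 2 * C * ln (3 * (K0 * d) * d\<^sup>2) - d * c"
    proof -
     have "d * c \<le> d * (1 / 2)" using c d0 by (intro mult_left_mono) auto
     then show ?thesis using Y by (simp add: Y_def mult.assoc)
    qed
    have R2: "ln (1 + \<epsilon>) + 1 + 2 / d + c * ln (1 / x) + x - f * (d - 2 * C * ln (3 * (K0 * d) * d\<^sup>2) - d * c) \<le> - \<kappa>"
    proof -
     have Y0: "0 \<le> Y"
     proof -
      have "1 \<le> 3 * K0 * d * d ^ 2" using K0 elim(1) by (simp add: Suc_le_eq)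
      then have "1 \<le> 3 * real K0 * real d * real d ^ 2" by (metis of_nat_1 of_nat_le_iff of_nat_mult of_nat_numeral of_nat_power)
      then show ?thesis by (simp add: Y_def ln_ge_zero)
     qed
     have "f * (Y + d * c) \<le> 2 / d * (Y + d * c)" using fu Y0 c by (intro mult_right_mono) auto
     also have "... = 2 * Y / d + 2 * c" using d0 by (simp add: field_simps)
     finally have a: "f * (Y + d * c) \<le> 2 * Y / d + 2 * c" .
     have b: "2 / d + 2 * Y / d \<le> \<kappa>0 / 8" using elim(12) by (simp add: Y_def mult.assoc)
     have e: "f * (d - Y - d * c) = (1 + \<epsilon> - \<delta>) - f * (Y + d * c)" using f0(2) by (simp add: algebra_simps)
     have "ln (1 + \<epsilon>) + 1 + 2 / d + c * ln (1 / x) + x - f * (d - Y - d * c) \<le> - \<kappa>"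
      unfolding e using a b c(3) \<kappa>0(1) \<kappa>_def \<delta>_def x_def \<kappa>0_def distrib_left[of c 2 "ln (1 / x)"] by linarith
     then show ?thesis by (simp add: Y_def mult.assoc)
    qed
    have num: "\<exists>q1 q2 r. 0 < q1 \<and> q1 < 1 \<and> 0 < q2 \<and> q2 < 1 \<and> k \<le> d\<^sup>2 * r \<and>
     exp (nat \<lfloor>\<sigma> / 18 / (d * ln d) * (k * ln (exp 1 * card V / k))\<rfloor> - \<delta>\<^sup>2 / (8 * d) * (c4 * (k * ln (exp 1 * card V / k)))) \<le>
     exp (6 * ln d - 3 * ln ?n) * ((1 - q1) ^ nat \<lfloor>20 / c * k\<rfloor> * q2 ^ (r + nat \<lfloor>\<sigma> / 18 / (d * ln d) * (k * ln (exp 1 * card V / k))\<rfloor>) *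
      (q1 ^ nat \<lfloor>\<sigma> / 18 / (d * ln d) * (k * ln (exp 1 * card V / k))\<rfloor> * (1 - q2) ^ ((d + d * (K0 * d * d)) * k)))"
     if k: "c / 2 * (K0 * d) \<le> real k" "k \<le> card V" for k
    proof -
     have eq: "\<delta>\<^sup>2 / (8 * d) * (c4 * X) = \<sigma> * X / d" for X
      by (simp add: \<sigma>_def)
     have nl: "1 + ln ?n \<le> d * ln d / 2" using sb(4) elim(6) by linarith
     have cn: "c6 * d \<le> ln ?n" using sb(3) by (simp add: c6_def mult.commute)
     show ?thesis unfolding eq
      by (rule slow_numerics[OF c(1) c1 \<sigma> K0(1) elim(1,3,4,5) nl elim(7) cn k])
    qed
    have "chance E (\<lambda>_. (1 + \<epsilon>) / d) (\<lambda>F. \<not> (\<exists>W. expands V F W (K0 * d) (c / 2) \<alpha> (\<sigma> / 18 / (d * ln d)))) \<le>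
     (card V * 2 ^ h * d ^ (K + 1) * exp (4 * (K + 1)\<^sup>2 * \<theta> - 3 * (K + 1) * \<theta>\<^sup>2 * h) + 2 * d\<^sup>2 * exp (4 * \<theta> - 3 * \<theta> * h))
     + card V * (3 * (K0 * d) * d\<^sup>2) * exp (- \<kappa> * (K0 * d)) + (card V)\<^sup>2 * exp (- 2 * real (K0 * d)) + (card V)\<^sup>2 * exp (6 * ln d - 3 * ln ?n)"
    proof (rule chance_expands[where \<epsilon> = \<epsilon> and \<rho> = \<rho> and x = x, folded \<theta>_def, folded \<alpha>_def, folded c4_def])
     show "1 \<le> K0 * d" using K0 elim(1) by simp
     show "K0 * d \<le> d\<^sup>2" using elim(1) by (simp add: power2_eq_square)
     show "1 \<le> C" "0 \<le> \<kappa>" using C \<kappa>0 by (auto simp: \<kappa>_def)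
     show "2 \<le> c * real (K0 * d)" using elim(8) by simp
     show "0 \<le> \<sigma> / 18 / (d * ln d)" using \<sigma> elim(3) by simp
    qed (rule \<epsilon> \<delta> \<rho> hl big[unfolded f_def] x c(1) c1 R1 R2[unfolded f_def] elim(13) num exp_ge_zero)+
    also have "... \<le> (\<xi> / 5 + \<xi> / 5) + \<xi> / 5 + \<xi> / 5 + \<xi> / 5"
    proof (intro add_mono)
     have ed: "real d = exp (ln d)" using d0 by simp
     have "card V * 2 ^ h * d ^ (K + 1) * exp (4 * (K + 1)\<^sup>2 * \<theta> - 3 * (K + 1) * \<theta>\<^sup>2 * h)
      = ?n * exp (h * ln 2) * exp ((K + 1) * ln d) * exp (4 * (real K + 1)\<^sup>2 * \<theta> - 3 * (real K + 1) * \<theta>\<^sup>2 * h)"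
     proof -
      have e: "(2::real) ^ h = exp (h * ln 2)" "real d ^ (K + 1) = exp ((K + 1) * ln d)"
       using d0 by (simp_all only: exp_of_nat_mult exp_ln) 
      show ?thesis by (simp only: of_nat_mult of_nat_power of_nat_numeral e of_nat_add of_nat_1)
     qed
     also have "... \<le> exp (d * ln C) * exp (d * 1) * exp ((K + 1) * ln d) * exp (4 * (real K + 1)\<^sup>2 * \<theta> - 3 * (real K + 1) * \<theta>\<^sup>2 * (\<rho> * d))"
     proof -
      have "real h * ln 2 \<le> real d * 1" using hd' ln2_le_25_over_36 by (intro mult_mono) auto
      moreover have "3 * (real K + 1) * \<theta>\<^sup>2 * (\<rho> * d) \<le> 3 * (real K + 1) * \<theta>\<^sup>2 * h" using hl by (intro mult_left_mono) auto
      ultimately show ?thesis using nle by (intro mult_mono) auto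
     qed
     also have "... = exp (d * ln C + d + (K + 1) * ln d + 4 * (real K + 1)\<^sup>2 * \<theta> - 3 * d * ((K + 1) * (\<theta>\<^sup>2 * \<rho>)))"
      by (simp add: exp_add[symmetric] algebra_simps)
     also have "... \<le> exp (- 2 * real d + (real K + 1) * ln (real d) + 4 * (real K + 1)\<^sup>2 * \<theta>)"
     proof -
      have "3 * d * (ln C + 1) \<le> 3 * d * ((K + 1) * (\<theta>\<^sup>2 * \<rho>))" using KK by (intro mult_left_mono) auto
      moreover have "0 \<le> d * ln C" using lC by simp
      ultimately show ?thesis by (simp add: algebra_simps)
     qed
     also have "... \<le> \<xi> / 5" by (rule elim(14))
     finally show "card V * 2 ^ h * d ^ (K + 1) * exp (4 * (K + 1)\<^sup>2 * \<theta> - 3 * (K + 1) * \<theta>\<^sup>2 * h) \<le> \<xi> / 5" .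
     have "2 * d\<^sup>2 * exp (4 * \<theta> - 3 * \<theta> * h) \<le> 2 * real d ^ 2 * exp (4 * \<theta> - 3 * \<theta> * (\<rho> * d))"
      using hl \<theta> by (auto intro!: mult_left_mono)
     then show "2 * d\<^sup>2 * exp (4 * \<theta> - 3 * \<theta> * h) \<le> \<xi> / 5" using elim(15) by linarith
     have "card V * (3 * (K0 * d) * d\<^sup>2) * exp (- \<kappa> * (K0 * d)) = 3 * real K0 * real d * real d ^ 2 * (?n * exp (- \<kappa> * (K0 * d)))"
      by simp
     also have "... \<le> 3 * real K0 * real d * real d ^ 2 * (exp (d * ln C) * exp (- (ln C + 1) * d))"
     proof -
      have "(ln C + 1) * d \<le> \<kappa> * K0 * d" using K0(2) by (intro mult_right_mono) auto
      then show ?thesis using nle by (intro mult_left_mono mult_mono) (auto simp: algebra_simps)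
     qed
     also have "... = 3 * real K0 * real d * real d ^ 2 * exp (- real d)"
      by (simp add: exp_add[symmetric] algebra_simps)
     finally show "card V * (3 * (K0 * d) * d\<^sup>2) * exp (- \<kappa> * (K0 * d)) \<le> \<xi> / 5" using elim(16) by linarith
     have "(card V)\<^sup>2 * exp (- 2 * real (K0 * d)) \<le> (exp (d * ln C))\<^sup>2 * exp (- 2 * ((ln C + 1) * d))"
     proof -
      have "(ln C + 1) * d \<le> real K0 * d" using K0(3) by (intro mult_right_mono) auto
      moreover have "?n\<^sup>2 \<le> (exp (d * ln C))\<^sup>2" using nle by (intro power_mono) auto
      ultimately show ?thesis by (simp add: mult_mono)
     qed
     also have "... = exp (- 2 * real d)" by (simp add: power2_eq_square exp_add[symmetric] algebra_simps)
     finally show "(card V)\<^sup>2 * exp (- 2 * real (K0 * d)) \<le> \<xi> / 5" using elim(17) by linarith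
     have "(card V)\<^sup>2 * exp (6 * ln d - 3 * ln ?n) = exp (ln ?n) ^ 2 * exp (6 * ln d - 3 * ln ?n)" using n0 by simp
     also have "... = exp (6 * ln d - ln ?n)" by (simp add: power2_eq_square exp_add[symmetric])
     also have "... \<le> exp (6 * ln (real d) - c6 * real d)" using sb(3) by (simp add: c6_def mult.commute)
     finally show "(card V)\<^sup>2 * exp (6 * ln d - 3 * ln ?n) \<le> \<xi> / 5" using elim(18) by linarith
    qed
    finally show "chance E (\<lambda>_. (1 + \<epsilon>) / d) (\<lambda>F. \<not> (\<exists>W. expands V F W (K0 * d) (c / 2) \<alpha> (\<sigma> / 18 / (d * ln d)))) \<le> \<xi>" by simp
   qed
  qed
 qed
 then show ?thesis using K0 c \<alpha> \<sigma> by (intro exI[of _ K0] exI[of _ "c / 2"] exI[of _ \<alpha>] exI[of _ "\<sigma> / 18"]) auto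
qed

section \<open>Volumes, components and the expansion of the giant component\<close>

locale network =
 fixes V :: "'v set" and E :: "'v set set"
 assumes finV: "finite V" and pairsE: "pairs E" and EV: "e \<in> E \<Longrightarrow> e \<subseteq> V"
begin

definition deg :: "'v \<Rightarrow> nat" where "deg x = card {e \<in> E. x \<in> e}"
definition vol :: "'v set \<Rightarrow> nat" where "vol S = (\<Sum>x\<in>S. deg x)"

lemma finE: "finite E"
 by (rule finite_subset[of _ "Pow V"]) (use EV finV in auto)

lemma fin: "S \<subseteq> V \<Longrightarrow> finite S" using finV by (rule finite_subset[rotated])

lemma finite_cut [simp]: "finite (cut E S)" unfolding cut_def using finE by simp

lemma vol_mono: "S \<subseteq> T \<Longrightarrow> T \<subseteq> V \<Longrightarrow> vol S \<le> vol T"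
 unfolding vol_def using fin by (intro sum_mono2) auto

lemma vol_Un: "S \<subseteq> V \<Longrightarrow> T \<subseteq> V \<Longrightarrow> S \<inter> T = {} \<Longrightarrow> vol (S \<union> T) = vol S + vol T"
 unfolding vol_def using fin by (intro sum.union_disjoint) auto

lemma vol_Diff: "S \<subseteq> T \<Longrightarrow> T \<subseteq> V \<Longrightarrow> vol T = vol S + vol (T - S)"
proof -
 assume ST: "S \<subseteq> T" "T \<subseteq> V"
 then have "S \<union> (T - S) = T" by blast
 moreover have "vol (S \<union> (T - S)) = vol S + vol (T - S)" by (rule vol_Un) (use ST in auto)
 ultimately show ?thesis by simp
qed

lemma vol_double: "S \<subseteq> V \<Longrightarrow> vol S = (\<Sum>e\<in>inc E S. card (e \<inter> S))"
proof -
 assume S: "S \<subseteq> V"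
 have "vol S = (\<Sum>x\<in>S. \<Sum>e\<in>inc E S. of_bool (x \<in> e))"
  unfolding vol_def deg_def
 proof (rule sum.cong[OF refl])
  fix x assume x: "x \<in> S"
  have "(\<Sum>e\<in>inc E S. of_bool (x \<in> e)) = card (inc E S \<inter> {e. x \<in> e})"
   using finE by (simp add: inc_def)
  also have "inc E S \<inter> {e. x \<in> e} = {e \<in> E. x \<in> e}" using x by (auto simp: inc_def)
  finally show "card {e \<in> E. x \<in> e} = (\<Sum>e\<in>inc E S. of_bool (x \<in> e))" by simp
 qed
 also have "... = (\<Sum>e\<in>inc E S. \<Sum>x\<in>S. of_bool (x \<in> e))" by (rule sum.swap)
 also have "... = (\<Sum>e\<in>inc E S. card (e \<inter> S))"
  using fin[OF S] by (intro sum.cong refl) (simp add: Int_commute)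
 finally show ?thesis .
qed

lemma vol_inc: "S \<subseteq> V \<Longrightarrow> vol S \<le> 2 * card (inc E S)"
proof -
 assume S: "S \<subseteq> V"
 have "card (e \<inter> S) \<le> 2" if "e \<in> inc E S" for e
 proof -
  have "card e = 2" using that pairsE by (auto simp: inc_def pairs_def)
  then show ?thesis using card_mono[of e "e \<inter> S"] by (metis card.infinite Int_lower1 zero_neq_numeral)
 qed
 then have "(\<Sum>e\<in>inc E S. card (e \<inter> S)) \<le> (\<Sum>e\<in>inc E S. 2)" by (rule sum_mono)
 then show ?thesis using vol_double[OF S] by simp
qed

lemma vol_V: "vol V = 2 * card E"
proof -
 have "e \<inter> V \<noteq> {}" if "e \<in> E" for e
  using EV[OF that] pairsE that by (auto simp: pairs_def Int_absorb2)
 then have "inc E V = E" unfolding inc_def by blast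
 moreover have "card (e \<inter> V) = 2" if "e \<in> E" for e
  using that EV[OF that] pairsE by (simp add: pairs_def Int_absorb2)
 ultimately show ?thesis using vol_double[OF order_refl] by simp
qed

lemma cut_le_vol: "S \<subseteq> V \<Longrightarrow> card (cut E S) \<le> vol S"
proof -
 assume S: "S \<subseteq> V"
 have "card (cut E S) \<le> card (inc E S)" using finE by (intro card_mono) (auto simp: cut_def inc_def)
 also have "... = (\<Sum>e\<in>inc E S. 1)" by simp
 also have "... \<le> (\<Sum>e\<in>inc E S. card (e \<inter> S))"
  using fin[OF S] by (intro sum_mono) (auto simp: inc_def Suc_le_eq card_gt_0_iff)
 finally show ?thesis using vol_double[OF S] by simp
qed

lemma comps:
 assumes U: "U \<subseteq> V"
 shows "finite (comp E U ` U)" "\<Union>(comp E U ` U) = U"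
  "R \<in> comp E U ` U \<Longrightarrow> conn E R \<and> R \<subseteq> U \<and> R \<noteq> {}"
  "R \<in> comp E U ` U \<Longrightarrow> R' \<in> comp E U ` U \<Longrightarrow> R \<noteq> R' \<Longrightarrow> R \<inter> R' = {}"
proof -
 show "finite (comp E U ` U)" using fin[OF U] by simp
 show "\<Union>(comp E U ` U) = U" using comp_subset[of _ U E] comp_self[of _ E U] by blast
 show "conn E R \<and> R \<subseteq> U \<and> R \<noteq> {}" if R: "R \<in> comp E U ` U"
 proof -
  obtain x where x: "x \<in> U" "R = comp E U x" using R by blast
  show ?thesis unfolding x(2) using comp_conn[OF x(1)] comp_subset[OF x(1)] by simp
 qed
 show "R \<inter> R' = {}" if R: "R \<in> comp E U ` U" "R' \<in> comp E U ` U" "R \<noteq> R'"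
 proof -
  obtain x y where x: "R = comp E U x" "R' = comp E U y" using R by blast
  show ?thesis using R(3) comp_disjoint[of E U x y] unfolding x by blast
 qed
qed

lemma vol_comps:
 assumes U: "U \<subseteq> V" and C: "\<C> \<subseteq> comp E U ` U" shows "vol (\<Union>\<C>) = (\<Sum>R\<in>\<C>. vol R)"
proof -
 have "\<forall>A\<in>\<C>. finite A"
 proof
  fix A assume "A \<in> \<C>"
  then have "A \<subseteq> U" using comps(3)[OF U, of A] C by blast
  then show "finite A" using fin[of A] U by blast
 qed
 moreover have "\<forall>A\<in>\<C>. \<forall>B\<in>\<C>. A \<noteq> B \<longrightarrow> A \<inter> B = {}"
  by (intro ballI impI comps(4)[OF U] subsetD[OF C])
 ultimately show ?thesis unfolding vol_def by (simp add: sum.Union_disjoint)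
qed

lemma comp_boundary:
 assumes U: "U \<subseteq> V" and R: "R \<in> comp E U ` U" and e: "{x, y} \<in> E" "x \<in> R" "y \<notin> R"
 shows "y \<notin> U"
proof
 assume y: "y \<in> U"
 obtain z where z: "z \<in> U" "R = comp E U z" using R by blast
 have "x \<in> U" using comps(3)[OF U R] e by blast
 then have "y \<in> comp E U z" using comp_step[of x E U z y] e y z by blast
 then show False using e z by blast
qed

text \<open>An edge that leaves a component of \<open>U\<close> leaves \<open>U\<close> altogether,
  so different components have disjoint cuts.\<close>

lemma sum_cut_comps:
 assumes U: "U \<subseteq> V" and C: "\<C> \<subseteq> comp E U ` U"
 shows "(\<Sum>R\<in>\<C>. card (cut E R)) = card (cut E (\<Union>\<C>))"
proof -
 have fC: "finite \<C>" using comps(1)[OF U] C by (rule finite_subset[rotated])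
 have one: "\<exists>x y. e = {x, y} \<and> x \<in> R \<and> y \<notin> U" if "R \<in> \<C>" "e \<in> cut E R" for R e
  using that cutE[OF pairsE that(2)] comp_boundary[OF U] C by (metis subsetD)
 have sub: "R \<subseteq> U" if "R \<in> \<C>" for R using that comps(3)[OF U] C by blast
 have un: "(\<Union>R\<in>\<C>. cut E R) = cut E (\<Union>\<C>)"
 proof
  show "(\<Union>R\<in>\<C>. cut E R) \<subseteq> cut E (\<Union>\<C>)"
  proof
   fix e assume "e \<in> (\<Union>R\<in>\<C>. cut E R)"
   then obtain R where R: "R \<in> \<C>" "e \<in> cut E R" by blast
   obtain x y where "e = {x, y}" "x \<in> R" "y \<notin> U" using one[OF R] by blast
   then show "e \<in> cut E (\<Union>\<C>)" using R sub unfolding cut_def by blast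
  qed
  show "cut E (\<Union>\<C>) \<subseteq> (\<Union>R\<in>\<C>. cut E R)" unfolding cut_def by blast
 qed
 have "card (\<Union>R\<in>\<C>. cut E R) = (\<Sum>R\<in>\<C>. card (cut E R))"
 proof (rule card_UN_disjoint[OF fC])
  show "\<forall>i\<in>\<C>. \<forall>j\<in>\<C>. i \<noteq> j \<longrightarrow> cut E i \<inter> cut E j = {}"
  proof (intro ballI impI)
   fix R R' assume RR: "R \<in> \<C>" "R' \<in> \<C>" "R \<noteq> R'"
   have dis: "R \<inter> R' = {}" by (rule comps(4)[OF U subsetD[OF C RR(1)] subsetD[OF C RR(2)] RR(3)])
   show "cut E R \<inter> cut E R' = {}"
   proof (rule equals0I)
    fix e assume e: "e \<in> cut E R \<inter> cut E R'"
    obtain x y where x: "e = {x, y}" "x \<in> R" "y \<notin> U" using one[OF RR(1)] e by blast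
    have "e \<inter> R' \<noteq> {}" using e unfolding cut_def by blast
    then show False using x dis sub[OF RR(2)] by blast
   qed
  qed
 qed simp
 then show ?thesis using un by simp
qed

end

locale expander = network +
 fixes s0 D M :: real
 assumes connV: "conn E V" and s0: "1 \<le> s0" "s0 \<le> D" and volV: "vol V \<le> M" "1 \<le> M"
  and expansion: "S \<subseteq> V \<Longrightarrow> conn E S \<Longrightarrow> s0 \<le> vol S \<Longrightarrow> 3 * vol S \<le> 2 * vol V \<Longrightarrow>
   vol S * ln (exp 1 * M / vol S) \<le> D * card (cut E S)"
  and sparse: "P \<subseteq> V \<Longrightarrow> conn E P \<Longrightarrow> vol P \<le> max (20 * real (card P)) s0"

lemma ln_exp1_ratio:
 fixes x M :: real
 assumes "0 < x" "x \<le> M" shows "1 \<le> ln (exp 1 * M / x)"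
proof -
 have "exp 1 \<le> exp 1 * M / x" using assms by (simp add: le_divide_eq)
 then have "ln (exp 1) \<le> ln (exp 1 * M / x)" by (subst ln_le_cancel_iff) (use assms in auto)
 then show ?thesis by simp
qed

context network begin

text \<open>While enough of \<open>W\<close> lies outside \<open>S\<close>, expansion is that of
  \<open>expands\<close>, rewritten in volumes. Otherwise the components of \<open>L - S\<close> are
  used: most of \<open>W\<close> lies outside each of them, namely in \<open>S\<close>, and their
  boundaries add up to that of \<open>S\<close>. This bounds the volume of \<open>L - S\<close>,
  hence that of \<open>S\<close>, by the boundary; the logarithm is at most a constant because
  \<open>S\<close> has linear volume.\<close>

lemma expander_component:
 fixes c \<alpha> \<psi> :: real and m :: nat
 assumes ex: "expands V E W m c \<alpha> \<psi>" and L: "v \<in> V" "L = cluster E v" "m \<le> card L"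
  and c: "0 < c" "c \<le> 1" "0 < \<alpha>" "0 < \<psi>" "2 \<le> m"
 shows "expander L {e \<in> E. e \<subseteq> L} (20 * real m) (2 * ln (20 * exp 1 / (3 * \<alpha> * c)) * max (20 / (\<psi> * c)) (20 * m)) (20 * card V / c)"
  and "3 * \<alpha> * card V \<le> real (network.vol {e \<in> E. e \<subseteq> L} L)"
proof -
 let ?n = "real (card V)" and ?M = "real (20 * card V) / c" and ?F = "{e \<in> E. e \<subseteq> L}"
 define D0 where "D0 = max (20 / (\<psi> * c)) (20 * m)"
 define \<Lambda> where "\<Lambda> = ln (20 * exp 1 / (3 * \<alpha> * c))"
 have WV: "W \<subseteq> V" and aW: "4 * \<alpha> * card V \<le> card W" using ex unfolding expands_def by blast+
 have ex1: "c * card S \<le> card (S \<inter> W)" "card (inc E S) \<le> 10 * card S"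
  and ex2: "\<alpha> * card V \<le> card (W - S) \<Longrightarrow> \<psi> * (card (S \<inter> W) * ln (exp 1 * card V / card (S \<inter> W))) < card (cut E S)"
  if "S \<subseteq> V" "conn E S" "m \<le> card S" for S
  using ex that unfolding expands_def by blast+
 have LV: "L \<subseteq> V" unfolding L using cluster_subset[of v V E] L EV by blast
 have vL: "v \<in> L" unfolding L by simp
 have cL: "conn E L" unfolding L by (rule comp_conn) simp
 have cutL: "cut E L = {}" unfolding L by (rule cluster_cut[OF pairsE])
 have closed: "e \<subseteq> L" if "e \<in> E" "x \<in> e" "x \<in> L" for e x using cutL that unfolding cut_def by blast
 have n0: "0 < ?n" using finV L by (auto simp: card_gt_0_iff)
 interpret N: network L ?F
  by unfold_locales (use fin[OF LV] pairs_subset[OF pairsE] in auto)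
 have degL: "N.deg x = deg x" if "x \<in> L" for x
 proof -
  have "{e \<in> ?F. x \<in> e} = {e \<in> E. x \<in> e}" using closed that by blast
  then show ?thesis unfolding N.deg_def deg_def by simp
 qed
 have volL: "N.vol S = vol S" if "S \<subseteq> L" for S
  unfolding N.vol_def vol_def using degL that by (intro sum.cong) auto
 have cutF: "cut ?F S = cut E S" if "S \<subseteq> L" for S
  unfolding cut_def using closed that by blast
 have connF: "conn E S" if "conn ?F S" for S using that by (rule conn_mono) auto
 have cn: "c * x \<le> 1 * x" if "0 \<le> x" for x using that c by (intro mult_right_mono) auto
 have v20: "vol S \<le> 20 * real (card S)" if "S \<subseteq> V" "conn E S" "m \<le> card S" for S
 proof -
  have "vol S \<le> 20 * card S" using vol_inc[OF that(1)] ex1(2)[OF that] by linarith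
  then show ?thesis by (metis of_nat_le_iff of_nat_mult of_nat_numeral)
 qed
 \<comment> \<open>The density of edges is known only from \<open>m\<close> vertices on, so a
   smaller set is first enlarged to exactly \<open>m\<close> vertices.\<close>
 have small: "vol S \<le> 20 * real m" if S: "S \<subseteq> L" "conn E S" "card S \<le> m" for S
 proof -
  obtain T where T: "S \<subseteq> T" "T \<subseteq> L" "conn E T" "card T = m"
   using conn_extend[OF cL fin[OF LV] S(2,1,3) L(3)] by blast
  have TV: "T \<subseteq> V" using T LV by blast
  show ?thesis using v20[OF TV T(3)] T(4) vol_mono[OF T(1) TV] by simp
 qed
 have D1: "20 / (\<psi> * c) \<le> D0" "20 * real m \<le> D0" "0 < D0" using c by (auto simp: D0_def)
 have volM: "vol S \<le> ?M" if "S \<subseteq> L" "m \<le> card S" "conn E S" for S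
 proof -
  have SV: "S \<subseteq> V" using that LV by blast
  have "vol S \<le> 20 * real (card S)" by (rule v20[OF SV that(3,2)])
  also have "... \<le> 20 * ?n" using card_mono[OF finV SV] by simp
  also have "... \<le> ?M" using c n0 by (simp add: le_divide_eq cn)
  finally show ?thesis .
 qed
 have main: "vol S * ln (exp 1 * ?M / vol S) \<le> 20 / (\<psi> * c) * card (cut E S)"
  if S: "S \<subseteq> L" "conn E S" "m \<le> card S" and a: "\<alpha> * card V \<le> card (W - S)" for S
 proof (cases "vol S = 0")
  case False
  have SV: "S \<subseteq> V" using S LV by blast
  let ?k = "real (card (S \<inter> W))"
  have "c * vol S / 20 \<le> c * card S" using v20[OF SV S(2,3)] c by simp
  then have "c * vol S / 20 \<le> ?k" using ex1(1)[OF SV S(2,3)] by linarith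
  moreover have "?k \<le> ?n" using card_mono[OF finV, of "S \<inter> W"] SV by auto
  ultimately have "c * vol S / 20 * ln (exp 1 * ?n / (c * vol S / 20)) \<le> ?k * ln (exp 1 * ?n / ?k)"
   using False c by (intro xlog_mono) auto
  also have "exp 1 * ?n / (c * vol S / 20) = exp 1 * ?M / vol S" using c by simp
  finally have "\<psi> * (c * vol S / 20 * ln (exp 1 * ?M / vol S)) \<le> \<psi> * (?k * ln (exp 1 * ?n / ?k))" using c by (intro mult_left_mono) auto
  also have "... \<le> card (cut E S)" using ex2[OF SV S(2,3) a] by simp
  finally have "\<psi> * c / 20 * (vol S * ln (exp 1 * ?M / vol S)) \<le> card (cut E S)" by simp
  then have "20 / (\<psi> * c) * (\<psi> * c / 20 * (vol S * ln (exp 1 * ?M / vol S))) \<le> 20 / (\<psi> * c) * card (cut E S)"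
   using c by (intro mult_left_mono) auto
  then show ?thesis using c by simp
 qed (use c in simp)
 have fW: "finite W" using WV finV by (rule finite_subset)
 \<comment> \<open>\<open>L\<close> has an empty cut and so violates the strict boundary estimate.
   Hence it contains all but a fraction \<alpha> of \<open>W\<close>, and a fortiori linearly many
   vertices.\<close>
 have WL: "card (W - L) < \<alpha> * card V"
 proof (rule ccontr)
  assume "\<not> ?thesis"
  then have "\<alpha> * card V \<le> card (W - L)" by simp
  then have "\<psi> * (card (L \<inter> W) * ln (exp 1 * card V / card (L \<inter> W))) < card (cut E L)"
   by (rule ex2[OF LV cL L(3)])
  moreover have "0 \<le> ln (exp 1 * card V / card (L \<inter> W))"
  proof (cases "card (L \<inter> W) = 0")
   case False
   have "card (L \<inter> W) \<le> card V" using LV by (intro card_mono finV) auto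
   then have "1 \<le> real (card V) / card (L \<inter> W)" using False by simp
   then have "1 * 1 \<le> exp 1 * (real (card V) / card (L \<inter> W))" by (intro mult_mono) auto
   then show ?thesis by (intro ln_ge_zero) simp
  qed simp
  ultimately show False unfolding cutL using c by (simp add: mult_less_0_iff)
 qed
 have inW: "card W \<le> card (W - S) + card (S \<inter> W)" for S
  using card_Un_le[of "W - S" "S \<inter> W"] by (simp add: Un_Diff_Int[of W S] Int_commute[of S])
 have deg1: "card S \<le> vol S" if S: "S \<subseteq> L" for S
 proof -
  have "1 \<le> deg x" if x: "x \<in> S" for x
  proof -
   have "L \<noteq> {x}" using L(3) c(5) by auto
   then obtain y where "{x, y} \<in> E" using conn_crossing[OF cL, of "{x}"] x S by blast
   then have "{e \<in> E. x \<in> e} \<noteq> {}" by blast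
   then show ?thesis unfolding deg_def using finE by (simp add: Suc_le_eq card_gt_0_iff)
  qed
  then have "(\<Sum>x\<in>S. 1) \<le> vol S" unfolding vol_def by (rule sum_mono)
  then show ?thesis by simp
 qed
 show vol3: "3 * \<alpha> * card V \<le> real (N.vol L)"
 proof -
  have "card (L \<inter> W) \<le> card L" using fin[OF LV] by (intro card_mono) auto
  then have "card W \<le> card (W - L) + vol L" using inW[of L] deg1[OF order_refl] by linarith
  then show ?thesis using WL aW unfolding volL[OF order_refl] by linarith
 qed
 have \<alpha>1: "4 * \<alpha> \<le> 1"
 proof -
  have "4 * \<alpha> * ?n \<le> 1 * ?n" using aW card_mono[OF finV WV] by linarith
  then show ?thesis using n0 by (simp add: mult_le_cancel_right)
 qed
 have \<Lambda>1: "1 \<le> \<Lambda>"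
 proof -
  have "\<alpha> * c \<le> 1 * 1" using \<alpha>1 c by (intro mult_mono) auto
  then have "exp 1 \<le> 20 * exp 1 / (3 * \<alpha> * c)" using c by (simp add: le_divide_eq)
  then have "ln (exp 1) \<le> \<Lambda>" unfolding \<Lambda>_def using c by (subst ln_le_cancel_iff) auto
  then show ?thesis by simp
 qed
 have D2: "D0 \<le> 2 * \<Lambda> * D0" using \<Lambda>1 D1 by (simp add: mult_le_cancel_right1)
 show "expander L ?F (20 * real m) (2 * ln (20 * exp 1 / (3 * \<alpha> * c)) * max (20 / (\<psi> * c)) (20 * m)) (20 * card V / c)"
  unfolding \<Lambda>_def[symmetric] D0_def[symmetric]
 proof
  show "conn ?F L"
   using conn_restrict[OF cL] by (rule conn_mono) auto
  show "1 \<le> ?M" using n0 c cn[of 1] by (simp add: le_divide_eq Suc_le_eq)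
  show "1 \<le> 20 * real m" using c(5) by simp
  show "20 * real m \<le> 2 * \<Lambda> * D0" using D1 D2 by linarith
  show "real (N.vol L) \<le> ?M" unfolding volL[OF order_refl] by (rule volM[OF order_refl L(3) cL])
  show "real (N.vol P) \<le> max (20 * real (card P)) (20 * real m)" if P: "P \<subseteq> L" "conn ?F P" for P
  proof (cases "m \<le> card P")
   case True
   have "P \<subseteq> V" using P LV by blast
   then show ?thesis using v20[OF _ connF[OF P(2)] True] volL[OF P(1)] by simp
  next
   case False
   then show ?thesis using small[OF P(1) connF[OF P(2)]] volL[OF P(1)] by simp
  qed
  fix S assume S: "S \<subseteq> L" "conn ?F S" "20 * real m \<le> N.vol S" "3 * N.vol S \<le> 2 * N.vol L"
  have cS: "conn E S" by (rule connF[OF S(2)])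
  have vS: "20 * real m \<le> vol S" "3 * vol S \<le> 2 * vol L" using S(3,4) volL[OF S(1)] volL[OF order_refl] by auto
  have SV: "S \<subseteq> V" using S(1) LV by blast
  \<comment> \<open>With fewer than \<open>m\<close> vertices, adding one neighbour would give a
    connected set of at most \<open>m\<close> vertices whose volume exceeds
    \<open>20 * m\<close>.\<close>
  have mS: "m \<le> card S"
  proof (rule ccontr)
   assume "\<not> m \<le> card S"
   then have lt: "Suc (card S) \<le> m" by simp
   have "S \<noteq> L" using L(3) lt by auto
   then obtain x y where xy: "x \<in> S" "y \<in> L - S" "{x, y} \<in> E" using conn_crossing[OF cL S(1)] cS unfolding conn_def by blast
   have cI: "conn E (insert y S)" by (rule conn_insert[OF cS xy(1,3)])
   have cc: "card (insert y S) = Suc (card S)" using xy fin[OF SV] by simp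
   have "vol (insert y S) \<le> 20 * real m" using xy S(1) lt cc by (intro small cI) auto
   moreover have "vol (insert y S) = vol {y} + vol S" using vol_Un[of "{y}" S] xy LV SV by auto
   moreover have "1 \<le> vol {y}" using deg1[of "{y}"] xy by simp
   ultimately show False using vS(1) by linarith
  qed
  have s0: "0 < real (vol S)" using vS c(5) by linarith
  have SM: "vol S \<le> ?M" by (rule volM[OF S(1) mS cS])
  have M0: "0 < ?M" using n0 c by simp
  have "vol S * ln (exp 1 * ?M / vol S) \<le> 2 * \<Lambda> * D0 * card (cut E S)"
  proof (cases "\<alpha> * card V \<le> card (W - S)")
   case True
   have "vol S * ln (exp 1 * ?M / vol S) \<le> 20 / (\<psi> * c) * card (cut E S)" by (rule main[OF S(1) cS mS True])
   also have "... \<le> 2 * \<Lambda> * D0 * card (cut E S)" by (rule mult_right_mono[OF order_trans[OF D1(1) D2]]) simp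
   finally show ?thesis .
  next
   case False
   have WS: "3 * \<alpha> * card V \<le> card (S \<inter> W)" using inW[of S] aW False by linarith
   let ?U = "L - S" and ?C = "comp E (L - S) ` (L - S)"
   have UV: "?U \<subseteq> V" using LV by blast
   have each: "vol R \<le> D0 * card (cut E R)" if R: "R \<in> ?C" for R
   proof -
    have Rc: "conn E R" "R \<subseteq> ?U" "R \<noteq> {}" using comps(3)[OF UV R] by auto
    have RL: "R \<subseteq> L" using Rc by blast
    show ?thesis
    proof (cases "m \<le> card R")
     case True
     have "card (S \<inter> W) \<le> card (W - R)" using Rc fW by (intro card_mono) auto
     moreover have "0 \<le> \<alpha> * card V" using c by simp
     ultimately have a: "\<alpha> * card V \<le> card (W - R)" using WS by linarith
     have R0: "0 < real (vol R)" using deg1[OF RL] True c(5) by linarith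
     have RM: "vol R \<le> ?M" by (rule volM[OF RL True Rc(1)])
     have "1 \<le> ln (exp 1 * ?M / vol R)" by (rule ln_exp1_ratio[OF R0 RM])
     then have "real (vol R) * 1 \<le> vol R * ln (exp 1 * ?M / vol R)" by (intro mult_left_mono) auto
     also have "... \<le> 20 / (\<psi> * c) * card (cut E R)" by (rule main[OF RL Rc(1) True a])
     also have "... \<le> D0 * card (cut E R)" using D1 by (intro mult_right_mono) auto
     finally show ?thesis by simp
    next
     case False
     have "R \<noteq> L" using Rc cS S(1) unfolding conn_def by blast
     then obtain x y where "x \<in> R" "y \<in> L - R" "{x, y} \<in> E" using conn_crossing[OF cL RL Rc(3)] by blast
     then have "cut E R \<noteq> {}" unfolding cut_def by blast
     then have "1 \<le> real (card (cut E R))" by (simp add: Suc_le_eq card_gt_0_iff)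
     then have "D0 * 1 \<le> D0 * card (cut E R)" using D1 by (intro mult_left_mono) auto
     then show ?thesis using small[OF RL Rc(1)] False D1(2) by linarith
    qed
   qed
   have cSU: "cut E ?U = cut E S"
    unfolding cut_def using closed S(1) by blast
   have "vol S \<le> 2 * vol ?U" using vS(2) vol_Diff[OF S(1) LV] by linarith
   then have "real (vol S) \<le> 2 * real (vol ?U)" by linarith
   also have "real (vol ?U) = (\<Sum>R\<in>?C. real (vol R))"
    using vol_comps[OF UV order_refl] comps(2)[OF UV] by simp
   also have "... \<le> (\<Sum>R\<in>?C. D0 * card (cut E R))" by (rule sum_mono[OF each])
   also have "... = D0 * card (cut E S)"
    using sum_cut_comps[OF UV order_refl] comps(2)[OF UV] cSU by (simp flip: sum_distrib_left of_nat_sum)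
   finally have vv: "vol S \<le> 2 * (D0 * card (cut E S))" by simp
   have "3 * \<alpha> * ?n \<le> vol S"
   proof -
    have "card (S \<inter> W) \<le> card S" using fin[OF SV] by (intro card_mono) auto
    then show ?thesis using WS deg1[OF S(1)] by linarith
   qed
   moreover have a0: "0 < 3 * \<alpha> * ?n" using c n0 by simp
   ultimately have "exp 1 * ?M / vol S \<le> exp 1 * ?M / (3 * \<alpha> * ?n)"
    using M0 s0 c(3) n0 by (intro divide_left_mono mult_pos_pos less_imp_le[OF mult_pos_pos]) simp_all
   also have "... = 20 * exp 1 / (3 * \<alpha> * c)" using n0 c by (simp add: mult_ac)
   finally have fr: "exp 1 * ?M / vol S \<le> 20 * exp 1 / (3 * \<alpha> * c)" .
   have "0 < exp 1 * ?M / vol S" by (intro divide_pos_pos mult_pos_pos M0 s0) simp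
   then have "ln (exp 1 * ?M / vol S) \<le> \<Lambda>" unfolding \<Lambda>_def using fr
    by (subst ln_le_cancel_iff) linarith+
   then have "vol S * ln (exp 1 * ?M / vol S) \<le> vol S * \<Lambda>" by (rule mult_left_mono) simp
   also have "... \<le> 2 * (D0 * card (cut E S)) * \<Lambda>" using vv by (rule mult_right_mono) (use \<Lambda>1 in simp)
   finally have "vol S * ln (exp 1 * ?M / vol S) \<le> 2 * (D0 * card (cut E S)) * \<Lambda>" .
   then show ?thesis by (simp add: mult_ac)
  qed
  then show "N.vol S * ln (exp 1 * ?M / N.vol S) \<le> 2 * \<Lambda> * D0 * card (cut ?F S)"
   unfolding volL[OF S(1)] cutF[OF S(1)] .
 qed
qed

end

section \<open>Diameter\<close>

lemma relpow_walk:
 assumes "(u, v) \<in> (links E V) ^^ k" "u \<in> V"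
 shows "\<exists>xs. walk_betw (UGraph V E) u xs v \<and> length xs = Suc k"
 using assms(1)
proof (induction k arbitrary: v)
 case 0
 then show ?case using assms(2) by (intro exI[of _ "[u]"]) (auto simp: walk_betw_def walk_def)
next
 case (Suc k)
 then obtain w where w: "(u, w) \<in> (links E V) ^^ k" "(w, v) \<in> links E V" by auto
 obtain xs where xs: "walk_betw (UGraph V E) u xs w" "length xs = Suc k" using Suc.IH[OF w(1)] by blast
 then have "walk_betw (UGraph V E) u (xs @ [v]) v"
  using w(2) by (auto simp: walk_betw_def walk_def links_def adj_def successively_append_iff)
 then show ?case using xs(2) by (intro exI[of _ "xs @ [v]"]) simp
qed

lemma graph_dist_le:
 assumes "(u, v) \<in> (links E V) ^^ k" "u \<in> V" shows "graph_dist (UGraph V E) u v \<le> k"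
 unfolding graph_dist_def by (rule Least_le) (rule relpow_walk[OF assms])

lemma relpow_links_sym:
 assumes "(u, v) \<in> (links E V) ^^ k" shows "(v, u) \<in> (links E V) ^^ k"
 using assms
proof (induction k arbitrary: v)
 case (Suc k)
 then obtain w where "(w, u) \<in> (links E V) ^^ k" "(w, v) \<in> links E V" by auto
 then show ?case using symD[OF sym_links] by (metis relpow_Suc_I2)
qed simp

lemma graph_diameter_le:
 assumes "finite V" "V \<noteq> {}" "\<And>u v. u \<in> V \<Longrightarrow> v \<in> V \<Longrightarrow> graph_dist (UGraph V E) u v \<le> K"
 shows "graph_diameter (UGraph V E) \<le> K"
proof -
 let ?S = "{graph_dist (UGraph V E) u v | u v. u \<in> V \<and> v \<in> V}"
 have "?S = (\<lambda>(u, v). graph_dist (UGraph V E) u v) ` (V \<times> V)" by auto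
 then have "finite ?S" using assms(1) by simp
 moreover have "?S \<noteq> {}" using assms(2) by auto
 ultimately show ?thesis unfolding graph_diameter_def ugraph.sel by (rule Max.boundedI) (use assms(3) in auto)
qed

context network begin

definition ball :: "'v \<Rightarrow> nat \<Rightarrow> 'v set" where "ball x k = {y. \<exists>j\<le>k. (x, y) \<in> (links E V) ^^ j}"

lemma ball_0: "ball x 0 = {x}" by (auto simp: ball_def)

lemma ball_Suc: "ball x (Suc k) = ball x k \<union> {z. \<exists>y\<in>ball x k. (y, z) \<in> links E V}"
proof
 show "ball x (Suc k) \<subseteq> ball x k \<union> {z. \<exists>y\<in>ball x k. (y, z) \<in> links E V}"
 proof
  fix z assume "z \<in> ball x (Suc k)"
  then obtain j where j: "j \<le> Suc k" "(x, z) \<in> (links E V) ^^ j" by (auto simp: ball_def)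
  show "z \<in> ball x k \<union> {z. \<exists>y\<in>ball x k. (y, z) \<in> links E V}"
  proof (cases "j \<le> k")
   case False
   then have "j = Suc k" using j by simp
   then show ?thesis using j by (auto simp: ball_def)
  qed (use j in \<open>auto simp: ball_def\<close>)
 qed
 show "ball x k \<union> {z. \<exists>y\<in>ball x k. (y, z) \<in> links E V} \<subseteq> ball x (Suc k)"
 proof
  fix z assume "z \<in> ball x k \<union> {z. \<exists>y\<in>ball x k. (y, z) \<in> links E V}"
  then consider j where "j \<le> k" "(x, z) \<in> (links E V) ^^ j"
   | j y where "j \<le> k" "(x, y) \<in> (links E V) ^^ j" "(y, z) \<in> links E V"
   unfolding ball_def by blast
  then show "z \<in> ball x (Suc k)"
  proof cases
   case 2
   then show ?thesis unfolding ball_def using relpow_Suc_I[OF 2(2,3)] by (intro CollectI exI[of _ "Suc j"]) simp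
  qed (auto simp: ball_def intro: le_SucI)
 qed
qed

lemma ball_V: "x \<in> V \<Longrightarrow> ball x k \<subseteq> V"
 by (induction k) (auto simp: ball_0 ball_Suc links_def)

lemma conn_ball: "conn E (ball x k)"
proof (induction k)
 case (Suc k)
 show ?case
 proof (rule connI)
  fix A assume A: "A \<subseteq> ball x (Suc k)" "A \<noteq> {}" "A \<noteq> ball x (Suc k)"
  show "\<exists>a\<in>A. \<exists>b\<in>ball x (Suc k) - A. {a, b} \<in> E"
  proof (cases "ball x k \<inter> A = {} \<or> ball x k \<subseteq> A")
   case False
   then obtain a b where "a \<in> ball x k \<inter> A" "b \<in> ball x k - ball x k \<inter> A" "{a, b} \<in> E"
    using conn_crossing[OF Suc.IH, of "ball x k \<inter> A"] by blast
   then show ?thesis unfolding ball_Suc by blast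
  next
   case True
   then show ?thesis
   proof
    assume e: "ball x k \<inter> A = {}"
    then obtain a where a: "a \<in> A" "a \<in> ball x (Suc k)" "a \<notin> ball x k" using A by blast
    then obtain y where y: "y \<in> ball x k" "(y, a) \<in> links E V" unfolding ball_Suc by blast
    then have "{a, y} \<in> E" by (simp add: links_def insert_commute)
    moreover have "y \<in> ball x (Suc k) - A" using y e unfolding ball_Suc by blast
    ultimately show ?thesis using a by blast
   next
    assume s: "ball x k \<subseteq> A"
    then obtain a where a: "a \<notin> A" "a \<in> ball x (Suc k)" "a \<notin> ball x k" using A by blast
    then obtain y where y: "y \<in> ball x k" "(y, a) \<in> links E V" unfolding ball_Suc by blast
    then have "{y, a} \<in> E" by (simp add: links_def)
    then show ?thesis using a y s by blast
   qed
  qed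
 next
  show "ball x (Suc k) \<noteq> {}" using Suc.IH unfolding ball_Suc conn_def by blast
 qed
qed (simp add: ball_0)

lemma vol_ball: 
 assumes x: "x \<in> V" shows "vol (ball x k) + card (cut E (ball x k)) \<le> vol (ball x (Suc k))"
proof -
 let ?T = "ball x (Suc k) - ball x k"
 have TV: "?T \<subseteq> V" using ball_V[OF x] by blast
 have "cut E (ball x k) \<subseteq> cut E ?T"
 proof
  fix e assume e: "e \<in> cut E (ball x k)"
  then obtain a b where ab: "e = {a, b}" "a \<in> ball x k" "b \<notin> ball x k" "{a, b} \<in> E" using cutE[OF pairsE] by metis
  then have "(a, b) \<in> links E V" using EV by (auto simp: links_def)
  then have "b \<in> ?T" using ab unfolding ball_Suc by blast
  then show "e \<in> cut E ?T" using ab unfolding cut_def by blast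
 qed
 then have "card (cut E (ball x k)) \<le> card (cut E ?T)" by (intro card_mono) auto
 also have "... \<le> vol ?T" by (rule cut_le_vol[OF TV])
 moreover have "vol (ball x (Suc k)) = vol (ball x k) + vol ?T"
  by (rule vol_Diff[OF _ ball_V[OF x]]) (auto simp: ball_Suc)
 ultimately show ?thesis by simp
qed

end

context expander begin

lemma cut_pos: "S \<subseteq> V \<Longrightarrow> S \<noteq> {} \<Longrightarrow> S \<noteq> V \<Longrightarrow> 1 \<le> card (cut E S)"
proof -
 assume S: "S \<subseteq> V" "S \<noteq> {}" "S \<noteq> V"
 obtain x y where "x \<in> S" "y \<in> V - S" "{x, y} \<in> E" using conn_crossing[OF connV S] by blast
 then have "cut E S \<noteq> {}" unfolding cut_def by blast
 then show ?thesis by (simp add: Suc_le_eq card_gt_0_iff)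
qed

lemma vol_le_M: "S \<subseteq> V \<Longrightarrow> real (vol S) \<le> M"
proof -
 assume "S \<subseteq> V"
 then have "vol S \<le> vol V" by (rule vol_mono) simp
 then show ?thesis using volV(1) by linarith
qed

definition radius :: real where "radius = s0 + 2 * D * ln (ln (exp 1 * M)) + 3"

text \<open>Up to volume \<open>s0\<close> a ball gains at least 1 per step. Beyond it, the quantity
  \<open>b = ln (exp 1 * M / vol)\<close> drives its own decay: the relative growth is at least
  \<open>b / D\<close>, so \<open>b\<close> shrinks by a factor 1 - 1 / (2 * D) per step. After more
  than \<open>2 * D * ln (ln (exp 1 * M))\<close> steps it would be below 1, although the volume
  never exceeds \<open>M\<close>.\<close>

lemma ball_large:
 assumes x: "x \<in> V" and \<Lambda>: "ln (exp 1 * M) \<le> D"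
 shows "\<exists>k. real k \<le> radius \<and> (ball x k = V \<or> 2 * vol V < 3 * vol (ball x k))"
proof (rule ccontr)
 assume neg: "\<not> ?thesis"
 define K1 where "K1 = nat \<lceil>s0\<rceil>"
 define i where "i = nat \<lfloor>2 * D * ln (ln (exp 1 * M))\<rfloor> + 1"
 have K1: "s0 \<le> K1" "real K1 \<le> s0 + 1" unfolding K1_def using s0 by linarith+
 let ?B = "\<lambda>k. ball x k"
 have grow: "?B k = V \<or> k \<le> vol (?B k)" for k
 proof (induction k)
  case (Suc k)
  show ?case
  proof (cases "?B k = V")
   case True
   have "?B k \<subseteq> ?B (Suc k)" unfolding ball_Suc by blast
   then have "?B (Suc k) = V" using True ball_V[OF x, of "Suc k"] by blast
   then show ?thesis by simp
  next
   case False
   have "1 \<le> card (cut E (?B k))" by (rule cut_pos[OF ball_V[OF x] _ False]) (use conn_ball[of x k] in \<open>auto simp: conn_def\<close>)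
   then show ?thesis using False Suc.IH vol_ball[OF x, of k] by linarith
  qed
 qed simp
 have D1: "1 \<le> D" using s0 by simp
 have l1: "1 \<le> ln (exp 1 * M)" using ln_exp1_ratio[of 1 M] volV by simp
 have l0: "0 \<le> 2 * D * ln (ln (exp 1 * M))" using l1 D1 by simp
 have i: "2 * D * ln (ln (exp 1 * M)) < i" "real i \<le> 2 * D * ln (ln (exp 1 * M)) + 1"
  using l0 unfolding i_def by linarith+
 have "K1 + i \<le> radius" using i K1 unfolding radius_def by simp
 then have out: "?B k \<noteq> V \<and> 3 * vol (?B k) \<le> 2 * vol V" if "k \<le> K1 + i" for k
  using neg that by (metis (no_types, lifting) le_less_linear of_nat_le_iff order_trans)
 define b where "b j = ln (exp 1 * M / vol (?B (K1 + j)))" for j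
 have vs: "s0 \<le> vol (?B (K1 + j))" if "j \<le> i" for j
  using out[of "K1 + j"] grow[of "K1 + j"] that K1 by linarith
 have "b j \<le> ln (exp 1 * M) * (1 - 1 / (2 * D)) ^ j" if "j \<le> i" for j
  using that
 proof (induction j)
  case 0
  have v1: "1 \<le> real (vol (?B K1))" using vs[of 0] s0 by simp
  then have "exp 1 * M / vol (?B K1) \<le> exp 1 * M / 1" using volV by (intro divide_left_mono) auto
  then show ?case unfolding b_def using v1 volV by (simp add: ln_mono)
 next
  case (Suc j)
  let ?v = "real (vol (?B (K1 + j)))" and ?v' = "real (vol (?B (K1 + Suc j)))"
  have v1: "1 \<le> ?v" using vs[of j] s0 Suc.prems by simp
  have vM: "?v \<le> M" by (rule vol_le_M[OF ball_V[OF x]])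
  have b1: "1 \<le> b j" unfolding b_def by (rule ln_exp1_ratio) (use v1 vM in auto)
  \<comment> \<open>With \<open>z = b j / D\<close> at most 1, the inequality 1 / (1 + z) \<le> 1 -
    z / 2 is available below; this is the role of the hypothesis on
    \<open>ln (exp 1 * M)\<close>.\<close>
  have bD: "b j \<le> D"
  proof -
   have "exp 1 * M / ?v \<le> exp 1 * M / 1" using volV v1 by (intro divide_left_mono) auto
   then have "b j \<le> ln (exp 1 * M)" unfolding b_def using v1 volV by (simp add: ln_mono)
   then show ?thesis using \<Lambda> by simp
  qed
  have o: "3 * vol (?B (K1 + j)) \<le> 2 * vol V" using out[of "K1 + j"] Suc.prems by simp
  have "s0 \<le> ?v" using vs[of j] Suc.prems by simp
  then have "?v * b j \<le> D * card (cut E (?B (K1 + j)))" unfolding b_def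
   using expansion[OF ball_V[OF x] conn_ball _ o] by simp
  then have "?v * b j / D \<le> card (cut E (?B (K1 + j)))" using D1 by (simp add: divide_le_eq mult.commute)
  moreover have "?v + card (cut E (?B (K1 + j))) \<le> ?v'" using vol_ball[OF x, of "K1 + j"] by simp
  ultimately have v': "?v * (1 + b j / D) \<le> ?v'" by (simp add: algebra_simps)
  have p: "0 < 1 + b j / D" using b1 D1 by (intro add_pos_nonneg) auto
  have "0 < ?v * (1 + b j / D)" using p v1 by simp
  then have "exp 1 * M / ?v' \<le> exp 1 * M / (?v * (1 + b j / D))" using v' volV by (intro divide_left_mono) auto
  also have "... = (exp 1 * M / ?v) * (1 / (1 + b j / D))" by simp
  finally have "b (Suc j) \<le> ln ((exp 1 * M / ?v) * (1 / (1 + b j / D)))"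
   unfolding b_def using \<open>0 < ?v * (1 + b j / D)\<close> v' volV by (intro ln_mono) auto
  also have "... = b j + ln (1 / (1 + b j / D))" unfolding b_def using p v1 volV by (subst ln_mult) (auto simp: b_def)
  also have "ln (1 / (1 + b j / D)) \<le> 1 / (1 + b j / D) - 1" using p by (intro ln_le_minus_one) simp
  also have "... \<le> - b j / (2 * D)"
  proof -
   have g: "1 / (1 + z) \<le> 1 - z / 2" if "0 \<le> z" "z \<le> 1" for z :: real
    using that mult_left_mono[of z 1 z] by (subst pos_divide_le_eq) (auto simp: algebra_simps)
   have "1 / (1 + b j / D) \<le> 1 - b j / D / 2" by (rule g) (use b1 bD D1 in auto)
   then show ?thesis by (simp add: mult.commute)
  qed
  finally have "b (Suc j) \<le> b j * (1 - 1 / (2 * D))" by (simp add: algebra_simps)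
  also have "... \<le> (ln (exp 1 * M) * (1 - 1 / (2 * D)) ^ j) * (1 - 1 / (2 * D))"
   by (rule mult_right_mono[OF Suc.IH]) (use Suc.prems D1 in auto)
  finally show ?case by (simp add: mult_ac)
 qed
 then have bi: "b i \<le> ln (exp 1 * M) * (1 - 1 / (2 * D)) ^ i" by simp
 have "1 \<le> b i" unfolding b_def
  by (rule ln_exp1_ratio) (use vs[of i] s0 vol_le_M[OF ball_V[OF x]] in auto)
 then have "1 \<le> ln (exp 1 * M) * (1 - 1 / (2 * D)) ^ i" using bi by simp
 also have "... \<le> ln (exp 1 * M) * exp (- (1 / (2 * D))) ^ i"
 proof -
  have "1 - 1 / (2 * D) \<le> exp (- (1 / (2 * D)))" using exp_ge_add_one_self[of "- (1 / (2 * D))"] by simp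
  then show ?thesis using l1 D1 by (intro mult_left_mono power_mono) auto
 qed
 also have "exp (- (1 / (2 * D))) ^ i = exp (i * - (1 / (2 * D)))" by (rule exp_of_nat_mult[symmetric])
 also have "ln (exp 1 * M) * exp (i * - (1 / (2 * D))) = exp (ln (ln (exp 1 * M))) * exp (i * - (1 / (2 * D)))"
  using l1 by (subst exp_ln) simp_all
 also have "... = exp (ln (ln (exp 1 * M)) + i * - (1 / (2 * D)))" by (rule exp_add[symmetric])
 also have "... < 1"
 proof -
  have "ln (ln (exp 1 * M)) < i / (2 * D)" using i(1) D1 by (subst pos_less_divide_eq) (auto simp: mult_ac)
  then show ?thesis by simp
 qed
 finally show False by simp
qed

theorem diameter_bound:
 assumes \<Lambda>: "ln (exp 1 * M) \<le> D"
 shows "real (graph_diameter (UGraph V E)) \<le> 2 * radius"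
proof -
 have ne: "V \<noteq> {}" using connV by (simp add: conn_def)
 have dist: "graph_dist (UGraph V E) u v \<le> nat \<lfloor>2 * radius\<rfloor>" if uv: "u \<in> V" "v \<in> V" for u v
 proof -
  obtain k where k: "real k \<le> radius" "ball u k = V \<or> 2 * vol V < 3 * vol (ball u k)"
   using ball_large[OF uv(1) \<Lambda>] by (elim exE conjE)
  obtain l where l: "real l \<le> radius" "ball v l = V \<or> 2 * vol V < 3 * vol (ball v l)"
   using ball_large[OF uv(2) \<Lambda>] by (elim exE conjE)
  have "ball u k \<inter> ball v l \<noteq> {}"
  proof
   assume e: "ball u k \<inter> ball v l = {}"
   have sub: "ball u k \<subseteq> V" "ball v l \<subseteq> V" by (rule ball_V[OF uv(1)], rule ball_V[OF uv(2)])
   have "vol (ball u k) + vol (ball v l) = vol (ball u k \<union> ball v l)" by (rule vol_Un[OF sub e, symmetric])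
   also have "... \<le> vol V" by (rule vol_mono) (use sub in simp_all)
   finally have "vol (ball u k) + vol (ball v l) \<le> vol V" .
   moreover have "ball u k \<noteq> {}" using conn_ball[of u k] unfolding conn_def by (rule conjunct1)
   moreover have "ball v l \<noteq> {}" using conn_ball[of v l] unfolding conn_def by (rule conjunct1)
   ultimately show False using k(2) l(2) e sub
    by (cases "ball u k = V \<or> ball v l = V") (blast, linarith)
  qed
  then obtain z i j where z: "i \<le> k" "(u, z) \<in> (links E V) ^^ i" "j \<le> l" "(v, z) \<in> (links E V) ^^ j"
   unfolding ball_def by blast
  have "(u, v) \<in> (links E V) ^^ (i + j)"
   using z(2) relpow_links_sym[OF z(4)] by (auto simp: relpow_add)
  then have "graph_dist (UGraph V E) u v \<le> i + j" by (rule graph_dist_le) (rule uv)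
  moreover have "real (i + j) \<le> 2 * radius" using z k l by linarith
  ultimately show ?thesis by linarith
 qed
 have "graph_diameter (UGraph V E) \<le> nat \<lfloor>2 * radius\<rfloor>" by (rule graph_diameter_le[OF finV ne dist])
 moreover have "0 \<le> radius"
 proof -
  obtain x where "x \<in> V" using ne by blast
  then show ?thesis using ball_large[OF _ \<Lambda>] by (meson of_nat_0_le_iff order_trans)
 qed
 ultimately show ?thesis by linarith
qed

end

section \<open>Circumference\<close>

abbreviation vpath :: "'v set set \<Rightarrow> 'v list \<Rightarrow> bool" where
 "vpath E xs \<equiv> xs \<noteq> [] \<and> distinct xs \<and> successively (\<lambda>a b. {a, b} \<in> E) xs"

lemma conn_path_between:
 assumes "(b, a) \<in> (links E R)\<^sup>*" "b \<in> R"
 shows "\<exists>ps. vpath E ps \<and> set ps \<subseteq> R \<and> hd ps = b \<and> last ps = a"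
 using assms(1)
proof (induction rule: rtrancl_induct)
 case base
 show ?case using assms(2) by (intro exI[of _ "[b]"]) simp
next
 case (step z z')
 then obtain ps where ps: "vpath E ps" "set ps \<subseteq> R" "hd ps = b" "last ps = z" by blast
 have zz: "{z, z'} \<in> E" "z' \<in> R" using step(2) by (auto simp: links_def)
 show ?case
 proof (cases "z' \<in> set ps")
  case True
  then obtain us vs where uv: "ps = us @ z' # vs" by (meson split_list)
  show ?thesis
   by (rule exI[of _ "us @ [z']"]) (use ps uv in \<open>auto simp: successively_append_iff hd_append split: if_splits\<close>)
 next
  case False
  then show ?thesis using ps zz
   by (intro exI[of _ "ps @ [z']"]) (auto simp: successively_append_iff)
 qed
qed

lemma conn_path: "vpath E xs \<Longrightarrow> conn E (set xs)"
proof (induction xs rule: rev_induct)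
 case (snoc x xs)
 show ?case
 proof (cases "xs = []")
  case False
  then have "conn E (set xs)" "{last xs, x} \<in> E" using snoc by (auto simp: successively_append_iff)
  then have "conn E (insert x (set xs))" using conn_insert[of E "set xs" "last xs" x] False by auto
  then show ?thesis by simp
 qed simp
qed simp

context expander begin

lemma circumference_ge:
 assumes "vpath E xs" "set xs \<subseteq> V" "3 \<le> length xs" "{last xs, hd xs} \<in> E"
 shows "length xs \<le> circumference (UGraph V E)"
proof -
 let ?G = "UGraph V E"
 have cyc: "cycle ?G xs" using assms by (auto simp: cycle_def walk_def adj_def[abs_def])
 have "{ys. cycle ?G ys} \<subseteq> {ys. set ys \<subseteq> V \<and> distinct ys}" by (auto simp: cycle_def walk_def)
 then have "finite {ys. cycle ?G ys}" using finite_subset_distinct[OF finV] by (rule finite_subset)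
 then have "finite (length ` {ys. cycle ?G ys})" by (rule finite_imageI)
 moreover have "{length ys | ys. cycle ?G ys} = length ` {ys. cycle ?G ys}" by blast
 ultimately show ?thesis unfolding circumference_def using cyc by (intro Max_ge) auto
qed

text \<open>State of a depth-first search that keeps only the heavy unexplored part: whatever leaves
  \<open>Q\<close> returns to the path, so the boundary of the remaining vertices is visible from
  the path alone. Demanding more than half of the volume makes the next component to enter
  unique.\<close>

definition probe :: "'a list \<Rightarrow> 'a set \<Rightarrow> bool" where
 "probe xs Q \<longleftrightarrow> vpath E xs \<and> set xs \<subseteq> V \<and> Q \<subseteq> V \<and> conn E Q \<and> Q \<inter> set xs = {last xs} \<and>
  (\<forall>a b. {a, b} \<in> E \<longrightarrow> a \<in> Q \<longrightarrow> b \<notin> Q \<longrightarrow> b \<in> set xs) \<and> vol V < 2 * vol Q"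

lemma last_adjacent:
 assumes "conn E Q" "y \<in> Q" "R \<in> comp E (Q - {y}) ` (Q - {y})" "Q \<subseteq> V"
 shows "\<exists>b\<in>R. {y, b} \<in> E"
proof -
 have QV: "Q - {y} \<subseteq> V" using assms(4) by blast
 note R = comps(3)[OF QV assms(3)]
 have RQ: "R \<subseteq> Q" "y \<notin> R" using R by blast+
 then have "R \<noteq> Q" using assms(2) by blast
 then obtain a b where ab: "a \<in> R" "b \<in> Q - R" "{a, b} \<in> E" using conn_crossing[OF assms(1) RQ(1)] R by blast
 have "b \<notin> Q - {y}" by (rule comp_boundary[OF QV assms(3) ab(3,1)]) (use ab in blast)
 then have "b = y" using ab by blast
 then show ?thesis using ab by (auto simp: insert_commute)
qed

text \<open>An extension enters the heavy component through a neighbour of the end of the path and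
  removes that end from \<open>Q\<close>, so \<open>card Q\<close> decreases.\<close>

lemma exhausted_probe:
 assumes "probe xs Q"
 shows "\<exists>xs Q. probe xs Q \<and> (\<forall>R\<in>comp E (Q - {last xs}) ` (Q - {last xs}). 2 * vol R \<le> vol V)"
 using assms
proof (induction "card Q" arbitrary: xs Q rule: less_induct)
 case less
 note pr = less.prems[unfolded probe_def]
 let ?y = "last xs"
 have QV: "Q - {?y} \<subseteq> V" using pr by blast
 show ?case
 proof (cases "\<forall>R\<in>comp E (Q - {?y}) ` (Q - {?y}). 2 * vol R \<le> vol V")
  case True
  then show ?thesis using less.prems by blast
 next
  case False
  then obtain R where R: "R \<in> comp E (Q - {?y}) ` (Q - {?y})" "vol V < 2 * vol R" by (meson not_le)
  have cQ: "conn E Q" "Q \<subseteq> V" and yQ: "?y \<in> Q" using pr by blast+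
  obtain b where b: "b \<in> R" "{?y, b} \<in> E" using last_adjacent[OF cQ(1) yQ R(1) cQ(2)] by blast
  have Rc: "conn E R" "R \<subseteq> Q - {?y}" using comps(3)[OF QV R(1)] by simp_all
  have bx: "b \<notin> set xs" using b Rc pr by blast
  have "probe (xs @ [b]) R"
   unfolding probe_def
  proof (intro conjI allI impI)
   show "xs @ [b] \<noteq> []" by simp
   show "distinct (xs @ [b])" using pr bx by simp
   show "successively (\<lambda>a b. {a, b} \<in> E) (xs @ [b])" using pr b by (simp add: successively_append_iff)
   show "set (xs @ [b]) \<subseteq> V" "R \<subseteq> V" using pr b Rc by auto
   show "conn E R" by (rule Rc)
   show "R \<inter> set (xs @ [b]) = {last (xs @ [b])}" using pr b Rc by auto
   show "vol V < 2 * vol R" by (rule R)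
   fix u v assume uv: "{u, v} \<in> E" "u \<in> R" "v \<notin> R"
   have "v \<notin> Q - {?y}" by (rule comp_boundary[OF QV R(1) uv])
   moreover have "u \<in> Q" using uv Rc by blast
   ultimately have "v \<in> set xs" using pr uv(1) by auto
   then show "v \<in> set (xs @ [b])" by simp
  qed
  moreover have "card R < card Q" using Rc yQ fin[OF cQ(2)] by (intro psubset_card_mono) auto
  ultimately show ?thesis using less.hyps by blast
 qed
qed

text \<open>Once the probe is exhausted, every remaining component is adjacent to the end of \<open>xs\<close>, so an edge from
 it back to an early vertex of \<open>xs\<close> would close a long cycle.\<close>

theorem circumference_bound:
 assumes s20: "20 \<le> s0" and big: "4 * D * s0 < vol V"
 shows "vol V \<le> 80 * D * circumference (UGraph V E)"
proof -
 define c where "c = circumference (UGraph V E)"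
 have D1: "1 \<le> D" using s0 by simp
 have "4 * s0 * 1 \<le> 4 * s0 * D" using D1 s0 by (intro mult_left_mono) auto
 then have big4: "4 * s0 < vol V" using big by (simp add: mult_ac)
 obtain x where x: "x \<in> V" using connV by (auto simp: conn_def)
 have "0 < vol V" using big4 s0 by simp
 then have p0: "probe [x] V" using x connV by (auto simp: probe_def dest!: EV)
 obtain xs Q where pQ: "probe xs Q" and sm: "\<forall>R\<in>comp E (Q - {last xs}) ` (Q - {last xs}). 2 * vol R \<le> vol V"
  using exhausted_probe[OF p0] by (elim exE conjE)
 note pr = pQ[unfolded probe_def]
 define y where "y = last xs"
 define Z where "Z = Q - {y}"
 \<comment> \<open>At least 1, so that \<open>P\<close> contains the end of the path even in an
   acyclic graph, whose circumference is 0.\<close>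
 define c' where "c' = max c 1"
 define P where "P = set (drop (length xs - c') xs)"
 let ?C = "comp E Z ` Z"
 have cQ: "conn E Q" "Q \<subseteq> V" and yQ: "y \<in> Q" using pr unfolding y_def by blast+
 have ZV: "Z \<subseteq> V" using cQ unfolding Z_def by blast
 have xs: "vpath E xs" "set xs \<subseteq> V" using pr by blast+
 have dne: "drop (length xs - c') xs \<noteq> []" using xs(1) by (cases xs) (auto simp: c'_def)
 \<comment> \<open>Going from the end of \<open>xs\<close> through \<open>R\<close> back to
   \<open>xs ! i\<close> closes a cycle longer than the part of \<open>xs\<close> from
   \<open>i\<close> on. Hence \<open>i\<close> is among the last \<open>c'\<close>
   positions.\<close>
 have near: "xs ! i \<in> P" if i: "i < length xs" and R: "R \<in> ?C" and a: "a \<in> R" "{xs ! i, a} \<in> E" for i R a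
 proof -
  have "length xs - c' \<le> i"
  proof (cases "i = length xs - 1")
   case False
   then have i2: "i < length xs - 1" using i by simp
   have Rc: "conn E R" "R \<subseteq> Z" using comps(3)[OF ZV R] by simp_all
   obtain b where b: "b \<in> R" "{y, b} \<in> E" using last_adjacent[OF cQ(1) yQ R[unfolded Z_def] cQ(2)] by blast
   have "(b, a) \<in> (links E R)\<^sup>*" using Rc(1) a(1) b(1) unfolding conn_def by blast
   then obtain ps where ps: "vpath E ps" "set ps \<subseteq> R" "hd ps = b" "last ps = a"
    using conn_path_between[OF _ b(1)] by blast
   let ?ys = "drop i xs @ ps"
   have di: "drop i xs \<noteq> []" "last (drop i xs) = y" "hd (drop i xs) = xs ! i"
    using i by (auto simp: y_def hd_drop_conv_nth)
   have xZ: "set xs \<inter> Z = {}" using pr unfolding Z_def y_def by blast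
   have "length ?ys \<le> c"
    unfolding c_def
   proof (rule circumference_ge)
    have "set (drop i xs) \<inter> set ps = {}" using xZ set_drop_subset[of i xs] ps(2) Rc(2) by blast
    moreover have "successively (\<lambda>a b. {a, b} \<in> E) (drop i xs)"
     using xs(1) successively_append_iff[of _ "take i xs" "drop i xs"] by auto
    ultimately show "vpath E ?ys" using xs(1) ps di b by (auto simp: successively_append_iff)
    show "set ?ys \<subseteq> V" using xs(2) set_drop_subset[of i xs] ps(2) Rc(2) ZV by auto
    show "3 \<le> length ?ys"
    proof -
     have "1 \<le> length ps" using ps(1) by (simp add: Suc_le_eq)
     then show ?thesis using i2 by simp
    qed
    show "{last ?ys, hd ?ys} \<in> E" using ps di a by (simp add: insert_commute)
   qed
   then show ?thesis using i by (simp add: c'_def)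
  qed (use i in \<open>auto simp: c'_def\<close>)
  then have "xs ! i = drop (length xs - c') xs ! (i - (length xs - c'))" "i - (length xs - c') < length (drop (length xs - c') xs)"
   using i by auto
  then show ?thesis unfolding P_def by (metis nth_mem)
 qed
 have PV: "P \<subseteq> V" using xs(2) set_drop_subset[of "length xs - c'" xs] unfolding P_def by blast
 have cP: "conn E P"
  unfolding P_def
 proof (rule conn_path, intro conjI)
  show "successively (\<lambda>a b. {a, b} \<in> E) (drop (length xs - c') xs)"
   using xs(1) successively_append_iff[of _ "take (length xs - c') xs" "drop (length xs - c') xs"] by auto
 qed (use xs dne in auto)
 have "card P \<le> length (drop (length xs - c') xs)" unfolding P_def by (rule card_length)
 then have "real (card P) \<le> c'" by (simp add: P_def)
 then have volP: "vol P \<le> max (20 * real c') s0" using sparse[OF PV cP] by linarith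
 \<comment> \<open>An edge leaving the remaining vertices ends on the path, by the invariant of the
   search, and then among its last \<open>c'\<close> vertices. So their boundary is bounded by the
   volume of a short path, which \<open>sparse\<close> controls.\<close>
 have "cut E Z \<subseteq> cut E P"
 proof
  fix e assume "e \<in> cut E Z"
  then obtain a b where ab: "e = {a, b}" "a \<in> Z" "b \<notin> Z" "{a, b} \<in> E" using cutE[OF pairsE] by metis
  have aQ: "a \<in> Q" "a \<noteq> y" using ab unfolding Z_def by auto
  have "b \<in> set xs"
  proof (cases "b \<in> Q")
   case True
   then have "b = y" using ab unfolding Z_def by blast
   then show ?thesis using xs(1) unfolding y_def by simp
  next
   case False
   then show ?thesis using pr ab(4) aQ by blast
  qed
  then obtain i where i: "i < length xs" "xs ! i = b" by (auto simp: in_set_conv_nth)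
  have "a \<in> comp E Z a" "comp E Z a \<in> ?C" using ab by auto
  then have "b \<in> P" using near[OF i(1), of "comp E Z a" a] ab(4) i(2) by (simp add: insert_commute)
  moreover have "a \<notin> P"
  proof
   assume "a \<in> P"
   then have "a \<in> set xs" unfolding P_def by (rule in_set_dropD)
   then show False using pr aQ unfolding y_def by blast
  qed
  ultimately show "e \<in> cut E P" using ab unfolding cut_def by blast
 qed
 then have "card (cut E Z) \<le> card (cut E P)" by (intro card_mono) auto
 then have cutZ: "real (card (cut E Z)) \<le> max (20 * real c') s0" using cut_le_vol[OF PV] volP by linarith
 have each: "real (vol R) \<le> D * card (cut E R)" if R: "R \<in> ?C" for R
 proof -
  have Rc: "conn E R" "R \<subseteq> Z" "R \<noteq> {}" using comps(3)[OF ZV R] by simp_all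
  have RV: "R \<subseteq> V" using Rc ZV by blast
  have s: "2 * vol R \<le> vol V" using R unfolding Z_def y_def by (rule bspec[OF sm])
  show ?thesis
  proof (cases "s0 \<le> vol R")
   case True
   have "1 \<le> ln (exp 1 * M / vol R)" by (rule ln_exp1_ratio) (use True s0 vol_le_M[OF RV] in auto)
   then have "real (vol R) * 1 \<le> vol R * ln (exp 1 * M / vol R)" by (intro mult_left_mono) auto
   also have "... \<le> D * card (cut E R)" by (rule expansion[OF RV Rc(1) True]) (use s in simp)
   finally show ?thesis by simp
  next
   case False
   have "R \<noteq> V" using Rc(2) yQ cQ(2) unfolding Z_def by blast
   then have "1 \<le> real (card (cut E R))" using cut_pos[OF RV Rc(3)] by simp
   then have "D * 1 \<le> D * card (cut E R)" using D1 by (intro mult_left_mono) auto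
   then show ?thesis using False s0 by linarith
  qed
 qed
 have "real (vol Z) = (\<Sum>R\<in>?C. real (vol R))" using vol_comps[OF ZV order_refl] comps(2)[OF ZV] by simp
 also have "... \<le> (\<Sum>R\<in>?C. D * card (cut E R))" by (rule sum_mono[OF each])
 also have "... = D * card (cut E Z)"
  using sum_cut_comps[OF ZV order_refl] comps(2)[OF ZV] by (simp flip: sum_distrib_left of_nat_sum)
 also have "... \<le> D * max (20 * real c') s0" using cutZ D1 by (intro mult_left_mono) auto
 finally have vZ: "real (vol Z) \<le> D * max (20 * real c') s0" .
 have "vol Q = vol {y} + vol Z" unfolding Z_def by (rule vol_Diff) (use yQ cQ in auto)
 moreover have "real (vol {y}) \<le> s0" using sparse[of "{y}"] yQ cQ s20 by auto
 moreover have "vol V < 2 * vol Q" using pr by blast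
 ultimately have "real (vol V) < 4 * vol Z" using big4 by linarith
 then have v: "vol V < 4 * D * max (20 * real c') s0" using vZ by simp
 \<comment> \<open>If the maximum were \<open>s0\<close>, the upper bound for \<open>vol V\<close>
   would contradict \<open>big\<close>. Because \<open>s0\<close> is at least 20, this also covers
   \<open>c' = 1\<close> for an acyclic graph.\<close>
 have "max (20 * real c') s0 = 20 * real c"
 proof (rule ccontr)
  assume "\<not> ?thesis"
  then have "max (20 * real c') s0 = s0" using s20 by (auto simp: c'_def max_def split: if_splits)
  then show False using v big by simp
 qed
 then show ?thesis using v unfolding c_def by simp
qed

end

section \<open>Mixing time\<close>

context network begin

definition nbr :: "'v \<Rightarrow> 'v set" where "nbr x = {z. {x, z} \<in> E}"

definition lazy :: "('v \<Rightarrow> real) \<Rightarrow> 'v \<Rightarrow> real" where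
 "lazy f x = f x / 2 + (\<Sum>z\<in>nbr x. f z) / (2 * real (deg x))"

text \<open>Weighting by degrees, the reversible measure up to normalisation, makes
  \<open>lazy\<close> self-adjoint.\<close>

definition ip :: "('v \<Rightarrow> real) \<Rightarrow> ('v \<Rightarrow> real) \<Rightarrow> real" where
 "ip f g = (\<Sum>x\<in>V. real (deg x) * f x * g x)"

lemma nbr_V: "nbr x \<subseteq> V" using EV by (auto simp: nbr_def)

lemma finite_nbr [simp]: "finite (nbr x)" by (rule fin[OF nbr_V])

lemma edge_V: "{x, z} \<in> E \<Longrightarrow> z \<in> V"
 using EV[of "{x, z}"] by simp

lemma card_nbr: "card (nbr x) = deg x"
 unfolding nbr_def deg_def by (rule card_neighbourhood[OF pairsE])

lemma sum_nbr_swap: "(\<Sum>x\<in>V. \<Sum>z\<in>nbr x. F x z) = (\<Sum>x\<in>V. \<Sum>z\<in>nbr x. F z x)"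
proof -
 have "(\<Sum>x\<in>V. \<Sum>z\<in>nbr x. F x z) = (\<Sum>(x, z)\<in>Sigma V nbr. F x z)" using finV by (simp add: sum.Sigma)
 also have "... = (\<Sum>(x, z)\<in>Sigma V nbr. F z x)"
  by (rule sum.reindex_bij_witness[where i = prod.swap and j = prod.swap]) (auto simp: nbr_def insert_commute dest: edge_V)
 also have "... = (\<Sum>x\<in>V. \<Sum>z\<in>nbr x. F z x)" using finV by (simp add: sum.Sigma)
 finally show ?thesis .
qed

lemma deg_lazy:
 fixes f :: "'v \<Rightarrow> real"
 shows "deg x * lazy f x = (deg x * f x + (\<Sum>z\<in>nbr x. f z)) / 2"
proof (cases "deg x = 0")
 case True
 then have "nbr x = {}" using card_nbr[of x] by simp
 then show ?thesis using True by simp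
next
 case False
 then show ?thesis by (simp add: lazy_def field_simps)
qed

lemma ip_lazy_expand: "2 * ip (lazy f) g = ip f g + (\<Sum>x\<in>V. \<Sum>z\<in>nbr x. f z * g x)"
proof -
 have "2 * (deg x * lazy f x * g x) = deg x * f x * g x + (\<Sum>z\<in>nbr x. f z * g x)" for x
 proof -
  have "2 * (deg x * lazy f x * g x) = 2 * (deg x * lazy f x) * g x" by (simp only: mult.assoc)
  also have "... = (deg x * f x + (\<Sum>z\<in>nbr x. f z)) * g x" unfolding deg_lazy[of x f] by simp
  finally show ?thesis by (simp add: distrib_right sum_distrib_right)
 qed
 then show ?thesis unfolding ip_def sum_distrib_left by (simp add: sum.distrib)
qed

lemma ip_commute: "ip f g = ip g f" unfolding ip_def by (simp add: mult_ac)

lemma ip_lazy: "ip (lazy f) g = ip f (lazy g)"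
proof -
 have "2 * ip (lazy f) g = 2 * ip (lazy g) f"
  unfolding ip_lazy_expand using ip_commute[of f g] sum_nbr_swap[of "\<lambda>x z. f z * g x"] by (simp add: mult.commute)
 then show ?thesis using ip_commute[of f "lazy g"] by simp
qed

lemma ip_diff: "ip (\<lambda>x. f x - g x) h = ip f h - ip g h" "ip h (\<lambda>x. f x - g x) = ip h f - ip h g"
 unfolding ip_def by (simp_all add: algebra_simps sum_subtractf)

lemma ip_self: "(\<Sum>x\<in>V. real (deg x) * (g x * g x)) = ip g g"
 unfolding ip_def by (simp add: mult.assoc)

text \<open>\<open>ip (lazy g) g\<close> is a quarter of the sum of
  \<open>(g x + g z)\<^sup>2\<close> over ordered adjacent pairs, and its difference from
  \<open>ip g g\<close> is a quarter of the sum of \<open>(g x - g z)\<^sup>2\<close>.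
  Non-negativity is what laziness buys; without it the operator may have negative
  eigenvalues.\<close>

lemma lazy_psd: "0 \<le> ip (lazy g) g" and lazy_contracts: "ip (lazy g) g \<le> ip g g"
proof -
 let ?X = "\<Sum>x\<in>V. \<Sum>z\<in>nbr x. g z * g x"
 have sw: "(\<Sum>x\<in>V. \<Sum>z\<in>nbr x. g z * g z) = ip g g"
  using sum_nbr_swap[of "\<lambda>x z. g z * g z"] ip_self[of g] by (simp add: card_nbr)
 have "0 \<le> (\<Sum>x\<in>V. \<Sum>z\<in>nbr x. (g x + g z)\<^sup>2)" by (intro sum_nonneg) auto
 also have "... = (\<Sum>x\<in>V. \<Sum>z\<in>nbr x. g x * g x + g z * g z + 2 * (g z * g x))"
  by (intro sum.cong refl) (simp add: power2_eq_square algebra_simps)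
 also have "... = 2 * ip g g + 2 * ?X" by (simp add: sum.distrib ip_self card_nbr sw flip: sum_distrib_left)
 finally show "0 \<le> ip (lazy g) g" using ip_lazy_expand[of g g] by simp
 have "0 \<le> (\<Sum>x\<in>V. \<Sum>z\<in>nbr x. (g x - g z)\<^sup>2)" by (intro sum_nonneg) auto
 also have "... = (\<Sum>x\<in>V. \<Sum>z\<in>nbr x. g x * g x + g z * g z - 2 * (g z * g x))"
  by (intro sum.cong refl) (simp add: power2_eq_square algebra_simps)
 also have "... = 2 * ip g g - 2 * ?X" by (simp add: sum.distrib sum_subtractf ip_self card_nbr sw flip: sum_distrib_left)
 finally show "ip (lazy g) g \<le> ip g g" using ip_lazy_expand[of g g] by simp
qed

lemma lazy_diff: "lazy (\<lambda>y. f y - g y) x = lazy f x - lazy g x"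
 unfolding lazy_def by (simp add: sum_subtractf diff_divide_distrib)

text \<open>The sequence \<open>\<langle>P\<^sup>k f, f\<rangle>\<close> is convex and decreasing, so its decrements are at most \<open>\<parallel>f\<parallel>\<^sup>2 / k\<close>.\<close>

lemma energy_decay:
 shows "2 * S * (\<Sum>u\<in>{S..<S + T}. ip (\<lambda>x. (lazy ^^ u) f x - (lazy ^^ Suc u) f x) (\<lambda>x. (lazy ^^ u) f x - (lazy ^^ Suc u) f x)) \<le> ip f f"
proof -
 define w where "w u = (lazy ^^ u) f" for u
 define c where "c k = ip (w k) f" for k
 define b where "b k = c k - c (Suc k)" for k
 have wS: "w (Suc u) = lazy (w u)" for u by (simp add: w_def)
 \<comment> \<open>By self-adjointness only the total number of steps on the two sides
   matters.\<close>
 have cc: "c (i + j) = ip (w i) (w j)" for i j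
 proof (induction j arbitrary: i)
  case 0 show ?case by (simp add: c_def w_def)
 next
  case (Suc j)
  have "c (i + Suc j) = c (Suc i + j)" by simp
  also have "... = ip (lazy (w i)) (w j)" using Suc.IH[of "Suc i"] by (simp add: wS)
  finally show ?case by (simp add: ip_lazy wS)
 qed
 have e0: "c (2 * u) = ip (w u) (w u)" "c (Suc (2 * u)) = ip (lazy (w u)) (w u)" "c (Suc (Suc (2 * u))) = ip (lazy (w u)) (lazy (w u))"
  "c (Suc (Suc (Suc (2 * u)))) = ip (lazy (lazy (w u))) (lazy (w u))" for u
  using cc[of u u] cc[of "Suc u" u] cc[of "Suc u" "Suc u"] cc[of "Suc (Suc u)" "Suc u"] by (simp_all add: wS mult_2)
 \<comment> \<open>The second differences of \<open>c\<close> at even places are squared norms of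
   increments; at odd places they are the quadratic form of \<open>lazy\<close> on increments. Both
   are non-negative, so \<open>b\<close> decreases, and the squared norms telescope.\<close>
 have sq: "b (2 * u) - b (Suc (2 * u)) = ip (\<lambda>x. w u x - w (Suc u) x) (\<lambda>x. w u x - w (Suc u) x)" for u
  unfolding b_def e0 wS ip_diff using ip_commute[of "w u" "lazy (w u)"] by simp
 have sq0: "0 \<le> ip g g" for g unfolding ip_def by (intro sum_nonneg) (auto simp: mult.assoc)
 have odd: "b (Suc (Suc (2 * u))) \<le> b (Suc (2 * u))" for u
 proof -
  let ?g = "\<lambda>x. w u x - lazy (w u) x"
  have lin: "lazy ?g = (\<lambda>x. lazy (w u) x - lazy (lazy (w u)) x)"
   by (rule ext) (rule lazy_diff)
  have c4: "c (Suc (Suc (Suc (2 * u)))) = ip (lazy (lazy (w u))) (lazy (w u))" by (rule e0)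
  have "0 \<le> ip (lazy ?g) ?g" by (rule lazy_psd)
  also have "... = ip (lazy (w u)) (w u) - ip (lazy (w u)) (lazy (w u)) - (ip (lazy (lazy (w u))) (w u) - ip (lazy (lazy (w u))) (lazy (w u)))"
   unfolding lin ip_diff by simp
  also have "ip (lazy (lazy (w u))) (w u) = ip (lazy (w u)) (lazy (w u))" by (rule ip_lazy)
  finally show ?thesis unfolding b_def e0(2,3) c4 by simp
 qed
 have dec1: "b (Suc k) \<le> b k" for k
 proof (cases "even k")
  case True
  then obtain u where "k = 2 * u" by blast
  then show ?thesis using sq[of u] sq0[of "\<lambda>x. w u x - w (Suc u) x"] by simp
 next
  case False
  then obtain u where "k = Suc (2 * u)" by (metis oddE Suc_eq_plus1)
  then show ?thesis using odd[of u] by simp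
 qed
 have dec: "b (k + i) \<le> b k" for k i by (induction i) (auto intro: order_trans[OF dec1])
 have ev: "0 \<le> b (2 * u)" for u unfolding b_def e0 using lazy_contracts[of "w u"] by simp
 have b0: "0 \<le> b k" for k using ev[of k] dec[of k k] by (simp add: mult_2)
 have tel: "(\<Sum>u\<in>{S..<S + n}. b (2 * u) - b (Suc (2 * u))) \<le> b (2 * S) - b (2 * (S + n))" for n
 proof (induction n)
  case (Suc n)
  then show ?case using dec1[of "Suc (2 * (S + n))"] by simp
 qed simp
 have csum: "(\<Sum>k<n. b k) = c 0 - c n" for n unfolding b_def by (rule sum_lessThan_telescope')
 have "2 * S * b (2 * S) = (\<Sum>k<2 * S. b (2 * S))" by simp
 also have "... \<le> (\<Sum>k<2 * S. b k)"
 proof (rule sum_mono)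
  fix k assume "k \<in> {..<2 * S}"
  then show "b (2 * S) \<le> b k" using dec[of k "2 * S - k"] by simp
 qed
 also have "... = c 0 - c (2 * S)" by (rule csum)
 also have "... \<le> ip f f" using sq0[of "w S"] unfolding e0 by (simp add: c_def w_def)
 finally have bS: "2 * S * b (2 * S) \<le> ip f f" .
 have "(\<Sum>u\<in>{S..<S + T}. ip (\<lambda>x. w u x - w (Suc u) x) (\<lambda>x. w u x - w (Suc u) x)) \<le> b (2 * S)"
  using tel[of T] b0[of "2 * (S + T)"] by (simp add: sq)
 then have "2 * S * (\<Sum>u\<in>{S..<S + T}. ip (\<lambda>x. w u x - w (Suc u) x) (\<lambda>x. w u x - w (Suc u) x)) \<le> 2 * S * b (2 * S)"
  by (intro mult_left_mono) auto
 then show ?thesis using bS unfolding w_def by linarith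
qed

lemma lazy_mono: "(\<And>z. z \<in> V \<Longrightarrow> f z \<le> g z) \<Longrightarrow> x \<in> V \<Longrightarrow> lazy f x \<le> lazy g x"
 unfolding lazy_def by (intro add_mono divide_right_mono sum_mono) (auto dest: subsetD[OF nbr_V])

lemma lazy_sum: "lazy (\<lambda>y. \<Sum>j\<in>J. q j y) x = (\<Sum>j\<in>J. lazy (q j) x)"
proof -
 have "(\<Sum>z\<in>nbr x. \<Sum>j\<in>J. q j z) = (\<Sum>j\<in>J. \<Sum>z\<in>nbr x. q j z)" by (rule sum.swap)
 then show ?thesis unfolding lazy_def by (simp only: sum.distrib sum_divide_distrib)
qed

lemma lazy_add_const: "0 < deg x \<Longrightarrow> lazy (\<lambda>y. (a::real) + f y) x = a + lazy f x"
proof -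
 assume d: "0 < deg x"
 have "(\<Sum>z\<in>nbr x. a + f z) = deg x * a + (\<Sum>z\<in>nbr x. f z)" by (simp add: sum.distrib card_nbr)
 then show ?thesis unfolding lazy_def using d by (simp add: add_divide_distrib)
qed

text \<open>One step of the walk killed on \<open>A\<close>. Applied \<open>j\<close> times to the
  indicator of the complement of \<open>A\<close>, it gives the probability that the walk avoids
  \<open>A\<close> up to time \<open>j\<close>.\<close>

definition kill :: "'v set \<Rightarrow> ('v \<Rightarrow> real) \<Rightarrow> 'v \<Rightarrow> real" where
 "kill A f x = (if x \<in> A then 0 else lazy f x)"

lemma ip_kill:
 assumes "\<And>y. y \<in> A \<Longrightarrow> f y = 0" "\<And>y. y \<in> A \<Longrightarrow> g y = 0"
 shows "ip (kill A f) g = ip f (kill A g)"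
proof -
 have "ip (kill A f) g = ip (lazy f) g" unfolding ip_def kill_def using assms(2) by (intro sum.cong refl) auto
 also have "... = ip f (lazy g)" by (rule ip_lazy)
 also have "... = ip f (kill A g)" unfolding ip_def kill_def using assms(1) by (intro sum.cong refl) auto
 finally show ?thesis .
qed

lemma kill_pow_0: "(\<And>y. y \<in> A \<Longrightarrow> f y = 0) \<Longrightarrow> y \<in> A \<Longrightarrow> (kill A ^^ j) f y = 0"
 by (cases j) (auto simp: kill_def)

lemma ip_kill_pow:
 assumes "\<And>y. y \<in> A \<Longrightarrow> f y = 0" "\<And>y. y \<in> A \<Longrightarrow> g y = 0"
 shows "ip ((kill A ^^ j) f) g = ip f ((kill A ^^ j) g)"
 using assms(1)
proof (induction j arbitrary: f)
 case (Suc j)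
 have "ip ((kill A ^^ Suc j) f) g = ip ((kill A ^^ j) (kill A f)) g" by (simp add: funpow_swap1)
 also have "... = ip (kill A f) ((kill A ^^ j) g)" by (rule Suc.IH) (simp add: kill_def)
 also have "... = ip f (kill A ((kill A ^^ j) g))" by (rule ip_kill[OF Suc.prems kill_pow_0[OF assms(2)]])
 finally show ?case by simp
qed simp

lemma kill_pow_nonneg: "(\<And>y. y \<in> V \<Longrightarrow> 0 \<le> f y) \<Longrightarrow> y \<in> V \<Longrightarrow> 0 \<le> (kill A ^^ j) f y"
proof (induction j arbitrary: y)
 case (Suc j)
 have "0 \<le> lazy ((kill A ^^ j) f) y" unfolding lazy_def
  by (intro add_nonneg_nonneg divide_nonneg_nonneg sum_nonneg Suc.IH Suc.prems) (use Suc.prems subsetD[OF nbr_V] in auto)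
 then show ?case unfolding funpow.simps o_apply kill_def[of A "(kill A ^^ j) f"] by simp
qed simp

end

section \<open>Potentials of killed walks\<close>

context network begin

definition bd :: "'v set \<Rightarrow> ('v \<times> 'v) set" where
 "bd S = {(y, z). y \<in> S \<and> z \<in> V - S \<and> {y, z} \<in> E}"

lemma card_bd: "S \<subseteq> V \<Longrightarrow> card (bd S) = card (cut E S)" and finite_bd: "S \<subseteq> V \<Longrightarrow> finite (bd S)"
proof -
 assume S: "S \<subseteq> V"
 show "finite (bd S)" by (rule finite_subset[of _ "V \<times> V"]) (use S finV in \<open>auto simp: bd_def\<close>)
 have "inj_on (\<lambda>(y, z). {y, z}) (bd S)" by (auto simp: inj_on_def bd_def doubleton_eq_iff)
 moreover have "(\<lambda>(y, z). {y, z}) ` bd S = cut E S"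
 proof
  show "cut E S \<subseteq> (\<lambda>(y, z). {y, z}) ` bd S"
  proof
   fix e assume e: "e \<in> cut E S"
   then obtain y z where yz: "e = {y, z}" "y \<in> S" "z \<notin> S" "{y, z} \<in> E" using cutE[OF pairsE] by metis
   then have "(y, z) \<in> bd S" using edge_V unfolding bd_def by blast
   then show "e \<in> (\<lambda>(y, z). {y, z}) ` bd S" using yz(1) by force
  qed
 qed (auto simp: bd_def cut_def)
 ultimately show "card (bd S) = card (cut E S)" by (metis card_image)
qed

text \<open>Discrete divergence theorem: the contributions of edges inside \<open>R\<close> cancel
  in pairs.\<close>

lemma flux:
 fixes g :: "'v \<Rightarrow> real"
 assumes R: "R \<subseteq> V"
 shows "(\<Sum>y\<in>R. \<Sum>z\<in>nbr y. g y - g z) = (\<Sum>(y, z)\<in>bd R. g y - g z)"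
proof -
 have fR: "finite R" by (rule fin[OF R])
 let ?in = "Sigma R (\<lambda>y. nbr y \<inter> R)" and ?out = "Sigma R (\<lambda>y. nbr y - R)"
 have "(\<Sum>(y, z)\<in>?in. g y - g z) = (\<Sum>(y, z)\<in>?in. g z - g y)"
  by (rule sum.reindex_bij_witness[where i = prod.swap and j = prod.swap]) (auto simp: nbr_def insert_commute)
 also have "... = - (\<Sum>(y, z)\<in>?in. g y - g z)" by (simp add: sum_negf[symmetric] case_prod_beta)
 finally have z: "(\<Sum>(y, z)\<in>?in. g y - g z) = 0" by simp
 have "?out = bd R" unfolding bd_def nbr_def using edge_V by auto
 then have o: "(\<Sum>y\<in>R. \<Sum>z\<in>nbr y - R. g y - g z) = (\<Sum>(y, z)\<in>bd R. g y - g z)"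
  using fR by (simp add: sum.Sigma)
 have "(\<Sum>y\<in>R. \<Sum>z\<in>nbr y. g y - g z) = (\<Sum>y\<in>R. (\<Sum>z\<in>nbr y \<inter> R. g y - g z) + (\<Sum>z\<in>nbr y - R. g y - g z))"
  by (intro sum.cong refl) (rule sum.Int_Diff, simp)
 also have "... = (\<Sum>(y, z)\<in>?in. g y - g z) + (\<Sum>y\<in>R. \<Sum>z\<in>nbr y - R. g y - g z)"
  using fR by (simp add: sum.distrib sum.Sigma)
 finally show ?thesis using z o by simp
qed

end

text \<open>Lowering \<open>l\<close> by \<rho> / 4 raises \<open>4 * D\<^sup>2 / l\<close> by about
  \<open>D\<^sup>2 * \<rho> / l\<^sup>2\<close>, and this is at least 1 / \<rho> as long as
  \<open>l\<close> is at most \<open>D * \<rho>\<close>.\<close>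

lemma inverse_log_gain:
 fixes D l l' \<rho> :: real
 assumes "0 < \<rho>" "\<rho> \<le> 1" "1 \<le> l" "1 \<le> l'" "l \<le> D * \<rho>" "l' \<le> l - \<rho> / 4"
 shows "1 / \<rho> \<le> 4 * D\<^sup>2 / l' - 4 * D\<^sup>2 / l"
proof -
 have ll: "l' \<le> l" using assms by simp
 have "l' * l \<le> l * l" using assms ll by (intro mult_right_mono) auto
 also have "... \<le> (D * \<rho>) * (D * \<rho>)" using assms by (intro mult_mono) auto
 finally have "l' * l \<le> D\<^sup>2 * \<rho>\<^sup>2" by (simp add: power2_eq_square mult_ac)
 then have "l' * l / \<rho> \<le> D\<^sup>2 * \<rho>" using assms by (simp add: divide_le_eq power2_eq_square mult_ac)
 also have "... \<le> 4 * D\<^sup>2 * (l - l')"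
 proof -
  have "4 * D\<^sup>2 * (\<rho> / 4) \<le> 4 * D\<^sup>2 * (l - l')" using assms by (intro mult_left_mono) auto
  then show ?thesis by simp
 qed
 finally have "l' * l / \<rho> \<le> 4 * D\<^sup>2 * (l - l')" .
 then have "1 / \<rho> * (l' * l) \<le> 4 * D\<^sup>2 * (l - l')" by simp
 then have "1 / \<rho> \<le> 4 * D\<^sup>2 * (l - l') / (l' * l)" using assms by (subst pos_le_divide_eq) auto
 also have "... = 4 * D\<^sup>2 / l' - 4 * D\<^sup>2 / l" using assms by (simp add: field_simps)
 finally show ?thesis .
qed

context expander begin

text \<open>Up to constants \<open>\<Psi>\<close> is the integral of \<open>v / \<phi>(v)\<^sup>2\<close>, where the profile \<open>\<phi>(v)\<close> is \<open>1\<close> below \<open>s0\<close> and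
 \<open>v * ln (e * M / v) / D\<close> above.\<close>

definition \<Psi> :: "real \<Rightarrow> real" where
 "\<Psi> v = 2 * s0 * min v (2 * s0) + 4 * D\<^sup>2 / ln (exp 1 * M / v)"

lemma \<Psi>_upper: "0 < v \<Longrightarrow> v \<le> M \<Longrightarrow> \<Psi> v \<le> 8 * D\<^sup>2" and \<Psi>_nonneg: "0 < v \<Longrightarrow> v \<le> M \<Longrightarrow> 0 \<le> \<Psi> v"
proof -
 assume v: "0 < v" "v \<le> M"
 have l: "1 \<le> ln (exp 1 * M / v)" by (rule ln_exp1_ratio[OF v])
 have "4 * D\<^sup>2 / ln (exp 1 * M / v) \<le> 4 * D\<^sup>2 / 1" using l by (intro divide_left_mono) auto
 moreover have "2 * s0 * min v (2 * s0) \<le> 2 * s0 * (2 * s0)" using s0 by (intro mult_left_mono) auto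
 moreover have "s0 * s0 \<le> D * D" using s0 by (intro mult_mono) auto
 ultimately show "\<Psi> v \<le> 8 * D\<^sup>2" unfolding \<Psi>_def by (simp add: power2_eq_square)
 show "0 \<le> \<Psi> v" 
 proof -
  have "0 \<le> 4 * D\<^sup>2 / ln (exp 1 * M / v)" by (rule divide_nonneg_nonneg[OF _ order_trans[OF zero_le_one l]]) simp
  moreover have "0 \<le> 2 * s0 * min v (2 * s0)" using s0 v by simp
  ultimately show ?thesis unfolding \<Psi>_def by linarith
 qed
qed

text \<open>Discrete form of the differential inequality for \<Psi> when the volume grows by at
  least half of the boundary \<open>c\<close>. Above \<open>s0\<close> the logarithmic summand
  provides the gain. Below \<open>s0\<close> the linear one does; its cap at \<open>2 * s0\<close>
  is not reached there, because \<open>c\<close> is at most \<open>v\<close>.\<close>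

lemma \<Psi>_gain:
 fixes v v' c :: real
 assumes v: "1 \<le> v" "v' \<le> M" and c: "1 \<le> c" "c \<le> v" "v + c / 2 \<le> v'"
  and ex: "s0 \<le> v \<Longrightarrow> v * ln (exp 1 * M / v) \<le> D * c"
 shows "v / c \<le> \<Psi> v' - \<Psi> v"
proof -
 have vv: "v \<le> v'" "0 < v" using c v by auto
 let ?l = "ln (exp 1 * M / v)" and ?l' = "ln (exp 1 * M / v')"
 have l: "1 \<le> ?l" "1 \<le> ?l'" using vv v by (auto intro!: ln_exp1_ratio)
 have M0: "0 < M" using volV by simp
 have mn: "2 * s0 * min v (2 * s0) \<le> 2 * s0 * min v' (2 * s0)" using vv s0 by (intro mult_left_mono) auto
 have r: "exp 1 * M / v' \<le> exp 1 * M / v" using vv M0 by (intro divide_left_mono) auto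
 have lm: "?l' \<le> ?l" using r vv M0 by (intro ln_mono) auto
 have ln2: "4 * D\<^sup>2 / ?l \<le> 4 * D\<^sup>2 / ?l'" using lm l by (intro divide_left_mono) auto
 show ?thesis
 proof (cases "s0 \<le> v")
  case True
  define \<rho> where "\<rho> = c / v"
  have \<rho>: "0 < \<rho>" "\<rho> \<le> 1" using c vv by (auto simp: \<rho>_def)
  have "?l \<le> D * \<rho>" using ex[OF True] vv by (simp add: \<rho>_def le_divide_eq mult.commute)
  moreover have "?l' \<le> ?l - \<rho> / 4"
  proof -
   have p: "0 < 1 + \<rho> / 2" using \<rho> by simp
   have vr: "v * (1 + \<rho> / 2) \<le> v'" using c vv by (simp add: \<rho>_def algebra_simps)
   have p2: "0 < v * (1 + \<rho> / 2)" using p vv by simp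
   have "exp 1 * M / v' \<le> exp 1 * M / (v * (1 + \<rho> / 2))" using vr p vv M0 by (intro divide_left_mono mult_pos_pos) auto
   also have "... = (exp 1 * M / v) * (1 / (1 + \<rho> / 2))" by simp
   finally have "?l' \<le> ln ((exp 1 * M / v) * (1 / (1 + \<rho> / 2)))" using vv M0 by (intro ln_mono) auto
   also have "... = ?l + ln (1 / (1 + \<rho> / 2))" using vv M0 p by (subst ln_mult) auto
   also have "ln (1 / (1 + \<rho> / 2)) \<le> 1 / (1 + \<rho> / 2) - 1" using p by (intro ln_le_minus_one) simp
   also have "... \<le> - \<rho> / 4"
   proof -
    have "\<rho> * \<rho> \<le> \<rho> * 1" using \<rho> by (intro mult_left_mono) auto
    then have "1 \<le> (1 - \<rho> / 4) * (1 + \<rho> / 2)" using \<rho> by (simp add: algebra_simps)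
    then have "1 / (1 + \<rho> / 2) \<le> 1 - \<rho> / 4" using p by (subst pos_divide_le_eq) auto
    then show ?thesis by simp
   qed
   finally show ?thesis by simp
  qed
  ultimately have "1 / \<rho> \<le> 4 * D\<^sup>2 / ?l' - 4 * D\<^sup>2 / ?l" by (intro inverse_log_gain \<rho> l)
  then show ?thesis using mn unfolding \<Psi>_def \<rho>_def by simp
 next
  case False
  have "v + c / 2 \<le> min v' (2 * s0)" using False c by auto
  then have "2 * s0 * (v + c / 2) \<le> 2 * s0 * min v' (2 * s0)" using s0 by (intro mult_left_mono) auto
  moreover have "min v (2 * s0) = v" using False v by simp
  moreover have "s0 * 1 \<le> s0 * c" using c s0 by (intro mult_left_mono) auto
  moreover have "v / c \<le> v" using c vv by (simp add: divide_le_eq)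
  ultimately show ?thesis using ln2 False unfolding \<Psi>_def by (simp add: algebra_simps)
 qed
qed

text \<open>The superlevel sets of \<open>g\<close> are connected because each of their components must contain the source \<open>x\<close>.
 Lowering the level by \<open>4 / c\<close>, where \<open>c\<close> is the size of the boundary, adds at least \<open>c / 2\<close> to the volume.\<close>

theorem potential_bound:
 fixes g :: "'a \<Rightarrow> real"
 assumes A: "A \<subseteq> V" "A \<noteq> {}" "3 * vol (V - A) \<le> 2 * vol V"
  and g0: "\<And>y. y \<in> V \<Longrightarrow> 0 \<le> g y" "\<And>y. y \<in> A \<Longrightarrow> g y = 0" and vol0: "0 < vol V"
  and src: "\<And>y. y \<in> V - A \<Longrightarrow> (\<Sum>z\<in>nbr y. g y - g z) \<le> (if y = x then 2 else 0)"
 shows "(\<Sum>y\<in>V. deg y * g y) \<le> 54 * D\<^sup>2"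
proof -
 define sup where "sup a = {y \<in> V. a \<le> g y}" for a
 \<comment> \<open>The degree-weighted excess over the level \<open>a\<close>, that is, the integral
   of the volumes of the superlevel sets above \<open>a\<close>.\<close>
 define I where "I a = (\<Sum>y\<in>V. deg y * max 0 (g y - a))" for a
 have supV: "sup a \<subseteq> V" for a by (auto simp: sup_def)
 have supA: "sup a \<subseteq> V - A" if "0 < a" for a using that g0(2) by (force simp: sup_def)
 have fl: "(\<Sum>(y, z)\<in>bd R. g y - g z) \<le> (if x \<in> R then 2 else 0)" if R: "R \<subseteq> V - A" for R
 proof -
  have RV: "R \<subseteq> V" using R by blast
  have "(\<Sum>(y, z)\<in>bd R. g y - g z) = (\<Sum>y\<in>R. \<Sum>z\<in>nbr y. g y - g z)" by (rule flux[OF RV, symmetric])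
  also have "... \<le> (\<Sum>y\<in>R. if y = x then 2 else 0)" using R by (intro sum_mono src) auto
  also have "... = (if x \<in> R then 2 else 0)" using fin[OF RV] by simp
  finally show ?thesis .
 qed
 \<comment> \<open>A component without the source would have strictly positive outward flux, whereas
   its flux is at most 0.\<close>
 have inR: "x \<in> R" if a: "0 < a" and R: "R \<in> comp E (sup a) ` sup a" for a R
 proof (rule ccontr)
  assume xR: "x \<notin> R"
  have Rc: "conn E R" "R \<subseteq> sup a" "R \<noteq> {}" using comps(3)[OF supV R] by simp_all
  have RA: "R \<subseteq> V - A" using Rc supA[OF a] by blast
  have pos: "0 < g y - g z" if "(y, z) \<in> bd R" for y z
  proof -
   have yz: "y \<in> R" "z \<in> V" "z \<notin> R" "{y, z} \<in> E" using that by (auto simp: bd_def)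
   have "z \<notin> sup a" by (rule comp_boundary[OF supV R yz(4,1,3)])
   then have "g z < a" using yz(2) by (simp add: sup_def)
   moreover have "a \<le> g y" using yz(1) Rc(2) by (auto simp: sup_def)
   ultimately show ?thesis by simp
  qed
  have RV: "R \<subseteq> V" "R \<noteq> V" using RA A by auto
  have "bd R \<noteq> {}" using cut_pos[OF RV(1) Rc(3) RV(2)] card_bd[OF RV(1)] by auto
  then have "0 < (\<Sum>(y, z)\<in>bd R. g y - g z)" using finite_bd[OF RV(1)] pos by (intro sum_pos) auto
  then show False using fl[OF RA] xR by simp
 qed
 have cs: "conn E (sup a) \<and> x \<in> sup a" if a: "0 < a" "sup a \<noteq> {}" for a
 proof -
  have xc: "x \<in> comp E (sup a) y" if "y \<in> sup a" for y using inR[OF a(1)] that by blast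
  obtain y where y: "y \<in> sup a" using a(2) by blast
  have xs: "x \<in> sup a" using xc[OF y] comp_subset[OF y] by blast
  have "sup a \<subseteq> comp E (sup a) x"
  proof
   fix z assume z: "z \<in> sup a"
   show "z \<in> comp E (sup a) x" unfolding comp_eq[OF xc[OF z]] by simp
  qed
  then show ?thesis using conn_via_comp[OF xs] xs by blast
 qed
 have v23: "3 * vol (sup a) \<le> 2 * vol V" if "0 < a" for a
  using vol_mono[OF supA[OF that]] A(3) by (meson Diff_subset le_trans mult_le_mono2)
 \<comment> \<open>The total outward flux is at most 2, so at most half of the boundary edges drop
   by more than \<open>4 / c\<close>. The ends of the other edges join the superlevel set.\<close>
 have down: "vol (sup a) + card (cut E (sup a)) / 2 \<le> vol (sup b)"
  if a: "0 < a" "sup a \<noteq> {}" and b: "b \<le> a - 4 / card (cut E (sup a))" for a b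
 proof -
  let ?S = "sup a" let ?c = "card (cut E ?S)"
  have SV: "?S \<subseteq> V" "?S \<noteq> V" using supV supA[OF a(1)] A by auto
  have c1: "1 \<le> ?c" by (rule cut_pos[OF SV(1) a(2) SV(2)])
  let ?near = "{p \<in> bd ?S. b \<le> g (snd p)}" and ?far = "{p \<in> bd ?S. \<not> b \<le> g (snd p)}"
  have fb: "finite (bd ?S)" by (rule finite_bd[OF SV(1)])
  have d0: "0 \<le> g y - g z" if "(y, z) \<in> bd ?S" for y z using that by (auto simp: bd_def sup_def)
  have "card ?far * (4 / ?c) = (\<Sum>p\<in>?far. 4 / ?c)" by simp
  also have "... \<le> (\<Sum>p\<in>?far. g (fst p) - g (snd p))"
   using b by (intro sum_mono) (auto simp: bd_def sup_def)
  also have "... \<le> (\<Sum>p\<in>bd ?S. g (fst p) - g (snd p))" using fb d0 by (intro sum_mono2) auto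
  also have "... \<le> 2" using fl[OF supA[OF a(1)]] cs[OF a] by (simp add: case_prod_beta)
  finally have "card ?far \<le> real ?c / 2" using c1 by (simp add: field_simps)
  moreover have "card (bd ?S) = card ?near + card ?far"
   using fb by (subst card_Un_disjoint[symmetric]) (auto intro!: arg_cong[where f = card])
  moreover have "card ?near \<le> vol (sup b - ?S)"
  proof -
   have ba: "b \<le> a" using b c1 by (smt (verit) divide_nonneg_nonneg of_nat_0_le_iff)
   have "?near \<subseteq> prod.swap ` (Sigma (sup b - ?S) nbr)"
    by (auto simp: bd_def nbr_def sup_def insert_commute image_iff)
   then have "card ?near \<le> card (prod.swap ` (Sigma (sup b - ?S) nbr))"
    using fin[OF supV, of b] by (intro card_mono) auto
   also have "... \<le> card (Sigma (sup b - ?S) nbr)" using fin[OF supV, of b] by (intro card_image_le) auto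
   also have "... = vol (sup b - ?S)" using fin[OF supV, of b] by (simp add: card_nbr vol_def)
   finally show ?thesis .
  qed
  moreover have "vol (sup b) = vol ?S + vol (sup b - ?S)"
  proof (rule vol_Diff[OF _ supV])
   have "0 \<le> 4 / real ?c" by simp
   then have "b \<le> a" using b by linarith
   then show "?S \<subseteq> sup b" by (auto simp: sup_def)
  qed
  ultimately show ?thesis using card_bd[OF SV(1)] by linarith
 qed
 have D1: "1 \<le> D" using s0 by simp
 have I0: "(\<Sum>y\<in>V. deg y * g y) = I 0" unfolding I_def using g0(1) by (intro sum.cong refl) (simp add: max_absorb2)
 \<comment> \<open>Induction over the finitely many values of \<open>g\<close>, from larger levels
   to smaller ones; it will be started at the maximum of \<open>g\<close>, where the excess
   vanishes.\<close>
 have descend: "I 0 \<le> 54 * D\<^sup>2" if "a \<in> g ` V" "0 < a" "I a \<le> 6 * \<Psi> (vol (sup a))" for a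
  using that
 proof (induction "card {b \<in> g ` V. b < a}" arbitrary: a rule: less_induct)
  case less
  let ?S = "sup a" let ?c = "card (cut E ?S)" and ?v = "real (vol (sup a))"
  note a = less.prems
  have ne: "?S \<noteq> {}" using a(1) by (auto simp: sup_def)
  have SV: "?S \<subseteq> V" "?S \<noteq> V" using supV supA[OF a(2)] A by auto
  have c1: "1 \<le> ?c" by (rule cut_pos[OF SV(1) ne SV(2)])
  have cv: "real ?c \<le> ?v" using cut_le_vol[OF SV(1)] by simp
  have v1: "1 \<le> ?v" using c1 cv by linarith
  have ex: "?v * ln (exp 1 * M / ?v) \<le> D * ?c" if "s0 \<le> ?v"
   by (rule expansion[OF SV(1) _ that v23[OF a(2)]]) (use cs[OF a(2) ne] in blast)
  \<comment> \<open>Lower values of \<open>g\<close> at which the volume has already grown by half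
    of the boundary. The largest of them, or 0 if there is none, is the next level
    \<open>b\<close>.\<close>
  define T where "T = {b \<in> g ` V. b < a \<and> ?v + ?c / 2 \<le> vol (sup b)}"
  have fT: "finite T" unfolding T_def using finV by simp
  define b where "b = Max (insert 0 T)"
  have b0: "0 \<le> b" unfolding b_def using fT by simp
  have ba: "b < a" unfolding b_def using fT a(2) by (subst Max_less_iff) (auto simp: T_def)
  have ab: "a - b \<le> 4 / ?c"
  proof (rule ccontr)
   assume "\<not> ?thesis"
   then have lt: "b < a - 4 / ?c" by simp
   define a' where "a' = a - 4 / ?c"
   have a': "0 < a'" "a' < a" using lt b0 c1 unfolding a'_def by auto
   have dn: "?v + ?c / 2 \<le> vol (sup a')" by (rule down[OF a(2) ne]) (simp add: a'_def)
   have "?S \<subseteq> sup a'" using a' by (auto simp: sup_def)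
   then have ne': "sup a' \<noteq> {}" using ne by blast
   define b' where "b' = Min (g ` sup a')"
   have fs: "finite (g ` sup a')" using fin[OF supV] by simp
   have b': "b' \<in> g ` sup a'" unfolding b'_def using fs ne' by (intro Min_in) auto
   have ab': "a' \<le> b'" using b' by (auto simp: sup_def)
   have eq: "sup b' = sup a'" 
   proof
    show "sup b' \<subseteq> sup a'" using ab' by (auto simp: sup_def)
    show "sup a' \<subseteq> sup b'"
    proof
     fix y assume y: "y \<in> sup a'"
     then have "b' \<le> g y" unfolding b'_def using fs by (intro Min_le) auto
     then show "y \<in> sup b'" using y by (auto simp: sup_def)
    qed
   qed
   have "b' < a"
   proof (rule ccontr)
    assume "\<not> b' < a"
    then have "sup b' \<subseteq> sup a" by (auto simp: sup_def)
    then have "vol (sup b') \<le> vol (sup a)" by (rule vol_mono[OF _ supV])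
    then show False using dn c1 unfolding eq by linarith
   qed
   moreover have "b' \<in> g ` V" using b' supV by blast
   moreover have "?v + ?c / 2 \<le> vol (sup b')" using dn unfolding eq .
   ultimately have "b' \<in> T" unfolding T_def by blast
   then have "b' \<le> b" unfolding b_def using fT by simp
   then show False using ab' lt unfolding a'_def by simp
  qed
  \<comment> \<open>By maximality of \<open>b\<close> the volume strictly above \<open>b\<close> has
    not yet grown by more than half of the boundary, which keeps the integral from \<open>b\<close>
    to \<open>a\<close> small.\<close>
  have gap: "real (vol {y \<in> V. b < g y}) \<le> ?v + ?c / 2"
  proof (cases "\<exists>y\<in>V. b < g y \<and> g y < a")
   case False
   then have "{y \<in> V. b < g y} \<subseteq> ?S" by (auto simp: sup_def not_less)
   then have "vol {y \<in> V. b < g y} \<le> vol ?S" by (rule vol_mono[OF _ supV])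
   then show ?thesis by simp
  next
   case True
   let ?B = "{y \<in> V. b < g y}"
   have fB: "finite (g ` ?B)" "g ` ?B \<noteq> {}" using finV True by auto
   define b' where "b' = Min (g ` ?B)"
   have b': "b' \<in> g ` ?B" unfolding b'_def using fB by (rule Min_in)
   have eq: "sup b' = ?B"
   proof
    show "sup b' \<subseteq> ?B" using b' by (auto simp: sup_def)
    show "?B \<subseteq> sup b'" unfolding sup_def b'_def using fB by (auto intro!: Min_le)
   qed
   have "b' < a"
   proof -
    obtain y where "y \<in> ?B" "g y < a" using True by blast
    moreover have "b' \<le> g y" unfolding b'_def using fB \<open>y \<in> ?B\<close> by (intro Min_le) auto
    ultimately show ?thesis by simp
   qed
   moreover have "b' \<notin> T"
   proof
    assume "b' \<in> T"
    then have "b' \<le> b" unfolding b_def using fT by simp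
    then show False using b' by auto
   qed
   ultimately have "\<not> ?v + ?c / 2 \<le> vol (sup b')" using b' unfolding T_def by auto
   then show ?thesis unfolding eq by simp
  qed
  have "I b - I a = (\<Sum>y\<in>V. deg y * (max 0 (g y - b) - max 0 (g y - a)))"
   unfolding I_def by (simp add: sum_subtractf algebra_simps)
  also have "... \<le> (\<Sum>y\<in>V. if b < g y then (a - b) * deg y else 0)"
  proof (rule sum_mono)
   fix y
   have "max 0 (g y - b) - max 0 (g y - a) \<le> (if b < g y then a - b else 0)" using ba by (auto simp: max_def)
   then have "deg y * (max 0 (g y - b) - max 0 (g y - a)) \<le> deg y * (if b < g y then a - b else 0)" by (rule mult_left_mono) simp
   then show "deg y * (max 0 (g y - b) - max 0 (g y - a)) \<le> (if b < g y then (a - b) * deg y else 0)" by (simp add: mult.commute split: if_splits)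
  qed
  also have "... = (a - b) * vol {y \<in> V. b < g y}"
   unfolding vol_def using finV by (simp add: sum.inter_filter[symmetric] sum_distrib_left)
  \<comment> \<open>The levels differ by at most \<open>4 / c\<close>, and since \<open>c\<close> is
    at most \<open>v\<close> the volume in between is at most 3/2 of \<open>v\<close>.\<close>
  also have "... \<le> 4 / ?c * (3 / 2 * ?v)"
   using ab gap cv ba by (intro mult_mono) auto
  finally have Ib: "I b \<le> I a + 6 * (?v / ?c)" by simp
  show ?case
  proof (cases "b \<in> T \<and> 0 < b")
   case True
   have bT: "b \<in> g ` V" "?v + ?c / 2 \<le> vol (sup b)" using True by (auto simp: T_def)
   have "?v / ?c \<le> \<Psi> (vol (sup b)) - \<Psi> ?v"
    by (rule \<Psi>_gain[OF v1 vol_le_M[OF supV] _ cv bT(2) ex]) (use c1 in auto)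
   then have "I b \<le> 6 * \<Psi> (vol (sup b))" using Ib a(3) by simp
   moreover have "card {b' \<in> g ` V. b' < b} < card {b \<in> g ` V. b < a}"
    using finV ba bT(1) by (intro psubset_card_mono) auto
   ultimately show ?thesis using less.hyps bT(1) True by blast
  next
   case False
   have "b \<in> insert 0 T" unfolding b_def using fT by (intro Max_in) auto
   then have "b = 0" using False b0 by auto
   moreover have "?v / ?c \<le> D"
   proof (cases "s0 \<le> ?v")
    case True
    have "1 \<le> ln (exp 1 * M / ?v)" by (rule ln_exp1_ratio) (use v1 vol_le_M[OF supV] in auto)
    then have "?v * 1 \<le> ?v * ln (exp 1 * M / ?v)" by (intro mult_left_mono) auto
    also have "... \<le> D * ?c" by (rule ex[OF True])
    finally show ?thesis using c1 by (simp add: divide_le_eq)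
   next
    case False
    have "?v / ?c \<le> ?v / 1" using c1 by (intro divide_left_mono) auto
    then show ?thesis using False s0 by simp
   qed
   \<comment> \<open>The constant 54 is 6 * 8 from the bound for \<Psi> plus 6 from the last descent
     to level 0.\<close>
   moreover have "\<Psi> ?v \<le> 8 * D\<^sup>2" by (rule \<Psi>_upper) (use v1 vol_le_M[OF supV] in auto)
   moreover have "D * 1 \<le> D * D" using D1 by (intro mult_left_mono) auto
   ultimately show ?thesis using Ib a(3) by (simp add: power2_eq_square)
  qed
 qed
 define a where "a = Max (g ` V)"
 have Vne: "V \<noteq> {}" using A by blast
 have aV: "a \<in> g ` V" unfolding a_def using finV Vne by (intro Max_in) auto
 have ga: "g y \<le> a" if "y \<in> V" for y unfolding a_def using finV that by (intro Max_ge) auto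
 show ?thesis
 proof (cases "0 < a")
  case True
  have "I a = 0" unfolding I_def by (intro sum.neutral) (auto simp: ga max_absorb1)
  moreover have "0 \<le> \<Psi> (vol (sup a))"
  proof -
   have SV: "sup a \<subseteq> V" "sup a \<noteq> V" "sup a \<noteq> {}" using supV supA[OF True] A aV by (auto simp: sup_def)
   have "1 \<le> vol (sup a)" using cut_pos[OF SV(1,3,2)] cut_le_vol[OF SV(1)] by linarith
   then show ?thesis using vol_le_M[OF SV(1)] by (intro \<Psi>_nonneg) auto
  qed
  ultimately show ?thesis using descend[OF aV True] I0 by simp
 next
  case False
  then have "g y = 0" if "y \<in> V" for y using ga[OF that] g0(1)[OF that] by simp
  then show ?thesis by simp
 qed
qed

end

section \<open>From hitting times to the mixing time\<close>

context network begin

lemma lazy_minus: "lazy (\<lambda>y. - f y) x = - lazy f x"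
 unfolding lazy_def by (simp add: sum_negf)

lemma lazy_const: "0 < deg x \<Longrightarrow> lazy (\<lambda>_. a) x = a"
 using lazy_add_const[of x a "\<lambda>_. 0"] by (simp add: lazy_def)

lemma kill_mono: "(\<And>z. z \<in> V \<Longrightarrow> f z \<le> g z) \<Longrightarrow> x \<in> V \<Longrightarrow> kill A f x \<le> kill A g x"
 unfolding kill_def using lazy_mono[of f g x] by simp

end

context expander begin

lemma deg_pos: "0 < vol V \<Longrightarrow> x \<in> V \<Longrightarrow> 0 < deg x"
proof -
 assume v: "0 < vol V" and x: "x \<in> V"
 have s: "vol {x} = deg x" by (simp add: vol_def)
 show ?thesis
 proof (cases "{x} = V")
  case False
  then have "1 \<le> card (cut E {x})" using cut_pos[of "{x}"] x by simp
  then show ?thesis using cut_le_vol[of "{x}"] x s by simp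
 qed (use v s in simp)
qed

text \<open>Survival probabilities decrease in time, so \<open>T\<close> times the last one is at
  most their sum over the times below \<open>T\<close>. By reversibility this sum is the
  degree-weighted total of the Green function of the killed walk with source \<open>x\<close>, to
  which \<open>potential_bound\<close> applies.\<close>

lemma hitting_tail:
 assumes A: "A \<subseteq> V" "A \<noteq> {}" "3 * vol (V - A) \<le> 2 * vol V" and vol0: "0 < vol V" and x: "x \<in> V"
 shows "T * (kill A ^^ T) (\<lambda>y. of_bool (y \<notin> A)) x \<le> 54 * D\<^sup>2"
proof (cases "x \<in> A")
 case True
 then have "(kill A ^^ T) (\<lambda>y. of_bool (y \<notin> A)) x = 0" by (intro kill_pow_0) auto
 then show ?thesis by simp
next
 case False
 note dp = deg_pos[OF vol0]
 define u0 :: "'a \<Rightarrow> real" where "u0 = (\<lambda>y. of_bool (y \<notin> A))"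
 \<comment> \<open>The density of the point mass at \<open>x\<close> with respect to the degrees, so
   that pairing with \<open>q0\<close> by \<open>ip\<close> evaluates at \<open>x\<close>.\<close>
 define q0 where "q0 = (\<lambda>y. if y = x then 1 / real (deg x) else 0)"
 define u where "u j = (kill A ^^ j) u0" for j
 define q where "q j = (kill A ^^ j) q0" for j
 define g where "g y = (\<Sum>j<T. q j y)" for y
 have uS: "u (Suc j) = kill A (u j)" and qS: "q (Suc j) = kill A (q j)" for j by (simp_all add: u_def q_def)
 have z: "\<And>y. y \<in> A \<Longrightarrow> u0 y = 0" "\<And>y. y \<in> A \<Longrightarrow> q0 y = 0" using False by (auto simp: u0_def q0_def)
 have qA: "q j y = 0" if "y \<in> A" for j y unfolding q_def by (rule kill_pow_0[OF z(2) that])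
 have q_nn: "0 \<le> q j y" if "y \<in> V" for j y unfolding q_def by (rule kill_pow_nonneg[OF _ that]) (simp add: q0_def)
 have dec: "u (Suc j) y \<le> u j y" if "y \<in> V" for j y
  using that
 proof (induction j arbitrary: y)
  case 0
  have "lazy u0 y \<le> lazy (\<lambda>_. 1) y" by (rule lazy_mono[OF _ 0]) (simp add: u0_def)
  then show ?case using lazy_const[OF dp[OF 0], of 1] by (simp add: u_def kill_def u0_def)
 next
  case (Suc j)
  show ?case unfolding uS[of "Suc j"] uS[of j] by (rule kill_mono[OF _ Suc.prems]) (use Suc.IH uS in simp)
 qed
 have decT: "u T x \<le> u j x" if "j \<le> T" for j
  using that
 proof (induction rule: inc_induct)
  case (step n)
  show ?case by (rule order_trans[OF step.IH dec[OF x]])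
 qed simp
 have uq: "u j x = (\<Sum>y\<in>V. deg y * q j y)" for j
 proof -
  have "u j x = ip (u j) q0"
  proof -
   have "ip (u j) q0 = (\<Sum>y\<in>V. if y = x then u j x else 0)"
    unfolding ip_def q0_def using dp[OF x] by (intro sum.cong) auto
   then show ?thesis using x finV by simp
  qed
  also have "... = ip u0 (q j)" unfolding u_def q_def by (rule ip_kill_pow[OF z])
  also have "... = (\<Sum>y\<in>V. deg y * q j y)" unfolding ip_def using qA by (intro sum.cong refl) (auto simp: u0_def)
  finally show ?thesis .
 qed
 have "T * u T x = (\<Sum>j<T. u T x)" by simp
 also have "... \<le> (\<Sum>j<T. u j x)" by (intro sum_mono decT) auto
 also have "... = (\<Sum>y\<in>V. deg y * g y)" unfolding uq g_def sum_distrib_left by (rule sum.swap)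
 also have "... \<le> 54 * D\<^sup>2"
 proof (rule potential_bound[OF A _ _ vol0, of g x])
  show "0 \<le> g y" if "y \<in> V" for y unfolding g_def using q_nn[OF that] by (intro sum_nonneg) auto
  show "g y = 0" if "y \<in> A" for y unfolding g_def using qA[OF that] by simp
  fix y assume y: "y \<in> V - A"
  have "lazy g y = (\<Sum>j<T. lazy (q j) y)" unfolding g_def by (rule lazy_sum)
  also have "... = (\<Sum>j<T. q (Suc j) y)" using y by (intro sum.cong refl) (simp add: qS kill_def)
  finally have "g y - lazy g y = (\<Sum>j<T. q j y - q (Suc j) y)" unfolding g_def by (simp add: sum_subtractf)
  also have "... = q 0 y - q T y" by (rule sum_lessThan_telescope')
  finally have gl: "g y - lazy g y \<le> q0 y" using q_nn[of y T] y by (simp add: q_def)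
  \<comment> \<open>The lazy step halves the difference to the neighbours; this is why the source
    has strength 2.\<close>
  have "(\<Sum>z\<in>nbr y. g y - g z) = deg y * g y - (\<Sum>z\<in>nbr y. g z)" by (simp add: sum_subtractf card_nbr)
  also have "... = 2 * deg y * (g y - lazy g y)" using deg_lazy[of y g] by (simp add: algebra_simps)
  also have "... \<le> 2 * deg y * q0 y" using gl by (intro mult_left_mono) auto
  also have "... = (if y = x then 2 else 0)" using dp[OF x] by (simp add: q0_def)
  finally show "(\<Sum>z\<in>nbr y. g y - g z) \<le> (if y = x then 2 else 0)" .
 qed
 finally show ?thesis unfolding u_def u0_def .
qed

text \<open>Maximum principle: on \<open>A\<close> the values stay below \<open>c\<close> during the
  window, and everywhere they start below \<open>c + 1\<close>. Hence a value exceeds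
  \<open>c\<close> by at most the probability that the walk has not met \<open>A\<close>.\<close>

lemma comparison:
 assumes h: "\<And>s x. x \<in> V \<Longrightarrow> h (Suc s) x = lazy (h s) x" and vol0: "0 < vol V"
  and top: "\<And>z. z \<in> V \<Longrightarrow> h S z \<le> c + 1"
  and A: "\<And>z s. z \<in> A \<Longrightarrow> S \<le> s \<Longrightarrow> s \<le> S + T \<Longrightarrow> h s z \<le> c"
  and jx: "j \<le> T" "x \<in> V"
 shows "h (S + j) x \<le> c + (kill A ^^ j) (\<lambda>y. of_bool (y \<notin> A)) x"
 using jx
proof (induction j arbitrary: x)
 case 0
 then show ?case using top[of x] A[of x S] by auto
next
 case (Suc j)
 let ?u = "(kill A ^^ j) (\<lambda>y. of_bool (y \<notin> A))"
 show ?case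
 proof (cases "x \<in> A")
  case True
  then show ?thesis using A[of x "S + Suc j"] Suc.prems by (simp add: kill_def)
 next
  case False
  have "h (S + Suc j) x = lazy (h (S + j)) x" using h[OF Suc.prems(2), of "S + j"] by simp
  also have "... \<le> lazy (\<lambda>y. c + ?u y) x" by (rule lazy_mono[OF _ Suc.prems(2)]) (use Suc in auto)
  also have "... = c + lazy ?u x" by (rule lazy_add_const[OF deg_pos[OF vol0 Suc.prems(2)]])
  also have "lazy ?u x = (kill A ^^ Suc j) (\<lambda>y. of_bool (y \<notin> A)) x" using False by (simp add: kill_def[of A ?u])
  finally show ?thesis .
 qed
qed

text \<open>On most vertices \<open>P\<^sup>s 1\<^sub>B\<close> hardly changes during the time window. From any vertex the walk soon hits such a
 vertex with a value at most (or at least) the median, so all values are close to the median.\<close>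

lemma near_constant:
 fixes B :: "'a set" and T :: nat
 assumes B: "B \<subseteq> V" and vol0: "0 < vol V" and T: "864 * D\<^sup>2 \<le> T" and x: "x \<in> V"
 defines "h \<equiv> \<lambda>s. (lazy ^^ s) (\<lambda>y. of_bool (y \<in> B))"
 shows "\<bar>h (768 * T + T) x - vol B / vol V\<bar> \<le> 1 / 4"
proof -
 \<comment> \<open>After \<open>768 * T\<close> steps the energy estimate leaves
   \<open>T * \<E>\<close> a degree-weighted average of at most 1/1536. By Markov's inequality the
   vertices where it exceeds 1/256 carry at most one sixth of the volume.\<close>
 define S where "S = 768 * T"
 define \<delta> where "\<delta> u y = h u y - h (Suc u) y" for u y
 define \<E> where "\<E> y = (\<Sum>u\<in>{S..<S + T}. (\<delta> u y)\<^sup>2)" for y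
 define Good where "Good = {y \<in> V. T * \<E> y \<le> 1 / 256}"
 note dp = deg_pos[OF vol0]
 have hS: "h (Suc s) = lazy (h s)" for s by (simp add: h_def)
 have D1: "1 \<le> D" using s0 by simp
 have "1 * 1 \<le> D * D" using D1 by (intro mult_mono) auto
 then have T0: "0 < real T" using T by (simp add: power2_eq_square)
 have h01: "0 \<le> h s y" "h s y \<le> 1" if "y \<in> V" for s y
  using that
 proof (induction s arbitrary: y)
  case (Suc s)
  { case 1
   have "lazy (\<lambda>_. 0) y \<le> lazy (h s) y" by (rule lazy_mono[OF Suc(1) 1])
   then show ?case by (simp add: hS lazy_def) }
  { case 2
   have "lazy (h s) y \<le> lazy (\<lambda>_. 1) y" by (rule lazy_mono[OF Suc(2) 2])
   then show ?case using lazy_const[OF dp[OF 2], of 1] by (simp add: hS) }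
 qed (auto simp: h_def)
 have volr: "real (vol U) = (\<Sum>y\<in>U. real (deg y))" for U by (simp add: vol_def)
 have "2 * real S * (\<Sum>u\<in>{S..<S + T}. ip (\<delta> u) (\<delta> u)) \<le> ip (\<lambda>y. of_bool (y \<in> B)) (\<lambda>y. of_bool (y \<in> B))"
  using energy_decay[where S = S and T = T and f = "\<lambda>y. of_bool (y \<in> B)"] unfolding \<delta>_def[abs_def] h_def .
 also have "... \<le> vol V" unfolding ip_def volr by (intro sum_mono) auto
 also have "(\<Sum>u\<in>{S..<S + T}. ip (\<delta> u) (\<delta> u)) = (\<Sum>y\<in>V. deg y * \<E> y)"
  unfolding ip_def \<E>_def sum_distrib_left by (subst sum.swap) (simp add: power2_eq_square mult.assoc)
 finally have en: "2 * real S * (\<Sum>y\<in>V. deg y * \<E> y) \<le> vol V" .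
 have \<E>0: "0 \<le> \<E> y" for y unfolding \<E>_def by (intro sum_nonneg) auto
 have volbad: "6 * vol (V - Good) \<le> vol V"
 proof -
  have "real (vol (V - Good)) * (1 / 256) = (\<Sum>y\<in>V - Good. deg y * (1 / 256))" unfolding volr by (simp add: sum_divide_distrib)
  also have "... \<le> (\<Sum>y\<in>V - Good. deg y * (T * \<E> y))"
   by (intro sum_mono mult_left_mono) (auto simp: Good_def)
  also have "... \<le> (\<Sum>y\<in>V. deg y * (T * \<E> y))" using finV \<E>0 by (intro sum_mono2) auto
  also have "... = T * (\<Sum>y\<in>V. deg y * \<E> y)" by (simp add: sum_distrib_left mult_ac)
  finally have "real (vol (V - Good)) * (1 / 256) \<le> T * (\<Sum>y\<in>V. deg y * \<E> y)" .
  then have "1536 * (real (vol (V - Good)) * (1 / 256)) \<le> vol V" using en by (simp add: S_def)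
  then show ?thesis by linarith
 qed
 \<comment> \<open>By Cauchy-Schwarz the square of a sum of at most \<open>T\<close> increments is
   at most \<open>T * \<E> y\<close>, which is at most 1/256 on \<open>Good\<close>.\<close>
 have steady: "\<bar>h s y - h S y\<bar> \<le> 1 / 16" if y: "y \<in> Good" and s: "S \<le> s" "s \<le> S + T" for s y
 proof -
  have "h S y - h s y = (\<Sum>u\<in>{S..<s}. \<delta> u y)"
   unfolding \<delta>_def using sum_Suc_diff'[OF s(1), of "\<lambda>u. h u y"] by (simp add: sum_subtractf)
  then have "(h S y - h s y)\<^sup>2 = (\<Sum>u\<in>{S..<s}. 1 * \<delta> u y)\<^sup>2" by simp
  also have "... \<le> (\<Sum>u\<in>{S..<s}. 1\<^sup>2) * (\<Sum>u\<in>{S..<s}. (\<delta> u y)\<^sup>2)" by (rule Cauchy_Schwarz_ineq_sum)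
  also have "... \<le> T * \<E> y" unfolding \<E>_def using s by (intro mult_mono sum_mono2 sum_nonneg) auto
  also have "... \<le> (1 / 16)\<^sup>2" using y by (simp add: Good_def power2_eq_square)
  finally have "\<bar>h S y - h s y\<bar> \<le> 1 / 16" by (rule power2_le_imp_le[of "\<bar>h S y - h s y\<bar>", simplified]) simp
  then show ?thesis by (simp add: abs_minus_commute)
 qed
 have Vne: "V \<noteq> {}" using x by blast
 \<comment> \<open>Its minimum \<open>c\<close> is a median of the values of \<open>h S\<close> with
   respect to the volume.\<close>
 define cs where "cs = {a \<in> h S ` V. vol V \<le> 2 * vol {y \<in> V. h S y \<le> a}}"
 define c where "c = Min cs"
 have csne: "cs \<noteq> {}" "finite cs"
 proof -
  have "Max (h S ` V) \<in> h S ` V" using finV Vne by (intro Max_in) auto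
  moreover have "{y \<in> V. h S y \<le> Max (h S ` V)} = V" using finV by auto
  ultimately have "Max (h S ` V) \<in> cs" unfolding cs_def by simp
  then show "cs \<noteq> {}" by blast
  show "finite cs" unfolding cs_def using finV by simp
 qed
 have cin: "c \<in> cs" unfolding c_def using csne by (intro Min_in)
 have lowc: "vol V \<le> 2 * vol {y \<in> V. h S y \<le> c}" using cin by (simp add: cs_def)
 have c01: "0 \<le> c" "c \<le> 1" using cin h01 by (auto simp: cs_def)
 have highc: "vol V \<le> 2 * vol {y \<in> V. c \<le> h S y}"
 proof -
  let ?U = "{y \<in> V. h S y < c}"
  have "2 * vol ?U \<le> vol V"
  proof (cases "?U = {}")
   case False
   have fU: "finite (h S ` ?U)" "h S ` ?U \<noteq> {}" using finV False by auto
   define b where "b = Max (h S ` ?U)"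
   have b: "b \<in> h S ` ?U" unfolding b_def by (rule Max_in[OF fU])
   then have "b < c" by auto
   then have "b \<notin> cs" unfolding c_def using csne by (metis Min_le not_le)
   moreover have "{y \<in> V. h S y \<le> b} = ?U"
   proof
    show "?U \<subseteq> {y \<in> V. h S y \<le> b}" unfolding b_def using fU by (auto intro!: Max_ge)
   qed (use \<open>b < c\<close> in auto)
   ultimately show ?thesis using b unfolding cs_def by auto
  next
   case True
   then have "vol ?U = 0" by (simp only: vol_def sum.empty)
   then show ?thesis by simp
  qed
  moreover have "V - ?U = {y \<in> V. c \<le> h S y}" by auto
  moreover have "vol V = vol ?U + vol (V - ?U)" by (rule vol_Diff) auto
  ultimately show ?thesis by simp
 qed
 \<comment> \<open>\<open>A\<close> misses at most one half plus one sixth of the volume, which is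
   the two thirds allowed in \<open>hitting_tail\<close>. As 864 is 16 * 54, the survival
   probability is at most 1/16.\<close>
 have tail: "(kill A ^^ T) (\<lambda>y. of_bool (y \<notin> A)) z \<le> 1 / 16"
  if A: "A = U \<inter> Good" "U \<subseteq> V" "vol V \<le> 2 * vol U" and z: "z \<in> V" for A U z
 proof -
  have AV: "A \<subseteq> V" using A by blast
  have "vol (V - A) \<le> vol ((V - U) \<union> (V - Good))" using A by (intro vol_mono) auto
  also have "... \<le> vol (V - U) + vol (V - Good)" unfolding vol_def by (subst sum_Un_nat) (use finV in auto)
  finally have le: "vol (V - A) \<le> vol (V - U) + vol (V - Good)" .
  have "vol V = vol U + vol (V - U)" by (rule vol_Diff[OF A(2)]) simp
  then have 3: "3 * vol (V - A) \<le> 2 * vol V" using le volbad A(3) by linarith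
  have "A \<noteq> {}" using 3 vol0 by auto
  then have "T * (kill A ^^ T) (\<lambda>y. of_bool (y \<notin> A)) z \<le> 54 * D\<^sup>2" by (rule hitting_tail[OF AV _ 3 vol0 z])
  also have "... \<le> T * (1 / 16)" using T by simp
  finally show ?thesis using T0 by (simp only: mult_le_cancel_left_pos)
 qed
 have up: "h (S + T) z \<le> c + 1 / 8" if z: "z \<in> V" for z
 proof -
  let ?A = "{y \<in> V. h S y \<le> c} \<inter> Good"
  have "h (S + T) z \<le> (c + 1 / 16) + (kill ?A ^^ T) (\<lambda>y. of_bool (y \<notin> ?A)) z"
  proof (rule comparison[OF _ vol0 _ _ order_refl z])
   show "h (Suc s) y = lazy (h s) y" for s y by (simp add: hS)
   show "h S y \<le> c + 1 / 16 + 1" if "y \<in> V" for y using h01(2)[OF that, of S] c01 by linarith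
   show "h s y \<le> c + 1 / 16" if "y \<in> ?A" "S \<le> s" "s \<le> S + T" for y s
   proof -
    have y: "y \<in> Good" "h S y \<le> c" using that(1) by auto
    then show ?thesis using steady[OF y(1) that(2,3)] by linarith
   qed
  qed
  moreover have "(kill ?A ^^ T) (\<lambda>y. of_bool (y \<notin> ?A)) z \<le> 1 / 16" by (rule tail[OF refl _ lowc z]) auto
  ultimately show ?thesis by linarith
 qed
 have lo: "c - 1 / 8 \<le> h (S + T) z" if z: "z \<in> V" for z
 proof -
  let ?A = "{y \<in> V. c \<le> h S y} \<inter> Good"
  have "- h (S + T) z \<le> (- c + 1 / 16) + (kill ?A ^^ T) (\<lambda>y. of_bool (y \<notin> ?A)) z"
  proof (rule comparison[where h = "\<lambda>s y. - h s y", OF _ vol0 _ _ order_refl z])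
   show "- h (Suc s) y = lazy (\<lambda>y. - h s y) y" for s y by (simp add: hS lazy_minus)
   show "- h S y \<le> - c + 1 / 16 + 1" if "y \<in> V" for y using h01(1)[OF that, of S] c01 by linarith
   show "- h s y \<le> - c + 1 / 16" if "y \<in> ?A" "S \<le> s" "s \<le> S + T" for y s
   proof -
    have y: "y \<in> Good" "c \<le> h S y" using that(1) by auto
    then show ?thesis using steady[OF y(1) that(2,3)] by linarith
   qed
  qed
  moreover have "(kill ?A ^^ T) (\<lambda>y. of_bool (y \<notin> ?A)) z \<le> 1 / 16" by (rule tail[OF refl _ highc z]) auto
  ultimately show ?thesis by linarith
 qed
 \<comment> \<open>The degree-weighted total is invariant, so \<open>vol B / vol V\<close> lies
   within 1/8 of \<open>c\<close>, as all values do; together these give 1/4.\<close>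
 have avg: "(\<Sum>y\<in>V. deg y * h s y) = vol B" for s
 proof (induction s)
  case 0
  have "(\<Sum>y\<in>V. deg y * h 0 y) = (\<Sum>y\<in>V. if y \<in> B then real (deg y) else 0)" by (intro sum.cong) (auto simp: h_def)
  also have "... = vol B" unfolding volr using finV B by (simp add: sum.If_cases Int_absorb1)
  finally show ?case .
 next
  case (Suc s)
  have "(\<Sum>y\<in>V. deg y * h (Suc s) y) = ip (lazy (h s)) (\<lambda>_. 1)" by (simp add: ip_def hS)
  also have "... = ip (h s) (lazy (\<lambda>_. 1))" by (rule ip_lazy)
  also have "... = (\<Sum>y\<in>V. deg y * h s y)" unfolding ip_def using lazy_const[OF dp] by (intro sum.cong) auto
  finally show ?case using Suc.IH by simp
 qed
 have v0: "0 < real (vol V)" using vol0 by simp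
 have "real (vol B) \<le> (\<Sum>y\<in>V. deg y * (c + 1 / 8))" unfolding avg[symmetric, of "S + T"] using up by (intro sum_mono mult_left_mono) auto
 also have "... = vol V * (c + 1 / 8)" unfolding volr sum_distrib_right ..
 finally have b1: "vol B / vol V \<le> c + 1 / 8" using v0 by (simp add: divide_le_eq mult.commute)
 have "vol V * (c - 1 / 8) = (\<Sum>y\<in>V. deg y * (c - 1 / 8))" unfolding volr sum_distrib_right ..
 also have "... \<le> vol B" unfolding avg[symmetric, of "S + T"] using lo by (intro sum_mono mult_left_mono) auto
 finally have b2: "c - 1 / 8 \<le> vol B / vol V" using v0 by (simp add: le_divide_eq mult.commute)
 show ?thesis using up[OF x] lo[OF x] b1 b2 unfolding S_def by linarith
qed

lemma neighbours_nbr: "neighbours (UGraph V E) v = nbr v"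
 using nbr_V by (auto simp: neighbours_def nbr_def adj_def)

lemma set_lazy_step: "0 < vol V \<Longrightarrow> v \<in> V \<Longrightarrow> set_pmf (lazy_step (UGraph V E) v) \<subseteq> V"
proof -
 assume v: "0 < vol V" "v \<in> V"
 have "nbr v \<noteq> {}" using deg_pos[OF v] card_nbr[of v] by auto
 then have "set_pmf (pmf_of_set (nbr v)) = nbr v" by (rule set_pmf_of_set) simp
 then show ?thesis using nbr_V[of v] v(2) unfolding lazy_step_def neighbours_nbr by (auto split: if_splits)
qed

lemma expectation_lazy_step:
 fixes f :: "'a \<Rightarrow> real"
 assumes "0 < vol V" "v \<in> V"
 shows "measure_pmf.expectation (lazy_step (UGraph V E) v) f = lazy f v"
proof -
 have ne: "nbr v \<noteq> {}" using deg_pos[OF assms] card_nbr[of v] by auto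
 have "measure_pmf.expectation (lazy_step (UGraph V E) v) f =
  (\<Sum>b\<in>UNIV. pmf (bernoulli_pmf (1 / 2)) b *\<^sub>R measure_pmf.expectation (if b then return_pmf v else pmf_of_set (nbr v)) f)"
  unfolding lazy_step_def neighbours_nbr by (rule pmf_expectation_bind) (use ne in \<open>auto simp: set_pmf_of_set\<close>)
 also have "... = lazy f v" using ne by (simp add: UNIV_bool integral_pmf_of_set lazy_def card_nbr)
 finally show ?thesis .
qed

lemma lazy_walk_expectation:
 fixes f :: "'a \<Rightarrow> real"
 assumes "0 < vol V" "v \<in> V"
 shows "set_pmf (lazy_walk (UGraph V E) s v) \<subseteq> V \<and>
  measure_pmf.expectation (lazy_walk (UGraph V E) s v) f = (lazy ^^ s) f v"
proof (induction s arbitrary: f)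
 case (Suc s)
 let ?w = "lazy_walk (UGraph V E) s v"
 have sub: "set_pmf ?w \<subseteq> V" using Suc.IH by blast
 have st: "set_pmf (lazy_step (UGraph V E) a) \<subseteq> V" if "a \<in> V" for a by (rule set_lazy_step[OF assms(1) that])
 have "measure_pmf.expectation (lazy_walk (UGraph V E) (Suc s) v) f =
  (\<Sum>a\<in>V. pmf ?w a *\<^sub>R measure_pmf.expectation (lazy_step (UGraph V E) a) f)"
  unfolding lazy_walk.simps by (rule pmf_expectation_bind[OF finV _ sub]) (use st fin in blast)
 also have "... = (\<Sum>a\<in>V. pmf ?w a *\<^sub>R lazy f a)" using expectation_lazy_step[OF assms(1)] by simp
 also have "... = measure_pmf.expectation ?w (lazy f)"
  by (rule integral_measure_pmf[OF finV, symmetric]) (use sub in auto)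
 also have "... = (lazy ^^ s) (lazy f) v" using Suc.IH by blast
 finally have "measure_pmf.expectation (lazy_walk (UGraph V E) (Suc s) v) f = (lazy ^^ Suc s) f v"
  by (simp add: funpow_swap1)
 moreover have "set_pmf (lazy_walk (UGraph V E) (Suc s) v) \<subseteq> V" using sub st by auto
 ultimately show ?case by blast
qed (use assms in simp)

text \<open>The iterate of \<open>lazy\<close> on the indicator of \<open>B\<close> is the
  probability of being in \<open>B\<close>, so \<open>near_constant\<close> for every
  \<open>B\<close> bounds the total variation distance. The factor 769 counts the 768 windows before
  the last one and that window itself.\<close>

theorem mixing_bound:
 assumes vol0: "0 < vol V"
 shows "real (mixing_time (UGraph V E)) \<le> 769 * (864 * D\<^sup>2 + 1)"
proof -
 define T where "T = nat \<lceil>864 * D\<^sup>2\<rceil>"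
 have T: "864 * D\<^sup>2 \<le> T" "real T \<le> 864 * D\<^sup>2 + 1" unfolding T_def by (simp_all add: real_nat_ceiling_ge)
 let ?G = "UGraph V E" and ?s = "768 * T + T"
 have Vne: "V \<noteq> {}" using connV by (simp add: conn_def)
 have tv: "tv_dist V (pmf (lazy_walk ?G ?s v)) (stationary ?G) \<le> 1 / 4" if v: "v \<in> V" for v
  unfolding tv_dist_def
 proof (rule Max.boundedI)
  fix a assume "a \<in> (\<lambda>A. \<bar>sum (pmf (lazy_walk ?G ?s v)) A - sum (stationary ?G) A\<bar>) ` Pow V"
  then obtain B where B: "B \<subseteq> V" "a = \<bar>sum (pmf (lazy_walk ?G ?s v)) B - sum (stationary ?G) B\<bar>" by blast
  note lw = lazy_walk_expectation[OF vol0 v, of ?s "\<lambda>y. of_bool (y \<in> B)"]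
  have "(lazy ^^ ?s) (\<lambda>y. of_bool (y \<in> B)) v = measure_pmf.expectation (lazy_walk ?G ?s v) (\<lambda>y. of_bool (y \<in> B))"
   using lw by simp
  also have "... = (\<Sum>y\<in>V. of_bool (y \<in> B) * pmf (lazy_walk ?G ?s v) y)"
   by (rule integral_measure_pmf_real[OF finV]) (use lw in auto)
  also have "... = (\<Sum>y\<in>V. if y \<in> B then pmf (lazy_walk ?G ?s v) y else 0)" by (intro sum.cong) auto
  also have "... = sum (pmf (lazy_walk ?G ?s v)) B" using finV B by (simp add: sum.If_cases Int_absorb1)
  finally have 1: "sum (pmf (lazy_walk ?G ?s v)) B = (lazy ^^ ?s) (\<lambda>y. of_bool (y \<in> B)) v" by simp
  have "sum (stationary ?G) B = vol B / vol V"
   by (simp add: stationary_def degree_def neighbours_nbr card_nbr vol_V vol_def[of B] sum_divide_distrib)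
  then show "a \<le> 1 / 4" using near_constant[OF B(1) vol0 T(1) v] unfolding B(2) 1 by simp
 qed (use finV in auto)
 have "mixing_time ?G \<le> ?s" unfolding mixing_time_def
 proof (rule Least_le, rule Max.boundedI)
  fix a assume "a \<in> (\<lambda>v. tv_dist (verts ?G) (pmf (lazy_walk ?G ?s v)) (stationary ?G)) ` verts ?G"
  then show "a \<le> 1 / 4" using tv by auto
 qed (use finV Vne in auto)
 then have "real (mixing_time ?G) \<le> 769 * real T" by simp
 then show ?thesis using T(2) by simp
qed

end

section \<open>Application to the largest component\<close>

lemma expander_weaken:
 assumes "expander V E s0 D M" "D \<le> D'" shows "expander V E s0 D' M"
proof -
 interpret expander V E s0 D M by (rule assms(1))
 show ?thesis
 proof
  show "conn E V" "1 \<le> s0" "vol V \<le> M" "1 \<le> M" by (rule connV s0 volV)+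
  show "s0 \<le> D'" using s0 assms(2) by simp
  show "vol S * ln (exp 1 * M / vol S) \<le> D' * card (cut E S)"
   if "S \<subseteq> V" "conn E S" "s0 \<le> vol S" "3 * vol S \<le> 2 * vol V" for S
  proof -
   have "vol S * ln (exp 1 * M / vol S) \<le> D * card (cut E S)" by (rule expansion[OF that])
   also have "... \<le> D' * card (cut E S)" by (rule mult_right_mono[OF assms(2)]) simp
   finally show ?thesis .
  qed
  show "vol P \<le> max (20 * real (card P)) s0" if "P \<subseteq> V" "conn E P" for P by (rule sparse[OF that])
 qed
qed

context network begin

lemma component_eq:
 assumes "v \<in> V"
 shows "induced_subgraph (UGraph V E) {u. reachable (UGraph V E) v u} = UGraph (cluster E v) {e \<in> E. e \<subseteq> cluster E v}"
proof -
 have "links E UNIV = links E V" unfolding links_def using EV by auto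
 then have r: "{u. reachable (UGraph V E) v u} = cluster E v"
  unfolding comp_def using assms by (auto simp: reachable_iff)
 have "cluster E v \<subseteq> V" using cluster_subset[of v V E] assms EV by blast
 then show ?thesis unfolding induced_subgraph_def r by auto
qed

text \<open>\<open>W\<close> is non-empty and its vertices lie in clusters with at least
  \<open>m\<close> vertices, so the largest component has at least \<open>m\<close> vertices,
  whichever one is chosen in case of a tie.\<close>

lemma largest_component_expander:
 fixes c \<alpha> \<psi> :: real
 assumes ex: "expands V E W m c \<alpha> \<psi>" and L: "largest_component (UGraph V E) L"
  and c: "0 < c" "c \<le> 1" "0 < \<alpha>" "0 < \<psi>" "2 \<le> m"
 obtains U where "L = UGraph U {e \<in> E. e \<subseteq> U}"
  "expander U {e \<in> E. e \<subseteq> U} (20 * real m) (2 * ln (20 * exp 1 / (3 * \<alpha> * c)) * max (20 / (\<psi> * c)) (real (20 * m))) (20 * card V / c)"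
  "3 * \<alpha> * card V \<le> real (network.vol {e \<in> E. e \<subseteq> U} U)"
proof -
 obtain v where v: "v \<in> V" "L = UGraph (cluster E v) {e \<in> E. e \<subseteq> cluster E v}"
  using L component_eq unfolding largest_component_def components_def by auto
 have W: "W \<subseteq> V" "4 * \<alpha> * real (card V) \<le> real (card W)" "\<forall>w\<in>W. m \<le> card (cluster E w)"
  using ex unfolding expands_def by blast+
 have "0 < card V" using v(1) finV by (auto simp: card_gt_0_iff)
 then have "0 < 4 * \<alpha> * real (card V)" using c by simp
 then have "W \<noteq> {}" using W(2) by auto
 then obtain w where w: "w \<in> W" by blast
 then have "UGraph (cluster E w) {e \<in> E. e \<subseteq> cluster E w} \<in> components (UGraph V E)"
  unfolding components_def using component_eq[of w] W(1) by (auto intro!: image_eqI[of _ _ w])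
 then have "card (cluster E w) \<le> card (cluster E v)"
  using L v(2) unfolding largest_component_def by (metis ugraph.sel(1))
 then have "m \<le> card (cluster E v)" using W(3) w by (meson le_trans)
 from expander_component[OF ex v(1) refl this c] that[OF v(2)] show thesis by blast
qed

end

theorem theorem6:
 fixes C :: nat
 assumes "C > 1"
 shows "\<exists>\<epsilon>\<^sub>0>0. \<forall>\<epsilon>::real. 0 < \<epsilon> \<and> \<epsilon> \<le> \<epsilon>\<^sub>0 \<longrightarrow>
  (\<exists>K\<^sub>a>0. \<exists>K\<^sub>b>0. \<exists>K\<^sub>c>0.
   \<forall>(G :: nat \<Rightarrow> nat \<Rightarrow> 'a ugraph) (r :: nat \<Rightarrow> nat \<Rightarrow> nat).
    (\<forall>t. \<forall>j\<in>{1..t}. simple_graph (G t j) \<and> connected_graph (G t j) \<and>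
      regular (r t j) (G t j) \<and> 1 < card (verts (G t j)) \<and> card (verts (G t j)) \<le> C)
    \<longrightarrow>
    (\<lambda>t. let P = cart_prod t (G t);
        n = real (card (verts P));
        d = real (\<Sum>j=1..t. r t j);
        p = (1 + \<epsilon>) / d
      in measure_pmf.prob (random_subgraph p P)
         {H. \<forall>L. largest_component H L \<longrightarrow>
            real (graph_diameter L) \<le> K\<^sub>a * (d * (ln d)\<^sup>2) \<and>
            real (mixing_time L) \<le> K\<^sub>b * (d\<^sup>2 * (ln d)\<^sup>2) \<and>
            real (circumference L) \<ge> K\<^sub>c * (n / (d * ln d))})
     \<longlonglongrightarrow> 1)"
proof (rule exI[of _ "1::real"], intro conjI allI impI, goal_cases)
 \<comment> \<open>The value 1 of the threshold serves every \<open>C\<close>, as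
   \<open>expands_whp\<close> asks only for \<epsilon> \<le> 1.\<close>
 case (2 \<epsilon>)
 note \<epsilon> = 2
 obtain K0 :: nat and c \<alpha> \<eta> :: real where K0: "0 < K0" and c: "0 < c" "c \<le> 1" and \<alpha>: "0 < \<alpha>" and \<eta>: "0 < \<eta>"
  and whp: "\<forall>\<xi>>0. \<forall>\<^sub>F d::nat in at_top. \<forall>t (G :: nat \<Rightarrow> 'a ugraph) r. product t G r C \<longrightarrow> d = (\<Sum>j\<in>{1..t}. r j) \<longrightarrow>
   chance (edges (cart_prod t G)) (\<lambda>_. (1 + \<epsilon>) / d)
    (\<lambda>F. \<not> (\<exists>W. expands (verts (cart_prod t G)) F W (K0 * d) c \<alpha> (\<eta> / (d * ln d)))) \<le> \<xi>"
  using expands_whp[OF assms conjunct1[OF \<epsilon>] conjunct2[OF \<epsilon>], where ?'a = 'a] by (elim exE conjE) (rule that; assumption)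
 \<comment> \<open>Makes \<open>K1 * (d * ln d)\<close> an upper bound for the expansion constant of
   the component; the summand 1 keeps \<open>K1\<close> at least 1.\<close>
 define K1 where "K1 = 2 * \<bar>ln (20 * exp 1 / (3 * \<alpha> * c))\<bar> * max (20 / (\<eta> * c)) (20 * K0) + 1"
 \<comment> \<open>The constants come from the three deterministic bounds with
   \<open>D = K1 * (d * ln d)\<close>: twice the radius, 769 * (864 * D^2 + 1) with the last 1
   absorbed into 865, and the volume, at least 3 * \<alpha> * n, divided by 80 * D.\<close>
 define Ka where "Ka = 2 * (20 * real K0 + 4 * K1 + 3)"
 define Kb where "Kb = 769 * 865 * K1\<^sup>2"
 define Kc where "Kc = 3 * \<alpha> / (80 * K1)"
 define c6 where "c6 = ln 2 / C"
 have K1: "1 \<le> K1" unfolding K1_def using \<eta> c by (simp add: le_max_iff_disj)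
 have c6: "0 < c6" using assms by (simp add: c6_def)
 have C0: "0 < real K0" "1 < real C" using K0 assms by auto
 have ev: "\<forall>\<^sub>F d::nat in at_top. 2 \<le> d" "\<forall>\<^sub>F d::nat in at_top. 1 \<le> ln (real d)"
  "\<forall>\<^sub>F d::nat in at_top. 1 + ln (20 / c) + d * ln C \<le> d * ln d"
  "\<forall>\<^sub>F d::nat in at_top. 4 * (K1 * (d * ln d)) * (20 * (K0 * d)) < 3 * \<alpha> * exp (c6 * d)"
  subgoal by (rule eventually_ge_at_top)
  subgoal by real_asymp
  subgoal using C0 c by real_asymp
  subgoal using C0 K1 c6 \<alpha> by real_asymp
  done
 then have "\<forall>\<^sub>F d::nat in at_top. 2 \<le> d \<and> 1 \<le> ln (real d) \<and> 1 + ln (20 / c) + d * ln C \<le> d * ln d \<and>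
   4 * (K1 * (d * ln d)) * (20 * (K0 * d)) < 3 * \<alpha> * exp (c6 * d)"
  by (intro eventually_conj)
 then obtain d0 where d0: "\<And>d. d0 \<le> d \<Longrightarrow> 2 \<le> d \<and> 1 \<le> ln (real d) \<and> 1 + ln (20 / c) + d * ln C \<le> d * ln d \<and>
   4 * (K1 * (d * ln d)) * (20 * (K0 * d)) < 3 * \<alpha> * exp (c6 * d)"
  unfolding eventually_at_top_linorder by blast
 have det: "real (graph_diameter L) \<le> Ka * (d * (ln d)\<^sup>2) \<and>
   real (mixing_time L) \<le> Kb * ((real d)\<^sup>2 * (ln d)\<^sup>2) \<and> Kc * (card (verts (cart_prod t G)) / (d * ln d)) \<le> real (circumference L)"
  if P: "product t G r C" and d: "d = (\<Sum>j\<in>{1..t}. r j)" and dd: "d0 \<le> d" and F: "F \<subseteq> edges (cart_prod t G)"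
   and W: "expands (verts (cart_prod t G)) F W (K0 * d) c \<alpha> (\<eta> / (d * ln d))"
   and L: "largest_component (UGraph (verts (cart_prod t G)) F) L"
  for t and G :: "nat \<Rightarrow> 'a ugraph" and r d F W L
 proof -
  interpret product t G r C by (rule P)
  interpret N: network V F
   by unfold_locales (use finV pairs_subset[OF pairs_E F] E_V F in auto)
  let ?n = "real (card V)" and ?M = "20 * card V / c" and ?D = "K1 * (d * ln d)" and ?s0 = "20 * real (K0 * d)"
  note sb = size_bounds[OF d] and dp = d0[OF dd]
  have dl: "0 < d * ln d" "1 \<le> ln (real d)" "2 \<le> real d" using dp by auto
  have n0: "0 < ?n"
  proof -
   have "verts (G j) \<noteq> {}" if "j \<in> J0" for j using baseG(6)[OF that] by auto
   then have "V \<noteq> {}" unfolding V_def by (simp add: PiE_eq_empty_iff)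
   then show ?thesis using finV by (simp add: card_gt_0_iff)
  qed
  have psi: "0 < \<eta> / (d * ln d)" using \<eta> dl by simp
  have m2: "2 \<le> K0 * d" using K0 dp by (metis mult_le_mono nat_mult_1 Suc_leI One_nat_def)
  obtain U where U: "L = UGraph U {e \<in> F. e \<subseteq> U}"
   and ex0: "expander U {e \<in> F. e \<subseteq> U} ?s0 (2 * ln (20 * exp 1 / (3 * \<alpha> * c)) * max (20 / (\<eta> / (d * ln d) * c)) (real (20 * (K0 * d)))) ?M"
   and vol: "3 * \<alpha> * card V \<le> real (network.vol {e \<in> F. e \<subseteq> U} U)"
   using N.largest_component_expander[OF W L c \<alpha> psi m2] by blast
  have "2 * ln (20 * exp 1 / (3 * \<alpha> * c)) * max (20 / (\<eta> / (d * ln d) * c)) (real (20 * (K0 * d))) \<le> ?D"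
  proof -
   have a: "max (20 / (\<eta> / (d * ln d) * c)) (real (20 * (K0 * d))) \<le> max (20 / (\<eta> * c)) (20 * K0) * (d * ln d)"
   proof (rule max.boundedI)
    have "20 / (\<eta> / (d * ln d) * c) = 20 / (\<eta> * c) * (d * ln d)" by simp
    also have "... \<le> max (20 / (\<eta> * c)) (20 * K0) * (d * ln d)" using dl by (intro mult_right_mono) auto
    finally show "20 / (\<eta> / (d * ln d) * c) \<le> max (20 / (\<eta> * c)) (20 * K0) * (d * ln d)" .
    have "(20 * real K0) * (d * 1) \<le> max (20 / (\<eta> * c)) (20 * K0) * (d * ln d)" using dl by (intro mult_mono) auto
    then show "real (20 * (K0 * d)) \<le> max (20 / (\<eta> * c)) (20 * K0) * (d * ln d)" by simp
   qed
   let ?l = "ln (20 * exp 1 / (3 * \<alpha> * c))"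
   have mx0: "0 \<le> max (20 / (\<eta> / (d * ln d) * c)) (real (20 * (K0 * d)))" by (simp add: le_max_iff_disj)
   have "2 * ?l * max (20 / (\<eta> / (d * ln d) * c)) (real (20 * (K0 * d))) \<le> 2 * \<bar>?l\<bar> * max (20 / (\<eta> / (d * ln d) * c)) (real (20 * (K0 * d)))"
    by (rule mult_right_mono[OF _ mx0]) simp
   also have "... \<le> 2 * \<bar>?l\<bar> * (max (20 / (\<eta> * c)) (20 * K0) * (d * ln d))" by (rule mult_left_mono[OF a]) simp
   also have "... \<le> ?D" unfolding K1_def using dl by (simp add: algebra_simps)
   finally show ?thesis .
  qed
  then interpret X: expander U "{e \<in> F. e \<subseteq> U}" ?s0 ?D ?M by (rule expander_weaken[OF ex0])
  have dD: "d * ln d \<le> ?D" using mult_right_mono[OF K1, of "d * ln d"] dl by simp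
  have lnM: "ln (exp 1 * ?M) = 1 + ln (20 / c) + ln ?n"
  proof -
   have "exp 1 * ?M = exp 1 * ((20 / c) * ?n)" by simp
   then have "ln (exp 1 * ?M) = ln (exp 1) + ln ((20 / c) * ?n)" using n0 c by (simp only: ln_mult_pos exp_gt_zero mult_pos_pos divide_pos_pos zero_less_numeral)
   also have "ln ((20 / c) * ?n) = ln (20 / c) + ln ?n" using n0 c by (intro ln_mult_pos) auto
   finally show ?thesis by simp
  qed
  have lM: "ln (exp 1 * ?M) \<le> d * ln d" using lnM sb(4) dp by linarith
  have lM1: "1 \<le> ln (exp 1 * ?M)" using ln_exp1_ratio[of 1 ?M] X.volV(2) by simp
  \<comment> \<open>The volume is at most exponential in d * ln d, so the iterated logarithm in the
    radius is at most 2 * ln d. Together with the ln d in \<open>D\<close> this gives the square of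
    the logarithm in the diameter bound.\<close>
  have llM: "ln (ln (exp 1 * ?M)) \<le> 2 * ln d"
  proof -
   have "ln (real d) \<le> real d" using ln_le_minus_one[of "real d"] dl by simp
   then have "d * ln d \<le> real d * real d" by (rule mult_left_mono) simp
   then have "ln (exp 1 * ?M) \<le> real d * real d" using lM by (rule order_trans[rotated])
   then have "ln (ln (exp 1 * ?M)) \<le> ln (real d * real d)" using lM1 by (intro ln_mono) auto
   also have "... = 2 * ln d" using dl by (simp add: ln_mult)
   finally show ?thesis .
  qed
  have D0: "0 < ?D" using dl K1 by simp
  have dl2: "real d \<le> d * (ln d)\<^sup>2" "1 \<le> d * (ln d)\<^sup>2"
  proof -
   have "1 \<le> (ln (real d))\<^sup>2" using dl by simp
   then show "real d \<le> d * (ln d)\<^sup>2" using dl mult_left_mono[of 1 "(ln (real d))\<^sup>2" "real d"] by simp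
   then show "1 \<le> d * (ln d)\<^sup>2" using dl by linarith
  qed
  have "real (graph_diameter L) \<le> 2 * X.radius" unfolding U by (rule X.diameter_bound) (use lM dD in linarith)
  also have "X.radius \<le> ?s0 + 2 * ?D * (2 * ln d) + 3" unfolding X.radius_def using llM D0 by (intro add_mono mult_left_mono) auto
  also have "?s0 + 2 * ?D * (2 * ln d) + 3 \<le> (20 * real K0 + 4 * K1 + 3) * (d * (ln d)\<^sup>2)"
  proof -
   have "?s0 \<le> 20 * real K0 * (d * (ln d)\<^sup>2)" using dl2(1) by (simp add: mult_left_mono)
   moreover have "2 * ?D * (2 * ln d) = 4 * K1 * (d * (ln d)\<^sup>2)" by (simp add: power2_eq_square)
   ultimately show ?thesis using dl2(2) unfolding distrib_right by linarith
  qed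
  finally have diam: "real (graph_diameter L) \<le> Ka * (d * (ln d)\<^sup>2)" by (simp only: Ka_def mult.assoc)
  have expv: "exp (c6 * d) \<le> ?n"
  proof -
   have "c6 * d \<le> ln ?n" using sb(3) by (simp add: c6_def mult.commute)
   then have "exp (c6 * d) \<le> exp (ln ?n)" by simp
   then show ?thesis using n0 by simp
  qed
  \<comment> \<open>The volume is exponential in \<open>d\<close>, while \<open>D\<close> and
    \<open>s0\<close> are of polynomial size; this gives the size condition of
    \<open>circumference_bound\<close>.\<close>
  have "3 * \<alpha> * exp (c6 * d) \<le> 3 * \<alpha> * ?n" using expv \<alpha> by (intro mult_left_mono) auto
  then have bigv: "4 * ?D * ?s0 < X.vol U" using dp vol by simp
  have "1 \<le> real (K0 * d)" using m2 by linarith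
  then have s20: "20 \<le> ?s0" by linarith
  have "0 < 4 * ?D * ?s0" by (rule mult_pos_pos) (use D0 s20 in linarith)+
  then have v0: "0 < X.vol U" using bigv by linarith
  have "real (mixing_time L) \<le> 769 * (864 * ?D\<^sup>2 + 1)" unfolding U by (rule X.mixing_bound[OF v0])
  also have "... \<le> 769 * (865 * ?D\<^sup>2)"
  proof -
   have "1 * 1 \<le> real d * ln d" using dl by (intro mult_mono) auto
   then have "1 \<le> ?D" using dD by linarith
   then have "1 \<le> ?D\<^sup>2" by simp
   then show ?thesis by simp
  qed
  also have "... = Kb * ((real d)\<^sup>2 * (ln d)\<^sup>2)" unfolding Kb_def by (simp add: power_mult_distrib)
  finally have mix: "real (mixing_time L) \<le> Kb * ((real d)\<^sup>2 * (ln d)\<^sup>2)" .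
  have "3 * \<alpha> * ?n \<le> 80 * ?D * circumference L" unfolding U using X.circumference_bound[OF s20 bigv] vol by linarith
  then have "3 * \<alpha> * ?n / (80 * ?D) \<le> circumference L" using D0 by (simp add: divide_le_eq mult.commute)
  then have "Kc * (?n / (d * ln d)) \<le> circumference L" unfolding Kc_def by simp
  then show ?thesis using diam mix by blast
 qed
 have pos: "0 < Ka" "0 < Kb" "0 < Kc" unfolding Ka_def Kb_def Kc_def using K1 \<alpha> by auto
 show ?case
 proof (rule exI[of _ Ka], rule conjI[OF pos(1)], rule exI[of _ Kb], rule conjI[OF pos(2)],
   rule exI[of _ Kc], rule conjI[OF pos(3)], intro allI impI, goal_cases)
  case (1 G r)
  note G = 1
  define good where "good t H \<longleftrightarrow> (\<forall>L. largest_component H L \<longrightarrow>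
    real (graph_diameter L) \<le> Ka * (real (\<Sum>j=1..t. r t j) * (ln (real (\<Sum>j=1..t. r t j)))\<^sup>2) \<and>
    real (mixing_time L) \<le> Kb * ((real (\<Sum>j=1..t. r t j))\<^sup>2 * (ln (real (\<Sum>j=1..t. r t j)))\<^sup>2) \<and>
    real (circumference L) \<ge> Kc * (real (card (verts (cart_prod t (G t)))) / (real (\<Sum>j=1..t. r t j) * ln (real (\<Sum>j=1..t. r t j)))))"
   for t and H :: "(nat \<Rightarrow> 'a) ugraph"
  let ?f = "\<lambda>t. measure_pmf.prob (random_subgraph ((1 + \<epsilon>) / real (\<Sum>j=1..t. r t j)) (cart_prod t (G t))) {H. good t H}"
  have "?f \<longlonglongrightarrow> 1"
  proof (rule LIMSEQ_I)
   fix \<xi> :: real assume \<xi>: "0 < \<xi>"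
   then have "0 < \<xi> / 2" by simp
   from whp[rule_format, OF this] obtain d1 where d1: "\<And>d t (G :: nat \<Rightarrow> 'a ugraph) r. d1 \<le> d \<Longrightarrow> product t G r C \<Longrightarrow> d = (\<Sum>j\<in>{1..t}. r j) \<Longrightarrow>
    chance (edges (cart_prod t G)) (\<lambda>_. (1 + \<epsilon>) / d)
     (\<lambda>F. \<not> (\<exists>W. expands (verts (cart_prod t G)) F W (K0 * d) c \<alpha> (\<eta> / (d * ln d)))) \<le> \<xi> / 2"
    unfolding eventually_at_top_linorder by blast
   show "\<exists>no. \<forall>t\<ge>no. norm (?f t - 1) < \<xi>"
   proof (intro exI[of _ "max 1 (max d0 d1)"] allI impI)
    fix t assume t: "max 1 (max d0 d1) \<le> t"
    have P: "product t (G t) (r t) C" by unfold_locales (use t G in auto)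
    interpret product t "G t" "r t" C by (rule P)
    define d where "d = (\<Sum>j=1..t. r t j)"
    have td: "t \<le> d" by (rule size_bounds(1)) (simp add: d_def)
    have dd: "d0 \<le> d" "d1 \<le> d" using t td by auto
    have d2: "2 \<le> real d" using d0[OF dd(1)] by simp
    have p: "0 \<le> (1 + \<epsilon>) / d" "(1 + \<epsilon>) / d \<le> 1" using \<epsilon> d2 by auto
    have pr: "probs E (\<lambda>_. (1 + \<epsilon>) / d)" using p by (simp add: probs_def)
    let ?Q = "\<lambda>F. \<exists>W. expands V F W (K0 * d) c \<alpha> (\<eta> / (d * ln d))"
    have ft: "?f t = chance E (\<lambda>_. (1 + \<epsilon>) / d) (\<lambda>F. good t (UGraph V F))"
     unfolding d_def[symmetric] by (rule prob_random_subgraph[OF finE p])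
    have "1 - \<xi> / 2 \<le> chance E (\<lambda>_. (1 + \<epsilon>) / d) ?Q"
     using d1[OF dd(2) P d_def] chance_Not[OF finE, of "\<lambda>_. (1 + \<epsilon>) / d" ?Q] by linarith
    also have "... \<le> chance E (\<lambda>_. (1 + \<epsilon>) / d) (\<lambda>F. good t (UGraph V F))"
    proof (rule chance_mono[OF pr])
     fix F assume F: "F \<subseteq> E" "?Q F"
     then obtain W where W: "expands V F W (K0 * d) c \<alpha> (\<eta> / (d * ln d))" by blast
     show "good t (UGraph V F)" unfolding good_def d_def[symmetric]
      using det[OF P d_def dd(1) F(1) W] by blast
    qed
    finally have "1 - \<xi> / 2 \<le> ?f t" unfolding ft .
    moreover have "?f t \<le> 1" by simp
    ultimately show "norm (?f t - 1) < \<xi>" using \<xi> by simp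
   qed
  qed
  then show ?case
   unfolding Let_def good_def .
 qed
qed simp

end
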